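(* Let $k$ be a field, $q\in k\setminus\{0\}$, let $\Lambda=\Lambda(q)$, and let $o(q)\in\{1,2,\dots\}\cup\{\infty\}$ be the multiplicative order of $q$. An indecomposable left $\Lambda$-module $M$ of dimension at most $3$ is (1) torsionless if and only if $M$ is simple or isomorphic to $\Lambda(x-y)$, to $\Lambda z$, to a module $M(1,b,c)$ with $b,c\in k$ and $b\neq -q$, to $M(0,1,0)$ or to $M(0,0,1)$; (2) extensionless if and only if $M$ is isomorphic to a module $M(1,b,c)$ with $b,c\in k$ and $b\neq -1$; (3) reflexive if and only if $M$ is isomorphic to a module $M(1,b,c)$ with $b,c\in k$ and $b\neq -q^i$ for $i=1,2$; (4) Gorenstein-projective if and only if $M$ is isomorphic to a module $M(1,b,c)$ with $b,c\in k$ and $b\neq -q^i$ for all $i\in\mathbb Z$; (5) semi-Gorenstein-projective if and only if $M$ is isomorphic to a module $M(1,b,c)$ with $b,c\in k$ and $b\neq -q^i$ for all integers $i\le 0$; (6) $\infty$-torsionfree if and only if $M$ is isomorphic to a module $M(1,b,c)$ with $b,c\in k$ and $b\neq -q^i$ for all integers $i\ge 1$; (7) pivotal semi-Gorenstein-projective if and only if $o(q)=\infty$ and $M$ is isomorphic to a module $M(1,-q,c)$ with $c\in k$; (8) pivotal $\infty$-torsionfree if and only if $o(q)=\infty$ and $M$ is isomorphic to a module $M(1,-1,c)$ with $c\in k$.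
   Context: $\Lambda=\Lambda(q)$ is the $k$-algebra generated by $x,y,z$ with relations $x^2=y^2=z^2=yz=0$, $xy+qyx=0$, $xz-zx=0$, $zy-zx=0$. It is a 6-dimensional local algebra with $k$-basis $1,x,y,z,yx,zx$, and $\operatorname{soc}\Lambda=\operatorname{rad}^2\Lambda=\Lambda yx\oplus\Lambda zx$. Modules are finite-dimensional left $\Lambda$-modules. For $(a,b,c)\in k^3\setminus\{0\}$, identified with $ax+by+cz\in\Lambda$, let $U(a,b,c)=\Lambda(ax+by+cz)+\operatorname{soc}\Lambda$ (a 3-dimensional left ideal) and $M(a,b,c)={}_\Lambda\Lambda/U(a,b,c)$. Write $M^*=\operatorname{Hom}_\Lambda(M,\Lambda)$. A module $M$ is torsionless if it is isomorphic to a submodule of a projective module (equivalently the canonical map $M\to M^{**}$ is injective), reflexive if the canonical map $M\to M^{**}$ is an isomorphism, extensionless if $\operatorname{Ext}^1_\Lambda(M,\Lambda)=0$, semi-Gorenstein-projective if $\operatorname{Ext}^i_\Lambda(M,\Lambda)=0$ for all $i\ge1$, and $\infty$-torsionfree if $\operatorname{Ext}^i(\operatorname{Tr}M,\Lambda_\Lambda)=0$ for all $i\ge1$, where $\operatorname{Tr}$ is the Auslander transpose. Equivalently, $M$ is $\infty$-torsionfree iff $\mho^tM$ is reflexive for all $t\ge0$, where $\mho M$ denotes the cokernel of a minimal left $\operatorname{add}(\Lambda)$-approximation of $M$. $M$ is Gorenstein-projective iff it is both semi-Gorenstein-projective and $\infty$-torsionfree. An indecomposable semi-Gorenstein-projective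 module is pivotal if it is not torsionless; an indecomposable $\infty$-torsionfree module is pivotal if it is not extensionless. *)

theory Defs
  imports "HOL-Algebra.QuotRing" "HOL-Algebra.Module" "HOL-Library.Poly_Mapping"
    "HOL-Library.Extended_Nat"
begin

section \<open>Left modules over a not necessarily commutative ring\<close>

text \<open>
  The locale \<^locale>\<open>module\<close> of the library requires a commutative ring of scalars. The records
  are reused here; the fields \<^const>\<open>mult\<close> and \<^const>\<open>one\<close> of a module record play no role.
\<close>

locale left_module = R?: ring R + M?: abelian_group M
  for R :: "('a, 'r) ring_scheme" (structure) and M :: "('a, 'm, 's) module_scheme" (structure) +
  assumes smult_closed [simp, intro]:
      "\<lbrakk>a \<in> carrier R; x \<in> carrier M\<rbrakk> \<Longrightarrow> a \<odot>\<^bsub>M\<^esub> x \<in> carrier M"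
    and smult_l_distr:
      "\<lbrakk>a \<in> carrier R; b \<in> carrier R; x \<in> carrier M\<rbrakk> \<Longrightarrow>
        (a \<oplus>\<^bsub>R\<^esub> b) \<odot>\<^bsub>M\<^esub> x = (a \<odot>\<^bsub>M\<^esub> x) \<oplus>\<^bsub>M\<^esub> (b \<odot>\<^bsub>M\<^esub> x)"
    and smult_r_distr:
      "\<lbrakk>a \<in> carrier R; x \<in> carrier M; y \<in> carrier M\<rbrakk> \<Longrightarrow>
        a \<odot>\<^bsub>M\<^esub> (x \<oplus>\<^bsub>M\<^esub> y) = (a \<odot>\<^bsub>M\<^esub> x) \<oplus>\<^bsub>M\<^esub> (a \<odot>\<^bsub>M\<^esub> y)"
    and smult_assoc:
      "\<lbrakk>a \<in> carrier R; b \<in> carrier R; x \<in> carrier M\<rbrakk> \<Longrightarrow>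
        (a \<otimes>\<^bsub>R\<^esub> b) \<odot>\<^bsub>M\<^esub> x = a \<odot>\<^bsub>M\<^esub> (b \<odot>\<^bsub>M\<^esub> x)"
    and smult_one [simp]:
      "x \<in> carrier M \<Longrightarrow> \<one>\<^bsub>R\<^esub> \<odot>\<^bsub>M\<^esub> x = x"

text \<open>Right modules over \<open>R\<close> are treated as left modules over the opposite ring.\<close>

definition op_ring :: "'a ring \<Rightarrow> 'a ring" where
  "op_ring R = R\<lparr>mult := \<lambda>x y. y \<otimes>\<^bsub>R\<^esub> x\<rparr>"

definition regular_module :: "'a ring \<Rightarrow> ('a, 'a) module" where
  "regular_module R =
    \<lparr>carrier = carrier R, mult = mult R, one = \<one>\<^bsub>R\<^esub>, zero = \<zero>\<^bsub>R\<^esub>, add = add R, smult = mult R\<rparr>"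

text \<open>Homomorphisms are extensional functions, so that they are determined by their values on the
  carrier.\<close>

definition mod_hom :: "'a ring \<Rightarrow> ('a, 'm) module \<Rightarrow> ('a, 'n) module \<Rightarrow> ('m \<Rightarrow> 'n) set" where
  "mod_hom R M N = {f \<in> carrier M \<rightarrow>\<^sub>E carrier N.
     (\<forall>x\<in>carrier M. \<forall>y\<in>carrier M. f (x \<oplus>\<^bsub>M\<^esub> y) = f x \<oplus>\<^bsub>N\<^esub> f y) \<and>
     (\<forall>a\<in>carrier R. \<forall>x\<in>carrier M. f (a \<odot>\<^bsub>M\<^esub> x) = a \<odot>\<^bsub>N\<^esub> f x)}"

definition mod_iso :: "'a ring \<Rightarrow> ('a, 'm) module \<Rightarrow> ('a, 'n) module \<Rightarrow> ('m \<Rightarrow> 'n) set" where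
  "mod_iso R M N = {f \<in> mod_hom R M N. bij_betw f (carrier M) (carrier N)}"

definition isomorphic :: "'a ring \<Rightarrow> ('a, 'm) module \<Rightarrow> ('a, 'n) module \<Rightarrow> bool" where
  "isomorphic R M N \<longleftrightarrow> mod_iso R M N \<noteq> {}"

definition quotient_module :: "('a, 'm) module \<Rightarrow> 'm set \<Rightarrow> ('a, 'm set) module" where
  "quotient_module M N =
    \<lparr>carrier = a_rcosets\<^bsub>M\<^esub> N, mult = undefined, one = undefined, zero = N, add = set_add M,
     smult = (\<lambda>a X. \<Union>x\<in>X. N +>\<^bsub>M\<^esub> (a \<odot>\<^bsub>M\<^esub> x))\<rparr>"

definition simple_module :: "'a ring \<Rightarrow> ('a, 'm) module \<Rightarrow> bool" where
  "simple_module R M \<longleftrightarrow> carrier M \<noteq> {\<zero>\<^bsub>M\<^esub>} \<and>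
     (\<forall>N. submodule N R M \<longrightarrow> N = {\<zero>\<^bsub>M\<^esub>} \<or> N = carrier M)"

definition indecomposable :: "'a ring \<Rightarrow> ('a, 'm) module \<Rightarrow> bool" where
  "indecomposable R M \<longleftrightarrow> carrier M \<noteq> {\<zero>\<^bsub>M\<^esub>} \<and>
     (\<forall>A B. submodule A R M \<and> submodule B R M \<and> set_add M A B = carrier M \<and> A \<inter> B = {\<zero>\<^bsub>M\<^esub>}
        \<longrightarrow> A = {\<zero>\<^bsub>M\<^esub>} \<or> B = {\<zero>\<^bsub>M\<^esub>})"

definition socle :: "'a ring \<Rightarrow> ('a, 'm) module \<Rightarrow> 'm set" where
  "socle R M = \<Inter>{N. submodule N R M \<and>
     (\<forall>S. submodule S R M \<and> simple_module R (M\<lparr>carrier := S\<rparr>) \<longrightarrow> S \<subseteq> N)}"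

section \<open>Projective modules and duality\<close>

definition free_module :: "'a ring \<Rightarrow> nat \<Rightarrow> ('a, nat \<Rightarrow> 'a) module" where
  "free_module R n =
    \<lparr>carrier = {..<n} \<rightarrow>\<^sub>E carrier R, mult = undefined, one = undefined,
     zero = (\<lambda>i\<in>{..<n}. \<zero>\<^bsub>R\<^esub>), add = (\<lambda>u v. \<lambda>i\<in>{..<n}. u i \<oplus>\<^bsub>R\<^esub> v i),
     smult = (\<lambda>a u. \<lambda>i\<in>{..<n}. a \<otimes>\<^bsub>R\<^esub> u i)\<rparr>"

text \<open>Finitely generated projective: a direct summand of some \<open>R\<^sup>n\<close>. Every such module is isomorphic
  to one whose elements have type \<^typ>\<open>nat \<Rightarrow> 'a\<close>, so that quantifying over modules on this type
  loses nothing.\<close>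

definition fg_projective :: "'a ring \<Rightarrow> ('a, 'm) module \<Rightarrow> bool" where
  "fg_projective R P \<longleftrightarrow> left_module R P \<and>
     (\<exists>n. \<exists>i\<in>mod_hom R P (free_module R n). \<exists>p\<in>mod_hom R (free_module R n) P.
        \<forall>x\<in>carrier P. p (i x) = x)"

text \<open>\<open>M\<^sup>* = Hom(M, R)\<close> with the right \<open>R\<close>-action \<open>(f a)(x) = f(x) a\<close>, as a left module over
  \<^term>\<open>op_ring R\<close>.\<close>

definition dual :: "'a ring \<Rightarrow> ('a, 'm) module \<Rightarrow> ('a, 'm \<Rightarrow> 'a) module" where
  "dual R M =
    \<lparr>carrier = mod_hom R M (regular_module R), mult = undefined, one = undefined,
     zero = (\<lambda>x\<in>carrier M. \<zero>\<^bsub>R\<^esub>), add = (\<lambda>f g. \<lambda>x\<in>carrier M. f x \<oplus>\<^bsub>R\<^esub> g x),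
     smult = (\<lambda>a f. \<lambda>x\<in>carrier M. f x \<otimes>\<^bsub>R\<^esub> a)\<rparr>"

definition bidual :: "'a ring \<Rightarrow> ('a, 'm) module \<Rightarrow> ('a, ('m \<Rightarrow> 'a) \<Rightarrow> 'a) module" where
  "bidual R M = dual (op_ring R) (dual R M)"

definition bidual_map :: "'a ring \<Rightarrow> ('a, 'm) module \<Rightarrow> 'm \<Rightarrow> ('m \<Rightarrow> 'a) \<Rightarrow> 'a" where
  "bidual_map R M = (\<lambda>x\<in>carrier M. \<lambda>f\<in>carrier (dual R M). f x)"

definition torsionless :: "'a ring \<Rightarrow> ('a, 'm) module \<Rightarrow> bool" where
  "torsionless R M \<longleftrightarrow> (\<exists>(P :: ('a, nat \<Rightarrow> 'a) module) N.
     fg_projective R P \<and> submodule N R P \<and> isomorphic R M (P\<lparr>carrier := N\<rparr>))"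

definition reflexive :: "'a ring \<Rightarrow> ('a, 'm) module \<Rightarrow> bool" where
  "reflexive R M \<longleftrightarrow> bidual_map R M \<in> mod_iso R M (bidual R M)"

section \<open>Vanishing of Ext\<close>

definition projective_resolution ::
    "'a ring \<Rightarrow> (nat \<Rightarrow> ('a, 'p) module) \<Rightarrow> (nat \<Rightarrow> 'p \<Rightarrow> 'p) \<Rightarrow> ('p \<Rightarrow> 'm) \<Rightarrow> ('a, 'm) module \<Rightarrow> bool" where
  "projective_resolution R P d e M \<longleftrightarrow>
     (\<forall>n. fg_projective R (P n)) \<and>
     (\<forall>n. d n \<in> mod_hom R (P (Suc n)) (P n)) \<and>
     e \<in> mod_hom R (P 0) M \<and>
     e ` carrier (P 0) = carrier M \<and>
     d 0 ` carrier (P 1) = a_kernel (P 0) M e \<and>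
     (\<forall>n. d (Suc n) ` carrier (P (Suc (Suc n))) = a_kernel (P (Suc n)) (P n) (d n))"

definition cocycles ::
    "'a ring \<Rightarrow> (nat \<Rightarrow> ('a, 'p) module) \<Rightarrow> (nat \<Rightarrow> 'p \<Rightarrow> 'p) \<Rightarrow> ('a, 'n) module \<Rightarrow> nat \<Rightarrow> ('p \<Rightarrow> 'n) set" where
  "cocycles R P d N n =
     {f \<in> mod_hom R (P n) N. \<forall>x\<in>carrier (P (Suc n)). f (d n x) = \<zero>\<^bsub>N\<^esub>}"

definition coboundaries ::
    "'a ring \<Rightarrow> (nat \<Rightarrow> ('a, 'p) module) \<Rightarrow> (nat \<Rightarrow> 'p \<Rightarrow> 'p) \<Rightarrow> ('a, 'n) module \<Rightarrow> nat \<Rightarrow> ('p \<Rightarrow> 'n) set" where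
  "coboundaries R P d N n =
     (case n of
        0 \<Rightarrow> {\<lambda>x\<in>carrier (P 0). \<zero>\<^bsub>N\<^esub>}
      | Suc m \<Rightarrow> (\<lambda>g. compose (carrier (P (Suc m))) g (d m)) ` mod_hom R (P m) N)"

text \<open>\<open>Ext\<^sup>n(M, N) = 0\<close>, computed from a resolution by finitely generated projectives; the choice of
  the resolution does not matter. Such resolutions exist for finitely generated modules over a left
  Noetherian ring, in particular for finite-dimensional modules over a finite-dimensional algebra.
  For other modules the predicate need not be meaningful.\<close>

definition Ext_vanishes :: "'a ring \<Rightarrow> nat \<Rightarrow> ('a, 'm) module \<Rightarrow> ('a, 'n) module \<Rightarrow> bool" where
  "Ext_vanishes R n M N \<longleftrightarrow>
     (\<exists>(P :: nat \<Rightarrow> ('a, nat \<Rightarrow> 'a) module) d e.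
        projective_resolution R P d e M \<and> cocycles R P d N n = coboundaries R P d N n)"

definition extensionless :: "'a ring \<Rightarrow> ('a, 'm) module \<Rightarrow> bool" where
  "extensionless R M \<longleftrightarrow> Ext_vanishes R 1 M (regular_module R)"

definition semi_Gorenstein_projective :: "'a ring \<Rightarrow> ('a, 'm) module \<Rightarrow> bool" where
  "semi_Gorenstein_projective R M \<longleftrightarrow> (\<forall>i\<ge>1. Ext_vanishes R i M (regular_module R))"

section \<open>The Auslander transpose\<close>

definition projective_cover :: "'a ring \<Rightarrow> ('a, 'p) module \<Rightarrow> ('p \<Rightarrow> 'm) \<Rightarrow> ('a, 'm) module \<Rightarrow> bool" where
  "projective_cover R P p M \<longleftrightarrow>
     fg_projective R P \<and> p \<in> mod_hom R P M \<and> p ` carrier P = carrier M \<and>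
     (\<forall>L. submodule L R P \<and> set_add P L (a_kernel P M p) = carrier P \<longrightarrow> L = carrier P)"

text \<open>A minimal projective presentation \<open>P1 \<rightarrow> P0 \<rightarrow> M \<rightarrow> 0\<close> with maps \<open>f\<close> and \<open>p\<close>.\<close>

definition minimal_presentation ::
    "'a ring \<Rightarrow> ('a, 'p) module \<Rightarrow> ('p \<Rightarrow> 'p) \<Rightarrow> ('a, 'p) module \<Rightarrow> ('p \<Rightarrow> 'm) \<Rightarrow> ('a, 'm) module \<Rightarrow> bool" where
  "minimal_presentation R P1 f P0 p M \<longleftrightarrow>
     projective_cover R P0 p M \<and>
     projective_cover R P1 f (P0\<lparr>carrier := a_kernel P0 M p\<rparr>)"

definition dual_map :: "('a, 'm) module \<Rightarrow> ('m \<Rightarrow> 'n) \<Rightarrow> ('n \<Rightarrow> 'a) \<Rightarrow> ('m \<Rightarrow> 'a)" where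
  "dual_map M f = (\<lambda>g. compose (carrier M) g f)"

text \<open>\<open>T\<close> is the transpose of \<open>M\<close>: the cokernel of \<open>f\<^sup>* : P0\<^sup>* \<rightarrow> P1\<^sup>*\<close>, a right \<open>R\<close>-module. It is
  determined by \<open>M\<close> up to isomorphism.\<close>

definition is_transpose ::
    "'a ring \<Rightarrow> ('a, 'm) module \<Rightarrow> ('a, ((nat \<Rightarrow> 'a) \<Rightarrow> 'a) set) module \<Rightarrow> bool" where
  "is_transpose R M T \<longleftrightarrow>
     (\<exists>P1 f P0 p. minimal_presentation R P1 f P0 p M \<and>
        T = quotient_module (dual R P1) (dual_map P1 f ` carrier (dual R P0)))"

definition infinity_torsionfree :: "'a ring \<Rightarrow> ('a, 'm) module \<Rightarrow> bool" where
  "infinity_torsionfree R M \<longleftrightarrow>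
     (\<exists>T. is_transpose R M T \<and>
        (\<forall>i\<ge>1. Ext_vanishes (op_ring R) i T (regular_module (op_ring R))))"

definition Gorenstein_projective :: "'a ring \<Rightarrow> ('a, 'm) module \<Rightarrow> bool" where
  "Gorenstein_projective R M \<longleftrightarrow> semi_Gorenstein_projective R M \<and> infinity_torsionfree R M"

definition pivotal_semi_Gorenstein_projective :: "'a ring \<Rightarrow> ('a, 'm) module \<Rightarrow> bool" where
  "pivotal_semi_Gorenstein_projective R M \<longleftrightarrow>
     indecomposable R M \<and> semi_Gorenstein_projective R M \<and> \<not> torsionless R M"

definition pivotal_infinity_torsionfree :: "'a ring \<Rightarrow> ('a, 'm) module \<Rightarrow> bool" where
  "pivotal_infinity_torsionfree R M \<longleftrightarrow>
     indecomposable R M \<and> infinity_torsionfree R M \<and> \<not> extensionless R M"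

section \<open>The algebra\<close>

datatype gen = X | Y | Z

datatype word = Word (letters: "gen list")

instantiation word :: monoid_add
begin

definition zero_word :: word where "0 = Word []"

definition plus_word :: "word \<Rightarrow> word \<Rightarrow> word" where "u + v = Word (letters u @ letters v)"

instance by standard (simp_all add: zero_word_def plus_word_def)

end

text \<open>Words under concatenation form the free monoid, so the library convolution product on
  \<^typ>\<open>word \<Rightarrow>\<^sub>0 'k\<close> makes this type the free associative algebra \<open>k\<langle>x, y, z\<rangle>\<close>.\<close>

type_synonym 'k free_alg = "word \<Rightarrow>\<^sub>0 'k"

definition free_ring :: "'k::field free_alg ring" where
  "free_ring = \<lparr>carrier = UNIV, mult = (*), one = 1, zero = 0, add = (+)\<rparr>"

definition const :: "'k::field \<Rightarrow> 'k free_alg" where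
  "const c = Poly_Mapping.single 0 c"

definition var :: "gen \<Rightarrow> 'k::field free_alg" where
  "var g = Poly_Mapping.single (Word [g]) 1"

definition relations :: "'k::field \<Rightarrow> 'k free_alg set" where
  "relations q =
     {var X * var X, var Y * var Y, var Z * var Z, var Y * var Z,
      var X * var Y + const q * var Y * var X,
      var X * var Z - var Z * var X,
      var Z * var Y - var Z * var X}"

type_synonym 'k lam = "'k free_alg set"

definition Lam :: "'k::field \<Rightarrow> 'k lam ring" where
  "Lam q = free_ring Quot (Idl\<^bsub>free_ring\<^esub> (relations q))"

definition cls :: "'k::field \<Rightarrow> 'k free_alg \<Rightarrow> 'k lam" where
  "cls q p = (Idl\<^bsub>free_ring\<^esub> (relations q)) +>\<^bsub>free_ring\<^esub> p"

text \<open>\<open>M\<close> has \<open>k\<close>-dimension \<open>n\<close>: there is a \<open>k\<close>-basis with \<open>n\<close> elements. Scalars act through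
  \<open>k \<rightarrow> \<Lambda>\<close>.\<close>

definition has_dim :: "'k::field \<Rightarrow> ('k lam, 'm) module \<Rightarrow> nat \<Rightarrow> bool" where
  "has_dim q M n \<longleftrightarrow>
     (\<exists>v \<in> {..<n} \<rightarrow> carrier M. \<forall>m\<in>carrier M.
        \<exists>!c. c \<in> {..<n} \<rightarrow>\<^sub>E UNIV \<and> m = (\<Oplus>\<^bsub>M\<^esub>i\<in>{..<n}. cls q (const (c i)) \<odot>\<^bsub>M\<^esub> v i))"

definition lin :: "'k::field \<Rightarrow> 'k \<Rightarrow> 'k \<Rightarrow> 'k \<Rightarrow> 'k lam" where
  "lin q a b c = cls q (const a * var X + const b * var Y + const c * var Z)"

text \<open>For any ring the library notation \<open>PIdl a\<close> stands for \<open>{r \<otimes> a | r. r \<in> carrier R}\<close>, that is,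
  the left ideal generated by \<open>a\<close>.\<close>

definition principal_module :: "'k::field \<Rightarrow> 'k lam \<Rightarrow> ('k lam, 'k lam) module" where
  "principal_module q a = (regular_module (Lam q))\<lparr>carrier := PIdl\<^bsub>Lam q\<^esub> a\<rparr>"

definition U_ideal :: "'k::field \<Rightarrow> 'k \<Rightarrow> 'k \<Rightarrow> 'k \<Rightarrow> 'k lam set" where
  "U_ideal q a b c =
     (PIdl\<^bsub>Lam q\<^esub> (lin q a b c)) <+>\<^bsub>Lam q\<^esub> socle (Lam q) (regular_module (Lam q))"

definition M_mod :: "'k::field \<Rightarrow> 'k \<Rightarrow> 'k \<Rightarrow> 'k \<Rightarrow> ('k lam, 'k lam set) module" where
  "M_mod q a b c = quotient_module (regular_module (Lam q)) (U_ideal q a b c)"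

definition mult_order :: "'k::field \<Rightarrow> enat" where
  "mult_order q =
     (if \<exists>n>0. q ^ n = 1 then enat (LEAST n. n > 0 \<and> q ^ n = 1) else \<infinity>)"

end

theory Submission imports Defs begin

text \<open>
  Every module \<open>\<Lambda>/U\<close> is described by a generator and its annihilator (\<open>cyc\<close>), and \<open>M \<cong> M(a, b, c)\<close> means
  that \<open>M\<close> has a generator with annihilator \<open>U(a, b, c)\<close>. On the family \<open>M(1, b, c)\<close> the syzygy
  acts by \<open>b \<mapsto> qb\<close> (lemma \<open>cyc_Us\<close>) as long as \<open>b \<noteq> - 1\<close>, while \<open>b = - 1\<close> is exactly the case
  \<open>Ext\<^sup>1(M, \<Lambda>) \<noteq> 0\<close> (\<open>Ext_1_Us\<close>). So \<open>M(1, b, c)\<close> is semi-Gorenstein-projective iff no \<open>q\<^sup>n b\<close>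
  with \<open>n \<ge> 0\<close> equals \<open>- 1\<close> (\<open>semi_Gorenstein_Us\<close>).

  On the other side the dual of \<open>M(1, b, c)\<close> is a right ideal of the same shape with \<open>b\<close> replaced by \<open>b/q\<close>
  (\<open>rann_Us\<close>), and right syzygies again divide \<open>b\<close> by \<open>q\<close> (\<open>cyc_Us_op\<close>). Torsionlessness fails exactly at
  \<open>b = - q\<close>, reflexivity fails in addition at \<open>b = - q\<^sup>2\<close> (\<open>reflexive_Us\<close>), and the higher extension
  groups of the transpose vanish iff \<open>b\<close> avoids the further powers (\<open>infinity_torsionfree_Us\<close>). For the
  transpose only one fact about minimal presentations is needed: that the obvious ones are minimal, by
  Nakayama's lemma. Conversely, from an arbitrary presentation one reads off that
  \<open>Ext\<^sup>1(Tr M, \<Lambda>) = Ext\<^sup>2(Tr M, \<Lambda>) = 0\<close> forces reflexivity, and that the second syzygy of \<open>Tr M\<close> is \<open>M\<^sup>*\<close>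
  (locale \<open>presentation\<close>).

  It remains to deal with all other indecomposable modules of dimension at most 3. The lemma \<open>classification\<close> shows
  that such a module is simple, or cyclic of dimension 2 or 3, or generated by two elements whose radicals lie in one
  line. Those outside \<open>M(1, b, c)\<close> have \<open>Ext\<^sup>1(M, \<Lambda>) \<noteq> 0\<close> (lemma \<open>Ext_1_cases\<close>), because some
  map from the syzygy to the socle of \<open>\<Lambda>\<close> is not a restriction, and the few that are torsionless (lemma \<open>separated_cases\<close>) are not reflexive
  (lemma \<open>not_reflexive_special\<close>).

  Extension groups are computed through \<open>Ext\<^sup>1\<close> of syzygies: a map from a syzygy
  \<open>K \<subseteq> P\<close> represents zero iff it extends to \<open>P\<close>, and by a form of Schanuel's lemma (\<open>stab\<close>) this does not depend on the
  projective resolution.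
\<close>

section \<open>Linear maps and finite sums\<close>

text \<open>Linear maps without the extensionality that \<^const>\<open>mod_hom\<close> demands, so that they can be
  composed and added pointwise.\<close>

definition linmap :: "'a ring \<Rightarrow> ('a, 'm) module \<Rightarrow> ('a, 'n) module \<Rightarrow> ('m \<Rightarrow> 'n) \<Rightarrow> bool" where
  "linmap R M N f \<longleftrightarrow> (\<forall>x\<in>carrier M. f x \<in> carrier N) \<and>
     (\<forall>x\<in>carrier M. \<forall>y\<in>carrier M. f (x \<oplus>\<^bsub>M\<^esub> y) = f x \<oplus>\<^bsub>N\<^esub> f y) \<and>
     (\<forall>a\<in>carrier R. \<forall>x\<in>carrier M. f (a \<odot>\<^bsub>M\<^esub> x) = a \<odot>\<^bsub>N\<^esub> f x)"

primrec lsum :: "('a, 'm, 's) module_scheme \<Rightarrow> nat \<Rightarrow> (nat \<Rightarrow> 'm) \<Rightarrow> 'm" where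
  "lsum M 0 v = \<zero>\<^bsub>M\<^esub>"
| "lsum M (Suc n) v = lsum M n v \<oplus>\<^bsub>M\<^esub> v n"

abbreviation sub :: "('a, 'm, 's) module_scheme \<Rightarrow> 'm set \<Rightarrow> ('a, 'm, 's) module_scheme" where
  "sub M N \<equiv> M\<lparr>carrier := N\<rparr>"

lemma linmapI:
  assumes "\<And>x. x \<in> carrier M \<Longrightarrow> f x \<in> carrier N"
    and "\<And>x y. x \<in> carrier M \<Longrightarrow> y \<in> carrier M \<Longrightarrow> f (x \<oplus>\<^bsub>M\<^esub> y) = f x \<oplus>\<^bsub>N\<^esub> f y"
    and "\<And>a x. a \<in> carrier R \<Longrightarrow> x \<in> carrier M \<Longrightarrow> f (a \<odot>\<^bsub>M\<^esub> x) = a \<odot>\<^bsub>N\<^esub> f x"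
  shows "linmap R M N f"
  using assms unfolding linmap_def by blast

lemma linmapD:
  assumes "linmap R M N f"
  shows "x \<in> carrier M \<Longrightarrow> f x \<in> carrier N"
    and "x \<in> carrier M \<Longrightarrow> y \<in> carrier M \<Longrightarrow> f (x \<oplus>\<^bsub>M\<^esub> y) = f x \<oplus>\<^bsub>N\<^esub> f y"
    and "a \<in> carrier R \<Longrightarrow> x \<in> carrier M \<Longrightarrow> f (a \<odot>\<^bsub>M\<^esub> x) = a \<odot>\<^bsub>N\<^esub> f x"
  using assms unfolding linmap_def by blast+

lemma mod_hom_linmap: "f \<in> mod_hom R M N \<Longrightarrow> linmap R M N f"
  unfolding mod_hom_def linmap_def by auto

lemma mod_hom_iff: "f \<in> mod_hom R M N \<longleftrightarrow> linmap R M N f \<and> f \<in> extensional (carrier M)"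
  unfolding mod_hom_def linmap_def by (auto simp: PiE_def)

lemma linmap_cong:
  assumes "left_module R M" "linmap R M N f" "\<And>x. x \<in> carrier M \<Longrightarrow> g x = f x"
  shows "linmap R M N g"
proof -
  interpret left_module R M by fact
  show ?thesis using assms(2,3) unfolding linmap_def by simp
qed

lemma linmap_restrict:
  assumes "left_module R M" "linmap R M N f"
  shows "restrict f (carrier M) \<in> mod_hom R M N"
  using linmap_cong[OF assms, of "restrict f (carrier M)"] by (simp add: mod_hom_iff)

lemma linmap_comp: "linmap R M N f \<Longrightarrow> linmap R N K g \<Longrightarrow> linmap R M K (\<lambda>x. g (f x))"
  unfolding linmap_def by simp

lemma linmap_sub: "linmap R M N f \<Longrightarrow> K \<subseteq> carrier M \<Longrightarrow> linmap R (sub M K) N f"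
  unfolding linmap_def by (simp add: subset_iff)

lemma linmap_into: "linmap R M N f \<Longrightarrow> (\<And>x. x \<in> carrier M \<Longrightarrow> f x \<in> K) \<Longrightarrow> linmap R M (sub N K) f"
  unfolding linmap_def by auto

lemma linmap_from: "linmap R M (sub N K) f \<Longrightarrow> K \<subseteq> carrier N \<Longrightarrow> linmap R M N f"
  unfolding linmap_def by auto

lemma linmap_id: "linmap R M M (\<lambda>x. x)"
  unfolding linmap_def by simp

lemma linmap_zero:
  assumes "left_module R M" "left_module R N" "linmap R M N f"
  shows "f \<zero>\<^bsub>M\<^esub> = \<zero>\<^bsub>N\<^esub>"
proof -
  interpret M: left_module R M by fact
  interpret N: left_module R N by fact
  have "f \<zero>\<^bsub>M\<^esub> \<oplus>\<^bsub>N\<^esub> f \<zero>\<^bsub>M\<^esub> = f \<zero>\<^bsub>M\<^esub>"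
    using linmapD(2)[OF assms(3), of "\<zero>\<^bsub>M\<^esub>" "\<zero>\<^bsub>M\<^esub>"] by simp
  then show ?thesis using linmapD(1)[OF assms(3), of "\<zero>\<^bsub>M\<^esub>"]
    by (metis M.M.zero_closed N.add.l_cancel_one')
qed

lemma linmap_neg:
  assumes "left_module R M" "left_module R N" "linmap R M N f" "x \<in> carrier M"
  shows "f (\<ominus>\<^bsub>M\<^esub> x) = \<ominus>\<^bsub>N\<^esub> f x"
proof -
  interpret M: left_module R M by fact
  interpret N: left_module R N by fact
  have "f (\<ominus>\<^bsub>M\<^esub> x) \<oplus>\<^bsub>N\<^esub> f x = \<zero>\<^bsub>N\<^esub>"
    using linmapD(2)[OF assms(3), of "\<ominus>\<^bsub>M\<^esub> x" x] assms(4)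
    by (simp add: M.l_neg linmap_zero[OF assms(1-3)])
  then show ?thesis using linmapD(1)[OF assms(3)] assms(4)
    by (metis M.M.a_inv_closed N.M.minus_equality)
qed

lemma linmap_minus:
  assumes "left_module R M" "left_module R N" "linmap R M N f" "x \<in> carrier M" "y \<in> carrier M"
  shows "f (x \<ominus>\<^bsub>M\<^esub> y) = f x \<ominus>\<^bsub>N\<^esub> f y"
proof -
  interpret M: left_module R M by fact
  interpret N: left_module R N by fact
  show ?thesis using assms linmapD(2)[OF assms(3)] linmap_neg[OF assms(1-3)]
    by (simp add: a_minus_def)
qed

context left_module
begin

lemma smult_r_null: "a \<in> carrier R \<Longrightarrow> a \<odot>\<^bsub>M\<^esub> \<zero>\<^bsub>M\<^esub> = \<zero>\<^bsub>M\<^esub>"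
  by (metis M.add.l_cancel_one' M.r_zero M.zero_closed smult_closed smult_r_distr)

lemma smult_l_null: "x \<in> carrier M \<Longrightarrow> \<zero>\<^bsub>R\<^esub> \<odot>\<^bsub>M\<^esub> x = \<zero>\<^bsub>M\<^esub>"
  by (metis M.add.l_cancel_one' R.r_zero R.zero_closed smult_closed smult_l_distr)

lemma smult_l_neg: "a \<in> carrier R \<Longrightarrow> x \<in> carrier M \<Longrightarrow> (\<ominus>\<^bsub>R\<^esub> a) \<odot>\<^bsub>M\<^esub> x = \<ominus>\<^bsub>M\<^esub> (a \<odot>\<^bsub>M\<^esub> x)"
  by (metis M.minus_equality R.a_inv_closed R.l_neg smult_closed smult_l_distr smult_l_null)

lemma smult_r_neg: "a \<in> carrier R \<Longrightarrow> x \<in> carrier M \<Longrightarrow> a \<odot>\<^bsub>M\<^esub> (\<ominus>\<^bsub>M\<^esub> x) = \<ominus>\<^bsub>M\<^esub> (a \<odot>\<^bsub>M\<^esub> x)"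
  by (metis M.a_inv_closed M.l_neg M.minus_equality smult_closed smult_r_distr smult_r_null)

lemma submodI:
  assumes "N \<subseteq> carrier M" "\<zero>\<^bsub>M\<^esub> \<in> N" "\<And>x y. x \<in> N \<Longrightarrow> y \<in> N \<Longrightarrow> x \<oplus>\<^bsub>M\<^esub> y \<in> N"
    "\<And>a x. a \<in> carrier R \<Longrightarrow> x \<in> N \<Longrightarrow> a \<odot>\<^bsub>M\<^esub> x \<in> N"
  shows "submodule N R M"
proof -
  have "\<ominus>\<^bsub>M\<^esub> x \<in> N" if "x \<in> N" for x
    using assms(4)[of "\<ominus>\<^bsub>R\<^esub> \<one>\<^bsub>R\<^esub>" x] that smult_l_neg[of "\<one>\<^bsub>R\<^esub>" x] assms(1) by auto
  then have "subgroup N (add_monoid M)"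
    using assms by (intro M.add.subgroupI) (auto simp: a_inv_def)
  then show ?thesis using assms(4) by (simp add: submodule_def submodule_axioms_def)
qed

lemma submodD:
  assumes "submodule N R M"
  shows "N \<subseteq> carrier M" "\<zero>\<^bsub>M\<^esub> \<in> N" "\<And>x y. x \<in> N \<Longrightarrow> y \<in> N \<Longrightarrow> x \<oplus>\<^bsub>M\<^esub> y \<in> N"
    "\<And>a x. a \<in> carrier R \<Longrightarrow> x \<in> N \<Longrightarrow> a \<odot>\<^bsub>M\<^esub> x \<in> N"
    "\<And>x. x \<in> N \<Longrightarrow> \<ominus>\<^bsub>M\<^esub> x \<in> N" "\<And>x y. x \<in> N \<Longrightarrow> y \<in> N \<Longrightarrow> x \<ominus>\<^bsub>M\<^esub> y \<in> N"
proof -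
  interpret s: submodule N R M by fact
  show "N \<subseteq> carrier M" "\<zero>\<^bsub>M\<^esub> \<in> N" "\<And>x y. x \<in> N \<Longrightarrow> y \<in> N \<Longrightarrow> x \<oplus>\<^bsub>M\<^esub> y \<in> N"
    "\<And>a x. a \<in> carrier R \<Longrightarrow> x \<in> N \<Longrightarrow> a \<odot>\<^bsub>M\<^esub> x \<in> N" 
    using s.subset s.one_closed s.m_closed by auto
  show n: "\<And>x. x \<in> N \<Longrightarrow> \<ominus>\<^bsub>M\<^esub> x \<in> N"
    using s.m_inv_closed by (simp add: a_inv_def)
  show "\<And>x y. x \<in> N \<Longrightarrow> y \<in> N \<Longrightarrow> x \<ominus>\<^bsub>M\<^esub> y \<in> N"
    using n s.m_closed by (auto simp: a_minus_def)
qed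

lemma lsum_closed: "(\<And>j. j < n \<Longrightarrow> v j \<in> carrier M) \<Longrightarrow> lsum M n v \<in> carrier M"
  by (induction n) auto

lemma lsum_add: "(\<And>j. j < n \<Longrightarrow> v j \<in> carrier M) \<Longrightarrow> (\<And>j. j < n \<Longrightarrow> w j \<in> carrier M) \<Longrightarrow>
   lsum M n (\<lambda>j. v j \<oplus>\<^bsub>M\<^esub> w j) = lsum M n v \<oplus>\<^bsub>M\<^esub> lsum M n w"
proof (induction n)
  case (Suc n)
  have "lsum M n v \<in> carrier M" "lsum M n w \<in> carrier M" "v n \<in> carrier M" "w n \<in> carrier M"
    using Suc by (auto intro: lsum_closed)
  then show ?case using Suc by (simp add: M.a_ac)
qed simp

lemma lsum_smult: "a \<in> carrier R \<Longrightarrow> (\<And>j. j < n \<Longrightarrow> v j \<in> carrier M) \<Longrightarrow>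
   lsum M n (\<lambda>j. a \<odot>\<^bsub>M\<^esub> v j) = a \<odot>\<^bsub>M\<^esub> lsum M n v"
  by (induction n) (auto simp: smult_r_null smult_r_distr lsum_closed)

lemma lsum_zero: "(\<And>j. j < n \<Longrightarrow> v j = \<zero>\<^bsub>M\<^esub>) \<Longrightarrow> lsum M n v = \<zero>\<^bsub>M\<^esub>"
  by (induction n) auto

lemma lsum_single: "k < n \<Longrightarrow> v k \<in> carrier M \<Longrightarrow> (\<And>j. j < n \<Longrightarrow> j \<noteq> k \<Longrightarrow> v j = \<zero>\<^bsub>M\<^esub>) \<Longrightarrow> lsum M n v = v k"
proof (induction n)
  case (Suc n)
  show ?case
  proof (cases "k = n")
    case True
    then have "lsum M n v = \<zero>\<^bsub>M\<^esub>" using Suc.prems by (intro lsum_zero) auto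
    then show ?thesis using True Suc.prems by simp
  next
    case False
    then show ?thesis using Suc by auto
  qed
qed simp

lemma left_module_sub:
  assumes "submodule N R M" shows "left_module R (sub M N)"
proof -
  note N = submodD[OF assms]
  have cl: "x \<in> carrier M" if "x \<in> N" for x using N(1) that by blast
  have inv: "\<exists>y\<in>N. y \<oplus>\<^bsub>M\<^esub> x = \<zero>\<^bsub>M\<^esub>" if "x \<in> N" for x
    using N(1) N(5)[of x] that by (intro bexI[of _ "\<ominus>\<^bsub>M\<^esub> x"]) (auto simp: M.l_neg)
  have "abelian_group (sub M N)"
    by (rule abelian_groupI)
      (use N(2,3) inv cl in \<open>simp_all add: M.a_ac\<close>)
  moreover have "left_module_axioms R (sub M N)"
    by unfold_locales (use N(4) cl in \<open>simp_all add: smult_l_distr smult_r_distr smult_assoc\<close>)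
  ultimately show ?thesis by (simp add: left_module_def R.ring_axioms)
qed

end

lemma lsum_cong: "(\<And>j. j < n \<Longrightarrow> v j = w j) \<Longrightarrow> lsum M n v = lsum M n w"
  by (induction n) auto

lemma linmap_lsum:
  assumes "left_module R M" "left_module R N" "linmap R M N f"
  shows "(\<And>j. j < n \<Longrightarrow> v j \<in> carrier M) \<Longrightarrow> f (lsum M n v) = lsum N n (\<lambda>j. f (v j))"
  by (induction n)
    (auto simp: linmap_zero[OF assms] linmapD(2)[OF assms(3)] left_module.lsum_closed[OF assms(1)])

lemma linmap_sum:
  assumes N: "left_module R N" and "\<And>j. j < n \<Longrightarrow> linmap R M N (f j)"
  shows "linmap R M N (\<lambda>x. lsum N n (\<lambda>j. f j x))"
proof -
  interpret N: left_module R N by fact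
  have c: "f j x \<in> carrier N" if "j < n" "x \<in> carrier M" for j x
    using linmapD(1)[OF assms(2)] that by blast
  show ?thesis
    by (rule linmapI)
      (auto simp: N.lsum_closed c N.lsum_add[symmetric] N.lsum_smult[symmetric]
        linmapD(2,3)[OF assms(2)] intro!: lsum_cong)
qed

lemma linmap_add:
  assumes N: "left_module R N" and "linmap R M N f" "linmap R M N g"
  shows "linmap R M N (\<lambda>x. f x \<oplus>\<^bsub>N\<^esub> g x)"
proof -
  interpret N: left_module R N by fact
  show ?thesis using assms(2,3) unfolding linmap_def by (auto simp: N.a_ac N.smult_r_distr)
qed

lemma linmap_uminus:
  assumes N: "left_module R N" and "linmap R M N f"
  shows "linmap R M N (\<lambda>x. \<ominus>\<^bsub>N\<^esub> f x)"
proof -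
  interpret N: left_module R N by fact
  show ?thesis using assms(2) unfolding linmap_def 
    by (auto simp: N.smult_r_neg N.minus_add N.a_comm)
qed

lemma linmap_const_zero:
  assumes N: "left_module R N"
  shows "linmap R M N (\<lambda>x. \<zero>\<^bsub>N\<^esub>)"
proof -
  interpret N: left_module R N by fact
  show ?thesis unfolding linmap_def by (auto simp: N.smult_r_null)
qed

lemma regular_simps [simp]:
  "carrier (regular_module R) = carrier R" "add (regular_module R) = add R"
  "zero (regular_module R) = \<zero>\<^bsub>R\<^esub>" "smult (regular_module R) = mult R"
  by (simp_all add: regular_module_def)

lemma free_simps [simp]:
  "carrier (free_module R n) = {..<n} \<rightarrow>\<^sub>E carrier R"
  "add (free_module R n) u v = (\<lambda>i\<in>{..<n}. u i \<oplus>\<^bsub>R\<^esub> v i)"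
  "zero (free_module R n) = (\<lambda>i\<in>{..<n}. \<zero>\<^bsub>R\<^esub>)" 
  "smult (free_module R n) a u = (\<lambda>i\<in>{..<n}. a \<otimes>\<^bsub>R\<^esub> u i)"
  by (simp_all add: free_module_def)

lemma regular_left_module:
  assumes "ring R" shows "left_module R (regular_module R)"
proof -
  interpret ring R by fact
  have "abelian_group (regular_module R)"
    by (rule abelian_groupI) (auto simp: a_ac intro: bexI[of _ "\<ominus>\<^bsub>R\<^esub> _"] l_neg)
  moreover have "left_module_axioms R (regular_module R)"
    by unfold_locales (auto simp: l_distr r_distr m_assoc)
  ultimately show ?thesis by (simp add: left_module_def ring_axioms)
qed

lemma free_left_module:
  assumes "ring R" shows "left_module R (free_module R n)"
proof -
  interpret ring R by fact
  let ?F = "free_module R n"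
  have cl: "x i \<in> carrier R" if "x \<in> {..<n} \<rightarrow>\<^sub>E carrier R" "i < n" for x i
    using that by (auto simp: PiE_iff)
  have ext: "x = y" if "x \<in> {..<n} \<rightarrow>\<^sub>E carrier R" "y \<in> {..<n} \<rightarrow>\<^sub>E carrier R" 
    "\<And>i. i < n \<Longrightarrow> x i = y i" for x y
    using that by (intro PiE_ext) auto
  have a: "x \<oplus>\<^bsub>?F\<^esub> y \<in> carrier ?F" if "x \<in> carrier ?F" "y \<in> carrier ?F" for x y
    using that cl by simp
  have z: "\<zero>\<^bsub>?F\<^esub> \<in> carrier ?F" by simp
  have s: "c \<odot>\<^bsub>?F\<^esub> x \<in> carrier ?F" if "c \<in> carrier R" "x \<in> carrier ?F" for c x
    using that cl by simp
  have ext': "x = y" if "x \<in> carrier ?F" "y \<in> carrier ?F" "\<And>i. i < n \<Longrightarrow> x i = y i" for x y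
    using ext that by simp
  have inv: "\<exists>y\<in>carrier ?F. y \<oplus>\<^bsub>?F\<^esub> x = \<zero>\<^bsub>?F\<^esub>" if x: "x \<in> carrier ?F" for x
  proof
    show n: "(\<lambda>i\<in>{..<n}. \<ominus>\<^bsub>R\<^esub> x i) \<in> carrier ?F" using x cl by simp
    show "(\<lambda>i\<in>{..<n}. \<ominus>\<^bsub>R\<^esub> x i) \<oplus>\<^bsub>?F\<^esub> x = \<zero>\<^bsub>?F\<^esub>"
      by (rule ext'[OF a[OF n x] z]) (use x cl in \<open>simp add: l_neg\<close>)
  qed
  have "abelian_group ?F"
  proof (rule abelian_groupI)
    fix x y w assume c: "x \<in> carrier ?F" "y \<in> carrier ?F" "w \<in> carrier ?F"
    show "(x \<oplus>\<^bsub>?F\<^esub> y) \<oplus>\<^bsub>?F\<^esub> w = x \<oplus>\<^bsub>?F\<^esub> (y \<oplus>\<^bsub>?F\<^esub> w)"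
      by (rule ext'[OF a[OF a[OF c(1,2)] c(3)] a[OF c(1) a[OF c(2,3)]]])
        (use c in \<open>simp add: cl a_assoc\<close>)
  next
    fix x y assume c: "x \<in> carrier ?F" "y \<in> carrier ?F"
    show "x \<oplus>\<^bsub>?F\<^esub> y = y \<oplus>\<^bsub>?F\<^esub> x"
      by (rule ext'[OF a[OF c] a[OF c(2,1)]]) (use c in \<open>simp add: a_comm cl\<close>)
  next
    fix x assume c: "x \<in> carrier ?F"
    show "\<zero>\<^bsub>?F\<^esub> \<oplus>\<^bsub>?F\<^esub> x = x"
      by (rule ext'[OF a[OF z c] c]) (use c in \<open>simp add: cl\<close>)
  qed (fact a z inv)+
  moreover have "left_module_axioms R ?F"
  proof
    fix c d x assume c: "c \<in> carrier R" "d \<in> carrier R" "x \<in> carrier ?F"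
    show "(c \<oplus>\<^bsub>R\<^esub> d) \<odot>\<^bsub>?F\<^esub> x = c \<odot>\<^bsub>?F\<^esub> x \<oplus>\<^bsub>?F\<^esub> d \<odot>\<^bsub>?F\<^esub> x"
      using c cl[of x] by (auto intro!: restrict_ext simp: l_distr)
    show "(c \<otimes>\<^bsub>R\<^esub> d) \<odot>\<^bsub>?F\<^esub> x = c \<odot>\<^bsub>?F\<^esub> (d \<odot>\<^bsub>?F\<^esub> x)"
      using c cl[of x] by (auto intro!: restrict_ext simp: m_assoc)
  next
    fix c x y assume c: "c \<in> carrier R" "x \<in> carrier ?F" "y \<in> carrier ?F"
    show "c \<odot>\<^bsub>?F\<^esub> (x \<oplus>\<^bsub>?F\<^esub> y) = c \<odot>\<^bsub>?F\<^esub> x \<oplus>\<^bsub>?F\<^esub> c \<odot>\<^bsub>?F\<^esub> y"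
      using c cl[of x] cl[of y] by (auto intro!: restrict_ext simp: r_distr)
  next
    fix x assume c: "x \<in> carrier ?F"
    show "\<one>\<^bsub>R\<^esub> \<odot>\<^bsub>?F\<^esub> x = x"
      by (rule ext'[OF s[OF one_closed c] c]) (use c in \<open>simp add: cl\<close>)
  qed (fact s)
  ultimately show ?thesis by (simp add: left_module_def ring_axioms)
qed

lemma op_simps [simp]:
  "carrier (op_ring R) = carrier R" "add (op_ring R) = add R" "zero (op_ring R) = \<zero>\<^bsub>R\<^esub>"
  "one (op_ring R) = \<one>\<^bsub>R\<^esub>" "x \<otimes>\<^bsub>op_ring R\<^esub> y = y \<otimes>\<^bsub>R\<^esub> x"
  by (simp_all add: op_ring_def)

lemma op_ring_ring:
  assumes "ring R" shows "ring (op_ring R)"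
proof -
  interpret ring R by fact
  show ?thesis
    by (rule ringI)
      (auto intro!: abelian_groupI monoidI simp: a_ac m_assoc l_distr r_distr 
         intro: bexI[of _ "\<ominus>\<^bsub>R\<^esub> _"] l_neg)
qed

lemma dual_simps [simp]:
  "carrier (dual R M) = mod_hom R M (regular_module R)"
  "add (dual R M) f g = (\<lambda>x\<in>carrier M. f x \<oplus>\<^bsub>R\<^esub> g x)"
  "zero (dual R M) = (\<lambda>x\<in>carrier M. \<zero>\<^bsub>R\<^esub>)"
  "smult (dual R M) a f = (\<lambda>x\<in>carrier M. f x \<otimes>\<^bsub>R\<^esub> a)"
  by (simp_all add: dual_def)

lemma dual_left_module:
  assumes M: "left_module R M" shows "left_module (op_ring R) (dual R M)"
proof -
  interpret M: left_module R M by fact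
  have R: "left_module R (regular_module R)" by (rule regular_left_module) unfold_locales
  note lin = linmap_restrict[OF M]
  have cl: "f x \<in> carrier R" if "f \<in> mod_hom R M (regular_module R)" "x \<in> carrier M" for f x
    using linmapD(1)[OF mod_hom_linmap[OF that(1)] that(2)] by simp
  have add: "(\<lambda>x\<in>carrier M. f x \<oplus>\<^bsub>R\<^esub> g x) \<in> mod_hom R M (regular_module R)"
    if "f \<in> mod_hom R M (regular_module R)" "g \<in> mod_hom R M (regular_module R)" for f g
    using linmap_add[OF R mod_hom_linmap[OF that(1)] mod_hom_linmap[OF that(2)]] by (intro lin) simp
  have ze: "(\<lambda>x\<in>carrier M. \<zero>\<^bsub>R\<^esub>) \<in> mod_hom R M (regular_module R)"
    using linmap_const_zero[OF R] by (intro lin) simp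
  have neg: "(\<lambda>x\<in>carrier M. \<ominus>\<^bsub>R\<^esub> f x) \<in> mod_hom R M (regular_module R)"
    if "f \<in> mod_hom R M (regular_module R)" for f
  proof (rule lin)
    have "\<ominus>\<^bsub>regular_module R\<^esub> y = \<ominus>\<^bsub>R\<^esub> y" for y by (simp add: a_inv_def m_inv_def)
    then show "linmap R M (regular_module R) (\<lambda>x. \<ominus>\<^bsub>R\<^esub> f x)"
      using linmap_uminus[OF R mod_hom_linmap[OF that]] by simp
  qed
  have sm: "(\<lambda>x\<in>carrier M. f x \<otimes>\<^bsub>R\<^esub> a) \<in> mod_hom R M (regular_module R)"
    if "f \<in> mod_hom R M (regular_module R)" "a \<in> carrier R" for f a
    using mod_hom_linmap[OF that(1)] that(2)
    by (intro lin) (auto simp: linmap_def M.R.l_distr M.R.m_assoc)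
  have inv: "\<exists>g\<in>carrier (dual R M). g \<oplus>\<^bsub>dual R M\<^esub> f = \<zero>\<^bsub>dual R M\<^esub>"
    if "f \<in> carrier (dual R M)" for f
    using that
    by (intro bexI[OF _ neg[of f, folded dual_simps(1)]]) (auto intro!: restrict_ext simp: cl M.R.l_neg)
  have ext: "(\<lambda>x\<in>carrier M. g x) = f" 
    if "f \<in> mod_hom R M (regular_module R)" "\<And>x. x \<in> carrier M \<Longrightarrow> g x = f x" for f g
    using that by (intro HOL.ext) (auto simp: mod_hom_iff extensional_def)
  have "abelian_group (dual R M)"
  proof (rule abelian_groupI)
    fix f assume "f \<in> carrier (dual R M)"
    then show "\<zero>\<^bsub>dual R M\<^esub> \<oplus>\<^bsub>dual R M\<^esub> f = f" using cl[of f] by (auto intro!: ext)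
  next
    fix f assume "f \<in> carrier (dual R M)"
    then show "\<exists>g\<in>carrier (dual R M). g \<oplus>\<^bsub>dual R M\<^esub> f = \<zero>\<^bsub>dual R M\<^esub>" by (rule inv)
  qed (use cl add ze in \<open>auto intro!: restrict_ext simp: M.R.a_ac\<close>)
  moreover have "left_module_axioms (op_ring R) (dual R M)"
  proof
    fix f assume "f \<in> carrier (dual R M)"
    then show "\<one>\<^bsub>op_ring R\<^esub> \<odot>\<^bsub>dual R M\<^esub> f = f" using cl[of f] by (auto intro!: ext)
  qed (use sm cl in \<open>auto simp: M.R.l_distr M.R.r_distr M.R.m_assoc intro!: restrict_ext\<close>)
  ultimately show ?thesis by (simp add: left_module_def op_ring_ring M.R.ring_axioms)
qed

lemma (in abelian_group) sum_minus_summands: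
  assumes "a \<in> carrier G" "b \<in> carrier G"
  shows "((a \<oplus> b) \<oplus> \<ominus> a) \<oplus> \<ominus> b = \<zero>"
proof -
  have "((a \<oplus> b) \<oplus> \<ominus> a) \<oplus> \<ominus> b = (a \<oplus> \<ominus> a) \<oplus> (b \<oplus> \<ominus> b)"
    using assms by (simp add: a_ac del: r_neg)
  then show ?thesis using assms by (simp add: r_neg)
qed

lemma (in abelian_group) add_diff:
  assumes "a \<in> carrier G" "b \<in> carrier G"
  shows "b \<oplus> (a \<oplus> \<ominus> b) = a"
proof -
  have "b \<oplus> (a \<oplus> \<ominus> b) = a \<oplus> (b \<oplus> \<ominus> b)"
    using assms by (simp add: a_ac del: r_neg)
  then show ?thesis using assms by (simp add: r_neg)
qed

section \<open>Projectivity\<close>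

text \<open>A finite dual basis. Unlike \<^const>\<open>fg_projective\<close> this form passes to the dual of a module
  and applies to modules on any type.\<close>

definition dual_basis :: "'a ring \<Rightarrow> ('a, 'm) module \<Rightarrow> nat \<Rightarrow> (nat \<Rightarrow> 'm \<Rightarrow> 'a) \<Rightarrow> (nat \<Rightarrow> 'm) \<Rightarrow> bool" where
  "dual_basis R P n \<phi> y \<longleftrightarrow> left_module R P \<and>
     (\<forall>j<n. linmap R P (regular_module R) (\<phi> j) \<and> y j \<in> carrier P) \<and>
     (\<forall>x\<in>carrier P. x = lsum P n (\<lambda>j. \<phi> j x \<odot>\<^bsub>P\<^esub> y j))"

definition proj :: "'a ring \<Rightarrow> ('a, 'm) module \<Rightarrow> bool" where
  "proj R P \<longleftrightarrow> (\<exists>n \<phi> y. dual_basis R P n \<phi> y)"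

definition unit_vec :: "'a ring \<Rightarrow> nat \<Rightarrow> nat \<Rightarrow> nat \<Rightarrow> 'a" where
  "unit_vec R n k = (\<lambda>i\<in>{..<n}. if i = k then \<one>\<^bsub>R\<^esub> else \<zero>\<^bsub>R\<^esub>)"

lemma proj_left_module: "proj R P \<Longrightarrow> left_module R P"
  unfolding proj_def dual_basis_def by blast

lemma left_module_ring: "left_module R M \<Longrightarrow> ring R"
  by (simp add: left_module_def)

lemma linmap_smult_vec:
  assumes "left_module R N" "y \<in> carrier N"
  shows "linmap R (regular_module R) N (\<lambda>r. r \<odot>\<^bsub>N\<^esub> y)"
proof -
  interpret left_module R N by fact
  show ?thesis using assms(2) by (intro linmapI) (auto simp: smult_l_distr smult_assoc)
qed

lemma linmap_coord: "j < n \<Longrightarrow> linmap R (free_module R n) (regular_module R) (\<lambda>u. u j)"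
  by (rule linmapI) (auto simp: PiE_iff)

text \<open>The map out of a free module with prescribed values.\<close>

lemma linmap_lin_comb:
  assumes N: "left_module R N" and y: "\<And>j. j < n \<Longrightarrow> y j \<in> carrier N"
    and f: "\<And>j. j < n \<Longrightarrow> linmap R M (regular_module R) (f j)"
  shows "linmap R M N (\<lambda>u. lsum N n (\<lambda>j. f j u \<odot>\<^bsub>N\<^esub> y j))"
  by (rule linmap_sum[OF N])
    (use linmap_comp[OF f linmap_smult_vec[OF N y]] in simp)

lemma unit_vec_closed: "ring R \<Longrightarrow> unit_vec R n k \<in> carrier (free_module R n)"
proof -
  assume "ring R"
  then interpret ring R .
  show ?thesis by (auto simp: unit_vec_def)
qed

lemma lsum_free:
  assumes "ring R" "i < n" "\<And>j. j < m \<Longrightarrow> v j \<in> carrier (free_module R n)"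
  shows "lsum (free_module R n) m v i = lsum (regular_module R) m (\<lambda>j. v j i)"
  using linmap_lsum[OF free_left_module[OF assms(1)] regular_left_module[OF assms(1)] linmap_coord[OF assms(2)]]
    assms(3) by blast

lemma free_dual_basis:
  assumes R: "ring R"
  shows "dual_basis R (free_module R n) n (\<lambda>j u. u j) (unit_vec R n)"
proof -
  interpret ring R by fact
  interpret F: left_module R "free_module R n" by (rule free_left_module[OF R])
  interpret RR: left_module R "regular_module R" by (rule regular_left_module[OF R])
  note uc = unit_vec_closed[OF R]
  have "x = lsum (free_module R n) n (\<lambda>j. x j \<odot>\<^bsub>free_module R n\<^esub> unit_vec R n j)"
    if x: "x \<in> carrier (free_module R n)" for x
  proof -
    have xc: "x j \<in> carrier R" if "j < n" for j using x that by (auto simp: PiE_iff)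
    have c: "x j \<odot>\<^bsub>free_module R n\<^esub> unit_vec R n j \<in> carrier (free_module R n)" if "j < n" for j
      using F.smult_closed[OF xc[OF that] uc] .
    have "x \<in> {..<n} \<rightarrow>\<^sub>E carrier R" using x by simp
    moreover have "lsum (free_module R n) n (\<lambda>j. x j \<odot>\<^bsub>free_module R n\<^esub> unit_vec R n j) \<in> {..<n} \<rightarrow>\<^sub>E carrier R"
      using F.lsum_closed[OF c] by simp
    moreover have "x i = lsum (free_module R n) n (\<lambda>j. x j \<odot>\<^bsub>free_module R n\<^esub> unit_vec R n j) i" if i: "i < n" for i
    proof -
      have "lsum (regular_module R) n (\<lambda>j. (x j \<odot>\<^bsub>free_module R n\<^esub> unit_vec R n j) i) = x i"
        by (subst RR.lsum_single[OF i]) (use i xc in \<open>auto simp: unit_vec_def\<close>)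
      then show ?thesis using lsum_free[OF R i c] by simp
    qed
    ultimately show ?thesis by (intro PiE_ext) auto
  qed
  then show ?thesis using uc
    by (simp add: dual_basis_def free_left_module[OF R] linmap_coord)
qed

lemma linmap_coords:
  assumes R: "ring R" and f: "\<And>j. j < n \<Longrightarrow> linmap R M (regular_module R) (f j)"
  shows "linmap R M (free_module R n) (\<lambda>x. \<lambda>j\<in>{..<n}. f j x)"
  by (rule linmapI) (use linmapD[OF f] in \<open>auto intro!: restrict_ext\<close>)

lemma fg_projective_iff: "fg_projective R P \<longleftrightarrow> proj R P"
proof
  assume "fg_projective R P"
  then obtain n i p where P: "left_module R P" and i: "i \<in> mod_hom R P (free_module R n)"
    and p: "p \<in> mod_hom R (free_module R n) P" and pi: "\<And>x. x \<in> carrier P \<Longrightarrow> p (i x) = x"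
    unfolding fg_projective_def by blast
  note i' = mod_hom_linmap[OF i] and p' = mod_hom_linmap[OF p]
  have R: "ring R" using left_module_ring[OF P] .
  have F: "left_module R (free_module R n)" by (rule free_left_module[OF R])
  have db': "u = lsum (free_module R n) n (\<lambda>j. u j \<odot>\<^bsub>free_module R n\<^esub> unit_vec R n j)"
    if "u \<in> carrier (free_module R n)" for u
    using free_dual_basis[OF R, of n] that unfolding dual_basis_def by blast
  interpret F: left_module R "free_module R n" by fact
  have "dual_basis R P n (\<lambda>j x. i x j) (\<lambda>j. p (unit_vec R n j))"
    unfolding dual_basis_def
  proof (intro conjI allI impI ballI)
    fix j assume j: "j < n"
    show "linmap R P (regular_module R) (\<lambda>x. i x j)" by (rule linmap_comp[OF i' linmap_coord[OF j]])
    show "p (unit_vec R n j) \<in> carrier P" by (rule linmapD(1)[OF p' unit_vec_closed[OF R]])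
  next
    fix x assume x: "x \<in> carrier P"
    have ix: "i x \<in> carrier (free_module R n)" by (rule linmapD(1)[OF i' x])
    have ixj: "i x j \<in> carrier R" if "j < n" for j using ix that by (auto simp: PiE_iff)
    have "x = p (lsum (free_module R n) n (\<lambda>j. i x j \<odot>\<^bsub>free_module R n\<^esub> unit_vec R n j))"
      using pi[OF x] arg_cong[OF db'[OF ix], of p] by simp
    also have "\<dots> = lsum P n (\<lambda>j. p (i x j \<odot>\<^bsub>free_module R n\<^esub> unit_vec R n j))"
      by (rule linmap_lsum[OF F P p']) (rule F.smult_closed[OF ixj unit_vec_closed[OF R]])
    also have "\<dots> = lsum P n (\<lambda>j. i x j \<odot>\<^bsub>P\<^esub> p (unit_vec R n j))"
      by (rule lsum_cong) (rule linmapD(3)[OF p' ixj unit_vec_closed[OF R]])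
    finally show "x = lsum P n (\<lambda>j. i x j \<odot>\<^bsub>P\<^esub> p (unit_vec R n j))" .
  qed (rule P)
  then show "proj R P" unfolding proj_def by blast
next
  assume "proj R P"
  then obtain n f y where db: "dual_basis R P n f y" unfolding proj_def by blast
  then have P: "left_module R P" and f: "\<And>j. j < n \<Longrightarrow> linmap R P (regular_module R) (f j)"
    and y: "\<And>j. j < n \<Longrightarrow> y j \<in> carrier P"
    and x: "\<And>x. x \<in> carrier P \<Longrightarrow> x = lsum P n (\<lambda>j. f j x \<odot>\<^bsub>P\<^esub> y j)"
    unfolding dual_basis_def by blast+
  have R: "ring R" using left_module_ring[OF P] .
  have F: "left_module R (free_module R n)" by (rule free_left_module[OF R])
  note i = linmap_restrict[OF P linmap_coords[OF R f]]
  note p = linmap_restrict[OF F linmap_lin_comb[OF P y linmap_coord]]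
  have "restrict (\<lambda>u. lsum P n (\<lambda>j. u j \<odot>\<^bsub>P\<^esub> y j)) (carrier (free_module R n)) 
      (restrict (\<lambda>x. \<lambda>j\<in>{..<n}. f j x) (carrier P) x) = x" if "x \<in> carrier P" for x
    using that x[OF that, symmetric] linmapD(1)[OF linmap_coords[OF R f] that]
    by (simp cong: lsum_cong)
  then show "fg_projective R P" unfolding fg_projective_def
    by (intro conjI P exI[of _ n] bexI[OF _ i] bexI[OF _ p] ballI)
qed

lemma proj_free: "ring R \<Longrightarrow> proj R (free_module R n)"
  unfolding proj_def using free_dual_basis by blast

lemma proj_regular:
  assumes R: "ring R" shows "proj R (regular_module R)"
proof -
  interpret ring R by fact
  have "dual_basis R (regular_module R) 1 (\<lambda>j x. x) (\<lambda>j. \<one>\<^bsub>R\<^esub>)"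
    by (simp add: dual_basis_def regular_left_module[OF R] linmap_id)
  then show ?thesis unfolding proj_def by blast
qed

lemma proj_lift:
  assumes P: "proj R P" and C: "left_module R C" and B: "left_module R B"
    and f: "linmap R P B f" and g: "linmap R C B g"
    and im: "\<And>x. x \<in> carrier P \<Longrightarrow> f x \<in> g ` carrier C"
  obtains h where "linmap R P C h" "\<And>x. x \<in> carrier P \<Longrightarrow> g (h x) = f x"
proof -
  obtain n \<phi> y where db: "dual_basis R P n \<phi> y" using P unfolding proj_def by blast
  then have P: "left_module R P" and \<phi>: "\<And>j. j < n \<Longrightarrow> linmap R P (regular_module R) (\<phi> j)"
    and y: "\<And>j. j < n \<Longrightarrow> y j \<in> carrier P"
    and x: "\<And>x. x \<in> carrier P \<Longrightarrow> x = lsum P n (\<lambda>j. \<phi> j x \<odot>\<^bsub>P\<^esub> y j)"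
    unfolding dual_basis_def by blast+
  interpret P: left_module R P by fact
  interpret C: left_module R C by fact
  have "\<forall>j. \<exists>c. j < n \<longrightarrow> c \<in> carrier C \<and> g c = f (y j)"
    using im y by (metis imageE)
  then obtain c where c: "\<And>j. j < n \<Longrightarrow> c j \<in> carrier C" "\<And>j. j < n \<Longrightarrow> g (c j) = f (y j)" by metis
  have l: "linmap R P C (\<lambda>x. lsum C n (\<lambda>j. \<phi> j x \<odot>\<^bsub>C\<^esub> c j))"
    by (rule linmap_lin_comb[OF C c(1) \<phi>])
  have "g (lsum C n (\<lambda>j. \<phi> j x \<odot>\<^bsub>C\<^esub> c j)) = f x" if xc: "x \<in> carrier P" for x
  proof -
    have \<phi>x: "\<phi> j x \<in> carrier R" if "j < n" for j using linmapD(1)[OF \<phi>[OF that] xc] by simp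
    have "g (lsum C n (\<lambda>j. \<phi> j x \<odot>\<^bsub>C\<^esub> c j)) = lsum B n (\<lambda>j. g (\<phi> j x \<odot>\<^bsub>C\<^esub> c j))"
      by (rule linmap_lsum[OF C B g]) (simp add: \<phi>x c)
    also have "\<dots> = lsum B n (\<lambda>j. f (\<phi> j x \<odot>\<^bsub>P\<^esub> y j))"
      by (rule lsum_cong) (simp add: linmapD(3)[OF g] linmapD(3)[OF f] \<phi>x c y)
    also have "\<dots> = f (lsum P n (\<lambda>j. \<phi> j x \<odot>\<^bsub>P\<^esub> y j))"
      by (rule linmap_lsum[OF P B f, symmetric]) (simp add: \<phi>x y)
    finally show ?thesis using x[OF xc] by simp
  qed
  with l show ?thesis by (rule that)
qed

lemma kernel_submodule:
  assumes "left_module R M" "left_module R N" "linmap R M N f"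
  shows "submodule (a_kernel M N f) R M"
proof -
  interpret M: left_module R M by fact
  interpret N: left_module R N by fact
  show ?thesis
    by (rule M.submodI)
      (auto simp: a_kernel_def' linmap_zero[OF assms] linmapD[OF assms(3)] N.smult_r_null)
qed

lemma image_submodule:
  assumes "left_module R M" "left_module R N" "linmap R M N f"
  shows "submodule (f ` carrier M) R N"
proof -
  interpret M: left_module R M by fact
  interpret N: left_module R N by fact
  show ?thesis
  proof (rule N.submodI)
    show "\<zero>\<^bsub>N\<^esub> \<in> f ` carrier M" using linmap_zero[OF assms] by (metis M.M.zero_closed imageI)
    show "x \<oplus>\<^bsub>N\<^esub> y \<in> f ` carrier M" if "x \<in> f ` carrier M" "y \<in> f ` carrier M" for x y
      using that linmapD(2)[OF assms(3)] by (metis (no_types, lifting) M.M.a_closed imageE imageI)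
    show "a \<odot>\<^bsub>N\<^esub> x \<in> f ` carrier M" if "a \<in> carrier R" "x \<in> f ` carrier M" for a x
      using that linmapD(3)[OF assms(3)] by (metis (no_types, lifting) M.smult_closed imageE imageI)
  qed (auto simp: linmapD[OF assms(3)])
qed

section \<open>Syzygies up to projective summands\<close>

text \<open>\<open>K \<subseteq> P\<close> is a retract of \<open>L \<subseteq> Q\<close> up to maps that extend to \<open>P\<close>. This is what Schanuel's lemma
  leaves of the stable equivalence of two syzygies of one module, and it is enough to compare the
  extendability of maps.\<close>

definition stab :: "'a ring \<Rightarrow> 'p set \<Rightarrow> ('a, 'p) module \<Rightarrow> 'q set \<Rightarrow> ('a, 'q) module \<Rightarrow> bool" where
  "stab R K P L Q \<longleftrightarrow> (\<exists>\<phi> \<psi> r. linmap R P Q \<phi> \<and> linmap R Q P \<psi> \<and> linmap R P P r \<and>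
     (\<forall>x\<in>K. \<phi> x \<in> L) \<and> (\<forall>x\<in>L. \<psi> x \<in> K) \<and> (\<forall>x\<in>carrier P. r x \<in> K) \<and>
     (\<forall>x\<in>K. \<psi> (\<phi> x) = x \<oplus>\<^bsub>P\<^esub> r x))"

definition extnd :: "'a ring \<Rightarrow> 'p set \<Rightarrow> ('a, 'p) module \<Rightarrow> ('a, 'n) module \<Rightarrow> bool" where
  "extnd R K P N \<longleftrightarrow> (\<forall>h. linmap R (sub P K) N h \<longrightarrow> (\<exists>g. linmap R P N g \<and> (\<forall>x\<in>K. g x = h x)))"

lemma stab_extnd:
  assumes st: "stab R K P L Q" and ex: "extnd R L Q N"
    and N: "left_module R N" and P: "left_module R P" and K: "submodule K R P" and L: "L \<subseteq> carrier Q"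
  shows "extnd R K P N"
  unfolding extnd_def
proof (intro allI impI)
  fix h assume h: "linmap R (sub P K) N h"
  obtain \<phi> \<psi> r where m: "linmap R P Q \<phi>" "linmap R Q P \<psi>" "linmap R P P r"
    and c: "\<And>x. x \<in> K \<Longrightarrow> \<phi> x \<in> L" "\<And>x. x \<in> L \<Longrightarrow> \<psi> x \<in> K" "\<And>x. x \<in> carrier P \<Longrightarrow> r x \<in> K"
    and e: "\<And>x. x \<in> K \<Longrightarrow> \<psi> (\<phi> x) = x \<oplus>\<^bsub>P\<^esub> r x"
    using st unfolding stab_def by metis
  interpret P: left_module R P by fact
  interpret N: left_module R N by fact
  have KP: "K \<subseteq> carrier P" using P.submodD[OF K] by blast
  have hD: "h x \<in> carrier N" if "x \<in> K" for x using linmapD(1)[OF h] that by simp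
  have "linmap R (sub Q L) N (\<lambda>x. h (\<psi> x))"
    by (rule linmap_comp[OF linmap_into[OF linmap_sub[OF m(2) L]] h]) (simp add: c)
  then obtain g where g: "linmap R Q N g" "\<And>x. x \<in> L \<Longrightarrow> g x = h (\<psi> x)"
    using ex unfolding extnd_def by blast
  have hr: "linmap R P N (\<lambda>x. h (r x))"
    by (rule linmap_comp[OF linmap_into[OF m(3)] h]) (simp add: c)
  have "linmap R P N (\<lambda>x. g (\<phi> x) \<oplus>\<^bsub>N\<^esub> \<ominus>\<^bsub>N\<^esub> h (r x))"
    by (rule linmap_add[OF N linmap_comp[OF m(1) g(1)] linmap_uminus[OF N hr]])
  moreover have "g (\<phi> x) \<oplus>\<^bsub>N\<^esub> \<ominus>\<^bsub>N\<^esub> h (r x) = h x" if x: "x \<in> K" for x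
  proof -
    have "g (\<phi> x) = h (x \<oplus>\<^bsub>P\<^esub> r x)" using g(2)[OF c(1)[OF x]] e[OF x] by simp
    also have "\<dots> = h x \<oplus>\<^bsub>N\<^esub> h (r x)" using linmapD(2)[OF h] x c(3) KP by auto
    finally show ?thesis using hD[OF x] hD[OF c(3)] x KP by (simp add: N.a_assoc N.r_neg subset_iff)
  qed
  ultimately show "\<exists>g. linmap R P N g \<and> (\<forall>x\<in>K. g x = h x)" by blast
qed

text \<open>One syzygy further. The new defect of the composite is corrected by a lift of the old one.\<close>

lemma stab_step_core:
  assumes K: "submodule K R P" and L: "submodule L R Q"
    and Pm: "left_module R P" and Qm: "left_module R Q"
    and m: "linmap R P Q \<phi>" "linmap R Q P \<psi>" "\<And>x. x \<in> K \<Longrightarrow> \<phi> x \<in> L" "\<And>x. x \<in> L \<Longrightarrow> \<psi> x \<in> K"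
    and P': "proj R P'" and Q': "proj R Q'"
    and d: "linmap R P' P d" "d ` carrier P' = K" and d': "linmap R Q' Q d'" "d' ` carrier Q' = L"
    and h: "linmap R P P' h" and hd: "\<And>x. x \<in> K \<Longrightarrow> \<psi> (\<phi> x) = x \<oplus>\<^bsub>P\<^esub> d (h x)"
  shows "stab R (a_kernel P' P d) P' (a_kernel Q' Q d') Q'"
proof -
  have P'm: "left_module R P'" and Q'm: "left_module R Q'" using P' Q' by (auto intro: proj_left_module)
  interpret P: left_module R P by fact
  interpret Q: left_module R Q by fact
  interpret P': left_module R P' by fact
  have KP: "K \<subseteq> carrier P" using P.submodD[OF K] by blast
  have LQ: "L \<subseteq> carrier Q" using Q.submodD[OF L] by blast
  have dK: "d x \<in> K" if "x \<in> carrier P'" for x using d(2) that by blast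
  have dL: "d' x \<in> L" if "x \<in> carrier Q'" for x using d'(2) that by blast
  obtain \<phi>' where \<phi>': "linmap R P' Q' \<phi>'" "\<And>x. x \<in> carrier P' \<Longrightarrow> d' (\<phi>' x) = \<phi> (d x)"
  proof (rule proj_lift[OF P' Q'm Qm linmap_comp[OF d(1) m(1)] d'(1)])
    show "\<phi> (d x) \<in> d' ` carrier Q'" if "x \<in> carrier P'" for x
      using m(3)[OF dK[OF that]] d'(2) by simp
  qed (use that in blast)
  obtain \<psi>' where \<psi>': "linmap R Q' P' \<psi>'" "\<And>x. x \<in> carrier Q' \<Longrightarrow> d (\<psi>' x) = \<psi> (d' x)"
  proof (rule proj_lift[OF Q' P'm Pm linmap_comp[OF d'(1) m(2)] d(1)])
    show "\<psi> (d' x) \<in> d ` carrier P'" if "x \<in> carrier Q'" for x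
      using m(4)[OF dL[OF that]] d(2) by simp
  qed (use that in blast)
  define r where "r x = (\<psi>' (\<phi>' x) \<oplus>\<^bsub>P'\<^esub> \<ominus>\<^bsub>P'\<^esub> x) \<oplus>\<^bsub>P'\<^esub> \<ominus>\<^bsub>P'\<^esub> h (d x)" for x
  have r: "linmap R P' P' r"
    unfolding r_def
    by (intro linmap_add[OF P'm] linmap_uminus[OF P'm] linmap_id linmap_comp[OF d(1) h]
        linmap_comp[OF \<phi>'(1) \<psi>'(1)])
  have cl: "\<phi>' x \<in> carrier Q'" "\<psi>' (\<phi>' x) \<in> carrier P'" "d x \<in> carrier P" "h (d x) \<in> carrier P'" 
    "d (h (d x)) \<in> carrier P"
    if "x \<in> carrier P'" for x
    using linmapD(1)[OF \<phi>'(1)] linmapD(1)[OF \<psi>'(1)] linmapD(1)[OF d(1)] linmapD(1)[OF h] that by auto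
  have "d (r x) = \<zero>\<^bsub>P\<^esub>" if x: "x \<in> carrier P'" for x
  proof -
    have "d (r x) = (d (\<psi>' (\<phi>' x)) \<oplus>\<^bsub>P\<^esub> \<ominus>\<^bsub>P\<^esub> d x) \<oplus>\<^bsub>P\<^esub> \<ominus>\<^bsub>P\<^esub> d (h (d x))"
      unfolding r_def using x cl[OF x]
      by (simp add: linmapD(2)[OF d(1)] linmap_neg[OF P'm Pm d(1)])
    also have "d (\<psi>' (\<phi>' x)) = \<psi> (\<phi> (d x))" using \<psi>'(2) \<phi>'(2) x cl by simp
    also have "\<dots> = d x \<oplus>\<^bsub>P\<^esub> d (h (d x))" by (rule hd[OF dK[OF x]])
    finally show ?thesis using cl[OF x]
      by (simp add: P.M.sum_minus_summands)
  qed
  then have rk: "r x \<in> a_kernel P' P d" if "x \<in> carrier P'" for x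
    using that linmapD(1)[OF r] by (simp add: a_kernel_def')
  have k1: "\<phi>' x \<in> a_kernel Q' Q d'" if "x \<in> a_kernel P' P d" for x
    using that \<phi>'(2)[of x] linmap_zero[OF Pm Qm m(1)] cl[of x] by (auto simp: a_kernel_def')
  have k2: "\<psi>' x \<in> a_kernel P' P d" if "x \<in> a_kernel Q' Q d'" for x
    using that \<psi>'(2)[of x] linmap_zero[OF Qm Pm m(2)] linmapD(1)[OF \<psi>'(1)] by (auto simp: a_kernel_def')
  have "\<psi>' (\<phi>' x) = x \<oplus>\<^bsub>P'\<^esub> r x" if "x \<in> a_kernel P' P d" for x
  proof -
    have x: "x \<in> carrier P'" "d x = \<zero>\<^bsub>P\<^esub>" using that by (auto simp: a_kernel_def')
    have "r x = \<psi>' (\<phi>' x) \<oplus>\<^bsub>P'\<^esub> \<ominus>\<^bsub>P'\<^esub> x"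
      unfolding r_def using x cl[OF x(1)] linmap_zero[OF Pm P'm h] by simp
    then show ?thesis using cl[OF x(1)] x(1)
      by (simp add: P'.M.add_diff)
  qed
  with r \<phi>'(1) \<psi>'(1) k1 k2 rk show ?thesis unfolding stab_def by blast
qed

lemma stab_step:
  assumes st: "stab R K P L Q" and K: "submodule K R P" and L: "submodule L R Q"
    and P: "proj R P" and Q: "left_module R Q"
    and P': "proj R P'" and Q': "proj R Q'"
    and d: "linmap R P' P d" "d ` carrier P' = K" and d': "linmap R Q' Q d'" "d' ` carrier Q' = L"
  shows "stab R (a_kernel P' P d) P' (a_kernel Q' Q d') Q'"
proof -
  obtain \<phi> \<psi> r where m: "linmap R P Q \<phi>" "linmap R Q P \<psi>" "linmap R P P r"
    and c: "\<And>x. x \<in> K \<Longrightarrow> \<phi> x \<in> L" "\<And>x. x \<in> L \<Longrightarrow> \<psi> x \<in> K" "\<And>x. x \<in> carrier P \<Longrightarrow> r x \<in> K"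
    and e: "\<And>x. x \<in> K \<Longrightarrow> \<psi> (\<phi> x) = x \<oplus>\<^bsub>P\<^esub> r x"
    using st unfolding stab_def by metis
  interpret P: left_module R P by (rule proj_left_module[OF P])
  have KP: "K \<subseteq> carrier P" using P.submodD[OF K] by blast
  obtain h where h: "linmap R P P' h" "\<And>x. x \<in> carrier P \<Longrightarrow> d (h x) = r x"
    by (rule proj_lift[OF P proj_left_module[OF P'] proj_left_module[OF P] m(3) d(1)])
      (use c(3) d(2) in auto)
  have "\<psi> (\<phi> x) = x \<oplus>\<^bsub>P\<^esub> d (h x)" if "x \<in> K" for x using e[OF that] h(2) KP that by auto
  from stab_step_core[OF K L proj_left_module[OF P] Q m(1,2) c(1,2) P' Q' d d' h(1) this]
  show ?thesis .
qed

lemma stab_base: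
  assumes M: "left_module R M" and P: "proj R P" and Q: "proj R Q"
    and d: "linmap R P M d" "d ` carrier P = carrier M" and d': "linmap R Q M d'" "d' ` carrier Q = carrier M"
  shows "stab R (a_kernel P M d) P (a_kernel Q M d') Q"
proof -
  interpret M: left_module R M by fact
  have Pm: "left_module R P" by (rule proj_left_module[OF P])
  have s: "submodule (carrier M) R M" by (rule M.submodI) auto
  show ?thesis
    by (rule stab_step_core[OF s s M M linmap_id linmap_id _ _ P Q d d' linmap_const_zero[OF Pm]])
      (auto simp: linmap_zero[OF Pm M d(1)])
qed

lemma (in abelian_group) minus_zero_iff:
  assumes "a \<in> carrier G" "b \<in> carrier G"
  shows "a \<ominus> b = \<zero> \<longleftrightarrow> a = b"
proof
  assume "a \<ominus> b = \<zero>"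
  then show "a = b" using assms add_diff[OF assms] by (simp add: a_minus_def)
qed (use assms in \<open>simp add: a_minus_def r_neg\<close>)

section \<open>Ext by dimension shifting\<close>

definition noeth :: "'a ring \<Rightarrow> bool" where
  "noeth R \<longleftrightarrow> (\<forall>n N. submodule N R (free_module R n) \<longrightarrow>
     (\<exists>m g. linmap R (free_module R m) (free_module R n) g \<and> g ` carrier (free_module R m) = N))"

definition fgen :: "'a ring \<Rightarrow> ('a, 'm) module \<Rightarrow> bool" where
  "fgen R M \<longleftrightarrow> (\<exists>n e. linmap R (free_module R n) M e \<and> e ` carrier (free_module R n) = carrier M)"

definition res_ker ::
    "(nat \<Rightarrow> ('a, 'p) module) \<Rightarrow> (nat \<Rightarrow> 'p \<Rightarrow> 'p) \<Rightarrow> ('p \<Rightarrow> 'm) \<Rightarrow> ('a, 'm) module \<Rightarrow> nat \<Rightarrow> 'p set" where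
  "res_ker P d e M n =
     (case n of 0 \<Rightarrow> a_kernel (P 0) M e | Suc k \<Rightarrow> a_kernel (P (Suc k)) (P k) (d k))"

lemma res_ker_simps [simp]:
  "res_ker P d e M 0 = a_kernel (P 0) M e"
  "res_ker P d e M (Suc k) = a_kernel (P (Suc k)) (P k) (d k)"
  by (simp_all add: res_ker_def)

lemma linmap_factor:
  assumes P: "left_module R P" and Q: "left_module R Q" and N: "left_module R N"
    and d: "linmap R P Q d" and f: "linmap R P N f"
    and k: "\<And>x. x \<in> carrier P \<Longrightarrow> d x = \<zero>\<^bsub>Q\<^esub> \<Longrightarrow> f x = \<zero>\<^bsub>N\<^esub>"
  obtains h where "linmap R (sub Q (d ` carrier P)) N h" "\<And>x. x \<in> carrier P \<Longrightarrow> h (d x) = f x"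
proof -
  interpret P: left_module R P by fact
  interpret Q: left_module R Q by fact
  interpret N: left_module R N by fact
  define s where "s y = (SOME x. x \<in> carrier P \<and> d x = y)" for y
  have s: "s (d x) \<in> carrier P" "d (s (d x)) = d x" if "x \<in> carrier P" for x
    using someI[of "\<lambda>z. z \<in> carrier P \<and> d z = d x" x] that unfolding s_def by auto
  have h: "f (s (d x)) = f x" if x: "x \<in> carrier P" for x
  proof -
    have "d (s (d x) \<ominus>\<^bsub>P\<^esub> x) = \<zero>\<^bsub>Q\<^esub>"
      using linmap_minus[OF P Q d s(1)[OF x] x] s(2)[OF x] linmapD(1)[OF d x]
      by (simp add: Q.M.r_neg a_minus_def)
    then have "f (s (d x) \<ominus>\<^bsub>P\<^esub> x) = \<zero>\<^bsub>N\<^esub>" using s x by (intro k) auto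
    then show ?thesis using linmap_minus[OF P N f s(1)[OF x] x] linmapD(1)[OF f] s(1)[OF x] x
      by (simp add: N.M.minus_zero_iff)
  qed
  have "linmap R (sub Q (d ` carrier P)) N (\<lambda>y. f (s y))"
  proof (rule linmapI; clarsimp)
    fix x assume "x \<in> carrier P" then show "f (s (d x)) \<in> carrier N" using h linmapD(1)[OF f] by simp
  next
    fix x y assume "x \<in> carrier P" "y \<in> carrier P"
    then show "f (s (d x \<oplus>\<^bsub>Q\<^esub> d y)) = f (s (d x)) \<oplus>\<^bsub>N\<^esub> f (s (d y))"
      using h[of "x \<oplus>\<^bsub>P\<^esub> y"] by (simp add: h linmapD(2)[OF d] linmapD(2)[OF f])
  next
    fix a x assume "a \<in> carrier R" "x \<in> carrier P"
    then show "f (s (a \<odot>\<^bsub>Q\<^esub> d x)) = a \<odot>\<^bsub>N\<^esub> f (s (d x))"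
      using h[of "a \<odot>\<^bsub>P\<^esub> x"] by (simp add: h linmapD(3)[OF d] linmapD(3)[OF f])
  qed
  then show ?thesis using h by (rule that)
qed

lemma resolution_facts:
  assumes "projective_resolution R P d e M" "left_module R M"
  shows "proj R (P n)" "linmap R (P (Suc n)) (P n) (d n)" "linmap R (P 0) M e"
    "e ` carrier (P 0) = carrier M"
    "d n ` carrier (P (Suc n)) = res_ker P d e M n" "submodule (res_ker P d e M n) R (P n)"
proof -
  note r = assms(1)[unfolded projective_resolution_def fg_projective_iff]
  have pr: "proj R (P n)" for n using r by simp
  have ld: "linmap R (P (Suc n)) (P n) (d n)" for n by (rule mod_hom_linmap) (use r in simp)
  have le: "linmap R (P 0) M e" by (rule mod_hom_linmap) (use r in simp)
  show "proj R (P n)" "linmap R (P (Suc n)) (P n) (d n)" "linmap R (P 0) M e" by fact+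
  show "e ` carrier (P 0) = carrier M" using r by simp
  show "d n ` carrier (P (Suc n)) = res_ker P d e M n" using r by (cases n) simp_all
  show "submodule (res_ker P d e M n) R (P n)"
    using kernel_submodule[OF proj_left_module[OF pr] assms(2) le]
      kernel_submodule[OF proj_left_module[OF pr] proj_left_module[OF pr] ld] by (cases n) auto
qed

text \<open>A cocycle in degree \<open>n + 1\<close> is the same as a map from the \<open>n\<close>-th syzygy, and it is a coboundary
  iff that map extends.\<close>

lemma Ext_extnd:
  assumes res: "projective_resolution R P d e M" and M: "left_module R M" and N: "left_module R N"
  shows "cocycles R P d N (Suc n) = coboundaries R P d N (Suc n) \<longleftrightarrow> extnd R (res_ker P d e M n) (P n) N"
    (is "?C = ?B \<longleftrightarrow> _")
proof -
  note F = resolution_facts[OF res M]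
  note Pm = proj_left_module[OF F(1)]
  interpret Pn: left_module R "P n" by (rule Pm)
  have KP: "res_ker P d e M n \<subseteq> carrier (P n)" using Pn.submodD[OF F(6)] by blast
  have dK: "d n x \<in> res_ker P d e M n" if "x \<in> carrier (P (Suc n))" for x
    using F(5) that by blast
  show ?thesis
  proof
    assume eq: "?C = ?B"
    show "extnd R (res_ker P d e M n) (P n) N" unfolding extnd_def
    proof (intro allI impI)
      fix h assume h: "linmap R (sub (P n) (res_ker P d e M n)) N h"
      have "linmap R (P (Suc n)) N (\<lambda>x. h (d n x))"
        by (rule linmap_comp[OF linmap_into[OF F(2) dK] h])
      note f = linmap_restrict[OF Pm this]
      have "restrict (\<lambda>x. h (d n x)) (carrier (P (Suc n))) \<in> ?C"
      proof -
        have "h (d n (d (Suc n) x)) = \<zero>\<^bsub>N\<^esub>" if "x \<in> carrier (P (Suc (Suc n)))" for x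
        proof -
          have "d n (d (Suc n) x) = \<zero>\<^bsub>P n\<^esub>" using F(5)[of "Suc n"] that by (auto simp: a_kernel_def')
          then show ?thesis using linmap_zero[OF Pn.left_module_sub[OF F(6)] N h] by simp
        qed
        then show ?thesis using f linmapD(1)[OF F(2)[of "Suc n"]] by (simp add: cocycles_def)
      qed
      then obtain g where g: "g \<in> mod_hom R (P n) N"
        "restrict (\<lambda>x. h (d n x)) (carrier (P (Suc n))) = compose (carrier (P (Suc n))) g (d n)"
        unfolding eq by (auto simp: coboundaries_def)
      have "g x = h x" if x: "x \<in> res_ker P d e M n" for x
      proof -
        obtain y where y: "y \<in> carrier (P (Suc n))" "x = d n y" using x F(5) by blast
        then show ?thesis using fun_cong[OF g(2), of y] by (simp add: compose_def)
      qed
      then show "\<exists>g. linmap R (P n) N g \<and> (\<forall>x\<in>res_ker P d e M n. g x = h x)"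
        using mod_hom_linmap[OF g(1)] by blast
    qed
  next
    assume ex: "extnd R (res_ker P d e M n) (P n) N"
    show "?C = ?B"
    proof
      show "?B \<subseteq> ?C"
      proof
        fix f assume "f \<in> ?B"
        then obtain g where g: "g \<in> mod_hom R (P n) N" "f = compose (carrier (P (Suc n))) g (d n)"
          by (auto simp: coboundaries_def)
        have "f \<in> mod_hom R (P (Suc n)) N"
          using linmap_restrict[OF Pm linmap_comp[OF F(2) mod_hom_linmap[OF g(1)]]] g(2)
          by (simp add: compose_def)
        moreover have "f (d (Suc n) x) = \<zero>\<^bsub>N\<^esub>" if "x \<in> carrier (P (Suc (Suc n)))" for x
        proof -
          have "d n (d (Suc n) x) = \<zero>\<^bsub>P n\<^esub>" using F(5)[of "Suc n"] that by (auto simp: a_kernel_def')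
          then show ?thesis
            using linmap_zero[OF Pm N mod_hom_linmap[OF g(1)]] linmapD(1)[OF F(2)[of "Suc n"] that]
            by (simp add: g(2) compose_def)
        qed
        ultimately show "f \<in> ?C" by (simp add: cocycles_def)
      qed
    next
      show "?C \<subseteq> ?B"
      proof
        fix f assume f: "f \<in> ?C"
        then have fh: "f \<in> mod_hom R (P (Suc n)) N" by (simp add: cocycles_def)
        have "f x = \<zero>\<^bsub>N\<^esub>" if "x \<in> carrier (P (Suc n))" "d n x = \<zero>\<^bsub>P n\<^esub>" for x
        proof -
          have "x \<in> d (Suc n) ` carrier (P (Suc (Suc n)))"
            using that F(5)[of "Suc n"] by (simp add: a_kernel_def')
          then show ?thesis using f by (auto simp: cocycles_def)
        qed
        then obtain h where h: "linmap R (sub (P n) (d n ` carrier (P (Suc n)))) N h"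
          "\<And>x. x \<in> carrier (P (Suc n)) \<Longrightarrow> h (d n x) = f x"
          using linmap_factor[OF Pm Pm N F(2) mod_hom_linmap[OF fh]] by metis
        then obtain g where g: "linmap R (P n) N g" "\<And>x. x \<in> res_ker P d e M n \<Longrightarrow> g x = h x"
          using ex F(5) unfolding extnd_def by metis
        have "f = compose (carrier (P (Suc n))) (restrict g (carrier (P n))) (d n)"
        proof
          fix x
          show "f x = compose (carrier (P (Suc n))) (restrict g (carrier (P n))) (d n) x"
            using fh h(2)[of x] g(2)[OF dK, of x] linmapD(1)[OF F(2), of x]
            by (auto simp: compose_def mod_hom_iff extensional_def)
        qed
        then show "f \<in> ?B" using linmap_restrict[OF Pm g(1)] by (auto simp: coboundaries_def)
      qed
    qed
  qed
qed

lemma resolution_exists: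
  assumes R: "noeth R" and M: "left_module R M" and fg: "fgen R M"
  shows "\<exists>(P :: nat \<Rightarrow> ('a, nat \<Rightarrow> 'a) module) d e. projective_resolution R P d e M"
proof -
  note ring = left_module_ring[OF M]
  note F = free_left_module[OF ring]
  obtain n0 e where e: "linmap R (free_module R n0) M e" "e ` carrier (free_module R n0) = carrier M"
    using fg unfolding fgen_def by blast
  define I :: "nat \<times> nat \<times> ((nat \<Rightarrow> 'a) \<Rightarrow> (nat \<Rightarrow> 'a)) \<Rightarrow> bool" where
    "I s \<longleftrightarrow> (case s of (m, n, g) \<Rightarrow> linmap R (free_module R m) (free_module R n) g)" for s
  define st :: "nat \<times> nat \<times> ((nat \<Rightarrow> 'a) \<Rightarrow> (nat \<Rightarrow> 'a)) \<Rightarrow> nat \<times> nat \<times> ((nat \<Rightarrow> 'a) \<Rightarrow> (nat \<Rightarrow> 'a)) \<Rightarrow> bool"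
    where "st s t \<longleftrightarrow> (case s of (m, n, g) \<Rightarrow> case t of (m', n', g') \<Rightarrow>
       n' = m \<and> g' ` carrier (free_module R m') = a_kernel (free_module R m) (free_module R n) g)" for s t
  define I0 where "I0 s \<longleftrightarrow> I s \<and> (case s of (m, n, g) \<Rightarrow>
       n = n0 \<and> g ` carrier (free_module R m) = a_kernel (free_module R n0) M e)" for s
  have "\<exists>s. I0 s"
    using R kernel_submodule[OF F M e(1)] unfolding noeth_def I0_def I_def by (auto split: prod.splits)
  moreover have "\<exists>t. I t \<and> st s t" if "I s" for s
  proof -
    obtain m n g where s: "s = (m, n, g)" by (cases s)
    have "submodule (a_kernel (free_module R m) (free_module R n) g) R (free_module R m)"
      using that unfolding s I_def by (intro kernel_submodule F) simp
    then show ?thesis using R unfolding noeth_def s I_def st_def by fastforce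
  qed
  ultimately have "\<exists>S. \<forall>k. (if k = 0 then I0 (S k) else I (S k)) \<and> st (S k) (S (Suc k))"
    by (intro dependent_nat_choice) (auto simp: I0_def split: if_splits)
  then obtain S where S: "\<And>k. if k = 0 then I0 (S k) else I (S k)" "\<And>k. st (S k) (S (Suc k))" by metis
  define P where "P k = free_module R (fst (snd (S k)))" for k
  define d where "d k = restrict (snd (snd (S k))) (carrier (P (Suc k)))" for k
  have PS: "P (Suc k) = free_module R (fst (S k))" for k
    using S(2)[of k] unfolding st_def P_def by (auto split: prod.splits)
  have I: "I (S k)" for k using S(1)[of k] by (auto simp: I0_def split: if_splits)
  have ld: "linmap R (P (Suc k)) (P k) (snd (snd (S k)))" for k
    using I[of k] unfolding I_def PS by (auto simp: P_def split: prod.splits)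
  have im: "d k ` carrier (P (Suc k)) = snd (snd (S k)) ` carrier (P (Suc k))" for k
    unfolding d_def by auto
  have ker: "a_kernel (P (Suc k)) (P k) (d k) = a_kernel (P (Suc k)) (P k) (snd (snd (S k)))" for k
    unfolding d_def by (auto simp: a_kernel_def')
  have P0: "P 0 = free_module R n0" using S(1)[of 0] unfolding I0_def P_def by (auto split: prod.splits)
  have "projective_resolution R P d (restrict e (carrier (P 0))) M"
    unfolding projective_resolution_def
  proof (intro conjI allI)
    show "fg_projective R (P n)" for n unfolding fg_projective_iff P_def by (rule proj_free[OF ring])
    show "d n \<in> mod_hom R (P (Suc n)) (P n)" for n
      unfolding d_def by (rule linmap_restrict[OF _ ld]) (simp only: PS F)
    show "restrict e (carrier (P 0)) \<in> mod_hom R (P 0) M"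
      using linmap_restrict[OF F e(1)] by (simp only: P0)
    show "restrict e (carrier (P 0)) ` carrier (P 0) = carrier M" using e(2) by (simp only: P0) simp
    have "a_kernel (P 0) M (restrict e (carrier (P 0))) = a_kernel (P 0) M e"
      by (auto simp: a_kernel_def')
    then show "d 0 ` carrier (P 1) = a_kernel (P 0) M (restrict e (carrier (P 0)))"
      using S(1)[of 0] im[of 0] unfolding I0_def by (auto simp: P0 PS split: prod.splits)
    show "d (Suc n) ` carrier (P (Suc (Suc n))) = a_kernel (P (Suc n)) (P n) (d n)" for n
      unfolding ker im using S(2)[of n] I[of n] unfolding st_def PS
      by (auto simp: P_def split: prod.splits)
  qed
  then show ?thesis by blast
qed

lemma fgen_sub_proj:
  assumes R: "noeth R" and P: "proj R P" and K: "submodule K R P"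
  shows "fgen R (sub P K)"
proof -
  obtain n \<phi> y where db: "dual_basis R P n \<phi> y" using P unfolding proj_def by blast
  then have Pm: "left_module R P" and \<phi>: "\<And>j. j < n \<Longrightarrow> linmap R P (regular_module R) (\<phi> j)"
    and y: "\<And>j. j < n \<Longrightarrow> y j \<in> carrier P"
    and x: "\<And>x. x \<in> carrier P \<Longrightarrow> lsum P n (\<lambda>j. \<phi> j x \<odot>\<^bsub>P\<^esub> y j) = x"
    unfolding dual_basis_def by auto
  interpret P: left_module R P by fact
  note ring = left_module_ring[OF Pm]
  have KP: "K \<subseteq> carrier P" using P.submodD[OF K] by blast
  define c where "c = (\<lambda>x. \<lambda>j\<in>{..<n}. \<phi> j x)"
  have c: "linmap R P (free_module R n) c" unfolding c_def by (rule linmap_coords[OF ring \<phi>])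
  have cK: "submodule (c ` K) R (free_module R n)"
    using image_submodule[OF P.left_module_sub[OF K] free_left_module[OF ring] linmap_sub[OF c KP]] by simp
  then obtain m g where g: "linmap R (free_module R m) (free_module R n) g"
    "g ` carrier (free_module R m) = c ` K"
    using R[unfolded noeth_def, rule_format, OF cK] by auto
  define p where "p u = lsum P n (\<lambda>j. u j \<odot>\<^bsub>P\<^esub> y j)" for u
  have p: "linmap R (free_module R n) P p"
    unfolding p_def by (rule linmap_lin_comb[OF Pm y linmap_coord])
  have pc: "p (c x) = x" if "x \<in> carrier P" for x
    using x[OF that] by (simp add: p_def c_def cong: lsum_cong)
  have im: "(\<lambda>u. p (g u)) ` carrier (free_module R m) = K"
    unfolding image_image[of p g, symmetric] g(2) using pc KP by (force simp: image_image)
  have "linmap R (free_module R m) (sub P K) (\<lambda>u. p (g u))"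
    by (rule linmap_into[OF linmap_comp[OF g(1) p]]) (use im in blast)
  then show ?thesis unfolding fgen_def using im by auto
qed

lemma fgen_image:
  assumes P: "proj R P" and e: "linmap R P M e" "e ` carrier P = carrier M"
  shows "fgen R M"
proof -
  obtain n \<phi> y where db: "dual_basis R P n \<phi> y" using P unfolding proj_def by blast
  then have Pm: "left_module R P" and \<phi>: "\<And>j. j < n \<Longrightarrow> linmap R P (regular_module R) (\<phi> j)"
    and y: "\<And>j. j < n \<Longrightarrow> y j \<in> carrier P"
    and x: "\<And>x. x \<in> carrier P \<Longrightarrow> lsum P n (\<lambda>j. \<phi> j x \<odot>\<^bsub>P\<^esub> y j) = x"
    unfolding dual_basis_def by auto
  note ring = left_module_ring[OF Pm]
  define c where "c = (\<lambda>x. \<lambda>j\<in>{..<n}. \<phi> j x)"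
  have c: "linmap R P (free_module R n) c" unfolding c_def by (rule linmap_coords[OF ring \<phi>])
  define p where "p u = lsum P n (\<lambda>j. u j \<odot>\<^bsub>P\<^esub> y j)" for u
  have p: "linmap R (free_module R n) P p"
    unfolding p_def by (rule linmap_lin_comb[OF Pm y linmap_coord])
  have "p (c x) = x" if "x \<in> carrier P" for x
    using x[OF that] by (simp add: p_def c_def cong: lsum_cong)
  then have "p ` carrier (free_module R n) = carrier P"
    using linmapD(1)[OF c] linmapD(1)[OF p] by (metis (no_types, lifting) imageI image_subsetI subsetI subset_antisym)
  then have "(\<lambda>u. e (p u)) ` carrier (free_module R n) = carrier M"
    unfolding image_image[of e p, symmetric] using e(2) by simp
  then show ?thesis using linmap_comp[OF p e(1)] unfolding fgen_def by blast
qed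

lemma stab_chain:
  assumes P: "projective_resolution R P d e M" "left_module R M"
    and Q: "projective_resolution R Q d' e' M'" "left_module R M'"
    and st: "stab R (res_ker P d e M i) (P i) (res_ker Q d' e' M' j) (Q j)"
  shows "stab R (res_ker P d e M (i + n)) (P (i + n)) (res_ker Q d' e' M' (j + n)) (Q (j + n))"
proof (induction n)
  case (Suc n)
  note F = resolution_facts[OF P] and G = resolution_facts[OF Q]
  show ?case using stab_step[OF Suc F(6) G(6) F(1) proj_left_module[OF G(1)] F(1) G(1) F(2) F(5) G(2) G(5)]
    by simp
qed (use st in simp)

theorem Ext_1_iff:
  fixes M :: "('a, 'm) module" and P :: "('a, 'p) module"
  assumes R: "noeth R" and M: "left_module R M" and N: "left_module R N"
    and P: "proj R P" and e: "linmap R P M e" "e ` carrier P = carrier M"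
  shows "Ext_vanishes R 1 M N \<longleftrightarrow> extnd R (a_kernel P M e) P N"
proof -
  note Pm = proj_left_module[OF P] 
  interpret P: left_module R P by fact
  note K = kernel_submodule[OF Pm M e(1)]
  have *: "extnd R (res_ker Q d e' M 0) (Q 0) N \<longleftrightarrow> extnd R (a_kernel P M e) P N"
    if res: "projective_resolution R Q d e' M" for Q :: "nat \<Rightarrow> ('a, nat \<Rightarrow> 'a) module" and d e'
  proof -
    note F = resolution_facts[OF res M]
    interpret Q0: left_module R "Q 0" by (rule proj_left_module[OF F(1)])
    show ?thesis
      using stab_extnd[OF stab_base[OF M P F(1) e F(3,4)] _ N Pm K]
        stab_extnd[OF stab_base[OF M F(1) P F(3,4) e] _ N Q0.left_module_axioms]
        F(6)[of 0] Q0.submodD(1)[OF F(6)[of 0]] P.submodD(1)[OF K] by auto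
  qed
  obtain Q :: "nat \<Rightarrow> ('a, nat \<Rightarrow> 'a) module" and d e' where "projective_resolution R Q d e' M"
    using resolution_exists[OF R M fgen_image[OF P e]] by blast
  then show ?thesis
    unfolding Ext_vanishes_def One_nat_def using * Ext_extnd[OF _ M N] by blast
qed

theorem Ext_shift:
  fixes M :: "('a, 'm) module" and P :: "('a, 'p) module"
  assumes R: "noeth R" and M: "left_module R M" and N: "left_module R N"
    and P: "proj R P" and e: "linmap R P M e" "e ` carrier P = carrier M"
  shows "Ext_vanishes R (Suc (Suc n)) M N \<longleftrightarrow> Ext_vanishes R (Suc n) (sub P (a_kernel P M e)) N"
proof -
  note Pm = proj_left_module[OF P]
  interpret P: left_module R P by fact
  note K = kernel_submodule[OF Pm M e(1)]
  let ?K = "sub P (a_kernel P M e)"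
  note Km = P.left_module_sub[OF K]
  have KP: "a_kernel P M e \<subseteq> carrier P" by (rule P.submodD(1)[OF K])
  have *: "extnd R (res_ker Q d e' M (Suc n)) (Q (Suc n)) N \<longleftrightarrow> extnd R (res_ker Q' d' e'' ?K n) (Q' n) N"
    if res: "projective_resolution R Q d e' M" and res': "projective_resolution R Q' d' e'' ?K"
    for Q Q' :: "nat \<Rightarrow> ('a, nat \<Rightarrow> 'a) module" and d d' e' e''
  proof -
    note F = resolution_facts[OF res M]
    note G = resolution_facts[OF res' Km]
    have G3: "linmap R (Q' 0) P e''" "e'' ` carrier (Q' 0) = a_kernel P M e"
      using G(3,4) linmap_from[OF G(3) KP] by simp_all
    have ker: "res_ker Q' d' e'' ?K 0 = a_kernel (Q' 0) P e''" by (simp add: a_kernel_def')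
    note b1 = stab_base[OF M P F(1) e F(3,4)] and b2 = stab_base[OF M F(1) P F(3,4) e]
    have F0: "d 0 ` carrier (Q (Suc 0)) = a_kernel (Q 0) M e'" "submodule (a_kernel (Q 0) M e') R (Q 0)"
      using F(5)[of 0] F(6)[of 0] by simp_all
    have s1: "stab R (res_ker Q' d' e'' ?K 0) (Q' 0) (res_ker Q d e' M (Suc 0)) (Q (Suc 0))"
      unfolding ker unfolding res_ker_simps
      by (rule stab_step[OF b1 K F0(2) P proj_left_module[OF F(1)] G(1) F(1) G3 F(2) F0(1)])
    have s2: "stab R (res_ker Q d e' M (Suc 0)) (Q (Suc 0)) (res_ker Q' d' e'' ?K 0) (Q' 0)"
      unfolding ker unfolding res_ker_simps
      by (rule stab_step[OF b2 F0(2) K F(1) Pm F(1) G(1) F(2) F0(1) G3])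
    have s: "res_ker Q d e' M (Suc n) \<subseteq> carrier (Q (Suc n))" "res_ker Q' d' e'' ?K n \<subseteq> carrier (Q' n)"
      using left_module.submodD(1)[OF proj_left_module[OF F(1)] F(6)]
        left_module.submodD(1)[OF proj_left_module[OF G(1)] G(6)] by blast+
    show ?thesis
      using stab_extnd[OF stab_chain[OF res' Km res M s1, of n] _ N proj_left_module[OF G(1)] G(6)]
        stab_extnd[OF stab_chain[OF res M res' Km s2, of n] _ N proj_left_module[OF F(1)] F(6)] s
      by (metis add_0 add_Suc)
  qed
  obtain Q :: "nat \<Rightarrow> ('a, nat \<Rightarrow> 'a) module" and d e' where "projective_resolution R Q d e' M"
    using resolution_exists[OF R M fgen_image[OF P e]] by blast
  moreover obtain Q' :: "nat \<Rightarrow> ('a, nat \<Rightarrow> 'a) module" and d' e'' where "projective_resolution R Q' d' e'' ?K"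
    using resolution_exists[OF R Km fgen_sub_proj[OF R P K]] by blast
  ultimately show ?thesis
    unfolding Ext_vanishes_def using * Ext_extnd[OF _ M N] Ext_extnd[OF _ Km N] by blast
qed

section \<open>Cyclic modules and annihilators\<close>

definition cyc :: "'a ring \<Rightarrow> ('a, 'm) module \<Rightarrow> 'm \<Rightarrow> 'a set \<Rightarrow> bool" where
  "cyc R M m U \<longleftrightarrow> left_module R M \<and> m \<in> carrier M \<and> (\<forall>x\<in>carrier M. \<exists>r\<in>carrier R. x = r \<odot>\<^bsub>M\<^esub> m) \<and>
     U = {r \<in> carrier R. r \<odot>\<^bsub>M\<^esub> m = \<zero>\<^bsub>M\<^esub>}"

lemma cycD:
  assumes "cyc R M m U"
  shows "left_module R M" "m \<in> carrier M" "x \<in> carrier M \<Longrightarrow> \<exists>r\<in>carrier R. x = r \<odot>\<^bsub>M\<^esub> m"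
    "U = {r \<in> carrier R. r \<odot>\<^bsub>M\<^esub> m = \<zero>\<^bsub>M\<^esub>}"
  using assms unfolding cyc_def by blast+

lemma cyc_surj:
  assumes "cyc R M m U"
  shows "linmap R (regular_module R) M (\<lambda>r. r \<odot>\<^bsub>M\<^esub> m)"
    "(\<lambda>r. r \<odot>\<^bsub>M\<^esub> m) ` carrier (regular_module R) = carrier M"
    "a_kernel (regular_module R) M (\<lambda>r. r \<odot>\<^bsub>M\<^esub> m) = U"
proof -
  note c = cycD[OF assms]
  interpret left_module R M by (rule c(1))
  show "linmap R (regular_module R) M (\<lambda>r. r \<odot>\<^bsub>M\<^esub> m)" by (rule linmap_smult_vec[OF c(1,2)])
  show "(\<lambda>r. r \<odot>\<^bsub>M\<^esub> m) ` carrier (regular_module R) = carrier M" using c(2,3) by auto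
  show "a_kernel (regular_module R) M (\<lambda>r. r \<odot>\<^bsub>M\<^esub> m) = U" using c(4) by (simp add: a_kernel_def')
qed

lemma cyc_hom:
  assumes "cyc R M m U" and N: "left_module R N" and w: "w \<in> carrier N"
    and U: "\<And>u. u \<in> U \<Longrightarrow> u \<odot>\<^bsub>N\<^esub> w = \<zero>\<^bsub>N\<^esub>"
  obtains h where "linmap R M N h" "\<And>r. r \<in> carrier R \<Longrightarrow> h (r \<odot>\<^bsub>M\<^esub> m) = r \<odot>\<^bsub>N\<^esub> w"
proof -
  note c = cycD[OF assms(1)] and s = cyc_surj[OF assms(1)]
  note R = regular_left_module[OF left_module_ring[OF N]]
  obtain h where "linmap R (sub M ((\<lambda>r. r \<odot>\<^bsub>M\<^esub> m) ` carrier (regular_module R))) N h"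
    "\<And>r. r \<in> carrier (regular_module R) \<Longrightarrow> h (r \<odot>\<^bsub>M\<^esub> m) = r \<odot>\<^bsub>N\<^esub> w"
    by (rule linmap_factor[OF R c(1) N s(1) linmap_smult_vec[OF N w]]) (use U c(4) in auto)
  then show ?thesis unfolding s(2) by (intro that) auto
qed

lemma linmap_regular:
  assumes "ring R" "linmap R (regular_module R) N g" "r \<in> carrier R"
  shows "g r = r \<odot>\<^bsub>N\<^esub> g \<one>\<^bsub>R\<^esub>"
proof -
  interpret ring R by fact
  show ?thesis using linmapD(3)[OF assms(2), of r "\<one>\<^bsub>R\<^esub>"] assms(3) by simp
qed

lemma cyc_Ext_1:
  assumes "noeth R" "cyc R M m U"
  shows "Ext_vanishes R 1 M (regular_module R) \<longleftrightarrow> extnd R U (regular_module R) (regular_module R)"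
proof -
  note c = cycD[OF assms(2)] and s = cyc_surj[OF assms(2)]
  note r = left_module_ring[OF c(1)]
  show ?thesis using Ext_1_iff[OF assms(1) c(1) regular_left_module[OF r] proj_regular[OF r] s(1,2)] s(3) by simp
qed

lemma cyc_Ext_shift:
  assumes "noeth R" "cyc R M m U"
  shows "Ext_vanishes R (Suc (Suc n)) M (regular_module R) \<longleftrightarrow>
    Ext_vanishes R (Suc n) (sub (regular_module R) U) (regular_module R)"
proof -
  note c = cycD[OF assms(2)] and s = cyc_surj[OF assms(2)]
  note r = left_module_ring[OF c(1)]
  show ?thesis using Ext_shift[OF assms(1) c(1) regular_left_module[OF r] proj_regular[OF r] s(1,2)] s(3) by simp
qed

text \<open>A map from a cyclic submodule \<open>L = Rl\<close> of \<open>P\<close> to \<open>R\<close> is an element killed by the annihilator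
  of \<open>l\<close>.\<close>

lemma cyc_extnd:
  assumes P: "left_module R P" and L: "L \<subseteq> carrier P" and cl: "cyc R (sub P L) l U"
  shows "extnd R L P (regular_module R) \<longleftrightarrow>
    (\<forall>w\<in>carrier R. (\<forall>u\<in>U. u \<otimes>\<^bsub>R\<^esub> w = \<zero>\<^bsub>R\<^esub>) \<longrightarrow> (\<exists>g. linmap R P (regular_module R) g \<and> g l = w))"
    (is "_ \<longleftrightarrow> ?A")
proof -
  note c = cycD[OF cl]
  note r = left_module_ring[OF P] 
  note RR = regular_left_module[OF r]
  interpret P: left_module R P by fact
  interpret L: left_module R "sub P L" by (rule c(1))
  have lL: "l \<in> L" "l \<in> carrier P" using c(2) L by auto
  show ?thesis
  proof
    assume e: "extnd R L P (regular_module R)"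
    show ?A
    proof (intro ballI impI)
      fix w assume w: "w \<in> carrier R" "\<forall>u\<in>U. u \<otimes>\<^bsub>R\<^esub> w = \<zero>\<^bsub>R\<^esub>"
      obtain h where h: "linmap R (sub P L) (regular_module R) h"
        "\<And>r. r \<in> carrier R \<Longrightarrow> h (r \<odot>\<^bsub>P\<^esub> l) = r \<otimes>\<^bsub>R\<^esub> w"
        by (rule cyc_hom[OF cl RR, of w]) (use w in simp_all)
      obtain g where g: "linmap R P (regular_module R) g" "\<forall>x\<in>L. g x = h x"
        using e h(1) unfolding extnd_def by blast
      have "g l = w" using g(2) lL h(2)[of "\<one>\<^bsub>R\<^esub>"] w(1) by simp
      with g(1) show "\<exists>g. linmap R P (regular_module R) g \<and> g l = w" by blast
    qed
  next
    assume A: ?A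
    show "extnd R L P (regular_module R)" unfolding extnd_def
    proof (intro allI impI)
      fix h assume h: "linmap R (sub P L) (regular_module R) h"
      have hl: "h l \<in> carrier R" using linmapD(1)[OF h] lL by simp
      have "u \<otimes>\<^bsub>R\<^esub> h l = \<zero>\<^bsub>R\<^esub>" if "u \<in> U" for u
        using linmapD(3)[OF h, of u l] that c(4) lL linmap_zero[OF c(1) RR h] by simp
      then obtain g where g: "linmap R P (regular_module R) g" "g l = h l" using A hl by blast
      have "g x = h x" if x: "x \<in> L" for x
      proof -
        obtain r where "r \<in> carrier R" "x = r \<odot>\<^bsub>P\<^esub> l" using c(3)[of x] x by auto
        then show ?thesis using linmapD(3)[OF h, of r l] linmapD(3)[OF g(1), of r l] g(2) lL by simp
      qed
      with g(1) show "\<exists>g. linmap R P (regular_module R) g \<and> (\<forall>x\<in>L. g x = h x)" by blast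
    qed
  qed
qed

lemma cyc_Ext_1_cyc:
  assumes "noeth R" "cyc R M m U" "cyc R (sub (regular_module R) U) l U'"
  shows "Ext_vanishes R 1 M (regular_module R) \<longleftrightarrow>
    (\<forall>w\<in>carrier R. (\<forall>u\<in>U'. u \<otimes>\<^bsub>R\<^esub> w = \<zero>\<^bsub>R\<^esub>) \<longrightarrow> (\<exists>v\<in>carrier R. w = l \<otimes>\<^bsub>R\<^esub> v))"
proof -
  note c = cycD[OF assms(2)]
  note r = left_module_ring[OF c(1)]
  interpret ring R by fact
  note RR = regular_left_module[OF r]
  have U: "U \<subseteq> carrier R" using c(4) by auto
  have l: "l \<in> carrier R" using cycD(2)[OF assms(3)] U by auto
  have "(\<exists>g. linmap R (regular_module R) (regular_module R) g \<and> g l = w) \<longleftrightarrow> (\<exists>v\<in>carrier R. w = l \<otimes>\<^bsub>R\<^esub> v)" for w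
    using linmap_regular[OF r, of "regular_module R" _ l] linmap_smult_vec[OF RR] l 
      linmapD(1)[of R "regular_module R" "regular_module R" _ "\<one>\<^bsub>R\<^esub>"]
    by (metis one_closed regular_simps(1,4))
  then show ?thesis
    unfolding cyc_Ext_1[OF assms(1,2)] by (subst cyc_extnd[OF RR _ assms(3)]) (use U in auto)
qed

text \<open>A parametrization of \<open>N\<close> by \<open>R/U\<close>, which makes \<open>M \<cong> N\<close> a statement about \<open>M\<close> alone.\<close>

lemma isomorphic_cyc_iff:
  fixes M :: "('a, 'm) module" and N :: "('a, 'n) module"
  assumes M: "left_module R M" and N: "cyc R N n U"
  shows "isomorphic R M N \<longleftrightarrow> (\<exists>m. cyc R M m U)"
proof
  note c = cycD[OF N]
  interpret M: left_module R M by fact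
  interpret N: left_module R N by (rule c(1))
  assume "isomorphic R M N"
  then obtain f where f: "f \<in> mod_hom R M N" "bij_betw f (carrier M) (carrier N)"
    unfolding isomorphic_def mod_iso_def by auto
  note f' = mod_hom_linmap[OF f(1)]
  have inj: "x = y" if "x \<in> carrier M" "y \<in> carrier M" "f x = f y" for x y
    using f(2) that by (meson bij_betw_def inj_onD)
  obtain m where m: "m \<in> carrier M" "f m = n" using f(2) c(2) by (metis bij_betw_def imageE)
  have "\<exists>r\<in>carrier R. x = r \<odot>\<^bsub>M\<^esub> m" if x: "x \<in> carrier M" for x
  proof -
    obtain r where r: "r \<in> carrier R" "f x = r \<odot>\<^bsub>N\<^esub> n" using c(3) linmapD(1)[OF f' x] by blast
    then have "x = r \<odot>\<^bsub>M\<^esub> m" using x m linmapD(3)[OF f', of r m] by (intro inj) auto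
    with r show ?thesis by blast
  qed
  moreover have "r \<odot>\<^bsub>M\<^esub> m = \<zero>\<^bsub>M\<^esub> \<longleftrightarrow> r \<odot>\<^bsub>N\<^esub> n = \<zero>\<^bsub>N\<^esub>" if r: "r \<in> carrier R" for r
    using linmapD(3)[OF f' r m(1)] m linmap_zero[OF M c(1) f'] inj[of "r \<odot>\<^bsub>M\<^esub> m" "\<zero>\<^bsub>M\<^esub>"] r by auto
  ultimately show "\<exists>m. cyc R M m U" using M m(1) c(4) unfolding cyc_def by blast
next
  note c = cycD[OF N]
  assume "\<exists>m. cyc R M m U"
  then obtain m where m: "cyc R M m U" by blast
  note d = cycD[OF m]
  obtain h where h: "linmap R M N h" "\<And>r. r \<in> carrier R \<Longrightarrow> h (r \<odot>\<^bsub>M\<^esub> m) = r \<odot>\<^bsub>N\<^esub> n"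
    by (rule cyc_hom[OF m c(1,2)]) (use c(4) in auto)
  obtain h' where h': "linmap R N M h'" "\<And>r. r \<in> carrier R \<Longrightarrow> h' (r \<odot>\<^bsub>N\<^esub> n) = r \<odot>\<^bsub>M\<^esub> m"
    by (rule cyc_hom[OF N d(1,2)]) (use d(4) in auto)
  have 1: "h' (h x) = x" if "x \<in> carrier M" for x using d(3)[OF that] h(2) h'(2) by auto
  have 2: "h (h' x) = x" if "x \<in> carrier N" for x using c(3)[OF that] h(2) h'(2) by auto
  have "bij_betw (restrict h (carrier M)) (carrier M) (carrier N)"
    by (rule bij_betwI[where g = h']) (use 1 2 linmapD(1)[OF h(1)] linmapD(1)[OF h'(1)] in auto)
  then show "isomorphic R M N"
    unfolding isomorphic_def mod_iso_def using linmap_restrict[OF M h(1)] by auto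
qed

section \<open>Quotient modules\<close>

lemma quotient_facts:
  assumes M: "left_module R M" and N: "submodule N R M"
  shows "left_module R (quotient_module M N)"
    and "linmap R M (quotient_module M N) (\<lambda>x. N +>\<^bsub>M\<^esub> x)"
    and "(\<lambda>x. N +>\<^bsub>M\<^esub> x) ` carrier M = carrier (quotient_module M N)"
    and "a_kernel M (quotient_module M N) (\<lambda>x. N +>\<^bsub>M\<^esub> x) = N"
proof -
  interpret M: left_module R M by fact
  note S = M.submodD[OF N]
  have "additive_subgroup N M"
    using N by (simp add: additive_subgroup_def submodule_def)
  then interpret N: abelian_subgroup N M
    by (rule abelian_subgroupI3) (rule M.M.abelian_group_axioms)
  let ?Q = "quotient_module M N"
  have car: "carrier ?Q = (\<lambda>x. N +>\<^bsub>M\<^esub> x) ` carrier M"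
    by (auto simp: quotient_module_def A_RCOSETS_def')
  then show "(\<lambda>x. N +>\<^bsub>M\<^esub> x) ` carrier M = carrier ?Q" by simp
  have add: "(N +>\<^bsub>M\<^esub> x) \<oplus>\<^bsub>?Q\<^esub> (N +>\<^bsub>M\<^esub> y) = N +>\<^bsub>M\<^esub> (x \<oplus>\<^bsub>M\<^esub> y)" if "x \<in> carrier M" "y \<in> carrier M" for x y
    using that by (simp add: quotient_module_def N.a_rcos_sum)
  have eq: "N +>\<^bsub>M\<^esub> x = N +>\<^bsub>M\<^esub> y" if "y \<in> N +>\<^bsub>M\<^esub> x" "x \<in> carrier M" for x y
    using N.a_repr_independence'[OF that] .
  have sm: "a \<odot>\<^bsub>?Q\<^esub> (N +>\<^bsub>M\<^esub> x) = N +>\<^bsub>M\<^esub> (a \<odot>\<^bsub>M\<^esub> x)" if a: "a \<in> carrier R" and x: "x \<in> carrier M" for a x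
  proof -
    have const: "N +>\<^bsub>M\<^esub> (a \<odot>\<^bsub>M\<^esub> y) = N +>\<^bsub>M\<^esub> (a \<odot>\<^bsub>M\<^esub> x)" if y: "y \<in> N +>\<^bsub>M\<^esub> x" for y
    proof -
      obtain n where n: "n \<in> N" "y = n \<oplus>\<^bsub>M\<^esub> x" using y unfolding a_r_coset_def' by blast
      then have "a \<odot>\<^bsub>M\<^esub> y = a \<odot>\<^bsub>M\<^esub> n \<oplus>\<^bsub>M\<^esub> a \<odot>\<^bsub>M\<^esub> x" using a x S(1) by (simp add: M.smult_r_distr subset_iff)
      then have "a \<odot>\<^bsub>M\<^esub> y \<in> N +>\<^bsub>M\<^esub> (a \<odot>\<^bsub>M\<^esub> x)" using S(4)[OF a n(1)] unfolding a_r_coset_def' by blast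
      then show ?thesis using eq a x by (metis M.smult_closed)
    qed
    have "N +>\<^bsub>M\<^esub> x \<noteq> {}" using N.a_rcos_self[OF x] by (metis empty_iff)
    then have "(\<Union>y\<in>N +>\<^bsub>M\<^esub> x. N +>\<^bsub>M\<^esub> (a \<odot>\<^bsub>M\<^esub> y)) = N +>\<^bsub>M\<^esub> (a \<odot>\<^bsub>M\<^esub> x)"
      using const by (rule SUP_eq_const)
    then show ?thesis by (simp add: quotient_module_def)
  qed
  have z: "\<zero>\<^bsub>?Q\<^esub> = N +>\<^bsub>M\<^esub> \<zero>\<^bsub>M\<^esub>"
    using N.a_rcos_const[OF S(2)] by (simp add: quotient_module_def)
  show lin: "linmap R M ?Q (\<lambda>x. N +>\<^bsub>M\<^esub> x)"
    by (rule linmapI) (auto simp: car add sm)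
  have ag: "abelian_group ?Q"
  proof (rule abelian_groupI)
    fix X assume "X \<in> carrier ?Q"
    then obtain x where x: "x \<in> carrier M" "X = N +>\<^bsub>M\<^esub> x" by (auto simp: car)
    show "\<zero>\<^bsub>?Q\<^esub> \<oplus>\<^bsub>?Q\<^esub> X = X" using x by (simp add: z add)
    show "\<exists>Y\<in>carrier ?Q. Y \<oplus>\<^bsub>?Q\<^esub> X = \<zero>\<^bsub>?Q\<^esub>"
      using x by (intro bexI[of _ "N +>\<^bsub>M\<^esub> (\<ominus>\<^bsub>M\<^esub> x)"]) (auto simp: z add car M.M.l_neg)
  qed (auto simp: car add z M.M.a_ac)
  moreover have "left_module_axioms R ?Q"
    by unfold_locales
      (auto simp: car add sm M.smult_l_distr M.smult_r_distr M.smult_assoc)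
  ultimately show "left_module R ?Q" by (simp add: left_module_def M.R.ring_axioms)
  have ker: "N +>\<^bsub>M\<^esub> x = N \<longleftrightarrow> x \<in> N" if "x \<in> carrier M" for x
    using that N.a_rcos_const[of x] N.a_rcos_self[of x] by auto
  have zN: "\<zero>\<^bsub>?Q\<^esub> = N" by (simp add: quotient_module_def)
  show "a_kernel M ?Q (\<lambda>x. N +>\<^bsub>M\<^esub> x) = N"
    unfolding a_kernel_def' zN using S(1) ker by blast
qed

lemma quotient_cyc:
  assumes R: "ring R" and U: "submodule U R (regular_module R)"
  shows "cyc R (quotient_module (regular_module R) U) (U +>\<^bsub>regular_module R\<^esub> \<one>\<^bsub>R\<^esub>) U"
proof -
  interpret ring R by fact
  note q = quotient_facts[OF regular_left_module[OF R] U]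
  have sm: "r \<odot>\<^bsub>quotient_module (regular_module R) U\<^esub> (U +>\<^bsub>regular_module R\<^esub> \<one>\<^bsub>R\<^esub>) = U +>\<^bsub>regular_module R\<^esub> r"
    if "r \<in> carrier R" for r
    using linmapD(3)[OF q(2), of r "\<one>\<^bsub>R\<^esub>"] that by simp
  let ?Q = "quotient_module (regular_module R) U"
  let ?u = "U +>\<^bsub>regular_module R\<^esub> \<one>\<^bsub>R\<^esub>"
  have "U = {r \<in> carrier R. U +>\<^bsub>regular_module R\<^esub> r = \<zero>\<^bsub>?Q\<^esub>}"
    using q(4) by (simp add: a_kernel_def')
  also have "\<dots> = {r \<in> carrier R. r \<odot>\<^bsub>?Q\<^esub> ?u = \<zero>\<^bsub>?Q\<^esub>}"
    using sm by (intro Collect_cong conj_cong) simp_all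
  finally have "U = {r \<in> carrier R. r \<odot>\<^bsub>?Q\<^esub> ?u = \<zero>\<^bsub>?Q\<^esub>}" .
  moreover have "\<exists>r\<in>carrier R. X = r \<odot>\<^bsub>?Q\<^esub> ?u" if "X \<in> carrier ?Q" for X
  proof -
    have "X \<in> (\<lambda>x. U +>\<^bsub>regular_module R\<^esub> x) ` carrier R" using q(3) that by simp
    then obtain r where "r \<in> carrier R" "X = U +>\<^bsub>regular_module R\<^esub> r" by (rule imageE)
    then show ?thesis using sm[of r] by (intro bexI[of _ r]) simp_all
  qed
  moreover have "?u \<in> carrier ?Q" using linmapD(1)[OF q(2), of "\<one>\<^bsub>R\<^esub>"] by simp
  ultimately show ?thesis unfolding cyc_def using q(1) by (intro conjI ballI)
qed

section \<open>Torsionless and reflexive modules\<close>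

definition separated :: "'a ring \<Rightarrow> ('a, 'm) module \<Rightarrow> bool" where
  "separated R M \<longleftrightarrow> (\<forall>x\<in>carrier M. (\<forall>g. linmap R M (regular_module R) g \<longrightarrow> g x = \<zero>\<^bsub>R\<^esub>) \<longrightarrow> x = \<zero>\<^bsub>M\<^esub>)"

lemma regular_minus_zero:
  assumes "ring R" "a \<in> carrier R" "b \<in> carrier R"
  shows "a \<ominus>\<^bsub>regular_module R\<^esub> b = \<zero>\<^bsub>R\<^esub> \<longleftrightarrow> a = b"
  using abelian_group.minus_zero_iff[OF left_module.axioms(2)[OF regular_left_module[OF assms(1)]]] assms(2,3)
  by simp

lemma dual_basis_separated:
  assumes "proj R P" shows "separated R P"
proof -
  obtain n \<phi> y where db: "dual_basis R P n \<phi> y" using assms unfolding proj_def by blast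
  then have P: "left_module R P" and \<phi>: "\<And>j. j < n \<Longrightarrow> linmap R P (regular_module R) (\<phi> j)"
    and y: "\<And>j. j < n \<Longrightarrow> y j \<in> carrier P"
    and x: "\<And>x. x \<in> carrier P \<Longrightarrow> x = lsum P n (\<lambda>j. \<phi> j x \<odot>\<^bsub>P\<^esub> y j)"
    unfolding dual_basis_def by blast+
  interpret P: left_module R P by fact
  show ?thesis unfolding separated_def
  proof (intro ballI impI)
    fix x assume "x \<in> carrier P" and 0: "\<forall>g. linmap R P (regular_module R) g \<longrightarrow> g x = \<zero>\<^bsub>R\<^esub>"
    have "\<phi> j x = \<zero>\<^bsub>R\<^esub>" if "j < n" for j using 0 \<phi>[OF that] by blast
    then have "lsum P n (\<lambda>j. \<phi> j x \<odot>\<^bsub>P\<^esub> y j) = \<zero>\<^bsub>P\<^esub>"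
      using y by (intro P.lsum_zero) (simp add: P.smult_l_null)
    then show "x = \<zero>\<^bsub>P\<^esub>" using x[OF \<open>x \<in> carrier P\<close>] by simp
  qed
qed

lemma torsionless_separated:
  fixes M :: "('a, 'm) module"
  assumes "torsionless R M" and M: "left_module R M"
  shows "separated R M"
proof -
  obtain P :: "('a, nat \<Rightarrow> 'a) module" and N f
    where P: "proj R P" and N: "submodule N R P" and f: "f \<in> mod_hom R M (sub P N)"
      "bij_betw f (carrier M) N"
    using assms(1) unfolding torsionless_def isomorphic_def mod_iso_def fg_projective_iff by auto
  note Pm = proj_left_module[OF P]
  interpret P: left_module R P by fact
  interpret M: left_module R M by fact
  note f' = linmap_from[OF mod_hom_linmap[OF f(1)] P.submodD(1)[OF N]]
  show ?thesis unfolding separated_def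
  proof (intro ballI impI)
    fix x assume x: "x \<in> carrier M" "\<forall>g. linmap R M (regular_module R) g \<longrightarrow> g x = \<zero>\<^bsub>R\<^esub>"
    have "g (f x) = \<zero>\<^bsub>R\<^esub>" if "linmap R P (regular_module R) g" for g
      using x(2) linmap_comp[OF f' that] by blast
    then have "f x = \<zero>\<^bsub>P\<^esub>"
      using dual_basis_separated[OF P] linmapD(1)[OF f' x(1)] unfolding separated_def by blast
    then show "x = \<zero>\<^bsub>M\<^esub>"
      using f(2) x(1) linmap_zero[OF M Pm f'] by (metis M.M.zero_closed bij_betw_def inj_onD)
  qed
qed

lemma torsionlessI:
  fixes M :: "('a, 'm) module" and n :: nat
  assumes M: "left_module R M" and f: "\<And>j. j < n \<Longrightarrow> linmap R M (regular_module R) (f j)"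
    and inj: "\<And>x. x \<in> carrier M \<Longrightarrow> (\<And>j. j < n \<Longrightarrow> f j x = \<zero>\<^bsub>R\<^esub>) \<Longrightarrow> x = \<zero>\<^bsub>M\<^esub>"
  shows "torsionless R M"
proof -
  note R = left_module_ring[OF M]
  interpret M: left_module R M by fact
  note F = free_left_module[OF R] and RR = regular_left_module[OF R]
  define c where "c = (\<lambda>x. \<lambda>j\<in>{..<n}. f j x)"
  have c: "linmap R M (free_module R n) c" unfolding c_def by (rule linmap_coords[OF R f])
  have fc: "f j x \<in> carrier R" if "j < n" "x \<in> carrier M" for j x using linmapD(1)[OF f[OF that(1)] that(2)] by simp
  have "inj_on c (carrier M)"
  proof (rule inj_onI)
    fix x y assume xy: "x \<in> carrier M" "y \<in> carrier M" "c x = c y"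
    have "f j (x \<ominus>\<^bsub>M\<^esub> y) = \<zero>\<^bsub>R\<^esub>" if j: "j < n" for j
    proof -
      have "f j x = f j y" using fun_cong[OF xy(3), of j] j by (simp add: c_def)
      then show ?thesis
        using linmap_minus[OF M RR f[OF j] xy(1,2)] fc[OF j xy(2)] fc[OF j xy(1)]
        by (simp add: regular_minus_zero left_module_ring[OF M])
    qed
    then have "x \<ominus>\<^bsub>M\<^esub> y = \<zero>\<^bsub>M\<^esub>" using xy by (intro inj) auto
    then show "x = y" using xy by (simp add: M.M.minus_zero_iff)
  qed
  then have "bij_betw (restrict c (carrier M)) (carrier M) (c ` carrier M)"
    by (simp add: bij_betw_def inj_on_def cong: image_cong_simp)
  moreover have "restrict c (carrier M) \<in> mod_hom R M (sub (free_module R n) (c ` carrier M))"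
    by (rule linmap_restrict[OF M linmap_into[OF c]]) simp
  ultimately have "isomorphic R M (sub (free_module R n) (c ` carrier M))"
    unfolding isomorphic_def mod_iso_def by auto
  then show ?thesis
    unfolding torsionless_def fg_projective_iff
    using proj_free[OF R] image_submodule[OF M F c] by blast
qed

lemma bidual_map_simps:
  "x \<in> carrier M \<Longrightarrow> bidual_map R M x = (\<lambda>f\<in>carrier (dual R M). f x)"
  by (simp add: bidual_map_def)

lemma bidual_map_hom:
  assumes M: "left_module R M" shows "bidual_map R M \<in> mod_hom R M (bidual R M)"
proof -
  interpret M: left_module R M by fact
  have ev: "(\<lambda>f\<in>carrier (dual R M). f x) \<in> carrier (bidual R M)" if x: "x \<in> carrier M" for x
  proof -
    have "linmap (op_ring R) (dual R M) (regular_module (op_ring R)) (\<lambda>f. f x)"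
      by (rule linmapI) (use x in \<open>auto simp: mod_hom_def\<close>)
    from linmap_restrict[OF dual_left_module[OF M] this] show ?thesis by (simp add: bidual_def)
  qed
  have "linmap R M (bidual R M) (\<lambda>x. \<lambda>f\<in>carrier (dual R M). f x)"
    by (rule linmapI) (use ev in \<open>auto simp: bidual_def mod_hom_def intro!: restrict_ext\<close>)
  then show ?thesis using linmap_restrict[OF M] by (simp add: bidual_map_def)
qed

lemma reflexive_iff:
  fixes M :: "('a, 'm) module"
  assumes M: "left_module R M"
  shows "reflexive R M \<longleftrightarrow> separated R M \<and>
    (\<forall>\<theta>. linmap (op_ring R) (dual R M) (regular_module (op_ring R)) \<theta> \<longrightarrow>
       (\<exists>x\<in>carrier M. \<forall>g\<in>carrier (dual R M). \<theta> g = g x))"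
proof -
  interpret M: left_module R M by fact
  note RR = regular_left_module[OF left_module_ring[OF M]]
  let ?b = "bidual_map R M"
  have inj: "inj_on ?b (carrier M) \<longleftrightarrow> separated R M"
  proof
    assume i: "inj_on ?b (carrier M)"
    show "separated R M" unfolding separated_def
    proof (intro ballI impI)
      fix x assume x: "x \<in> carrier M" "\<forall>g. linmap R M (regular_module R) g \<longrightarrow> g x = \<zero>\<^bsub>R\<^esub>"
      have "g x = g \<zero>\<^bsub>M\<^esub>" if "g \<in> mod_hom R M (regular_module R)" for g
        using x(2) linmap_zero[OF M RR mod_hom_linmap[OF that]] mod_hom_linmap[OF that] by simp
      then have "?b x = ?b \<zero>\<^bsub>M\<^esub>"
        using x(1) by (simp add: bidual_map_simps) (rule restrict_ext)
      then show "x = \<zero>\<^bsub>M\<^esub>" using i x(1) by (meson M.M.zero_closed inj_onD)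
    qed
  next
    assume s: "separated R M"
    show "inj_on ?b (carrier M)"
    proof (rule inj_onI)
      fix x y assume xy: "x \<in> carrier M" "y \<in> carrier M" "?b x = ?b y"
      have "g (x \<ominus>\<^bsub>M\<^esub> y) = \<zero>\<^bsub>R\<^esub>" if g: "linmap R M (regular_module R) g" for g
      proof -
        have "g x = g y"
          using fun_cong[OF xy(3), of "restrict g (carrier M)"] linmap_restrict[OF M g] xy(1,2)
          by (simp add: bidual_map_simps)
        then show ?thesis
          using linmap_minus[OF M RR g xy(1,2)] linmapD(1)[OF g xy(2)] linmapD(1)[OF g xy(1)]
          by (simp add: regular_minus_zero left_module_ring[OF M])
      qed
      then have "x \<ominus>\<^bsub>M\<^esub> y = \<zero>\<^bsub>M\<^esub>" using s xy unfolding separated_def by blast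
      then show "x = y" using xy by (simp add: M.M.minus_zero_iff)
    qed
  qed
  have surj: "?b ` carrier M = carrier (bidual R M) \<longleftrightarrow> 
    (\<forall>\<theta>. linmap (op_ring R) (dual R M) (regular_module (op_ring R)) \<theta> \<longrightarrow>
       (\<exists>x\<in>carrier M. \<forall>g\<in>carrier (dual R M). \<theta> g = g x))" (is "?L \<longleftrightarrow> ?R")
  proof
    assume L: ?L
    show ?R
    proof (intro allI impI)
      fix \<theta> assume "linmap (op_ring R) (dual R M) (regular_module (op_ring R)) \<theta>"
      from linmap_restrict[OF dual_left_module[OF M] this]
      have "restrict \<theta> (carrier (dual R M)) \<in> ?b ` carrier M" using L by (simp add: bidual_def)
      then obtain x where x: "x \<in> carrier M" "restrict \<theta> (carrier (dual R M)) = ?b x" by blast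
      have "\<theta> g = g x" if "g \<in> carrier (dual R M)" for g
        using fun_cong[OF x(2), of g] that x(1) by (simp add: bidual_map_simps)
      then show "\<exists>x\<in>carrier M. \<forall>g\<in>carrier (dual R M). \<theta> g = g x" using x(1) by blast
    qed
  next
    assume R: ?R
    show ?L
    proof
      show "?b ` carrier M \<subseteq> carrier (bidual R M)" 
        using linmapD(1)[OF mod_hom_linmap[OF bidual_map_hom[OF M]]] by blast
      show "carrier (bidual R M) \<subseteq> ?b ` carrier M"
      proof
        fix \<theta> assume t: "\<theta> \<in> carrier (bidual R M)"
        then have t': "linmap (op_ring R) (dual R M) (regular_module (op_ring R)) \<theta>" 
          "\<theta> \<in> extensional (carrier (dual R M))"
          by (simp_all add: bidual_def mod_hom_iff)
        then obtain x where x: "x \<in> carrier M" "\<And>g. g \<in> carrier (dual R M) \<Longrightarrow> \<theta> g = g x" using R by blast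
        then have "\<theta> = ?b x" using t'(2) by (intro ext) (auto simp: bidual_map_simps extensional_def)
        then show "\<theta> \<in> ?b ` carrier M" using x(1) by blast
      qed
    qed
  qed
  show ?thesis
    unfolding reflexive_def mod_iso_def bij_betw_def mem_Collect_eq inj surj using bidual_map_hom[OF M] by blast
qed

section \<open>Duals of projective modules\<close>

lemma lsum_op: "lsum (regular_module (op_ring R)) n v = lsum (regular_module R) n v"
  by (induction n) simp_all

lemma eval_linmap:
  assumes "x \<in> carrier M"
  shows "linmap (op_ring R) (dual R M) (regular_module (op_ring R)) (\<lambda>g. g x)"
  by (rule linmapI) (use assms in \<open>auto simp: mod_hom_def\<close>)

lemma dual_expand:
  assumes db: "dual_basis R P n \<phi> y" and u: "u \<in> mod_hom R P (regular_module R)"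
  shows "u = lsum (dual R P) n (\<lambda>j. u (y j) \<odot>\<^bsub>dual R P\<^esub> restrict (\<phi> j) (carrier P))"
proof -
  from db have P: "left_module R P" and \<phi>: "\<And>j. j < n \<Longrightarrow> linmap R P (regular_module R) (\<phi> j)"
    and y: "\<And>j. j < n \<Longrightarrow> y j \<in> carrier P"
    and x: "\<And>x. x \<in> carrier P \<Longrightarrow> lsum P n (\<lambda>j. \<phi> j x \<odot>\<^bsub>P\<^esub> y j) = x"
    unfolding dual_basis_def by auto
  note R = left_module_ring[OF P]
  note RR = regular_left_module[OF R]
  interpret P: left_module R P by fact
  interpret D: left_module "op_ring R" "dual R P" by (rule dual_left_module[OF P])
  note u' = mod_hom_linmap[OF u]
  let ?t = "\<lambda>j. u (y j) \<odot>\<^bsub>dual R P\<^esub> restrict (\<phi> j) (carrier P)"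
  have uy: "u (y j) \<in> carrier R" if "j < n" for j using linmapD(1)[OF u' y[OF that]] by simp
  have t: "?t j \<in> carrier (dual R P)" if "j < n" for j
    using D.smult_closed[of "u (y j)" "restrict (\<phi> j) (carrier P)"] uy[OF that] linmap_restrict[OF P \<phi>[OF that]]
    by simp
  have s: "lsum (dual R P) n ?t \<in> mod_hom R P (regular_module R)" using D.lsum_closed[OF t] by simp
  show ?thesis
  proof (rule extensionalityI)
    show "u \<in> extensional (carrier P)" "lsum (dual R P) n ?t \<in> extensional (carrier P)"
      using u s by (simp_all add: mod_hom_iff)
    fix z assume z: "z \<in> carrier P"
    have pz: "\<phi> j z \<in> carrier R" if "j < n" for j using linmapD(1)[OF \<phi>[OF that] z] by simp
    have "lsum (dual R P) n ?t z = lsum (regular_module R) n (\<lambda>j. ?t j z)"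
      using linmap_lsum[OF dual_left_module[OF P] regular_left_module[OF op_ring_ring[OF R]] eval_linmap[OF z], of n ?t] t
      by (simp add: lsum_op)
    also have "\<dots> = lsum (regular_module R) n (\<lambda>j. u (\<phi> j z \<odot>\<^bsub>P\<^esub> y j))"
      by (rule lsum_cong) (simp add: z linmapD(3)[OF u'] pz y)
    also have "\<dots> = u (lsum P n (\<lambda>j. \<phi> j z \<odot>\<^bsub>P\<^esub> y j))"
      by (rule linmap_lsum[OF P RR u', symmetric]) (simp add: pz y)
    finally show "u z = lsum (dual R P) n ?t z" using x[OF z] by simp
  qed
qed

lemma proj_dual:
  assumes "proj R P" shows "proj (op_ring R) (dual R P)"
proof -
  obtain n \<phi> y where db: "dual_basis R P n \<phi> y" using assms unfolding proj_def by blast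
  then have P: "left_module R P" and \<phi>: "\<And>j. j < n \<Longrightarrow> linmap R P (regular_module R) (\<phi> j)"
    and y: "\<And>j. j < n \<Longrightarrow> y j \<in> carrier P"
    unfolding dual_basis_def by auto
  have "dual_basis (op_ring R) (dual R P) n (\<lambda>j u. u (y j)) (\<lambda>j. restrict (\<phi> j) (carrier P))"
    unfolding dual_basis_def
    using dual_left_module[OF P] eval_linmap[OF y] linmap_restrict[OF P \<phi>] dual_expand[OF db] by simp
  then show ?thesis unfolding proj_def by blast
qed

lemma proj_reflexive:
  assumes "proj R P" and \<theta>: "linmap (op_ring R) (dual R P) (regular_module (op_ring R)) \<theta>"
  obtains z where "z \<in> carrier P" "\<And>u. u \<in> mod_hom R P (regular_module R) \<Longrightarrow> \<theta> u = u z"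
proof -
  obtain n \<phi> y where db: "dual_basis R P n \<phi> y" using assms(1) unfolding proj_def by blast
  then have P: "left_module R P" and \<phi>: "\<And>j. j < n \<Longrightarrow> linmap R P (regular_module R) (\<phi> j)"
    and y: "\<And>j. j < n \<Longrightarrow> y j \<in> carrier P"
    unfolding dual_basis_def by auto
  note R = left_module_ring[OF P]
  interpret P: left_module R P by fact
  interpret D: left_module "op_ring R" "dual R P" by (rule dual_left_module[OF P])
  let ?p = "\<lambda>j. restrict (\<phi> j) (carrier P)"
  have p: "?p j \<in> carrier (dual R P)" if "j < n" for j using linmap_restrict[OF P \<phi>[OF that]] by simp
  have tp: "\<theta> (?p j) \<in> carrier R" if "j < n" for j using linmapD(1)[OF \<theta> p[OF that]] by simp
  let ?z = "lsum P n (\<lambda>j. \<theta> (?p j) \<odot>\<^bsub>P\<^esub> y j)"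
  have z: "?z \<in> carrier P" by (rule P.lsum_closed) (simp add: tp y)
  have "\<theta> u = u ?z" if u: "u \<in> mod_hom R P (regular_module R)" for u
  proof -
    note u' = mod_hom_linmap[OF u]
    have uy: "u (y j) \<in> carrier (op_ring R)" if "j < n" for j using linmapD(1)[OF u' y[OF that]] by simp
    have "\<theta> u = \<theta> (lsum (dual R P) n (\<lambda>j. u (y j) \<odot>\<^bsub>dual R P\<^esub> ?p j))"
      using dual_expand[OF db u] by simp
    also have "\<dots> = lsum (regular_module (op_ring R)) n (\<lambda>j. \<theta> (u (y j) \<odot>\<^bsub>dual R P\<^esub> ?p j))"
      by (rule linmap_lsum[OF dual_left_module[OF P] regular_left_module[OF op_ring_ring[OF R]] \<theta>])
        (rule D.smult_closed[OF uy p])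
    also have "\<dots> = lsum (regular_module R) n (\<lambda>j. u (\<theta> (?p j) \<odot>\<^bsub>P\<^esub> y j))"
      unfolding lsum_op
    proof (rule lsum_cong)
      fix j assume j: "j < n"
      show "\<theta> (u (y j) \<odot>\<^bsub>dual R P\<^esub> ?p j) = u (\<theta> (?p j) \<odot>\<^bsub>P\<^esub> y j)"
        using linmapD(3)[OF \<theta> uy[OF j] p[OF j]] linmapD(3)[OF u' tp[OF j] y[OF j]] by simp
    qed
    also have "\<dots> = u ?z"
      by (rule linmap_lsum[OF P regular_left_module[OF R] u', symmetric]) (simp add: tp y)
    finally show ?thesis .
  qed
  with z show ?thesis by (rule that)
qed

section \<open>The transpose\<close>

lemma dual_map_linmap:
  assumes P1: "left_module R P1" and P0: "left_module R P0" and f: "linmap R P1 P0 f"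
  shows "linmap (op_ring R) (dual R P0) (dual R P1) (dual_map P1 f)"
proof (rule linmapI)
  fix u assume "u \<in> carrier (dual R P0)"
  then have u: "linmap R P0 (regular_module R) u" by (simp add: mod_hom_linmap)
  show "dual_map P1 f u \<in> carrier (dual R P1)"
    using linmap_restrict[OF P1 linmap_comp[OF f u]] by (simp add: dual_map_def compose_def)
qed (use linmapD(1)[OF f] in \<open>auto simp: dual_map_def compose_def intro!: restrict_ext\<close>)

lemma dual_map_apply: "x \<in> carrier M \<Longrightarrow> dual_map M f g x = g (f x)"
  by (simp add: dual_map_def compose_def)

text \<open>\<open>M\<^sup>*\<close> is the kernel of \<open>P0\<^sup>* \<rightarrow> P1\<^sup>*\<close>.\<close>

lemma dual_kernel:
  assumes P1: "left_module R P1" and P0: "left_module R P0" and M: "left_module R M"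
    and f: "linmap R P1 P0 f" and p: "linmap R P0 M p" "p ` carrier P0 = carrier M"
    and ex: "f ` carrier P1 = a_kernel P0 M p"
  shows "dual_map P0 p ` carrier (dual R M) = a_kernel (dual R P0) (dual R P1) (dual_map P1 f)"
    and "\<And>g. g \<in> carrier (dual R M) \<Longrightarrow> dual_map P0 p g = \<zero>\<^bsub>dual R P0\<^esub> \<Longrightarrow> g = \<zero>\<^bsub>dual R M\<^esub>"
proof -
  note RR = regular_left_module[OF left_module_ring[OF M]]
  note ps = dual_map_linmap[OF P0 M p(1)] and fs = dual_map_linmap[OF P1 P0 f]
  have pf: "p (f x) = \<zero>\<^bsub>M\<^esub>" if "x \<in> carrier P1" for x using ex that by (auto simp: a_kernel_def')
  show "dual_map P0 p ` carrier (dual R M) = a_kernel (dual R P0) (dual R P1) (dual_map P1 f)"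
  proof
    show "dual_map P0 p ` carrier (dual R M) \<subseteq> a_kernel (dual R P0) (dual R P1) (dual_map P1 f)"
    proof
      fix u assume "u \<in> dual_map P0 p ` carrier (dual R M)"
      then obtain g where g: "g \<in> carrier (dual R M)" "u = dual_map P0 p g" by blast
      have g': "linmap R M (regular_module R) g" using g(1) by (simp add: mod_hom_linmap)
      have "dual_map P1 f u = \<zero>\<^bsub>dual R P1\<^esub>"
        unfolding g(2) using pf linmapD(1)[OF f] linmap_zero[OF M RR g']
        by (auto simp: dual_map_def compose_def intro!: restrict_ext)
      then show "u \<in> a_kernel (dual R P0) (dual R P1) (dual_map P1 f)"
        using linmapD(1)[OF ps g(1)] unfolding g(2) a_kernel_def' by blast
    qed
    show "a_kernel (dual R P0) (dual R P1) (dual_map P1 f) \<subseteq> dual_map P0 p ` carrier (dual R M)"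
    proof
      fix u assume "u \<in> a_kernel (dual R P0) (dual R P1) (dual_map P1 f)"
      then have u: "u \<in> mod_hom R P0 (regular_module R)" "dual_map P1 f u = \<zero>\<^bsub>dual R P1\<^esub>"
        by (auto simp: a_kernel_def')
      have "u x = \<zero>\<^bsub>regular_module R\<^esub>" if x: "x \<in> carrier P0" "p x = \<zero>\<^bsub>M\<^esub>" for x
      proof -
        obtain y where y: "y \<in> carrier P1" "x = f y" using ex x by (auto simp: a_kernel_def')
        show ?thesis using fun_cong[OF u(2), of y] y by (simp add: dual_map_apply)
      qed
      then obtain h where h: "linmap R (sub M (p ` carrier P0)) (regular_module R) h"
        "\<And>x. x \<in> carrier P0 \<Longrightarrow> h (p x) = u x"
        using linmap_factor[OF P0 M RR p(1) mod_hom_linmap[OF u(1)]] by metis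
      have h': "linmap R M (regular_module R) h" using h(1) p(2) by simp
      have "dual_map P0 p (restrict h (carrier M)) = u"
      proof (rule extensionalityI[of _ "carrier P0"])
        show "u \<in> extensional (carrier P0)" using u(1) by (simp add: mod_hom_iff)
      qed (use h(2) linmapD(1)[OF p(1)] in \<open>auto simp: dual_map_def compose_def\<close>)
      moreover have "restrict h (carrier M) \<in> carrier (dual R M)" using linmap_restrict[OF M h'] by simp
      ultimately show "u \<in> dual_map P0 p ` carrier (dual R M)" by blast
    qed
  qed
  fix g assume g: "g \<in> carrier (dual R M)" "dual_map P0 p g = \<zero>\<^bsub>dual R P0\<^esub>"
  show "g = \<zero>\<^bsub>dual R M\<^esub>"
  proof (rule extensionalityI[of _ "carrier M"])
    show "g \<in> extensional (carrier M)" using g(1) by (simp add: mod_hom_iff)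
    fix x assume x: "x \<in> carrier M"
    then obtain z where z: "z \<in> carrier P0" "x = p z" using p(2) by blast
    show "g x = \<zero>\<^bsub>dual R M\<^esub> x" using fun_cong[OF g(2), of z] z x by (simp add: dual_map_apply)
  qed simp
qed

locale presentation =
  fixes R :: "'a ring" and P1 :: "('a, nat \<Rightarrow> 'a) module" and f and P0 :: "('a, nat \<Rightarrow> 'a) module"
    and p and M :: "('a, 'm) module"
  assumes noeth_op: "noeth (op_ring R)" and P1: "proj R P1" and P0: "proj R P0" and M: "left_module R M"
    and f: "linmap R P1 P0 f" and p: "linmap R P0 M p" "p ` carrier P0 = carrier M"
    and ex: "f ` carrier P1 = a_kernel P0 M p"
begin

abbreviation "S \<equiv> op_ring R"
abbreviation "D1 \<equiv> dual R P1"
abbreviation "D0 \<equiv> dual R P0"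
abbreviation "fs \<equiv> dual_map P1 f"
definition "im = fs ` carrier D0"
definition "ker = a_kernel D0 D1 fs"
definition "T = quotient_module D1 im"

lemmas P1m = proj_left_module[OF P1] and P0m = proj_left_module[OF P0]
lemmas ringR = left_module_ring[OF M]
lemmas ringS = op_ring_ring[OF ringR]
lemmas D1m = dual_left_module[OF P1m] and D0m = dual_left_module[OF P0m] and Mm = dual_left_module[OF M]
lemmas fs = dual_map_linmap[OF P1m P0m f]
lemmas ps = dual_map_linmap[OF P0m M p(1)]
lemmas ker_eq = dual_kernel(1)[OF P1m P0m M f p ex, folded ker_def]
lemmas ps_inj = dual_kernel(2)[OF P1m P0m M f p ex]

lemma im_sub: "submodule im S D1"
  unfolding im_def by (rule image_submodule[OF D0m D1m fs])

lemma im_left_module: "left_module S (sub D1 im)"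
  by (rule left_module.left_module_sub[OF D1m im_sub])

lemma fs_into: "linmap S D0 (sub D1 im) fs" "fs ` carrier D0 = carrier (sub D1 im)"
  "a_kernel D0 (sub D1 im) fs = ker"
  by (auto intro: linmap_into[OF fs] simp: im_def ker_def a_kernel_def' simp del: dual_simps)

lemma Ext_T:
  assumes N: "left_module S N"
  shows "Ext_vanishes S 1 T N \<longleftrightarrow> extnd S im D1 N"
    and "Ext_vanishes S (Suc (Suc n)) T N \<longleftrightarrow> Ext_vanishes S (Suc n) (sub D1 im) N"
    and "Ext_vanishes S 1 (sub D1 im) N \<longleftrightarrow> extnd S ker D0 N"
    and "Ext_vanishes S (Suc (Suc n)) (sub D1 im) N \<longleftrightarrow> Ext_vanishes S (Suc n) (sub D0 ker) N"
proof -
  note q = quotient_facts[OF D1m im_sub, folded T_def]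
  show "Ext_vanishes S 1 T N \<longleftrightarrow> extnd S im D1 N"
    using Ext_1_iff[OF noeth_op q(1) N proj_dual[OF P1] q(2,3)] q(4) by (simp only:)
  show "Ext_vanishes S (Suc (Suc n)) T N \<longleftrightarrow> Ext_vanishes S (Suc n) (sub D1 im) N"
    using Ext_shift[OF noeth_op q(1) N proj_dual[OF P1] q(2,3)] q(4) by (simp only:)
  show "Ext_vanishes S 1 (sub D1 im) N \<longleftrightarrow> extnd S ker D0 N"
    using Ext_1_iff[OF noeth_op im_left_module N proj_dual[OF P0] fs_into(1,2)] fs_into(3) by (simp only:)
  show "Ext_vanishes S (Suc (Suc n)) (sub D1 im) N \<longleftrightarrow> Ext_vanishes S (Suc n) (sub D0 ker) N"
    using Ext_shift[OF noeth_op im_left_module N proj_dual[OF P0] fs_into(1,2)] fs_into(3) by (simp only:)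
qed

lemma separated_if_extnd:
  assumes e: "extnd S im D1 (regular_module S)"
  shows "separated R M"
  unfolding separated_def
proof (intro ballI impI)
  fix x assume x: "x \<in> carrier M" "\<forall>g. linmap R M (regular_module R) g \<longrightarrow> g x = \<zero>\<^bsub>R\<^esub>"
  note RR = regular_left_module[OF ringR] and SS = regular_left_module[OF ringS]
  obtain z where z: "z \<in> carrier P0" "x = p z" using p(2) x(1) by blast
  have k: "u z = \<zero>\<^bsub>regular_module S\<^esub>" if u: "u \<in> carrier D0" "fs u = \<zero>\<^bsub>D1\<^esub>" for u
  proof -
    have "u \<in> dual_map P0 p ` carrier (dual R M)" unfolding ker_eq ker_def a_kernel_def' using u by blast
    then obtain g where g: "g \<in> carrier (dual R M)" "u = dual_map P0 p g" by blast
    then show ?thesis using x(2) z by (simp add: dual_map_apply mod_hom_linmap)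
  qed
  have ez: "linmap S D0 (regular_module S) (\<lambda>u. u z)" by (rule eval_linmap[OF z(1)])
  obtain h where h: "linmap S (sub D1 (fs ` carrier D0)) (regular_module S) h" 
    "\<And>u. u \<in> carrier D0 \<Longrightarrow> h (fs u) = u z"
    by (rule linmap_factor[OF D0m D1m SS fs ez]) (use k in blast)+
  then obtain \<theta> where t: "linmap S D1 (regular_module S) \<theta>" "\<And>v. v \<in> im \<Longrightarrow> \<theta> v = h v"
    using e unfolding extnd_def im_def by blast
  obtain y where y: "y \<in> carrier P1" "\<And>v. v \<in> mod_hom R P1 (regular_module R) \<Longrightarrow> \<theta> v = v y"
    using proj_reflexive[OF P1 t(1)] by blast
  interpret P0: left_module R P0 by (rule P0m)
  have fy: "f y \<in> carrier P0" by (rule linmapD(1)[OF f y(1)])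
  have "u (z \<ominus>\<^bsub>P0\<^esub> f y) = \<zero>\<^bsub>R\<^esub>" if u: "linmap R P0 (regular_module R) u" for u
  proof -
    let ?u = "restrict u (carrier P0)"
    have u': "?u \<in> carrier D0" using linmap_restrict[OF P0m u] by simp
    have "u z = \<theta> (fs ?u)" using h(2)[OF u'] t(2)[of "fs ?u"] u' z(1) by (simp add: im_def)
    also have "\<dots> = fs ?u y" using y(2) linmapD(1)[OF fs u'] by simp
    also have "\<dots> = u (f y)" using y(1) fy by (simp add: dual_map_apply)
    finally show ?thesis
      using linmap_minus[OF P0m RR u z(1) fy] linmapD(1)[OF u fy] regular_minus_zero[OF ringR] by simp
  qed
  then have "z \<ominus>\<^bsub>P0\<^esub> f y = \<zero>\<^bsub>P0\<^esub>"
    using dual_basis_separated[OF P0] z(1) fy unfolding separated_def by blast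
  then have "z = f y" using z(1) fy by (simp add: P0.M.minus_zero_iff)
  then have "z \<in> a_kernel P0 M p" using ex y(1) by blast
  then show "x = \<zero>\<^bsub>M\<^esub>" using z(2) by (simp add: a_kernel_def')
qed

theorem reflexive_if_extnd:
  assumes "extnd S im D1 (regular_module S)" "extnd S ker D0 (regular_module S)"
  shows "reflexive R M"
  unfolding reflexive_iff[OF M]
proof (intro conjI allI impI)
  show "separated R M" by (rule separated_if_extnd[OF assms(1)])
  fix \<theta> assume t: "linmap S (dual R M) (regular_module S) \<theta>"
  note SS = regular_left_module[OF ringS]
  have k: "\<theta> g = \<zero>\<^bsub>regular_module S\<^esub>" if "g \<in> carrier (dual R M)" "dual_map P0 p g = \<zero>\<^bsub>D0\<^esub>" for g
    using ps_inj[OF that] linmap_zero[OF Mm SS t] by simp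
  obtain h where h: "linmap S (sub D0 (dual_map P0 p ` carrier (dual R M))) (regular_module S) h"
    "\<And>g. g \<in> carrier (dual R M) \<Longrightarrow> h (dual_map P0 p g) = \<theta> g"
    by (rule linmap_factor[OF Mm D0m SS ps t]) (use k in blast)+
  obtain \<theta>' where t': "linmap S D0 (regular_module S) \<theta>'" "\<And>u. u \<in> ker \<Longrightarrow> \<theta>' u = h u"
    using assms(2) h(1) unfolding extnd_def ker_eq by blast
  obtain z where z: "z \<in> carrier P0" "\<And>u. u \<in> mod_hom R P0 (regular_module R) \<Longrightarrow> \<theta>' u = u z"
    using proj_reflexive[OF P0 t'(1)] by blast
  have "\<theta> g = g (p z)" if g: "g \<in> carrier (dual R M)" for g
  proof -
    have "dual_map P0 p g \<in> ker" using g unfolding ker_eq[symmetric] by blast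
    then have "\<theta> g = \<theta>' (dual_map P0 p g)" using h(2)[OF g] t'(2) by simp
    then show ?thesis using z linmapD(1)[OF ps g] by (simp add: dual_map_apply)
  qed
  then show "\<exists>x\<in>carrier M. \<forall>g\<in>carrier (dual R M). \<theta> g = g x"
    using linmapD(1)[OF p(1) z(1)] by blast
qed

end

section \<open>Duality for cyclic modules\<close>

definition rann :: "'a ring \<Rightarrow> 'a set \<Rightarrow> 'a set" where
  "rann R U = {w \<in> carrier R. \<forall>u\<in>U. u \<otimes>\<^bsub>R\<^esub> w = \<zero>\<^bsub>R\<^esub>}"

lemma cyc_image:
  assumes c: "cyc R M m U" and N: "left_module R N" and f: "linmap R M N f" "f ` carrier M = carrier N"
    and inj: "\<And>x. x \<in> carrier M \<Longrightarrow> f x = \<zero>\<^bsub>N\<^esub> \<Longrightarrow> x = \<zero>\<^bsub>M\<^esub>"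
  shows "cyc R N (f m) U"
proof -
  note c = cycD[OF c]
  interpret M: left_module R M by (rule c(1))
  have "\<exists>r\<in>carrier R. y = r \<odot>\<^bsub>N\<^esub> f m" if y: "y \<in> carrier N" for y
  proof -
    obtain x where x: "x \<in> carrier M" "y = f x" using f(2) y by blast
    then obtain r where "r \<in> carrier R" "x = r \<odot>\<^bsub>M\<^esub> m" using c(3) by blast
    then show ?thesis using x linmapD(3)[OF f(1) _ c(2)] by blast
  qed
  moreover have "r \<odot>\<^bsub>M\<^esub> m = \<zero>\<^bsub>M\<^esub> \<longleftrightarrow> r \<odot>\<^bsub>N\<^esub> f m = \<zero>\<^bsub>N\<^esub>" if "r \<in> carrier R" for r
    using linmapD(3)[OF f(1) that c(2)] inj[of "r \<odot>\<^bsub>M\<^esub> m"] linmap_zero[OF c(1) N f(1)] that c(2) by auto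
  ultimately show ?thesis
    using N linmapD(1)[OF f(1) c(2)] c(4) unfolding cyc_def by blast
qed

lemma cyc_preimage:
  assumes c: "cyc R N n U" and M: "left_module R M" and f: "linmap R M N f" "f ` carrier M = carrier N"
    and inj: "\<And>x. x \<in> carrier M \<Longrightarrow> f x = \<zero>\<^bsub>N\<^esub> \<Longrightarrow> x = \<zero>\<^bsub>M\<^esub>"
  shows "\<exists>m. cyc R M m U"
proof -
  note c = cycD[OF c]
  interpret M: left_module R M by (rule M)
  obtain m where m: "m \<in> carrier M" "n = f m" using c(2) f(2) by blast
  have "\<exists>r\<in>carrier R. x = r \<odot>\<^bsub>M\<^esub> m" if x: "x \<in> carrier M" for x
  proof -
    obtain r where r: "r \<in> carrier R" "f x = r \<odot>\<^bsub>N\<^esub> n" using c(3)[OF linmapD(1)[OF f(1) x]] by blast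
    have fr: "f (r \<odot>\<^bsub>M\<^esub> m) = f x" using linmapD(3)[OF f(1) r(1) m(1)] m(2) r(2) by simp
    interpret N: left_module R N by (rule c(1))
    have "f (x \<ominus>\<^bsub>M\<^esub> r \<odot>\<^bsub>M\<^esub> m) = \<zero>\<^bsub>N\<^esub>"
      using linmap_minus[OF M c(1) f(1) x, of "r \<odot>\<^bsub>M\<^esub> m"] fr r(1) m(1) linmapD(1)[OF f(1) x]
      by (simp add: N.M.minus_zero_iff)
    then have "x \<ominus>\<^bsub>M\<^esub> r \<odot>\<^bsub>M\<^esub> m = \<zero>\<^bsub>M\<^esub>" using x r(1) m(1) by (intro inj) auto
    then show ?thesis using x r(1) m(1) by (auto simp: M.M.minus_zero_iff)
  qed
  moreover have "r \<odot>\<^bsub>M\<^esub> m = \<zero>\<^bsub>M\<^esub> \<longleftrightarrow> r \<odot>\<^bsub>N\<^esub> n = \<zero>\<^bsub>N\<^esub>" if "r \<in> carrier R" for r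
    using linmapD(3)[OF f(1) that m(1)] inj[of "r \<odot>\<^bsub>M\<^esub> m"] linmap_zero[OF M c(1) f(1)] that m by auto
  ultimately show ?thesis using M m(1) c(4) unfolding cyc_def by blast
qed

lemma cyc_dual:
  assumes "cyc R M m U"
  shows "(\<lambda>g. g m) ` carrier (dual R M) = rann R U"
    and "\<And>g. g \<in> carrier (dual R M) \<Longrightarrow> g m = \<zero>\<^bsub>R\<^esub> \<Longrightarrow> g = \<zero>\<^bsub>dual R M\<^esub>"
    and "\<And>g r. g \<in> carrier (dual R M) \<Longrightarrow> r \<in> carrier R \<Longrightarrow> g (r \<odot>\<^bsub>M\<^esub> m) = r \<otimes>\<^bsub>R\<^esub> g m"
proof -
  note c = cycD[OF assms]
  interpret M: left_module R M by (rule c(1))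
  note RR = regular_left_module[OF left_module_ring[OF c(1)]]
  show gr: "g (r \<odot>\<^bsub>M\<^esub> m) = r \<otimes>\<^bsub>R\<^esub> g m" if "g \<in> carrier (dual R M)" "r \<in> carrier R" for g r
    using linmapD(3)[OF mod_hom_linmap[of g] that(2) c(2)] that(1) by simp
  show "(\<lambda>g. g m) ` carrier (dual R M) = rann R U"
  proof
    show "(\<lambda>g. g m) ` carrier (dual R M) \<subseteq> rann R U"
    proof clarify
      fix g assume g: "g \<in> carrier (dual R M)"
      have g': "linmap R M (regular_module R) g" using g by (simp add: mod_hom_linmap)
      have "u \<otimes>\<^bsub>R\<^esub> g m = \<zero>\<^bsub>R\<^esub>" if "u \<in> U" for u
        using gr[OF g, of u] that c(4) linmap_zero[OF c(1) RR g'] by simp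
      then show "g m \<in> rann R U" using linmapD(1)[OF g' c(2)] by (simp add: rann_def)
    qed
    show "rann R U \<subseteq> (\<lambda>g. g m) ` carrier (dual R M)"
    proof
      fix w assume w: "w \<in> rann R U"
      obtain h where h: "linmap R M (regular_module R) h" "\<And>r. r \<in> carrier R \<Longrightarrow> h (r \<odot>\<^bsub>M\<^esub> m) = r \<otimes>\<^bsub>R\<^esub> w"
        by (rule cyc_hom[OF assms RR, of w]) (use w in \<open>auto simp: rann_def\<close>)
      have "restrict h (carrier M) \<in> carrier (dual R M)" using linmap_restrict[OF c(1) h(1)] by simp
      moreover have "restrict h (carrier M) m = w" using h(2)[of "\<one>\<^bsub>R\<^esub>"] c(2) w by (simp add: rann_def)
      ultimately show "w \<in> (\<lambda>g. g m) ` carrier (dual R M)" by blast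
    qed
  qed
  fix g assume g: "g \<in> carrier (dual R M)" "g m = \<zero>\<^bsub>R\<^esub>"
  show "g = \<zero>\<^bsub>dual R M\<^esub>"
  proof (rule extensionalityI[of _ "carrier M"])
    show "g \<in> extensional (carrier M)" using g(1) by (simp add: mod_hom_iff)
    fix x assume x: "x \<in> carrier M"
    then obtain r where "r \<in> carrier R" "x = r \<odot>\<^bsub>M\<^esub> m" using c(3) by blast
    then show "g x = \<zero>\<^bsub>dual R M\<^esub> x" using gr[OF g(1)] g(2) x c(2) by simp
  qed simp
qed

lemma cyc_separated_iff:
  assumes "cyc R M m U"
  shows "separated R M \<longleftrightarrow> (\<forall>r\<in>carrier R. (\<forall>w\<in>rann R U. r \<otimes>\<^bsub>R\<^esub> w = \<zero>\<^bsub>R\<^esub>) \<longrightarrow> r \<in> U)"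
proof -
  note c = cycD[OF assms] and d = cyc_dual[OF assms]
  interpret M: left_module R M by (rule c(1))
  have cM: "carrier M = (\<lambda>r. r \<odot>\<^bsub>M\<^esub> m) ` carrier R" using cyc_surj(2)[OF assms] by simp
  have "separated R M \<longleftrightarrow> (\<forall>r\<in>carrier R. (\<forall>g. linmap R M (regular_module R) g \<longrightarrow> g (r \<odot>\<^bsub>M\<^esub> m) = \<zero>\<^bsub>R\<^esub>) \<longrightarrow> r \<odot>\<^bsub>M\<^esub> m = \<zero>\<^bsub>M\<^esub>)"
    unfolding separated_def cM by simp
  also have "\<dots> \<longleftrightarrow> (\<forall>r\<in>carrier R. (\<forall>w\<in>rann R U. r \<otimes>\<^bsub>R\<^esub> w = \<zero>\<^bsub>R\<^esub>) \<longrightarrow> r \<in> U)"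
  proof (intro ball_cong refl arg_cong2[where f = "(\<longrightarrow>)"])
    fix r assume r: "r \<in> carrier R"
    show "(r \<odot>\<^bsub>M\<^esub> m = \<zero>\<^bsub>M\<^esub>) = (r \<in> U)" using c(4) r by simp
    have "(\<forall>w\<in>rann R U. r \<otimes>\<^bsub>R\<^esub> w = \<zero>\<^bsub>R\<^esub>) \<longleftrightarrow> (\<forall>g\<in>carrier (dual R M). g (r \<odot>\<^bsub>M\<^esub> m) = \<zero>\<^bsub>R\<^esub>)"
      unfolding d(1)[symmetric] using d(3)[OF _ r] by simp
    also have "\<dots> \<longleftrightarrow> (\<forall>g. linmap R M (regular_module R) g \<longrightarrow> g (r \<odot>\<^bsub>M\<^esub> m) = \<zero>\<^bsub>R\<^esub>)" (is "?A \<longleftrightarrow> ?B")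
    proof
      assume A: ?A
      show ?B
      proof (intro allI impI)
        fix g assume "linmap R M (regular_module R) g"
        from A[rule_format, unfolded dual_simps, OF linmap_restrict[OF c(1) this]]
        show "g (r \<odot>\<^bsub>M\<^esub> m) = \<zero>\<^bsub>R\<^esub>" using r c(2) by simp
      qed
    qed (simp add: mod_hom_linmap)
    finally show "(\<forall>g. linmap R M (regular_module R) g \<longrightarrow> g (r \<odot>\<^bsub>M\<^esub> m) = \<zero>\<^bsub>R\<^esub>) = (\<forall>w\<in>rann R U. r \<otimes>\<^bsub>R\<^esub> w = \<zero>\<^bsub>R\<^esub>)" ..
  qed
  finally show ?thesis .
qed

lemma rann_linmap:
  assumes "cyc R M m U"
  shows "linmap (op_ring R) (dual R M) (sub (regular_module (op_ring R)) (rann R U)) (\<lambda>g. g m)"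
  by (rule linmap_into[OF eval_linmap[OF cycD(2)[OF assms]]]) (use cyc_dual(1)[OF assms] in blast)

text \<open>For \<open>M = R/U\<close> the dual is the right annihilator of \<open>U\<close>, so a functional on \<open>M\<^sup>*\<close> is a map from a right ideal
  to \<open>R\<close>, and it is evaluation at a point iff it is a left multiplication.\<close>

lemma cyc_reflexive_iff:
  assumes "cyc R M m U"
  shows "reflexive R M \<longleftrightarrow> separated R M \<and>
    (\<forall>\<theta>. linmap (op_ring R) (sub (regular_module (op_ring R)) (rann R U)) (regular_module (op_ring R)) \<theta> \<longrightarrow>
      (\<exists>r\<in>carrier R. \<forall>w\<in>rann R U. \<theta> w = r \<otimes>\<^bsub>R\<^esub> w))"
    (is "_ \<longleftrightarrow> _ \<and> ?A")
proof -
  note c = cycD[OF assms] and d = cyc_dual[OF assms]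
  interpret M: left_module R M by (rule c(1))
  note SS = regular_left_module[OF op_ring_ring[OF left_module_ring[OF c(1)]]]
  have "(\<forall>\<theta>. linmap (op_ring R) (dual R M) (regular_module (op_ring R)) \<theta> \<longrightarrow>
       (\<exists>x\<in>carrier M. \<forall>g\<in>carrier (dual R M). \<theta> g = g x)) \<longleftrightarrow> ?A" (is "?B \<longleftrightarrow> _")
  proof
    assume B: ?B
    show ?A
    proof (intro allI impI)
      fix \<theta> assume "linmap (op_ring R) (sub (regular_module (op_ring R)) (rann R U)) (regular_module (op_ring R)) \<theta>"
      from B[rule_format, OF linmap_comp[OF rann_linmap[OF assms] this]]
      obtain x where x: "x \<in> carrier M" "\<forall>g\<in>carrier (dual R M). \<theta> (g m) = g x" by blast
      obtain r where r: "r \<in> carrier R" "x = r \<odot>\<^bsub>M\<^esub> m" using c(3) x(1) by blast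
      have "\<forall>w\<in>rann R U. \<theta> w = r \<otimes>\<^bsub>R\<^esub> w"
        unfolding d(1)[symmetric] using x(2) r d(3) by auto
      then show "\<exists>r\<in>carrier R. \<forall>w\<in>rann R U. \<theta> w = r \<otimes>\<^bsub>R\<^esub> w" using r(1) by blast
    qed
  next
    assume A: ?A
    show ?B
    proof (intro allI impI)
      fix \<theta> assume t: "linmap (op_ring R) (dual R M) (regular_module (op_ring R)) \<theta>"
      have k: "\<theta> g = \<zero>\<^bsub>regular_module (op_ring R)\<^esub>" if "g \<in> carrier (dual R M)"
        "g m = \<zero>\<^bsub>regular_module (op_ring R)\<^esub>" for g
        using d(2)[of g] that linmap_zero[OF dual_left_module[OF c(1)] SS t] by simp
      obtain h where h: "linmap (op_ring R) (sub (regular_module (op_ring R)) ((\<lambda>g. g m) ` carrier (dual R M))) (regular_module (op_ring R)) h"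
        "\<And>g. g \<in> carrier (dual R M) \<Longrightarrow> h (g m) = \<theta> g"
        by (rule linmap_factor[OF dual_left_module[OF c(1)] SS SS eval_linmap[OF c(2), of R] t]) (use k in blast)+
      obtain r where r: "r \<in> carrier R" "\<forall>w\<in>rann R U. h w = r \<otimes>\<^bsub>R\<^esub> w"
        using A h(1) unfolding d(1) by blast
      have "\<theta> g = g (r \<odot>\<^bsub>M\<^esub> m)" if g: "g \<in> carrier (dual R M)" for g
        using h(2)[OF g] r d(1) d(3)[OF g r(1)] g by (metis imageI)
      then show "\<exists>x\<in>carrier M. \<forall>g\<in>carrier (dual R M). \<theta> g = g x" using r(1) c(2) M.smult_closed by blast
    qed
  qed
  then show ?thesis using reflexive_iff[OF c(1)] by simp
qed

lemma cyc_torsionlessI: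
  fixes n :: nat
  assumes "cyc R M m U" and w: "\<And>j. j < n \<Longrightarrow> w j \<in> rann R U"
    and inj: "\<And>r. r \<in> carrier R \<Longrightarrow> (\<And>j. j < n \<Longrightarrow> r \<otimes>\<^bsub>R\<^esub> w j = \<zero>\<^bsub>R\<^esub>) \<Longrightarrow> r \<in> U"
  shows "torsionless R M"
proof -
  note c = cycD[OF assms(1)] and d = cyc_dual[OF assms(1)]
  have "\<forall>j. \<exists>g. j < n \<longrightarrow> g \<in> carrier (dual R M) \<and> g m = w j"
  proof
    fix j show "\<exists>g. j < n \<longrightarrow> g \<in> carrier (dual R M) \<and> g m = w j"
      using w[of j] unfolding d(1)[symmetric] by (metis imageE)
  qed
  then obtain g where g: "\<And>j. j < n \<Longrightarrow> g j \<in> carrier (dual R M)" "\<And>j. j < n \<Longrightarrow> g j m = w j" by metis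
  show ?thesis
  proof (rule torsionlessI[OF c(1), of n g])
    show "linmap R M (regular_module R) (g j)" if "j < n" for j using g(1)[OF that] by (simp add: mod_hom_linmap)
    fix x assume x: "x \<in> carrier M" "\<And>j. j < n \<Longrightarrow> g j x = \<zero>\<^bsub>R\<^esub>"
    then obtain r where r: "r \<in> carrier R" "x = r \<odot>\<^bsub>M\<^esub> m" using c(3) by blast
    have "r \<in> U" using x(2) r d(3)[OF g(1) r(1)] g(2) by (intro inj[OF r(1)]) auto
    then show "x = \<zero>\<^bsub>M\<^esub>" using r c(4) by simp
  qed
qed

lemma (in presentation) cyc_ker:
  assumes "cyc R M m U" "cyc S (sub (regular_module S) (rann R U)) w U'"
  shows "\<exists>v. cyc S (sub D0 ker) v U'"
proof -
  have "(\<lambda>g. g m) ` carrier (dual R M) = carrier (sub (regular_module S) (rann R U))"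
    using cyc_dual(1)[OF assms(1)] by simp
  then obtain g where g: "cyc S (dual R M) g U'"
    using cyc_preimage[OF assms(2) Mm rann_linmap[OF assms(1)]] cyc_dual(2)[OF assms(1)] by auto
  have k: "left_module S (sub D0 ker)" unfolding ker_def
    by (rule left_module.left_module_sub[OF D0m kernel_submodule[OF D0m D1m fs]])
  have "linmap S (dual R M) (sub D0 ker) (dual_map P0 p)"
    by (rule linmap_into[OF ps]) (use ker_eq in blast)
  then have "cyc S (sub D0 ker) (dual_map P0 p g) U'"
    by (rule cyc_image[OF g k]) (use ker_eq ps_inj in auto)
  then show ?thesis by blast
qed

text \<open>For a presentation of a cyclic module \<open>M\<close> by \<open>R\<close> itself, the image of \<open>R\<^sup>* \<rightarrow> P1\<^sup>*\<close> is cyclic.\<close>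

lemma (in presentation) cyc_im:
  assumes c: "cyc R M m U" and P0_eq: "P0 = free_module R 1" 
    and p_eq: "\<And>u. u \<in> carrier P0 \<Longrightarrow> p u = u 0 \<odot>\<^bsub>M\<^esub> m"
  defines "\<epsilon> \<equiv> \<lambda>u\<in>carrier P0. u 0"
  shows "cyc S (sub D1 im) (fs \<epsilon>) (rann R U)"
    and "\<And>v. v \<in> U \<Longrightarrow> \<exists>g. linmap S D1 (regular_module S) g \<and> g (fs \<epsilon>) = v"
proof -
  note cd = cycD[OF c]
  interpret M: left_module R M by (rule cd(1))
  have e: "\<epsilon> \<in> carrier D0"
    using linmap_restrict[OF P0m, of "regular_module R" "\<lambda>u. u 0"] linmap_coord[of 0 1 R] unfolding \<epsilon>_def P0_eq
    by simp
  interpret D0: left_module S D0 by (rule D0m)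
  interpret D1: left_module S D1 by (rule D1m)
  have fU: "(\<lambda>y. f y 0) ` carrier P1 = U"
  proof -
    have "(\<lambda>y. f y 0) ` carrier P1 = (\<lambda>u. u 0) ` a_kernel P0 M p" unfolding ex[symmetric] image_image ..
    also have "\<dots> = (\<lambda>u. u 0) ` {u \<in> carrier P0. u 0 \<odot>\<^bsub>M\<^esub> m = \<zero>\<^bsub>M\<^esub>}"
      using p_eq by (simp add: a_kernel_def' cong: conj_cong)
    also have "\<dots> = U"
    proof
      show "(\<lambda>u. u 0) ` {u \<in> carrier P0. u 0 \<odot>\<^bsub>M\<^esub> m = \<zero>\<^bsub>M\<^esub>} \<subseteq> U"
        unfolding cd(4) P0_eq by (auto simp: PiE_iff)
      show "U \<subseteq> (\<lambda>u. u 0) ` {u \<in> carrier P0. u 0 \<odot>\<^bsub>M\<^esub> m = \<zero>\<^bsub>M\<^esub>}"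
      proof
        fix v assume v: "v \<in> U"
        then have "(\<lambda>i\<in>{..<1::nat}. v) \<in> {u \<in> carrier P0. u 0 \<odot>\<^bsub>M\<^esub> m = \<zero>\<^bsub>M\<^esub>}"
          unfolding cd(4) P0_eq by auto
        from imageI[OF this, of "\<lambda>u. u 0"] show "v \<in> (\<lambda>u. u 0) ` {u \<in> carrier P0. u 0 \<odot>\<^bsub>M\<^esub> m = \<zero>\<^bsub>M\<^esub>}"
          by simp
      qed
    qed
    finally show ?thesis .
  qed
  have fse: "fs \<epsilon> y = f y 0" if "y \<in> carrier P1" for y
    using that linmapD(1)[OF f that] by (simp add: dual_map_apply \<epsilon>_def)
  have ev: "\<exists>r\<in>carrier S. u = r \<odot>\<^bsub>D0\<^esub> \<epsilon>" if u: "u \<in> carrier D0" for u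
  proof -
    have u': "linmap R P0 (regular_module R) u" "u \<in> extensional (carrier P0)" using u by (auto simp: mod_hom_iff)
    let ?e = "\<lambda>i\<in>{..<1::nat}. \<one>\<^bsub>R\<^esub>"
    have eP: "?e \<in> carrier P0" by (simp add: P0_eq)
    have "u = u ?e \<odot>\<^bsub>D0\<^esub> \<epsilon>"
    proof (rule extensionalityI[OF u'(2)])
      fix z assume z: "z \<in> carrier P0"
      then have z0: "z 0 \<in> carrier R" by (auto simp: P0_eq PiE_iff)
      have "z 0 \<odot>\<^bsub>P0\<^esub> ?e = z"
      proof (rule extensionalityI)
        show "z 0 \<odot>\<^bsub>P0\<^esub> ?e \<in> extensional {..<1}" by (simp add: P0_eq)
        show "z \<in> extensional {..<1}" using z by (simp add: P0_eq PiE_iff)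
        fix i :: nat assume "i \<in> {..<1}"
        then show "(z 0 \<odot>\<^bsub>P0\<^esub> ?e) i = z i" using z0 by (simp add: P0_eq)
      qed
      then show "u z = (u ?e \<odot>\<^bsub>D0\<^esub> \<epsilon>) z" using linmapD(3)[OF u'(1) z0 eP] z by (simp add: \<epsilon>_def)
    qed simp
    then show ?thesis using linmapD(1)[OF u'(1) eP] by auto
  qed
  show "cyc S (sub D1 im) (fs \<epsilon>) (rann R U)" unfolding cyc_def
  proof (intro conjI ballI)
    show "left_module S (sub D1 im)" by (rule im_left_module)
    show "fs \<epsilon> \<in> carrier (sub D1 im)" using e unfolding im_def by simp
    fix v assume "v \<in> carrier (sub D1 im)"
    then obtain u where u: "u \<in> carrier D0" "v = fs u" unfolding im_def by auto
    obtain r where r: "r \<in> carrier S" "u = r \<odot>\<^bsub>D0\<^esub> \<epsilon>" using ev[OF u(1)] by blast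
    show "\<exists>r\<in>carrier S. v = r \<odot>\<^bsub>sub D1 im\<^esub> fs \<epsilon>"
      using linmapD(3)[OF fs r(1) e] r u(2) by (intro bexI[OF _ r(1)]) simp
  next
    have "r \<odot>\<^bsub>D1\<^esub> fs \<epsilon> = \<zero>\<^bsub>D1\<^esub> \<longleftrightarrow> (\<forall>u\<in>U. u \<otimes>\<^bsub>R\<^esub> r = \<zero>\<^bsub>R\<^esub>)" if r: "r \<in> carrier R" for r
    proof -
      have "r \<odot>\<^bsub>D1\<^esub> fs \<epsilon> = \<zero>\<^bsub>D1\<^esub> \<longleftrightarrow> (\<forall>y\<in>carrier P1. fs \<epsilon> y \<otimes>\<^bsub>R\<^esub> r = \<zero>\<^bsub>R\<^esub>)"
        by (auto simp: fun_eq_iff)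
      also have "\<dots> \<longleftrightarrow> (\<forall>u\<in>U. u \<otimes>\<^bsub>R\<^esub> r = \<zero>\<^bsub>R\<^esub>)" unfolding fU[symmetric] using fse by simp
      finally show ?thesis .
    qed
    then show "rann R U = {r \<in> carrier S. r \<odot>\<^bsub>sub D1 im\<^esub> fs \<epsilon> = \<zero>\<^bsub>sub D1 im\<^esub>}"
      by (auto simp: rann_def simp del: dual_simps)
  qed
  fix v assume "v \<in> U"
  then obtain y where y: "y \<in> carrier P1" "v = f y 0" using fU by blast
  then show "\<exists>g. linmap S D1 (regular_module S) g \<and> g (fs \<epsilon>) = v"
    using eval_linmap[OF y(1)] fse by auto
qed

section \<open>Coordinates of the algebra\<close>

lemma free_alg_induct [case_names zero add]:
  fixes p :: "'k::field free_alg"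
  assumes "P 0" "\<And>p u c. P p \<Longrightarrow> P (p + Poly_Mapping.single (Word u) c)"
  shows "P p"
proof (induction p rule: update_induct)
  case (update p w c)
  have "Poly_Mapping.update w c p = p + Poly_Mapping.single w c"
    using update(1) by (intro poly_mapping_eqI) (auto simp: lookup_update lookup_add lookup_single Poly_Mapping.in_keys_iff)
  then show ?case using assms(2)[OF update(3), of "letters w" c] by simp
qed (rule assms(1))

lemma single_word_mult:
  "Poly_Mapping.single (Word u) c * Poly_Mapping.single (Word v) d = Poly_Mapping.single (Word (u @ v)) (c * d)"
  by (simp add: mult_single plus_word_def)

lemma const_word: "const c = Poly_Mapping.single (Word []) c"
  by (simp add: const_def zero_word_def)

lemma lookup_mult_short:
  fixes p :: "'k::field free_alg" and r :: "'k free_alg"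
  shows "Poly_Mapping.lookup (p * r) (Word []) = Poly_Mapping.lookup p (Word []) * Poly_Mapping.lookup r (Word [])"
    and "Poly_Mapping.lookup (p * r) (Word [a]) = Poly_Mapping.lookup p (Word []) * Poly_Mapping.lookup r (Word [a]) + Poly_Mapping.lookup p (Word [a]) * Poly_Mapping.lookup r (Word [])"
    and "Poly_Mapping.lookup (p * r) (Word [a, b]) = Poly_Mapping.lookup p (Word []) * Poly_Mapping.lookup r (Word [a, b])
       + Poly_Mapping.lookup p (Word [a]) * Poly_Mapping.lookup r (Word [b]) + Poly_Mapping.lookup p (Word [a, b]) * Poly_Mapping.lookup r (Word [])"
proof -
  have 1: "Poly_Mapping.lookup (Poly_Mapping.single (Word u) c * r) (Word []) = (c when u = []) * Poly_Mapping.lookup r (Word [])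
    \<and> Poly_Mapping.lookup (Poly_Mapping.single (Word u) c * r) (Word [a]) = (c when u = []) * Poly_Mapping.lookup r (Word [a]) + (c when u = [a]) * Poly_Mapping.lookup r (Word [])
    \<and> Poly_Mapping.lookup (Poly_Mapping.single (Word u) c * r) (Word [a, b]) = (c when u = []) * Poly_Mapping.lookup r (Word [a, b])
       + (c when u = [a]) * Poly_Mapping.lookup r (Word [b]) + (c when u = [a, b]) * Poly_Mapping.lookup r (Word [])" for u and c :: 'k
  proof (induction r rule: free_alg_induct)
    case (add r v d)
    then show ?case
      by (auto simp: distrib_left lookup_add single_word_mult lookup_single when_def algebra_simps
          append_eq_Cons_conv Cons_eq_append_conv)
  qed simp
  show "Poly_Mapping.lookup (p * r) (Word []) = Poly_Mapping.lookup p (Word []) * Poly_Mapping.lookup r (Word [])"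
    by (induction p rule: free_alg_induct) (auto simp: distrib_right lookup_add 1 lookup_single algebra_simps)
  show "Poly_Mapping.lookup (p * r) (Word [a]) = Poly_Mapping.lookup p (Word []) * Poly_Mapping.lookup r (Word [a]) + Poly_Mapping.lookup p (Word [a]) * Poly_Mapping.lookup r (Word [])"
    by (induction p rule: free_alg_induct) (auto simp: distrib_right lookup_add 1 lookup_single algebra_simps)
  show "Poly_Mapping.lookup (p * r) (Word [a, b]) = Poly_Mapping.lookup p (Word []) * Poly_Mapping.lookup r (Word [a, b])
       + Poly_Mapping.lookup p (Word [a]) * Poly_Mapping.lookup r (Word [b]) + Poly_Mapping.lookup p (Word [a, b]) * Poly_Mapping.lookup r (Word [])"
    by (induction p rule: free_alg_induct) (auto simp: distrib_right lookup_add 1 lookup_single algebra_simps)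
qed

definition kx :: "'k::field free_alg \<Rightarrow> gen \<Rightarrow> 'k" where "kx p g = Poly_Mapping.lookup p (Word [g])"
definition k0 :: "'k::field free_alg \<Rightarrow> 'k" where "k0 p = Poly_Mapping.lookup p (Word [])"
definition kyx :: "'k::field \<Rightarrow> 'k free_alg \<Rightarrow> 'k" where
  "kyx q p = Poly_Mapping.lookup p (Word [Y, X]) - q * Poly_Mapping.lookup p (Word [X, Y])"
definition kzx :: "'k::field free_alg \<Rightarrow> 'k" where
  "kzx p = Poly_Mapping.lookup p (Word [Z, X]) + Poly_Mapping.lookup p (Word [X, Z]) + Poly_Mapping.lookup p (Word [Z, Y])"

lemmas k_defs = k0_def kx_def kyx_def kzx_def

lemma k_add: "k0 (p + r) = k0 p + k0 r" "kx (p + r) g = kx p g + kx r g"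
  "kyx q (p + r) = kyx q p + kyx q r" "kzx (p + r) = kzx p + kzx r"
  by (simp_all add: k_defs lookup_add algebra_simps)

lemma k_minus: "k0 (p - r) = k0 p - k0 r" "kx (p - r) g = kx p g - kx r g"
  "kyx q (p - r) = kyx q p - kyx q r" "kzx (p - r) = kzx p - kzx r"
  by (simp_all add: k_defs lookup_minus algebra_simps)

lemma k_mult: "k0 (p * r) = k0 p * k0 r"
  "kx (p * r) g = k0 p * kx r g + kx p g * k0 r"
  "kyx q (p * r) = k0 p * kyx q r + kyx q p * k0 r + kx p Y * kx r X - q * (kx p X * kx r Y)"
  "kzx (p * r) = k0 p * kzx r + kzx p * k0 r + kx p Z * kx r X + kx p X * kx r Z + kx p Z * kx r Y"
  by (simp_all add: k_defs lookup_mult_short algebra_simps)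

definition nf :: "'k::field \<Rightarrow> 'k \<Rightarrow> 'k \<Rightarrow> 'k \<Rightarrow> 'k \<Rightarrow> 'k \<Rightarrow> 'k free_alg" where
  "nf a b c d e f = Poly_Mapping.single (Word []) a + Poly_Mapping.single (Word [X]) b
     + Poly_Mapping.single (Word [Y]) c + Poly_Mapping.single (Word [Z]) d
     + Poly_Mapping.single (Word [Y, X]) e + Poly_Mapping.single (Word [Z, X]) f"

lemma k_nf: "k0 (nf a b c d e f) = a" "kx (nf a b c d e f) X = b" "kx (nf a b c d e f) Y = c"
  "kx (nf a b c d e f) Z = d" "kyx q (nf a b c d e f) = e" "kzx (nf a b c d e f) = f"
  by (simp_all add: k_defs nf_def lookup_add lookup_single when_def)

lemma free_ring_simps [simp]:
  "carrier free_ring = UNIV" "x \<otimes>\<^bsub>free_ring\<^esub> y = x * y" "\<one>\<^bsub>free_ring\<^esub> = 1" "\<zero>\<^bsub>free_ring\<^esub> = 0"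
  "x \<oplus>\<^bsub>free_ring\<^esub> y = x + y"
  by (simp_all add: free_ring_def)

lemma free_ring_ring: "ring (free_ring :: 'k::field free_alg ring)"
proof (rule ringI)
  show "abelian_group (free_ring :: 'k free_alg ring)"
  proof (rule abelian_groupI)
    show "\<exists>y\<in>carrier free_ring. y \<oplus>\<^bsub>free_ring\<^esub> x = \<zero>\<^bsub>free_ring\<^esub>" for x :: "'k free_alg"
      by (intro bexI[of _ "- x"]) auto
  qed (auto simp: algebra_simps)
qed (auto intro!: monoidI simp: algebra_simps)

definition rel_ideal :: "'k::field \<Rightarrow> 'k free_alg set" where
  "rel_ideal q = Idl\<^bsub>free_ring\<^esub> (relations q)"

lemma rel_ideal_ideal: "ideal (rel_ideal q) free_ring"
  unfolding rel_ideal_def by (rule ring.genideal_ideal[OF free_ring_ring]) simp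

lemma rel_ideal_closed:
  shows "0 \<in> rel_ideal q" "p \<in> rel_ideal q \<Longrightarrow> r \<in> rel_ideal q \<Longrightarrow> p + r \<in> rel_ideal q"
    "p \<in> rel_ideal q \<Longrightarrow> r * p \<in> rel_ideal q" "p \<in> rel_ideal q \<Longrightarrow> p * r \<in> rel_ideal q"
    "p \<in> relations q \<Longrightarrow> p \<in> rel_ideal q"
proof -
  interpret ideal "rel_ideal q" free_ring by (rule rel_ideal_ideal)
  note ag = is_additive_subgroup
  show "0 \<in> rel_ideal q" using additive_subgroup.zero_closed[OF ag] by simp
  show "p \<in> rel_ideal q \<Longrightarrow> r \<in> rel_ideal q \<Longrightarrow> p + r \<in> rel_ideal q"
    using additive_subgroup.a_closed[OF ag, of p r] by simp
  show "p \<in> rel_ideal q \<Longrightarrow> r * p \<in> rel_ideal q" "p \<in> rel_ideal q \<Longrightarrow> p * r \<in> rel_ideal q"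
    using I_l_closed I_r_closed by simp_all
  show "p \<in> relations q \<Longrightarrow> p \<in> rel_ideal q"
    using ring.genideal_self[OF free_ring_ring, of "relations q"] by (auto simp: rel_ideal_def)
qed

definition eqv :: "'k::field \<Rightarrow> 'k free_alg \<Rightarrow> 'k free_alg \<Rightarrow> bool" where
  "eqv q p r \<longleftrightarrow> p - r \<in> rel_ideal q"

lemma eqv_refl: "eqv q p p" by (simp add: eqv_def rel_ideal_closed)

lemma eqv_trans: "eqv q p r \<Longrightarrow> eqv q r s \<Longrightarrow> eqv q p s"
  unfolding eqv_def using rel_ideal_closed(2)[of "p - r" q "r - s"] by simp

lemma eqv_add: "eqv q p r \<Longrightarrow> eqv q p' r' \<Longrightarrow> eqv q (p + p') (r + r')"
  unfolding eqv_def using rel_ideal_closed(2)[of "p - r" q "p' - r'"] by (simp add: algebra_simps)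

lemma eqv_mult: "eqv q p r \<Longrightarrow> eqv q p' r' \<Longrightarrow> eqv q (p * p') (r * r')"
  unfolding eqv_def
  using rel_ideal_closed(2)[OF rel_ideal_closed(4)[of "p - r" q p'] rel_ideal_closed(3)[of "p' - r'" q r]]
  by (simp add: algebra_simps)

abbreviation sg :: "gen list \<Rightarrow> 'k::field \<Rightarrow> 'k free_alg" where
  "sg u c \<equiv> Poly_Mapping.single (Word u) c"

lemma eqv_relations:
  "eqv q (sg [X, X] c) 0" "eqv q (sg [Y, Y] c) 0" "eqv q (sg [Z, Z] c) 0" "eqv q (sg [Y, Z] c) 0"
  "eqv q (sg [X, Y] c) (sg [Y, X] (- q * c))" "eqv q (sg [X, Z] c) (sg [Z, X] c)"
  "eqv q (sg [Z, Y] c) (sg [Z, X] c)"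
proof -
  have m: "sg [] c * p \<in> rel_ideal q" if "p \<in> relations q" for p
    using rel_ideal_closed(3,5) that by blast
  note r = m[unfolded relations_def var_def const_word]
  show "eqv q (sg [X, X] c) 0" using r[of "sg [X] 1 * sg [X] 1"] by (simp add: eqv_def single_word_mult)
  show "eqv q (sg [Y, Y] c) 0" using r[of "sg [Y] 1 * sg [Y] 1"] by (simp add: eqv_def single_word_mult)
  show "eqv q (sg [Z, Z] c) 0" using r[of "sg [Z] 1 * sg [Z] 1"] by (simp add: eqv_def single_word_mult)
  show "eqv q (sg [Y, Z] c) 0" using r[of "sg [Y] 1 * sg [Z] 1"] by (simp add: eqv_def single_word_mult)
  show "eqv q (sg [X, Y] c) (sg [Y, X] (- q * c))"
    using r[of "sg [X] 1 * sg [Y] 1 + sg [] q * sg [Y] 1 * sg [X] 1"]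
    by (simp add: eqv_def single_word_mult distrib_left single_uminus mult.commute)
  show "eqv q (sg [X, Z] c) (sg [Z, X] c)"
    using r[of "sg [X] 1 * sg [Z] 1 - sg [Z] 1 * sg [X] 1"]
    by (simp add: eqv_def single_word_mult right_diff_distrib)
  show "eqv q (sg [Z, Y] c) (sg [Z, X] c)"
    using r[of "sg [Z] 1 * sg [Y] 1 - sg [Z] 1 * sg [X] 1"]
    by (simp add: eqv_def single_word_mult right_diff_distrib)
qed

lemma eqv_sg_app:
  assumes "eqv q (sg u c) (sg v d)"
  shows "eqv q (sg (u @ w) c) (sg (v @ w) d)" "eqv q (sg (w @ u) c) (sg (w @ v) d)"
  using eqv_mult[OF assms eqv_refl, of "sg w 1"] eqv_mult[OF eqv_refl[of q "sg w 1"] assms]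
  by (simp_all add: single_word_mult)

lemma eqv_zero_app:
  assumes "eqv q (sg u c) 0"
  shows "eqv q (sg (u @ w) c) 0" "eqv q (sg (w @ u) c) 0"
  using eqv_mult[OF assms eqv_refl, of "sg w 1"] eqv_mult[OF eqv_refl[of q "sg w 1"] assms]
  by (simp_all add: single_word_mult)

lemma eqv_cube: "eqv q (sg [a, b, c] t) 0"
proof -
  note r = eqv_relations
  have yx: "eqv q (sg [Y, X, g] s) 0" for g s
  proof (cases g)
    case X then show ?thesis using eqv_zero_app(2)[OF r(1), of q "[Y]" s] by simp
  next
    case Y
    have "eqv q (sg [Y, X, Y] s) (sg [Y, Y, X] (- q * s))" using eqv_sg_app(2)[OF r(5), of q "[Y]" s] by simp
    moreover have "eqv q (sg [Y, Y, X] (- q * s)) 0" using eqv_zero_app(1)[OF r(2), of q "[X]" "- q * s"] by simp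
    ultimately show ?thesis unfolding Y by (rule eqv_trans)
  next
    case Z
    have "eqv q (sg [Y, X, Z] s) (sg [Y, Z, X] s)" using eqv_sg_app(2)[OF r(6), of q "[Y]" s] by simp
    moreover have "eqv q (sg [Y, Z, X] s) 0" using eqv_zero_app(1)[OF r(4), of q "[X]" s] by simp
    ultimately show ?thesis unfolding Z by (rule eqv_trans)
  qed
  have zxx: "eqv q (sg [Z, X, X] s) 0" for s
    using eqv_zero_app(2)[OF r(1), of q "[Z]" s] by simp
  have zx: "eqv q (sg [Z, X, g] s) 0" for g s
  proof (cases g)
    case X then show ?thesis using zxx by simp
  next
    case Y
    have "eqv q (sg [Z, X, Y] s) (sg [Z, Y, X] (- q * s))" using eqv_sg_app(2)[OF r(5), of q "[Z]" s] by simp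
    moreover have "eqv q (sg [Z, Y, X] (- q * s)) (sg [Z, X, X] (- q * s))"
      using eqv_sg_app(1)[OF r(7), of q "[X]" "- q * s"] by simp
    ultimately show ?thesis unfolding Y using zxx eqv_trans by blast
  next
    case Z
    have "eqv q (sg [Z, X, Z] s) (sg [Z, Z, X] s)" using eqv_sg_app(2)[OF r(6), of q "[Z]" s] by simp
    moreover have "eqv q (sg [Z, Z, X] s) 0" using eqv_zero_app(1)[OF r(3), of q "[X]" s] by simp
    ultimately show ?thesis unfolding Z by (rule eqv_trans)
  qed
  have z: "eqv q (sg [a, b, c] t) 0" if "eqv q (sg [a, b] t) 0"
    using eqv_zero_app(1)[OF that, of "[c]"] by simp
  note s = eqv_sg_app(1)[of q "[a, b]" t _ _ "[c]"]
  show ?thesis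
  proof (cases a; cases b)
    assume ab: "a = X" "b = Y"
    have "eqv q (sg [a, b, c] t) (sg [Y, X, c] (- q * t))" using s[of "[Y, X]"] r(5)[of q t] unfolding ab by simp
    then show ?thesis using yx eqv_trans by blast
  next
    assume ab: "a = X" "b = Z"
    have "eqv q (sg [a, b, c] t) (sg [Z, X, c] t)" using s[of "[Z, X]"] r(6)[of q t] unfolding ab by simp
    then show ?thesis using zx eqv_trans by blast
  next
    assume ab: "a = Z" "b = Y"
    have "eqv q (sg [a, b, c] t) (sg [Z, X, c] t)" using s[of "[Z, X]"] r(7)[of q t] unfolding ab by simp
    then show ?thesis using zx eqv_trans by blast
  qed (use z r(1-4)[of q t] yx zx in simp_all)
qed

abbreviation nfk :: "'k::field \<Rightarrow> 'k free_alg \<Rightarrow> 'k free_alg" where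
  "nfk q p \<equiv> nf (k0 p) (kx p X) (kx p Y) (kx p Z) (kyx q p) (kzx p)"

lemma nf_add: "nf a b c d e f + nf a' b' c' d' e' f' = nf (a + a') (b + b') (c + c') (d + d') (e + e') (f + f')"
  by (simp add: nf_def single_add algebra_simps)

lemma eqv_nf_single: "eqv q (sg u c) (nfk q (sg u c))"
proof -
  note r = eqv_relations
  consider "u = []" | a where "u = [a]" | a b where "u = [a, b]" | a b d v where "u = a # b # d # v"
    by (metis list.exhaust)
  then show ?thesis
  proof cases
    case 1 then show ?thesis by (simp add: k_defs nf_def lookup_single when_def eqv_refl)
  next
    case 2 then show ?thesis by (cases a) (simp_all add: k_defs nf_def lookup_single when_def eqv_refl)
  next
    case 3 then show ?thesis using eqv_relations[where q = q and c = c]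
      by (cases a; cases b) (simp_all add: k_defs nf_def lookup_single when_def eqv_refl)
  next
    case 4
    have "eqv q (sg u c) 0" unfolding 4 using eqv_zero_app(1)[OF eqv_cube[of q a b d c], of v] by simp
    then show ?thesis unfolding 4 by (simp add: k_defs nf_def lookup_single when_def)
  qed
qed

lemma eqv_nf: "eqv q p (nfk q p)"
proof (induction p rule: free_alg_induct)
  case zero then show ?case by (simp add: k_defs nf_def eqv_refl)
next
  case (add p u c)
  show ?case using eqv_add[OF add eqv_nf_single[of q u c]] by (simp add: k_add nf_add)
qed

lemma rel_ideal_k:
  assumes "p \<in> rel_ideal q"
  shows "k0 p = 0 \<and> kx p X = 0 \<and> kx p Y = 0 \<and> kx p Z = 0 \<and> kyx q p = 0 \<and> kzx p = 0"
proof -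
  interpret ring "free_ring :: 'a free_alg ring" by (rule free_ring_ring)
  let ?N = "{p. k0 p = 0 \<and> kx p X = 0 \<and> kx p Y = 0 \<and> kx p Z = 0 \<and> kyx q p = 0 \<and> kzx p = 0}"
  have z: "k0 (0 :: 'a free_alg) = 0" "kx (0 :: 'a free_alg) g = 0" "kyx q 0 = 0" "kzx (0 :: 'a free_alg) = 0" for g by (simp_all add: k_defs)
  have "ideal ?N free_ring"
  proof (rule idealI[OF free_ring_ring])
    have inv: "\<ominus>\<^bsub>free_ring\<^esub> a = - a" for a :: "'a free_alg"
      using minus_equality[of "- a" a] by simp
    show "subgroup ?N (add_monoid free_ring)"
    proof (rule add.subgroupI)
      show "\<ominus>\<^bsub>free_ring\<^esub> a \<in> ?N" if "a \<in> ?N" for a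
        using that inv k_minus[where p = 0 and r = a] z by simp
    qed (use z in \<open>auto simp: k_add\<close>)
  qed (auto simp: k_mult)
  moreover have "relations q \<subseteq> ?N"
    unfolding relations_def var_def const_word
    by (auto simp: single_word_mult k_defs lookup_single lookup_add lookup_minus when_def)
  ultimately have "rel_ideal q \<subseteq> ?N" unfolding rel_ideal_def by (rule genideal_minimal)
  then show ?thesis using assms by blast
qed

lemma cls_eq: "cls q p = cls q r \<longleftrightarrow> eqv q p r"
proof -
  interpret ideal "rel_ideal q" free_ring by (rule rel_ideal_ideal)
  interpret abelian_subgroup "rel_ideal q" free_ring
    by (rule abelian_subgroupI3[OF is_additive_subgroup is_abelian_group])
  have c: "p \<in> rel_ideal q +>\<^bsub>free_ring\<^esub> r \<longleftrightarrow> eqv q p r"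
    unfolding a_r_coset_def' eqv_def by (auto simp: algebra_simps intro: bexI[of _ "p - r"])
  have "cls q p = cls q r \<longleftrightarrow> p \<in> rel_ideal q +>\<^bsub>free_ring\<^esub> r"
    unfolding cls_def rel_ideal_def[symmetric]
    using a_repr_independence'[of p r] a_rcos_self[of p] by auto
  then show ?thesis using c by simp
qed

section \<open>The ring structure in coordinates\<close>

text \<open>\<open>E q a b c d e f\<close> is \<open>a + b x + c y + d z + e yx + f zx\<close>.\<close>

definition E :: "'k::field \<Rightarrow> 'k \<Rightarrow> 'k \<Rightarrow> 'k \<Rightarrow> 'k \<Rightarrow> 'k \<Rightarrow> 'k \<Rightarrow> 'k lam" where
  "E q a b c d e f = cls q (nf a b c d e f)"

lemma cls_E: "cls q p = E q (k0 p) (kx p X) (kx p Y) (kx p Z) (kyx q p) (kzx p)"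
  unfolding E_def cls_eq by (rule eqv_nf)

lemma E_inject [simp]:
  "E q a b c d e f = E q a' b' c' d' e' f' \<longleftrightarrow> a = a' \<and> b = b' \<and> c = c' \<and> d = d' \<and> e = e' \<and> f = f'"
proof
  assume "E q a b c d e f = E q a' b' c' d' e' f'"
  from rel_ideal_k[OF this[unfolded E_def cls_eq eqv_def]]
  show "a = a' \<and> b = b' \<and> c = c' \<and> d = d' \<and> e = e' \<and> f = f'" by (simp add: k_minus k_nf)
qed simp

lemma Lam_ops:
  "cls q p \<oplus>\<^bsub>Lam q\<^esub> cls q r = cls q (p + r)" "cls q p \<otimes>\<^bsub>Lam q\<^esub> cls q r = cls q (p * r)"
  "\<zero>\<^bsub>Lam q\<^esub> = cls q 0" "\<one>\<^bsub>Lam q\<^esub> = cls q 1" "carrier (Lam q) = range (cls q)"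
proof -
  interpret ideal "rel_ideal q" free_ring by (rule rel_ideal_ideal)
  interpret abelian_subgroup "rel_ideal q" free_ring
    by (rule abelian_subgroupI3[OF is_additive_subgroup is_abelian_group])
  note d = cls_def rel_ideal_def[symmetric] Lam_def FactRing_def
  show "cls q p \<oplus>\<^bsub>Lam q\<^esub> cls q r = cls q (p + r)" unfolding d using a_rcos_sum[of p r] by simp
  show "cls q p \<otimes>\<^bsub>Lam q\<^esub> cls q r = cls q (p * r)" unfolding d using rcoset_mult_add[of p r] by simp
  show "\<zero>\<^bsub>Lam q\<^esub> = cls q 0" unfolding d using a_rcos_const[of 0] rel_ideal_closed(1)[of q] by simp
  show "\<one>\<^bsub>Lam q\<^esub> = cls q 1" unfolding d by simp
  show "carrier (Lam q) = range (cls q)" unfolding d by (auto simp: A_RCOSETS_def')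
qed

lemma Lam_ring: "ring (Lam q)"
  unfolding Lam_def rel_ideal_def[symmetric] by (rule ideal.quotient_is_ring[OF rel_ideal_ideal])

lemma E_closed [simp]: "E q a b c d e f \<in> carrier (Lam q)"
  by (simp add: E_def Lam_ops)

lemma E_cases:
  assumes "r \<in> carrier (Lam q)"
  obtains a b c d e f where "r = E q a b c d e f"
  using assms cls_E unfolding Lam_ops by blast

lemma E_add [simp]: "E q a b c d e f \<oplus>\<^bsub>Lam q\<^esub> E q a' b' c' d' e' f' = E q (a + a') (b + b') (c + c') (d + d') (e + e') (f + f')"
  by (simp add: E_def Lam_ops nf_add)

lemma E_mult [simp]: "E q a b c d e f \<otimes>\<^bsub>Lam q\<^esub> E q a' b' c' d' e' f' =
   E q (a * a') (a * b' + b * a') (a * c' + c * a') (a * d' + d * a')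
     (a * e' + e * a' - q * b * c' + c * b') (a * f' + f * a' + b * d' + d * b' + d * c')"
proof -
  have "cls q (nf a b c d e f) \<otimes>\<^bsub>Lam q\<^esub> cls q (nf a' b' c' d' e' f')
    = cls q (nf a b c d e f * nf a' b' c' d' e' f')" by (rule Lam_ops)
  then show ?thesis unfolding cls_E k_mult k_nf by (simp add: algebra_simps)
qed

lemma E_zero: "\<zero>\<^bsub>Lam q\<^esub> = E q 0 0 0 0 0 0"
  unfolding Lam_ops cls_E by (simp add: k_defs)

lemma E_one: "\<one>\<^bsub>Lam q\<^esub> = E q 1 0 0 0 0 0"
  unfolding Lam_ops cls_E by (simp add: k_defs lookup_one when_def zero_word_def)

lemma cls_const: "cls q (const c) = E q c 0 0 0 0 0"
  unfolding cls_E const_word by (simp add: k_defs lookup_single when_def)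

lemma lin_E: "lin q a b c = E q 0 a b c 0 0"
  unfolding lin_def cls_E var_def const_word by (simp add: k_defs single_word_mult lookup_add lookup_single when_def)

section \<open>Submodules of free modules over the algebra\<close>

text \<open>Linear algebra over the base field: coordinates on a ring in which scalars act make
  submodules of free modules finitely generated.\<close>

lemma noethI:
  fixes R :: "'a ring" and co :: "nat \<Rightarrow> 'a \<Rightarrow> 'k::field" and s :: "'k \<Rightarrow> 'a"
  assumes R: "ring R" and s: "\<And>t. s t \<in> carrier R"
    and add: "\<And>i a b. a \<in> carrier R \<Longrightarrow> b \<in> carrier R \<Longrightarrow> co i (a \<oplus>\<^bsub>R\<^esub> b) = co i a + co i b"
    and mult: "\<And>i t a. a \<in> carrier R \<Longrightarrow> co i (s t \<otimes>\<^bsub>R\<^esub> a) = t * co i a"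
    and inj: "\<And>a. a \<in> carrier R \<Longrightarrow> (\<And>i. i < d \<Longrightarrow> co i a = 0) \<Longrightarrow> a = \<zero>\<^bsub>R\<^esub>"
  shows "noeth R"
  unfolding noeth_def
proof (intro allI impI)
  fix n N assume N: "submodule N R (free_module R n)"
  let ?F = "free_module R n"
  note Fm = free_left_module[OF R, of n]
  interpret F: left_module R ?F by (rule Fm)
  note S = F.submodD[OF N]
  have fc: "u j \<in> carrier R" if "u \<in> carrier ?F" "j < n" for u j using that by (auto simp: PiE_iff)
  define cf where "cf k u = co (k mod d) (u (k div d))" for k and u :: "nat \<Rightarrow> 'a"
  have ladd: "cf k (u \<oplus>\<^bsub>?F\<^esub> v) = cf k u + cf k v" if "u \<in> carrier ?F" "v \<in> carrier ?F" "k < n * d" for k u v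
    using that fc[of u "k div d"] fc[of v "k div d"] by (simp add: cf_def add less_mult_imp_div_less)
  have lmult: "cf k (s t \<odot>\<^bsub>?F\<^esub> u) = t * cf k u" if "u \<in> carrier ?F" "k < n * d" for k u t
    using that fc[of u "k div d"] by (simp add: cf_def mult less_mult_imp_div_less)
  have linj: "u = \<zero>\<^bsub>?F\<^esub>" if u: "u \<in> carrier ?F" and z: "\<And>k. k < n * d \<Longrightarrow> cf k u = 0" for u
  proof (rule extensionalityI[of _ "{..<n}"])
    fix j assume j: "j \<in> {..<n}"
    have "co i (u j) = 0" if i: "i < d" for i
    proof -
      have "j * d + i < n * d" using i j
        using mult_le_mono1[of "Suc j" n d] by simp
      from z[OF this] show ?thesis using i by (simp add: cf_def)
    qed
    then show "u j = \<zero>\<^bsub>?F\<^esub> j" using inj[OF fc[OF u]] j by simp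
  qed (use u in \<open>auto simp: PiE_iff\<close>)
  \<comment> \<open>Gaussian elimination, one functional at a time.\<close>
  have "\<exists>m v. (\<forall>j<m. v j \<in> N) \<and> (\<forall>u\<in>N. (\<forall>i<k. cf i u = 0) \<longrightarrow>
      (\<exists>r. (\<forall>j<m. r j \<in> carrier R) \<and> u = lsum ?F m (\<lambda>j. r j \<odot>\<^bsub>?F\<^esub> v j)))" if "k \<le> n * d" for k
    using that
  proof (induction k rule: inc_induct)
    case base
    have "\<exists>r. (\<forall>j<0::nat. r j \<in> carrier R) \<and> u = lsum ?F 0 (\<lambda>j. r j \<odot>\<^bsub>?F\<^esub> (\<lambda>_. \<zero>\<^bsub>?F\<^esub>) j)"
      if "u \<in> N" "\<forall>i<n * d. cf i u = 0" for u
      using linj[of u] that S(1) by (auto simp: subset_iff simp del: free_simps)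
    then show ?case by (intro exI[of _ 0] exI[of _ "\<lambda>_. \<zero>\<^bsub>?F\<^esub>"]) auto
  next
    case (step k)
    then obtain m v where v: "\<And>j. j < m \<Longrightarrow> v j \<in> N"
      and sp: "\<And>u. u \<in> N \<Longrightarrow> \<forall>i<Suc k. cf i u = 0 \<Longrightarrow>
         \<exists>r. (\<forall>j<m. r j \<in> carrier R) \<and> u = lsum ?F m (\<lambda>j. r j \<odot>\<^bsub>?F\<^esub> v j)"
      by blast
    show ?case
    proof (cases "\<exists>w\<in>N. (\<forall>i<k. cf i w = 0) \<and> cf k w \<noteq> 0")
      case False
      have "\<forall>i<Suc k. cf i u = 0" if "u \<in> N" "\<forall>i<k. cf i u = 0" for u
        using False that less_Suc_eq by auto
      then have "\<forall>u\<in>N. (\<forall>i<k. cf i u = 0) \<longrightarrow>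
        (\<exists>r. (\<forall>j<m. r j \<in> carrier R) \<and> u = lsum ?F m (\<lambda>j. r j \<odot>\<^bsub>?F\<^esub> v j))"
        using sp by blast
      then show ?thesis using v by blast
    next
      case True
      then obtain w where w: "w \<in> N" "\<forall>i<k. cf i w = 0" "cf k w \<noteq> 0" by blast
      let ?v = "v(m := w)"
      have "\<exists>r. (\<forall>j<Suc m. r j \<in> carrier R) \<and> u = lsum ?F (Suc m) (\<lambda>j. r j \<odot>\<^bsub>?F\<^esub> ?v j)"
        if u: "u \<in> N" "\<forall>i<k. cf i u = 0" for u
      proof -
        let ?t = "cf k u / cf k w"
        let ?u = "u \<oplus>\<^bsub>?F\<^esub> s (- ?t) \<odot>\<^bsub>?F\<^esub> w"
        have c: "u \<in> carrier ?F" "w \<in> carrier ?F" "s (- ?t) \<odot>\<^bsub>?F\<^esub> w \<in> carrier ?F" "s ?t \<odot>\<^bsub>?F\<^esub> w \<in> carrier ?F"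
          using S(1) u(1) w(1) F.smult_closed[OF s] by blast+
        have uN: "?u \<in> N" using S(3,4) u(1) w(1) s by blast
        have "\<forall>i<Suc k. cf i ?u = 0"
        proof (intro allI impI)
          fix i assume i: "i < Suc k"
          then have ik: "i < n * d" using step by simp
          have "cf i ?u = cf i u + (- ?t) * cf i w"
            using ladd[OF c(1,3) ik] lmult[OF c(2) ik, of "- ?t"] by simp
          then show "cf i ?u = 0" using u(2) w(2,3) i by (cases "i = k") auto
        qed
        from sp[OF uN this] obtain r where r: "\<forall>j<m. r j \<in> carrier R" "?u = lsum ?F m (\<lambda>j. r j \<odot>\<^bsub>?F\<^esub> v j)"
          by blast
        let ?r = "r(m := s ?t)"
        have "s ?t \<odot>\<^bsub>?F\<^esub> w \<oplus>\<^bsub>?F\<^esub> s (- ?t) \<odot>\<^bsub>?F\<^esub> w = \<zero>\<^bsub>?F\<^esub>"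
        proof (rule linj)
          show "s ?t \<odot>\<^bsub>?F\<^esub> w \<oplus>\<^bsub>?F\<^esub> s (- ?t) \<odot>\<^bsub>?F\<^esub> w \<in> carrier ?F" using c by blast
          show "cf i (s ?t \<odot>\<^bsub>?F\<^esub> w \<oplus>\<^bsub>?F\<^esub> s (- ?t) \<odot>\<^bsub>?F\<^esub> w) = 0" if "i < n * d" for i
            unfolding ladd[OF c(4,3) that] lmult[OF c(2) that] by simp
        qed
        then have "?u \<oplus>\<^bsub>?F\<^esub> s ?t \<odot>\<^bsub>?F\<^esub> w = u"
          using c by (metis F.M.a_assoc F.M.a_comm F.M.r_zero)
        moreover have "lsum ?F m (\<lambda>j. ?r j \<odot>\<^bsub>?F\<^esub> ?v j) = lsum ?F m (\<lambda>j. r j \<odot>\<^bsub>?F\<^esub> v j)"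
          by (rule lsum_cong) simp
        ultimately have "u = lsum ?F (Suc m) (\<lambda>j. ?r j \<odot>\<^bsub>?F\<^esub> ?v j)"
          using r(2) by (simp del: free_simps)
        moreover have "\<forall>j<Suc m. ?r j \<in> carrier R" using r(1) s less_Suc_eq by auto
        ultimately show ?thesis by blast
      qed
      moreover have "\<forall>j<Suc m. ?v j \<in> N" using v w(1) less_Suc_eq by auto
      ultimately show ?thesis by blast
    qed
  qed
  from this[of 0] obtain m v where v: "\<And>j. j < m \<Longrightarrow> v j \<in> N"
    and sp: "\<And>u. u \<in> N \<Longrightarrow> \<exists>r. (\<forall>j<m. r j \<in> carrier R) \<and> u = lsum ?F m (\<lambda>j. r j \<odot>\<^bsub>?F\<^esub> v j)"
    by (simp del: free_simps) blast
  have vF: "v j \<in> carrier ?F" if "j < m" for j using v[OF that] S(1) by blast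
  let ?g = "\<lambda>r. lsum ?F m (\<lambda>j. r j \<odot>\<^bsub>?F\<^esub> v j)"
  have g: "linmap R (free_module R m) ?F ?g" by (rule linmap_lin_comb[OF Fm vF linmap_coord])
  interpret NN: left_module R "sub ?F N" by (rule F.left_module_sub[OF N])
  have "?g ` carrier (free_module R m) = N"
  proof
    show "?g ` carrier (free_module R m) \<subseteq> N"
    proof clarify
      fix r assume r: "r \<in> carrier (free_module R m)"
      have "lsum ?F k (\<lambda>j. r j \<odot>\<^bsub>?F\<^esub> v j) \<in> N" if "k \<le> m" for k
        using that
      proof (induction k)
        case 0 then show ?case using S(2) by (simp del: free_simps)
      next
        case (Suc k)
        then have "r k \<in> carrier R" "v k \<in> N" using r v by (auto simp: PiE_iff)
        then show ?case using Suc S(3,4) by (simp del: free_simps)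
      qed
      then show "?g r \<in> N" by blast
    qed
    show "N \<subseteq> ?g ` carrier (free_module R m)"
    proof
      fix u assume "u \<in> N"
      from sp[OF this] obtain r where r: "\<And>j. j < m \<Longrightarrow> r j \<in> carrier R" "u = ?g r" by blast
      have "?g (restrict r {..<m}) = ?g r" by (rule lsum_cong) simp
      moreover have "restrict r {..<m} \<in> carrier (free_module R m)" using r(1) by simp
      ultimately show "u \<in> ?g ` carrier (free_module R m)"
        unfolding r(2) by (intro image_eqI[where x = "restrict r {..<m}"]) (simp_all del: free_simps)
    qed
  qed
  then show "\<exists>m g. linmap R (free_module R m) (free_module R n) g \<and> g ` carrier (free_module R m) = N"
    using g by blast
qed

definition Ec :: "'k::field \<Rightarrow> nat \<Rightarrow> 'k lam \<Rightarrow> 'k" where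
  "Ec q i r = (THE t. \<exists>a b c d e f. r = E q a b c d e f \<and> t = [a, b, c, d, e, f] ! i)"

lemma Ec_E: "Ec q i (E q a b c d e f) = [a, b, c, d, e, f] ! i"
  unfolding Ec_def by (rule the_equality) auto

lemma Lam_noeth: "noeth (Lam q)" "noeth (op_ring (Lam q))"
proof -
  have add: "Ec q (i mod 6) (a \<oplus>\<^bsub>Lam q\<^esub> b) = Ec q (i mod 6) a + Ec q (i mod 6) b"
    if ab: "a \<in> carrier (Lam q)" "b \<in> carrier (Lam q)" for i a b
  proof -
    have "i mod 6 < 6" by simp
    then have "i mod 6 \<in> {0, 1, 2, 3, 4, 5}" by auto
    moreover obtain a0 a1 a2 a3 a4 a5 where "a = E q a0 a1 a2 a3 a4 a5" by (rule E_cases[OF ab(1)])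
    moreover obtain b0 b1 b2 b3 b4 b5 where "b = E q b0 b1 b2 b3 b4 b5" by (rule E_cases[OF ab(2)])
    ultimately show ?thesis by (auto simp: Ec_E)
  qed
  have mult: "Ec q (i mod 6) (E q t 0 0 0 0 0 \<otimes>\<^bsub>Lam q\<^esub> a) = t * Ec q (i mod 6) a"
    "Ec q (i mod 6) (a \<otimes>\<^bsub>Lam q\<^esub> E q t 0 0 0 0 0) = t * Ec q (i mod 6) a"
    if a: "a \<in> carrier (Lam q)" for i a t
  proof -
    have "i mod 6 < 6" by simp
    then have "i mod 6 \<in> {0, 1, 2, 3, 4, 5}" by auto
    moreover obtain a0 a1 a2 a3 a4 a5 where "a = E q a0 a1 a2 a3 a4 a5" by (rule E_cases[OF a])
    ultimately show "Ec q (i mod 6) (E q t 0 0 0 0 0 \<otimes>\<^bsub>Lam q\<^esub> a) = t * Ec q (i mod 6) a"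
      "Ec q (i mod 6) (a \<otimes>\<^bsub>Lam q\<^esub> E q t 0 0 0 0 0) = t * Ec q (i mod 6) a"
      by (auto simp: Ec_E)
  qed
  have inj: "a = \<zero>\<^bsub>Lam q\<^esub>" if a: "a \<in> carrier (Lam q)" and z: "\<And>i. i < 6 \<Longrightarrow> Ec q (i mod 6) a = 0" for a
  proof -
    obtain a0 b c d e f where "a = E q a0 b c d e f" by (rule E_cases[OF a])
    then show ?thesis using z[of 0] z[of 1] z[of 2] z[of 3] z[of 4] z[of 5] by (simp add: Ec_E E_zero)
  qed
  show "noeth (Lam q)"
    by (rule noethI[OF Lam_ring, where co = "\<lambda>i. Ec q (i mod 6)" and s = "\<lambda>t. E q t 0 0 0 0 0" and d = 6])
      (use add mult inj in simp_all)
  show "noeth (op_ring (Lam q))"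
    by (rule noethI[OF op_ring_ring[OF Lam_ring], where co = "\<lambda>i. Ec q (i mod 6)" and s = "\<lambda>t. E q t 0 0 0 0 0" and d = 6])
      (use add mult inj in simp_all)
qed

section \<open>Cyclic modules over the algebra\<close>

lemma cyc_principal:
  assumes R: "ring R" and l: "l \<in> carrier R"
  shows "cyc R (sub (regular_module R) ((\<lambda>r. r \<otimes>\<^bsub>R\<^esub> l) ` carrier R)) l {r \<in> carrier R. r \<otimes>\<^bsub>R\<^esub> l = \<zero>\<^bsub>R\<^esub>}"
proof -
  interpret ring R by fact
  note RR = regular_left_module[OF R]
  have "linmap R (regular_module R) (regular_module R) (\<lambda>r. r \<otimes>\<^bsub>R\<^esub> l)"
    using linmap_smult_vec[OF RR] l by simp
  from left_module.left_module_sub[OF RR image_submodule[OF RR RR this]]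
  have "left_module R (sub (regular_module R) ((\<lambda>r. r \<otimes>\<^bsub>R\<^esub> l) ` carrier R))" by simp
  moreover have "l \<in> (\<lambda>r. r \<otimes>\<^bsub>R\<^esub> l) ` carrier R" using l by (intro image_eqI[of _ _ "\<one>\<^bsub>R\<^esub>"]) auto
  ultimately show ?thesis unfolding cyc_def by auto
qed

lemma cyc_principalI:
  assumes R: "ring R" and l: "l \<in> carrier R" and "U = (\<lambda>r. r \<otimes>\<^bsub>R\<^esub> l) ` carrier R"
    and "A = {r \<in> carrier R. r \<otimes>\<^bsub>R\<^esub> l = \<zero>\<^bsub>R\<^esub>}"
  shows "cyc R (sub (regular_module R) U) l A"
  using cyc_principal[OF R l] assms(3,4) by simp

text \<open>The radical, the annihilators of \<open>z\<close> and of \<open>x - y\<close>, and the subspaces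
  \<open>k (ax + by + cz) + soc\<close>; the last are left and right ideals at once.\<close>

definition Us :: "'k::field \<Rightarrow> 'k \<Rightarrow> 'k \<Rightarrow> 'k \<Rightarrow> 'k lam set" where
  "Us q a b c = {r. \<exists>t u v. r = E q 0 (t * a) (t * b) (t * c) u v}"

definition Vs :: "'k::field \<Rightarrow> 'k \<Rightarrow> 'k \<Rightarrow> 'k \<Rightarrow> 'k lam set" where
  "Vs q a b c = {r. \<exists>r1 r2 r3 u v. r = E q 0 r1 r2 r3 u v \<and> a * r1 + b * r2 + c * r3 = 0}"

lemma E_Us: "E q r0 r1 r2 r3 u v \<in> Us q a b c \<longleftrightarrow> r0 = 0 \<and> (\<exists>t. r1 = t * a \<and> r2 = t * b \<and> r3 = t * c)"
  unfolding Us_def by auto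

lemma E_Vs: "E q r0 r1 r2 r3 u v \<in> Vs q a b c \<longleftrightarrow> r0 = 0 \<and> a * r1 + b * r2 + c * r3 = 0"
  unfolding Vs_def by auto

lemma E_Us1: "E q r0 r1 r2 r3 u v \<in> Us q 1 b c \<longleftrightarrow> r0 = 0 \<and> r2 = r1 * b \<and> r3 = r1 * c"
  unfolding E_Us by auto

lemma right_syzygy_arith:
  fixes q :: "'k::field"
  assumes "q \<noteq> 0"
  shows "b * w1 = q * w2 \<and> w3 + c * w1 + c * w2 = 0 \<longleftrightarrow> w2 = w1 * (b / q) \<and> w3 = w1 * (- (c * (1 + b / q)))"
proof -
  have 1: "b * w1 = q * w2 \<longleftrightarrow> w2 = w1 * (b / q)" using assms by (auto simp: field_simps)
  have 2: "w3 + c * w1 + c * w2 = 0 \<longleftrightarrow> w3 = w1 * (- (c * (1 + b / q)))" if "w2 = w1 * (b / q)"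
  proof -
    have "w3 + c * w1 + c * w2 = w3 - w1 * (- (c * (1 + b / q)))"
      by (simp add: that algebra_simps)
    then show ?thesis by (metis eq_iff_diff_eq_0)
  qed
  show ?thesis using 1 2 by blast
qed

lemma left_syzygy_arith:
  fixes q :: "'k::field"
  assumes "1 + b \<noteq> 0"
  shows "w2 = q * w1 * b \<and> w1 * c + w3 * (1 + b) = 0 \<longleftrightarrow> w2 = w1 * (q * b) \<and> w3 = w1 * (- c / (1 + b))"
proof -
  have "w1 * c + w3 * (1 + b) = 0 \<longleftrightarrow> w3 * (1 + b) = - (w1 * c)"
    by (metis add.commute eq_neg_iff_add_eq_0)
  also have "\<dots> \<longleftrightarrow> w3 = - (w1 * c) / (1 + b)" using assms nonzero_eq_divide_eq[of "1 + b" w3 "- (w1 * c)"] by metis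
  also have "- (w1 * c) / (1 + b) = w1 * (- c / (1 + b))" by simp
  finally show ?thesis by (metis mult.commute mult.left_commute)
qed

lemma one_add_neq: "b \<noteq> -1 \<Longrightarrow> 1 + b \<noteq> (0 :: 'k::field)"
  by (metis add.commute eq_neg_iff_add_eq_0)

lemma UsE:
  assumes "r \<in> Us q a b c" obtains t u v where "r = E q 0 (t * a) (t * b) (t * c) u v"
  using assms unfolding Us_def by blast

lemma ball_Us: "(\<forall>r\<in>Us q a b c. P r) \<longleftrightarrow> (\<forall>t u v. P (E q 0 (t * a) (t * b) (t * c) u v))"
  unfolding Us_def by blast

lemma Us_carrier: "Us q a b c \<subseteq> carrier (Lam q)" "Vs q a b c \<subseteq> carrier (Lam q)"
  unfolding Us_def Vs_def by auto

lemma Lam_set_eqI: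
  assumes "A \<subseteq> carrier (Lam q)" "B \<subseteq> carrier (Lam q)"
    and "\<And>a b c d e f. E q a b c d e f \<in> A \<longleftrightarrow> E q a b c d e f \<in> B"
  shows "A = B"
proof -
  have "r \<in> A \<longleftrightarrow> r \<in> B" if "r \<in> carrier (Lam q)" for r
    by (rule E_cases[OF that]) (simp add: assms(3))
  then show ?thesis using assms(1,2) by blast
qed

lemma Lam_bex: "(\<exists>r\<in>carrier (Lam q). P r) \<longleftrightarrow> (\<exists>a b c d e f. P (E q a b c d e f))"
  by (metis E_cases E_closed)

lemma Us_scale: "a \<noteq> 0 \<Longrightarrow> Us q a b c = Us q 1 (b / a) (c / a)"
  by (rule Lam_set_eqI[OF Us_carrier(1) Us_carrier(1)], unfold E_Us)
    (safe; (rule_tac x = "t * a" in exI; simp; fail | rule_tac x = "t / a" in exI; simp; fail | simp))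

lemma Us_scale2: "b \<noteq> 0 \<Longrightarrow> Us q 0 b 0 = Us q 0 1 0" "c \<noteq> 0 \<Longrightarrow> Us q 0 0 c = Us q 0 0 1"
  by (rule Lam_set_eqI[OF Us_carrier(1) Us_carrier(1)]; unfold E_Us;
      safe; (rule_tac x = "t * b" in exI; simp; fail | rule_tac x = "t / b" in exI; simp; fail | simp))
    (rule Lam_set_eqI[OF Us_carrier(1) Us_carrier(1)]; unfold E_Us;
      safe; (rule_tac x = "t * c" in exI; simp; fail | rule_tac x = "t / c" in exI; simp; fail | simp))

lemmas Lreg = regular_left_module[OF Lam_ring] and Lop = op_ring_ring[OF Lam_ring]
lemmas LregS = regular_left_module[OF Lop]

lemma Us_submodule: "submodule (Us q a b c) (Lam q) (regular_module (Lam q))"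
proof (rule left_module.submodI[OF Lreg])
  show "\<zero>\<^bsub>regular_module (Lam q)\<^esub> \<in> Us q a b c" by (simp add: E_zero E_Us exI[of _ 0])
  fix x y assume "x \<in> Us q a b c" "y \<in> Us q a b c"
  then show "x \<oplus>\<^bsub>regular_module (Lam q)\<^esub> y \<in> Us q a b c"
    by (auto elim!: UsE simp: E_Us distrib_right[symmetric])
next
  fix r x assume r: "r \<in> carrier (Lam q)" and x: "x \<in> Us q a b c"
  obtain r0 r1 r2 r3 r4 r5 where "r = E q r0 r1 r2 r3 r4 r5" by (rule E_cases[OF r])
  then show "r \<odot>\<^bsub>regular_module (Lam q)\<^esub> x \<in> Us q a b c"
    using x by (auto elim!: UsE simp: E_Us mult.assoc[symmetric])
qed (use Us_carrier(1)[of q a b c] in simp)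

text \<open>The dual of \<open>M(1, b, c)\<close>, as a right ideal, again belongs to the family, with \<open>b\<close> divided by \<open>q\<close>.\<close>

lemma rann_Us:
  assumes "q \<noteq> 0"
  shows "rann (Lam q) (Us q 1 b c) = Us q 1 (b / q) (- (c * (1 + b / q)))"
proof (rule Lam_set_eqI[OF _ Us_carrier(1)])
  show "rann (Lam q) (Us q 1 b c) \<subseteq> carrier (Lam q)" by (auto simp: rann_def)
  fix w0 w1 w2 w3 w4 w5
  have "E q w0 w1 w2 w3 w4 w5 \<in> rann (Lam q) (Us q 1 b c) \<longleftrightarrow>
    (\<forall>t u v. E q 0 t (t * b) (t * c) u v \<otimes>\<^bsub>Lam q\<^esub> E q w0 w1 w2 w3 w4 w5 = \<zero>\<^bsub>Lam q\<^esub>)"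
    unfolding rann_def mem_Collect_eq ball_Us by simp
  also have "\<dots> \<longleftrightarrow> w0 = 0 \<and> b * w1 = q * w2 \<and> w3 + c * w1 + c * w2 = 0" (is "?A \<longleftrightarrow> ?B")
  proof
    assume A: ?A
    show ?B using A[rule_format, of 1 0 0] by (auto simp: E_zero)
  next
    assume B: ?B
    show ?A
    proof (intro allI)
      fix t u v
      have "t * b * w1 - q * t * w2 = t * (b * w1 - q * w2)" "t * w3 + t * c * w1 + t * c * w2 = t * (w3 + c * w1 + c * w2)"
        by (simp_all add: algebra_simps)
      then show "E q 0 t (t * b) (t * c) u v \<otimes>\<^bsub>Lam q\<^esub> E q w0 w1 w2 w3 w4 w5 = \<zero>\<^bsub>Lam q\<^esub>"
        using B by (simp add: E_zero)
    qed
  qed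
  also have "\<dots> \<longleftrightarrow> E q w0 w1 w2 w3 w4 w5 \<in> Us q 1 (b / q) (- (c * (1 + b / q)))"
    unfolding E_Us1 right_syzygy_arith[OF assms] ..
  finally show "E q w0 w1 w2 w3 w4 w5 \<in> rann (Lam q) (Us q 1 b c) \<longleftrightarrow>
    E q w0 w1 w2 w3 w4 w5 \<in> Us q 1 (b / q) (- (c * (1 + b / q)))" .
qed

lemma lann_Us:
  assumes "b \<noteq> -1"
  shows "{r \<in> carrier (Lam q). \<forall>w\<in>Us q 1 b c. r \<otimes>\<^bsub>Lam q\<^esub> w = \<zero>\<^bsub>Lam q\<^esub>} = Us q 1 (q * b) (- c / (1 + b))"
    (is "?L = _")
proof (rule Lam_set_eqI[OF _ Us_carrier(1)])
  fix w0 w1 w2 w3 w4 w5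
  have "E q w0 w1 w2 w3 w4 w5 \<in> ?L \<longleftrightarrow>
    (\<forall>t u v. E q w0 w1 w2 w3 w4 w5 \<otimes>\<^bsub>Lam q\<^esub> E q 0 t (t * b) (t * c) u v = \<zero>\<^bsub>Lam q\<^esub>)"
    unfolding mem_Collect_eq ball_Us by simp
  also have "\<dots> \<longleftrightarrow> w0 = 0 \<and> w2 = q * w1 * b \<and> w1 * c + w3 * (1 + b) = 0" (is "?A \<longleftrightarrow> ?B")
  proof
    assume A: ?A
    show ?B using A[rule_format, of 1 0 0] by (auto simp: E_zero algebra_simps)
  next
    assume B: ?B
    show ?A
    proof (intro allI)
      fix t u v
      have "w2 * t - q * w1 * (t * b) = t * (w2 - q * w1 * b)"
        "w1 * (t * c) + w3 * t + w3 * (t * b) = t * (w1 * c + w3 * (1 + b))"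
        by (simp_all add: algebra_simps)
      then show "E q w0 w1 w2 w3 w4 w5 \<otimes>\<^bsub>Lam q\<^esub> E q 0 t (t * b) (t * c) u v = \<zero>\<^bsub>Lam q\<^esub>"
        using B by (simp add: E_zero)
    qed
  qed
  also have "\<dots> \<longleftrightarrow> E q w0 w1 w2 w3 w4 w5 \<in> Us q 1 (q * b) (- c / (1 + b))"
    unfolding E_Us1 left_syzygy_arith[OF one_add_neq[OF assms]] ..
  finally show "E q w0 w1 w2 w3 w4 w5 \<in> ?L \<longleftrightarrow> E q w0 w1 w2 w3 w4 w5 \<in> Us q 1 (q * b) (- c / (1 + b))" .
qed auto

text \<open>On the right the syzygies move in the opposite direction, \<open>b\<close> being divided by \<open>q\<close>.\<close>

lemma cyc_Us_op:
  assumes "q \<noteq> 0"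
  shows "cyc (op_ring (Lam q)) (sub (regular_module (op_ring (Lam q))) (Us q 1 b c)) (E q 0 1 b c 0 0)
    (Us q 1 (b / q) (- (c * (1 + b / q))))"
proof (rule cyc_principalI[OF Lop])
  show "Us q 1 b c = (\<lambda>r. r \<otimes>\<^bsub>op_ring (Lam q)\<^esub> E q 0 1 b c 0 0) ` carrier (op_ring (Lam q))"
  proof
    show "Us q 1 b c \<subseteq> (\<lambda>r. r \<otimes>\<^bsub>op_ring (Lam q)\<^esub> E q 0 1 b c 0 0) ` carrier (op_ring (Lam q))"
    proof
      fix r assume "r \<in> Us q 1 b c"
      then obtain t u v where r: "r = E q 0 (t * 1) (t * b) (t * c) u v" by (rule UsE)
      show "r \<in> (\<lambda>r. r \<otimes>\<^bsub>op_ring (Lam q)\<^esub> E q 0 1 b c 0 0) ` carrier (op_ring (Lam q))"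
        by (rule image_eqI[where x = "E q t 0 (- u / q) (v + c * u / q) 0 0"])
          (use assms in \<open>simp_all add: r field_simps\<close>)
    qed
    show "(\<lambda>r. r \<otimes>\<^bsub>op_ring (Lam q)\<^esub> E q 0 1 b c 0 0) ` carrier (op_ring (Lam q)) \<subseteq> Us q 1 b c"
      by (auto elim!: E_cases simp: E_Us)
  qed
  show "Us q 1 (b / q) (- (c * (1 + b / q))) =
    {r \<in> carrier (op_ring (Lam q)). r \<otimes>\<^bsub>op_ring (Lam q)\<^esub> E q 0 1 b c 0 0 = \<zero>\<^bsub>op_ring (Lam q)\<^esub>}"
  proof (rule Lam_set_eqI[OF Us_carrier(1)])
    fix w0 w1 w2 w3 w4 w5
    show "E q w0 w1 w2 w3 w4 w5 \<in> Us q 1 (b / q) (- (c * (1 + b / q))) \<longleftrightarrow> E q w0 w1 w2 w3 w4 w5 \<in>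
      {r \<in> carrier (op_ring (Lam q)). r \<otimes>\<^bsub>op_ring (Lam q)\<^esub> E q 0 1 b c 0 0 = \<zero>\<^bsub>op_ring (Lam q)\<^esub>}"
      unfolding E_Us1 right_syzygy_arith[OF assms, symmetric] by (auto simp: E_zero)
  qed auto
qed simp

text \<open>The syzygy of \<open>M(1, b, c)\<close> is generated by \<open>x + by + cz\<close> unless \<open>b = - 1\<close>, and then is
  \<open>M(1, qb, - c/(1 + b))\<close>; iterating multiplies \<open>b\<close> by powers of \<open>q\<close>.\<close>

lemma cyc_Us:
  assumes "b \<noteq> -1"
  shows "cyc (Lam q) (sub (regular_module (Lam q)) (Us q 1 b c)) (E q 0 1 b c 0 0) (Us q 1 (q * b) (- c / (1 + b)))"
proof (rule cyc_principalI[OF Lam_ring])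
  note b = one_add_neq[OF assms]
  show "Us q 1 b c = (\<lambda>r. r \<otimes>\<^bsub>Lam q\<^esub> E q 0 1 b c 0 0) ` carrier (Lam q)"
  proof
    show "Us q 1 b c \<subseteq> (\<lambda>r. r \<otimes>\<^bsub>Lam q\<^esub> E q 0 1 b c 0 0) ` carrier (Lam q)"
    proof
      fix r assume "r \<in> Us q 1 b c"
      then obtain t u v where r: "r = E q 0 (t * 1) (t * b) (t * c) u v" by (rule UsE)
      show "r \<in> (\<lambda>r. r \<otimes>\<^bsub>Lam q\<^esub> E q 0 1 b c 0 0) ` carrier (Lam q)"
      proof -
        define s where "s = v / (1 + b)"
        then have "v = s + s * b" using b by (simp add: eq_divide_eq distrib_left)
        then show ?thesis by (intro image_eqI[where x = "E q t 0 u s 0 0"]) (simp_all add: r)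
      qed
    qed
    show "(\<lambda>r. r \<otimes>\<^bsub>Lam q\<^esub> E q 0 1 b c 0 0) ` carrier (Lam q) \<subseteq> Us q 1 b c"
      by (auto elim!: E_cases simp: E_Us)
  qed
  show "Us q 1 (q * b) (- c / (1 + b)) = {r \<in> carrier (Lam q). r \<otimes>\<^bsub>Lam q\<^esub> E q 0 1 b c 0 0 = \<zero>\<^bsub>Lam q\<^esub>}"
  proof (rule Lam_set_eqI[OF Us_carrier(1)])
    fix w0 w1 w2 w3 w4 w5
    show "E q w0 w1 w2 w3 w4 w5 \<in> Us q 1 (q * b) (- c / (1 + b)) \<longleftrightarrow>
       E q w0 w1 w2 w3 w4 w5 \<in> {r \<in> carrier (Lam q). r \<otimes>\<^bsub>Lam q\<^esub> E q 0 1 b c 0 0 = \<zero>\<^bsub>Lam q\<^esub>}"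
      unfolding E_Us1 left_syzygy_arith[OF b, symmetric] by (auto simp: E_zero algebra_simps)
  qed auto
qed simp

section \<open>The modules of the statement\<close>

lemma submodule_line:
  assumes "t = E q 0 0 0 0 u v"
  shows "submodule ((\<lambda>r. r \<otimes>\<^bsub>Lam q\<^esub> t) ` carrier (Lam q)) (Lam q) (regular_module (Lam q))"
    and "(\<lambda>r. r \<otimes>\<^bsub>Lam q\<^esub> t) ` carrier (Lam q) = {E q 0 0 0 0 (s * u) (s * v) | s. True}"
proof -
  have "linmap (Lam q) (regular_module (Lam q)) (regular_module (Lam q)) (\<lambda>r. r \<otimes>\<^bsub>Lam q\<^esub> t)"
    using linmap_smult_vec[OF Lreg, of t q] assms by simp
  from image_submodule[OF Lreg Lreg this]
  show "submodule ((\<lambda>r. r \<otimes>\<^bsub>Lam q\<^esub> t) ` carrier (Lam q)) (Lam q) (regular_module (Lam q))" by simp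
  show "(\<lambda>r. r \<otimes>\<^bsub>Lam q\<^esub> t) ` carrier (Lam q) = {E q 0 0 0 0 (s * u) (s * v) | s. True}"
  proof
    show "(\<lambda>r. r \<otimes>\<^bsub>Lam q\<^esub> t) ` carrier (Lam q) \<subseteq> {E q 0 0 0 0 (s * u) (s * v) | s. True}"
      using assms by (auto elim!: E_cases)
    show "{E q 0 0 0 0 (s * u) (s * v) | s. True} \<subseteq> (\<lambda>r. r \<otimes>\<^bsub>Lam q\<^esub> t) ` carrier (Lam q)"
    proof clarify
      fix s show "E q 0 0 0 0 (s * u) (s * v) \<in> (\<lambda>r. r \<otimes>\<^bsub>Lam q\<^esub> t) ` carrier (Lam q)"
        by (rule image_eqI[where x = "E q s 0 0 0 0 0"]) (use assms in simp_all)
    qed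
  qed
qed

lemma socle_Lam:
  assumes q: "q \<noteq> 0"
  shows "socle (Lam q) (regular_module (Lam q)) = {E q 0 0 0 0 u v | u v. True}" (is "_ = ?S")
proof
  let ?R = "regular_module (Lam q)"
  interpret R: left_module "Lam q" ?R by (rule Lreg)
  have S: "?S = Us q 0 0 0" unfolding Us_def by auto
  have line: "submodule L (Lam q) ?R" "t \<in> L" "L \<subseteq> ?S" "L = {E q 0 0 0 0 (s * u) (s * v) | s. True}"
    if "t = E q 0 0 0 0 u v" "L = (\<lambda>r. r \<otimes>\<^bsub>Lam q\<^esub> t) ` carrier (Lam q)" for t u v L
  proof -
    show "submodule L (Lam q) ?R" "L = {E q 0 0 0 0 (s * u) (s * v) | s. True}"
      using submodule_line[OF that(1)] that(2) by simp_all
    then show "L \<subseteq> ?S" by auto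
    show "t \<in> L" using that(1) \<open>L = {E q 0 0 0 0 (s * u) (s * v) | s. True}\<close> by (auto intro!: exI[of _ 1])
  qed
  show "socle (Lam q) ?R \<subseteq> ?S" unfolding socle_def
  proof (rule Inter_lower, safe)
    show "submodule ?S (Lam q) ?R" unfolding S by (rule Us_submodule)
    fix N r assume N: "submodule N (Lam q) ?R" "simple_module (Lam q) (sub ?R N)" and r: "r \<in> N"
    note ND = R.submodD[OF N(1)]
    obtain a b c d e f where rE: "r = E q a b c d e f" using r ND(1) E_cases by (metis regular_simps(1) subsetD)
    show "\<exists>u v. r = E q 0 0 0 0 u v \<and> True"
    proof (rule ccontr)
      assume "\<nexists>u v. r = E q 0 0 0 0 u v \<and> True"
      then have nz: "a \<noteq> 0 \<or> b \<noteq> 0 \<or> c \<noteq> 0 \<or> d \<noteq> 0" using rE by auto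
      have mem: "s \<otimes>\<^bsub>Lam q\<^esub> r \<in> N" if "s \<in> carrier (Lam q)" for s using ND(4)[OF that r] by simp
      have "\<exists>u v. E q 0 0 0 0 u v \<in> N \<and> (u \<noteq> 0 \<or> v \<noteq> 0)"
      proof (cases "a = 0")
        case False
        then show ?thesis using mem[of "E q 0 0 0 0 1 0"] rE by auto
      next
        case True
        have "E q 0 0 0 0 (- (q * c)) d \<in> N" "E q 0 0 0 0 b 0 \<in> N"
          using mem[of "E q 0 1 0 0 0 0"] mem[of "E q 0 0 1 0 0 0"] rE True by simp_all
        moreover have "- (q * c) \<noteq> 0 \<or> d \<noteq> 0 \<or> b \<noteq> 0" using q nz True by auto
        ultimately show ?thesis by blast
      qed
      then obtain u v where t: "E q 0 0 0 0 u v \<in> N" "u \<noteq> 0 \<or> v \<noteq> 0" by blast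
      let ?t = "E q 0 0 0 0 u v"
      let ?L = "(\<lambda>r. r \<otimes>\<^bsub>Lam q\<^esub> ?t) ` carrier (Lam q)"
      note L = line[OF refl refl, of u v]
      have LN: "?L \<subseteq> N" using ND(4)[OF _ t(1)] by auto
      have "left_module (Lam q) (sub ?R N)" by (rule R.left_module_sub[OF N(1)])
      then interpret N: left_module "Lam q" "sub ?R N" .
      have "submodule ?L (Lam q) (sub ?R N)"
        by (rule N.submodI) (use LN R.submodD(2-4)[OF L(1)] in simp_all)
      then have "?L = {\<zero>\<^bsub>Lam q\<^esub>} \<or> ?L = N" using N(2) unfolding simple_module_def by auto
      moreover have "?t \<noteq> \<zero>\<^bsub>Lam q\<^esub>" using t(2) by (simp add: E_zero)
      then have "?L \<noteq> {\<zero>\<^bsub>Lam q\<^esub>}" using L(2) by (metis singletonD)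
      ultimately have "r \<in> ?S" using L(3) r by auto
      then show False using nz rE by auto
    qed
  qed
  show "?S \<subseteq> socle (Lam q) ?R" unfolding socle_def
  proof (intro Inter_greatest, clarify)
    fix N u v assume N: "submodule N (Lam q) ?R"
      and si: "\<forall>S. submodule S (Lam q) ?R \<and> simple_module (Lam q) (sub ?R S) \<longrightarrow> S \<subseteq> N"
    let ?t = "E q 0 0 0 0 u v"
    let ?L = "(\<lambda>r. r \<otimes>\<^bsub>Lam q\<^esub> ?t) ` carrier (Lam q)"
    note L = line[OF refl refl, of u v]
    show "?t \<in> N"
    proof (cases "u = 0 \<and> v = 0")
      case True then show ?thesis using R.submodD(2)[OF N] by (simp add: E_zero)
    next
      case False
      interpret L: left_module "Lam q" "sub ?R ?L" by (rule R.left_module_sub[OF L(1)])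
      have "simple_module (Lam q) (sub ?R ?L)" unfolding simple_module_def
      proof (intro conjI allI impI)
        have "?t \<noteq> \<zero>\<^bsub>Lam q\<^esub>" using False by (simp add: E_zero)
        then have "?L \<noteq> {\<zero>\<^bsub>Lam q\<^esub>}" using L(2) by (metis singletonD)
        then show "carrier (sub ?R ?L) \<noteq> {\<zero>\<^bsub>sub ?R ?L\<^esub>}" by simp
        fix A assume A: "submodule A (Lam q) (sub ?R ?L)"
        note AD = L.submodD[OF A]
        show "A = {\<zero>\<^bsub>sub ?R ?L\<^esub>} \<or> A = carrier (sub ?R ?L)"
        proof (cases "A \<subseteq> {\<zero>\<^bsub>Lam q\<^esub>}")
          case True then show ?thesis using AD(2) by auto
        next
          case False
          then obtain r where r: "r \<in> A" "r \<noteq> \<zero>\<^bsub>Lam q\<^esub>" by auto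
          then have "r \<in> ?L" using AD(1) by auto
          then obtain s where s: "r = E q 0 0 0 0 (s * u) (s * v)" unfolding L(4) by blast
          then have s0: "s \<noteq> 0" using r(2) by (auto simp: E_zero)
          have "?t \<in> A" using AD(4)[of "E q (1 / s) 0 0 0 0 0" r] r(1) s s0 by simp
          then have "?L \<subseteq> A" using AD(4)[of _ ?t] by auto
          then show ?thesis using AD(1) by auto
        qed
      qed
      then have "?L \<subseteq> N" using si L(1) by blast
      then show ?thesis using L(2) by blast
    qed
  qed
qed

lemma U_ideal_Us:
  assumes "q \<noteq> 0" shows "U_ideal q a b c = Us q a b c"
proof
  let ?P = "(\<lambda>r. r \<otimes>\<^bsub>Lam q\<^esub> E q 0 a b c 0 0) ` carrier (Lam q)"
  let ?S = "{E q 0 0 0 0 u v | u v. True}"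
  have P: "PIdl\<^bsub>Lam q\<^esub> (lin q a b c) = ?P"
    unfolding cgenideal_def lin_E by blast
  have U: "U_ideal q a b c = (\<Union>x\<in>?P. \<Union>y\<in>?S. {x \<oplus>\<^bsub>Lam q\<^esub> y})"
    unfolding U_ideal_def set_add_def' socle_Lam[OF assms] P ..
  show "U_ideal q a b c \<subseteq> Us q a b c" unfolding U by (auto elim!: E_cases simp: E_Us)
  show "Us q a b c \<subseteq> U_ideal q a b c"
  proof
    fix r assume "r \<in> Us q a b c"
    then obtain t u v where r: "r = E q 0 (t * a) (t * b) (t * c) u v" by (rule UsE)
    have "E q t 0 0 0 0 0 \<otimes>\<^bsub>Lam q\<^esub> E q 0 a b c 0 0 \<in> ?P" by (rule imageI) simp
    moreover have "E q 0 0 0 0 u v \<in> ?S" by blast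
    moreover have "r = E q t 0 0 0 0 0 \<otimes>\<^bsub>Lam q\<^esub> E q 0 a b c 0 0 \<oplus>\<^bsub>Lam q\<^esub> E q 0 0 0 0 u v" by (simp add: r)
    ultimately show "r \<in> U_ideal q a b c" unfolding U by (intro UN_I) (assumption | simp)+
  qed
qed

lemma isomorphic_M_mod_iff:
  assumes "q \<noteq> 0" "left_module (Lam q) M"
  shows "isomorphic (Lam q) M (M_mod q a b c) \<longleftrightarrow> (\<exists>m. cyc (Lam q) M m (Us q a b c))"
  using isomorphic_cyc_iff[OF assms(2) quotient_cyc[OF Lam_ring Us_submodule]]
  unfolding M_mod_def U_ideal_Us[OF assms(1)] .

lemma isomorphic_principal_iff:
  assumes "left_module (Lam q) M"
  shows "isomorphic (Lam q) M (principal_module q (lin q 1 (- 1) 0)) \<longleftrightarrow> (\<exists>m. cyc (Lam q) M m (Vs q q 1 0))"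
    and "isomorphic (Lam q) M (principal_module q (lin q 0 0 1)) \<longleftrightarrow> (\<exists>m. cyc (Lam q) M m (Vs q 1 0 0))"
proof -
  have PI: "PIdl\<^bsub>Lam q\<^esub> l = (\<lambda>r. r \<otimes>\<^bsub>Lam q\<^esub> l) ` carrier (Lam q)" for l
    unfolding cgenideal_def by blast
  have "cyc (Lam q) (principal_module q (lin q 1 (- 1) 0)) (lin q 1 (- 1) 0) (Vs q q 1 0)"
    unfolding principal_module_def PI
  proof (rule cyc_principalI[OF Lam_ring _ refl])
    show "Vs q q 1 0 = {r \<in> carrier (Lam q). r \<otimes>\<^bsub>Lam q\<^esub> lin q 1 (- 1) 0 = \<zero>\<^bsub>Lam q\<^esub>}"
      by (rule Lam_set_eqI[OF Us_carrier(2)]) (auto simp: E_Vs lin_E E_zero)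
  qed (simp add: lin_E)
  from isomorphic_cyc_iff[OF assms this]
  show "isomorphic (Lam q) M (principal_module q (lin q 1 (- 1) 0)) \<longleftrightarrow> (\<exists>m. cyc (Lam q) M m (Vs q q 1 0))" .
  have "cyc (Lam q) (principal_module q (lin q 0 0 1)) (lin q 0 0 1) (Vs q 1 0 0)"
    unfolding principal_module_def PI
  proof (rule cyc_principalI[OF Lam_ring _ refl])
    show "Vs q 1 0 0 = {r \<in> carrier (Lam q). r \<otimes>\<^bsub>Lam q\<^esub> lin q 0 0 1 = \<zero>\<^bsub>Lam q\<^esub>}"
      by (rule Lam_set_eqI[OF Us_carrier(2)]) (auto simp: E_Vs lin_E E_zero)
  qed (simp add: lin_E)
  from isomorphic_cyc_iff[OF assms this]
  show "isomorphic (Lam q) M (principal_module q (lin q 0 0 1)) \<longleftrightarrow> (\<exists>m. cyc (Lam q) M m (Vs q 1 0 0))" .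
qed

section \<open>Extensions, torsionlessness and reflexivity for explicit annihilators\<close>

abbreviation lreg :: "'k::field \<Rightarrow> ('k lam, 'k lam) module" where
  "lreg q \<equiv> regular_module (Lam q)"

abbreviation rreg :: "'k::field \<Rightarrow> ('k lam, 'k lam) module" where
  "rreg q \<equiv> regular_module (op_ring (Lam q))"

lemma Ec_simps [simp]:
  "Ec q 1 (E q a b c d e f) = b" "Ec q (Suc 0) (E q a b c d e f) = b" "Ec q 2 (E q a b c d e f) = c"
  "Ec q 3 (E q a b c d e f) = d" "Ec q 4 (E q a b c d e f) = e" "Ec q 5 (E q a b c d e f) = f"
  by (simp_all add: Ec_E)

lemma VsE:
  assumes "r \<in> Vs q a b c"
  obtains r1 r2 r3 u v where "r = E q 0 r1 r2 r3 u v" "a * r1 + b * r2 + c * r3 = 0"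
  using assms unfolding Vs_def by blast

lemma Vs_000: "E q 0 r1 r2 r3 u v \<in> Vs q 0 0 0" by (simp add: E_Vs)

text \<open>A linear map \<open>rad/soc \<rightarrow> soc\<close> is both left and right linear.\<close>

definition top_map :: "'k::field \<Rightarrow> 'k \<Rightarrow> 'k \<Rightarrow> 'k \<Rightarrow> 'k \<Rightarrow> 'k \<Rightarrow> 'k \<Rightarrow> 'k lam \<Rightarrow> 'k lam" where
  "top_map q a1 a2 a3 b1 b2 b3 r = E q 0 0 0 0 (a1 * Ec q 1 r + a2 * Ec q 2 r + a3 * Ec q 3 r)
     (b1 * Ec q 1 r + b2 * Ec q 2 r + b3 * Ec q 3 r)"

lemma top_map_E [simp]:
  "top_map q a1 a2 a3 b1 b2 b3 (E q r0 r1 r2 r3 u v) =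
    E q 0 0 0 0 (a1 * r1 + a2 * r2 + a3 * r3) (b1 * r1 + b2 * r2 + b3 * r3)"
  by (simp add: top_map_def)

lemma linmap_top:
  assumes U: "U \<subseteq> Vs q 0 0 0"
  shows "linmap (Lam q) (sub (lreg q) U) (lreg q) (top_map q a1 a2 a3 b1 b2 b3)"
    and "linmap (op_ring (Lam q)) (sub (rreg q) U) (rreg q) (top_map q a1 a2 a3 b1 b2 b3)"
proof -
  have J: "\<exists>r1 r2 r3 u v. x = E q 0 r1 r2 r3 u v" if "x \<in> U" for x
    using that U by (blast elim: VsE)
  show "linmap (Lam q) (sub (lreg q) U) (lreg q) (top_map q a1 a2 a3 b1 b2 b3)"
    by (rule linmapI) (auto dest!: J elim!: E_cases simp: algebra_simps)
  show "linmap (op_ring (Lam q)) (sub (rreg q) U) (rreg q) (top_map q a1 a2 a3 b1 b2 b3)"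
    by (rule linmapI) (auto dest!: J elim!: E_cases simp: algebra_simps)
qed

lemma not_Ext_1I:
  assumes c: "cyc (Lam q) M m U" and h: "linmap (Lam q) (sub (lreg q) U) (lreg q) h"
    and n: "\<And>v0 v1 v2 v3 v4 v5. \<exists>u\<in>U. h u \<noteq> u \<otimes>\<^bsub>Lam q\<^esub> E q v0 v1 v2 v3 v4 v5"
  shows "\<not> Ext_vanishes (Lam q) 1 M (lreg q)"
proof
  assume "Ext_vanishes (Lam q) 1 M (lreg q)"
  then obtain g where g: "linmap (Lam q) (lreg q) (lreg q) g" "\<And>x. x \<in> U \<Longrightarrow> g x = h x"
    using h unfolding cyc_Ext_1[OF Lam_noeth(1) c] extnd_def by blast
  have "g \<one>\<^bsub>Lam q\<^esub> \<in> carrier (Lam q)"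
    using linmapD(1)[OF g(1), of "\<one>\<^bsub>Lam q\<^esub>"] by (simp add: E_one)
  then obtain v0 v1 v2 v3 v4 v5 where v: "g \<one>\<^bsub>Lam q\<^esub> = E q v0 v1 v2 v3 v4 v5" by (rule E_cases)
  obtain u where u: "u \<in> U" "h u \<noteq> u \<otimes>\<^bsub>Lam q\<^esub> E q v0 v1 v2 v3 v4 v5" using n by blast
  have "u \<in> carrier (Lam q)" using u(1) cycD(4)[OF c] by blast
  then show False using linmap_regular[OF Lam_ring g(1), of u] g(2)[OF u(1)] u(2) v by simp
qed

lemma not_Ext_1_cycI:
  assumes "cyc (Lam q) M m U" and "cyc (Lam q) (sub (lreg q) U) l U'"
    and w: "w \<in> carrier (Lam q)" "\<And>u. u \<in> U' \<Longrightarrow> u \<otimes>\<^bsub>Lam q\<^esub> w = \<zero>\<^bsub>Lam q\<^esub>"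
    and n: "\<And>v0 v1 v2 v3 v4 v5. w \<noteq> l \<otimes>\<^bsub>Lam q\<^esub> E q v0 v1 v2 v3 v4 v5"
  shows "\<not> Ext_vanishes (Lam q) 1 M (lreg q)"
  unfolding cyc_Ext_1_cyc[OF Lam_noeth(1) assms(1,2)] Lam_bex using w n by blast

lemma Us_left: "w \<in> Us q 1 b c \<Longrightarrow> b \<noteq> -1 \<Longrightarrow> \<exists>r\<in>carrier (Lam q). w = r \<otimes>\<^bsub>Lam q\<^esub> E q 0 1 b c 0 0"
  using cycD(3)[OF cyc_Us[of b q c], of w] by simp

lemma Us_right: "w \<in> Us q 1 b c \<Longrightarrow> q \<noteq> 0 \<Longrightarrow> \<exists>r\<in>carrier (Lam q). w = E q 0 1 b c 0 0 \<otimes>\<^bsub>Lam q\<^esub> r"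
  using cycD(3)[OF cyc_Us_op[of q b c], of w] by simp

text \<open>The syzygy of \<open>\<Lambda>/U\<close> is again some \<open>\<Lambda>/V\<close>; that the right annihilator of \<open>V\<close> is \<open>U = l\<Lambda>\<close>, where
  \<open>l\<close> generates the syzygy, makes every map from the syzygy to \<open>\<Lambda>\<close> extend.\<close>

lemma rann_left_syzygy:
  assumes "q \<noteq> 0" "b \<noteq> -1"
  shows "rann (Lam q) (Us q 1 (q * b) (- c / (1 + b))) = Us q 1 b c"
  unfolding rann_Us[OF assms(1)] using assms one_add_neq[OF assms(2)] by simp

lemma lann_right_syzygy:
  assumes "q \<noteq> 0" "b \<noteq> -q"
  shows "{r \<in> carrier (Lam q). \<forall>w\<in>Us q 1 (b / q) (- (c * (1 + b / q))). r \<otimes>\<^bsub>Lam q\<^esub> w = \<zero>\<^bsub>Lam q\<^esub>} = Us q 1 b c"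
proof -
  have n: "b / q \<noteq> -1" using assms by (auto simp: divide_eq_minus_1_iff)
  show ?thesis unfolding lann_Us[OF n] using assms one_add_neq[OF n] by simp
qed

lemma cyc_Us_minus_1:
  assumes "c \<noteq> 0"
  shows "cyc (Lam q) (sub (lreg q) (Us q 1 (- 1) c)) (E q 0 1 (- 1) c 0 0) (Us q 0 0 1)"
proof (rule cyc_principalI[OF Lam_ring])
  show "Us q 1 (- 1) c = (\<lambda>r. r \<otimes>\<^bsub>Lam q\<^esub> E q 0 1 (- 1) c 0 0) ` carrier (Lam q)"
  proof
    show "Us q 1 (- 1) c \<subseteq> (\<lambda>r. r \<otimes>\<^bsub>Lam q\<^esub> E q 0 1 (- 1) c 0 0) ` carrier (Lam q)"
    proof
      fix r assume "r \<in> Us q 1 (- 1) c"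
      then obtain t u v where "r = E q 0 (t * 1) (t * (- 1)) (t * c) u v" by (rule UsE)
      then show "r \<in> (\<lambda>r. r \<otimes>\<^bsub>Lam q\<^esub> E q 0 1 (- 1) c 0 0) ` carrier (Lam q)"
        using assms by (intro image_eqI[where x = "E q t (v / c) (u - q * v / c) 0 0 0"]) (simp_all)
    qed
  qed (auto elim!: E_cases simp: E_Us1)
  show "Us q 0 0 1 = {r \<in> carrier (Lam q). r \<otimes>\<^bsub>Lam q\<^esub> E q 0 1 (- 1) c 0 0 = \<zero>\<^bsub>Lam q\<^esub>}"
    by (rule Lam_set_eqI[OF Us_carrier(1)]) (use assms in \<open>auto simp: E_Us E_zero\<close>)
qed simp

lemma Ext_1_Us:
  assumes q: "q \<noteq> 0" and c: "cyc (Lam q) M m (Us q 1 b c)"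
  shows "Ext_vanishes (Lam q) 1 M (lreg q) \<longleftrightarrow> b \<noteq> -1"
proof (cases "b = -1")
  case False
  have "\<exists>v\<in>carrier (Lam q). w = E q 0 1 b c 0 0 \<otimes>\<^bsub>Lam q\<^esub> v"
    if "w \<in> carrier (Lam q)" "\<forall>u\<in>Us q 1 (q * b) (- c / (1 + b)). u \<otimes>\<^bsub>Lam q\<^esub> w = \<zero>\<^bsub>Lam q\<^esub>" for w
    using that rann_left_syzygy[OF q False, of c] Us_right[OF _ q, of w b c] unfolding rann_def by blast
  then show ?thesis
    unfolding cyc_Ext_1_cyc[OF Lam_noeth(1) c cyc_Us[OF False]] using False by blast
next
  case b: True
  have "\<not> Ext_vanishes (Lam q) 1 M (lreg q)"
  proof (cases "c = 0")
    case True
    let ?h = "\<lambda>r. E q 0 0 0 0 0 (Ec q 5 r)"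
    have "linmap (Lam q) (sub (lreg q) (Us q 1 b c)) (lreg q) ?h"
      by (rule linmapI) (auto elim!: UsE E_cases simp: b True algebra_simps)
    then show ?thesis
    proof (rule not_Ext_1I[OF c])
      fix v0 v1 v2 v3 v4 v5
      show "\<exists>u\<in>Us q 1 b c. ?h u \<noteq> u \<otimes>\<^bsub>Lam q\<^esub> E q v0 v1 v2 v3 v4 v5"
      proof (cases "v0 = 1")
        case False
        then show ?thesis by (intro bexI[of _ "E q 0 0 0 0 0 1"]) (auto simp: E_Us1)
      next
        case True
        then show ?thesis by (intro bexI[of _ "E q 0 1 b c 0 0"]) (auto simp: E_Us1)
      qed
    qed
  next
    case False
    have "cyc (Lam q) (sub (lreg q) (Us q 1 b c)) (E q 0 1 b c 0 0) (Us q 0 0 1)"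
      unfolding b by (rule cyc_Us_minus_1[OF False])
    then show ?thesis
      by (rule not_Ext_1_cycI[OF c, where w = "E q 0 0 0 1 0 0"]) (auto elim!: UsE simp: E_zero)
  qed
  then show ?thesis using b by simp
qed

lemma not_Ext_1_Us0:
  assumes q: "q \<noteq> 0" and c: "cyc (Lam q) M m (Us q 0 b c)" and nz: "b \<noteq> 0 \<or> c \<noteq> 0"
  shows "\<not> Ext_vanishes (Lam q) 1 M (lreg q)"
proof (cases "b = 0")
  case False
  have "cyc (Lam q) (sub (lreg q) (Us q 0 b c)) (E q 0 0 b c 0 0) (Us q 0 1 0)"
  proof (rule cyc_principalI[OF Lam_ring])
    show "Us q 0 b c = (\<lambda>r. r \<otimes>\<^bsub>Lam q\<^esub> E q 0 0 b c 0 0) ` carrier (Lam q)"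
    proof
      show "Us q 0 b c \<subseteq> (\<lambda>r. r \<otimes>\<^bsub>Lam q\<^esub> E q 0 0 b c 0 0) ` carrier (Lam q)"
      proof
        fix r assume "r \<in> Us q 0 b c"
        then obtain t u v where r: "r = E q 0 (t * 0) (t * b) (t * c) u v" by (rule UsE)
        define s where "s = - u / (q * b)"
        define s' where "s' = (v - s * c) / b"
        have "u = - (q * s * b)" "v = s * c + s' * b" using False q by (simp_all add: s_def s'_def)
        then show "r \<in> (\<lambda>r. r \<otimes>\<^bsub>Lam q\<^esub> E q 0 0 b c 0 0) ` carrier (Lam q)"
          by (intro image_eqI[where x = "E q t s 0 s' 0 0"]) (simp_all add: r)
      qed
    qed (auto elim!: E_cases simp: E_Us)
    show "Us q 0 1 0 = {r \<in> carrier (Lam q). r \<otimes>\<^bsub>Lam q\<^esub> E q 0 0 b c 0 0 = \<zero>\<^bsub>Lam q\<^esub>}"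
      by (rule Lam_set_eqI[OF Us_carrier(1)]) (use False q in \<open>auto simp: E_Us E_zero\<close>)
  qed simp
  then show ?thesis
    by (rule not_Ext_1_cycI[OF c, where w = "E q 0 0 0 1 0 0"]) (use False in \<open>auto elim!: UsE simp: E_zero\<close>)
next
  case b: True
  let ?h = "\<lambda>r. E q 0 0 0 0 (Ec q 4 r) 0"
  have "linmap (Lam q) (sub (lreg q) (Us q 0 b c)) (lreg q) ?h"
    by (rule linmapI) (auto elim!: UsE E_cases simp: b)
  then show ?thesis
  proof (rule not_Ext_1I[OF c])
    fix v0 v1 v2 v3 v4 v5
    show "\<exists>u\<in>Us q 0 b c. ?h u \<noteq> u \<otimes>\<^bsub>Lam q\<^esub> E q v0 v1 v2 v3 v4 v5"
    proof (cases "v0 = 1")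
      case False
      then show ?thesis by (intro bexI[of _ "E q 0 0 0 0 1 0"]) (auto simp: E_Us intro: exI[of _ 0])
    next
      case True
      then show ?thesis using nz b
        by (intro bexI[of _ "E q 0 0 b c 0 0"]) (auto simp: E_Us intro: exI[of _ 1])
    qed
  qed
qed

lemma not_Ext_1_Vs:
  assumes q: "q \<noteq> 0" and cy: "cyc (Lam q) M m (Vs q a b c)"
  shows "\<not> Ext_vanishes (Lam q) 1 M (lreg q)"
proof -
  have J: "Vs q a b c \<subseteq> Vs q 0 0 0" by (auto elim!: VsE simp: E_Vs)
  consider "b = 0" | "c = 0" | "b \<noteq> 0" "c \<noteq> 0" by blast
  then show ?thesis
  proof cases
    case 1
    show ?thesis
      by (rule not_Ext_1I[OF cy linmap_top(1)[OF J, of 0 0 0 0 1 0]], rule bexI[of _ "E q 0 0 1 0 0 0"])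
        (simp_all add: E_Vs 1)
  next
    case 2
    show ?thesis
      by (rule not_Ext_1I[OF cy linmap_top(1)[OF J, of 0 0 1 0 0 0]], rule bexI[of _ "E q 0 0 0 1 0 0"])
        (simp_all add: E_Vs 2)
  next
    case 3
    show ?thesis
    proof (rule not_Ext_1I[OF cy linmap_top(1)[OF J, of 0 0 0 0 0 1]], rule ccontr)
      fix v0 v1 v2 v3 v4 v5
      assume "\<not> (\<exists>u\<in>Vs q a b c. top_map q 0 0 0 0 0 1 u \<noteq> u \<otimes>\<^bsub>Lam q\<^esub> E q v0 v1 v2 v3 v4 v5)"
      then have e: "u \<otimes>\<^bsub>Lam q\<^esub> E q v0 v1 v2 v3 v4 v5 = top_map q 0 0 0 0 0 1 u" if "u \<in> Vs q a b c" for u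
        using that by auto
      have "v1 = 0" "v2 = 1" using e[of "E q 0 0 c (- b) 0 0"] 3 by (auto simp: E_Vs)
      then show False using e[of "E q 0 b (- a) 0 0 0"] 3 q by (auto simp: E_Vs)
    qed
  qed
qed

lemma cyc_torsionless_lann:
  assumes "cyc R M m U" "w \<in> carrier R" "U = {r \<in> carrier R. r \<otimes>\<^bsub>R\<^esub> w = \<zero>\<^bsub>R\<^esub>}"
  shows "torsionless R M"
proof (rule cyc_torsionlessI[OF assms(1), of 1 "\<lambda>_. w"])
  show "w \<in> rann R U" using assms(2) unfolding rann_def assms(3) by blast
  show "r \<in> U" if "r \<in> carrier R" "\<And>j. j < (1::nat) \<Longrightarrow> r \<otimes>\<^bsub>R\<^esub> w = \<zero>\<^bsub>R\<^esub>" for r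
    using that(1) that(2)[of 0] unfolding assms(3) by simp
qed

lemma torsionless_Us:
  assumes q: "q \<noteq> 0" and c: "cyc (Lam q) M m (Us q 1 b c)" and b: "b \<noteq> - q"
  shows "torsionless (Lam q) M"
proof -
  have n: "b / q \<noteq> -1" using q b by (auto simp: divide_eq_minus_1_iff)
  let ?c = "- (c * (1 + b / q))"
  have "Us q 1 b c = {r \<in> carrier (Lam q). r \<otimes>\<^bsub>Lam q\<^esub> E q 0 1 (b / q) ?c 0 0 = \<zero>\<^bsub>Lam q\<^esub>}"
    using cycD(4)[OF cyc_Us[OF n, of q ?c]] q one_add_neq[OF n] by simp
  then show ?thesis by (rule cyc_torsionless_lann[OF c E_closed])
qed

text \<open>For \<open>b = - q\<close> the element \<open>z\<close>, which is not in \<open>U\<close>, kills the right annihilator of \<open>U\<close>.\<close>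

lemma not_separated_Us:
  assumes q: "q \<noteq> 0" and c: "cyc (Lam q) M m (Us q 1 (- q) c)"
  shows "\<not> separated (Lam q) M"
proof -
  have "E q 0 0 0 1 0 0 \<otimes>\<^bsub>Lam q\<^esub> w = \<zero>\<^bsub>Lam q\<^esub>" if "w \<in> rann (Lam q) (Us q 1 (- q) c)" for w
    using that q unfolding rann_Us[OF q] by (auto elim!: UsE simp: E_zero)
  moreover have "E q 0 0 0 1 0 0 \<notin> Us q 1 (- q) c" by (simp add: E_Us1)
  ultimately show ?thesis unfolding cyc_separated_iff[OF c] by (metis E_closed)
qed

lemma rann_Us0:
  assumes "b \<noteq> 0 \<or> c \<noteq> 0"
  shows "E q w0 w1 w2 w3 w4 w5 \<in> rann (Lam q) (Us q 0 b c) \<longleftrightarrow> w0 = 0 \<and> b * w1 = 0 \<and> c * (w1 + w2) = 0"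
proof -
  have "E q w0 w1 w2 w3 w4 w5 \<in> rann (Lam q) (Us q 0 b c) \<longleftrightarrow>
    (\<forall>t u v. E q 0 0 (t * b) (t * c) u v \<otimes>\<^bsub>Lam q\<^esub> E q w0 w1 w2 w3 w4 w5 = \<zero>\<^bsub>Lam q\<^esub>)"
    unfolding rann_def mem_Collect_eq ball_Us by simp
  also have "\<dots> \<longleftrightarrow> w0 = 0 \<and> b * w1 = 0 \<and> c * (w1 + w2) = 0" (is "?A \<longleftrightarrow> ?B")
  proof
    assume A: ?A
    show ?B using A[rule_format, of 1 0 0] assms by (auto simp: E_zero distrib_left)
  next
    assume B: ?B
    have "t * c * w1 + t * c * w2 = t * (c * (w1 + w2))" "t * b * w1 = t * (b * w1)" for t
      by (simp_all add: algebra_simps)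
    then show ?A using B by (simp add: E_zero)
  qed
  finally show ?thesis .
qed

lemma torsionless_special:
  assumes q: "q \<noteq> 0" and "cyc (Lam q) M m U"
    and "U = Us q 0 1 0 \<or> U = Us q 0 0 1 \<or> U = Vs q q 1 0 \<or> U = Vs q 1 0 0 \<or> U = Vs q 0 0 0"
  shows "torsionless (Lam q) M"
proof -
  \<comment> \<open>In each case \<open>U\<close> is the left annihilator of one element \<open>w\<close>.\<close>
  have "\<exists>w\<in>carrier (Lam q). U = {r \<in> carrier (Lam q). r \<otimes>\<^bsub>Lam q\<^esub> w = \<zero>\<^bsub>Lam q\<^esub>}"
    using assms(3)
  proof (elim disjE)
    assume U: "U = Us q 0 1 0"
    show ?thesis unfolding U
      by (rule bexI[of _ "E q 0 0 1 0 0 0"], rule Lam_set_eqI[OF Us_carrier(1)]) (use q in \<open>auto simp: E_Us E_zero\<close>)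
  next
    assume U: "U = Us q 0 0 1"
    show ?thesis unfolding U
      by (rule bexI[of _ "E q 0 1 (- 1) 1 0 0"], rule Lam_set_eqI[OF Us_carrier(1)]) (use q in \<open>auto simp: E_Us E_zero\<close>)
  next
    assume U: "U = Vs q q 1 0"
    show ?thesis unfolding U
      by (rule bexI[of _ "E q 0 1 (- 1) 0 0 0"], rule Lam_set_eqI[OF Us_carrier(2)]) (auto simp: E_Vs E_zero)
  next
    assume U: "U = Vs q 1 0 0"
    show ?thesis unfolding U
      by (rule bexI[of _ "E q 0 0 0 1 0 0"], rule Lam_set_eqI[OF Us_carrier(2)]) (auto simp: E_Vs E_zero)
  next
    assume U: "U = Vs q 0 0 0"
    show ?thesis unfolding U
      by (rule bexI[of _ "E q 0 0 0 0 0 1"], rule Lam_set_eqI[OF Us_carrier(2)]) (auto simp: E_Vs E_zero)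
  qed
  then show ?thesis using cyc_torsionless_lann[OF assms(2)] by blast
qed

text \<open>The element \<open>y\<close>, which is not in \<open>U\<close>, kills the right annihilator of \<open>U\<close>.\<close>

lemma not_separated_Us0:
  assumes "cyc (Lam q) M m (Us q 0 b c)" "b \<noteq> 0" "c \<noteq> 0"
  shows "\<not> separated (Lam q) M"
proof -
  have "E q 0 0 1 0 0 0 \<otimes>\<^bsub>Lam q\<^esub> w = \<zero>\<^bsub>Lam q\<^esub>" if w: "w \<in> rann (Lam q) (Us q 0 b c)" for w
  proof -
    have "w \<in> carrier (Lam q)" using w by (simp add: rann_def)
    then obtain w0 w1 w2 w3 w4 w5 where we: "w = E q w0 w1 w2 w3 w4 w5" by (rule E_cases)
    then show ?thesis using w rann_Us0[of b c q w0 w1 w2 w3 w4 w5] assms(2,3) by (simp add: E_zero)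
  qed
  moreover have "E q 0 0 1 0 0 0 \<notin> Us q 0 b c" using assms(3) by (auto simp: E_Us)
  ultimately show ?thesis unfolding cyc_separated_iff[OF assms(1)] by (metis E_closed)
qed

text \<open>Outside the two special cases the right annihilator lies in the socle, so functionals vanish on the radical.\<close>

lemma separated_Vs:
  assumes q: "q \<noteq> 0" and cy: "cyc (Lam q) M m (Vs q a b c)" and nz: "a \<noteq> 0 \<or> b \<noteq> 0 \<or> c \<noteq> 0"
    and sep: "separated (Lam q) M"
  shows "Vs q a b c = Vs q q 1 0 \<or> Vs q a b c = Vs q 1 0 0"
proof (rule ccontr)
  assume contra: "\<not> ?thesis"
  have soc: "w1 = 0 \<and> w2 = 0 \<and> w3 = 0 \<and> w0 = 0" if w: "E q w0 w1 w2 w3 w4 w5 \<in> rann (Lam q) (Vs q a b c)" for w0 w1 w2 w3 w4 w5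
  proof -
    have e: "r1 * w0 = 0 \<and> r2 * w0 = 0 \<and> r3 * w0 = 0 \<and> r2 * w1 = q * r1 * w2 \<and> r1 * w3 + r3 * w1 + r3 * w2 = 0"
      if "a * r1 + b * r2 + c * r3 = 0" for r1 r2 r3
    proof -
      have "E q 0 r1 r2 r3 0 0 \<otimes>\<^bsub>Lam q\<^esub> E q w0 w1 w2 w3 w4 w5 = \<zero>\<^bsub>Lam q\<^esub>"
        using w bspec[of "Vs q a b c" _ "E q 0 r1 r2 r3 0 0"] that unfolding rann_def E_Vs by blast
      then show ?thesis by (simp add: E_zero)
    qed
    have e1: "- (a * w1) = q * b * w2" "b * w3 = 0" "b * w0 = 0" "a * w0 = 0" using e[of b "- a" 0] by simp_all
    have e2: "c * w2 = 0" "c * w3 - a * w1 - a * w2 = 0" "c * w0 = 0" using e[of c 0 "- a"] q by auto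
    have e3: "c * w1 = 0" using e[of 0 c "- b"] by simp
    have w0: "w0 = 0" using nz e1 e2 by auto
    show ?thesis
    proof (cases "c = 0")
      case False then show ?thesis using e2 e3 w0 by auto
    next
      case c: True
      have "w1 + w2 = 0" using e[of 0 0 1] c by simp
      then have w2: "w2 = - w1" by (simp add: eq_neg_iff_add_eq_0 add.commute)
      show ?thesis
      proof (cases "b = 0")
        case True
        then have "Vs q a b c = Vs q 1 0 0"
          using nz c by (intro Lam_set_eqI[OF Us_carrier(2) Us_carrier(2)]) (simp add: E_Vs)
        then show ?thesis using contra by blast
      next
        case False
        have "a \<noteq> q * b"
        proof
          assume "a = q * b"
          then have "a * r1 + b * r2 = b * (q * r1 + r2)" for r1 r2 by (simp add: algebra_simps)
          then have "Vs q a b c = Vs q q 1 0"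
            using c False by (intro Lam_set_eqI[OF Us_carrier(2) Us_carrier(2)]) (simp add: E_Vs)
          then show False using contra by blast
        qed
        moreover have "(q * b - a) * w1 = 0" using e1(1) w2 by (auto simp: algebra_simps)
        ultimately show ?thesis using w0 w2 e1(2) False by simp
      qed
    qed
  qed
  obtain r1 r2 r3 where r: "a * r1 + b * r2 + c * r3 \<noteq> 0"
    using nz by (metis add.left_neutral add.right_neutral mult.right_neutral mult_zero_right)
  have "E q 0 r1 r2 r3 0 0 \<otimes>\<^bsub>Lam q\<^esub> w = \<zero>\<^bsub>Lam q\<^esub>" if w: "w \<in> rann (Lam q) (Vs q a b c)" for w
  proof -
    have "w \<in> carrier (Lam q)" using w by (simp add: rann_def)
    then obtain w0 w1 w2 w3 w4 w5 where we: "w = E q w0 w1 w2 w3 w4 w5" by (rule E_cases)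
    then show ?thesis using soc[OF w[unfolded we]] by (simp add: E_zero)
  qed
  then have "E q 0 r1 r2 r3 0 0 \<in> Vs q a b c" using sep unfolding cyc_separated_iff[OF cy] by (metis E_closed)
  then show False using r by (simp add: E_Vs)
qed

lemma reflexive_Us:
  assumes q: "q \<noteq> 0" and c: "cyc (Lam q) M m (Us q 1 b c)" and b: "b \<noteq> - q" 
  shows "reflexive (Lam q) M \<longleftrightarrow> b \<noteq> - (q ^ 2)"
proof -
  define b' where "b' = b / q"
  define c' where "c' = - (c * (1 + b / q))"
  have W: "rann (Lam q) (Us q 1 b c) = Us q 1 b' c'" unfolding b'_def c'_def by (rule rann_Us[OF q])
  let ?w = "E q 0 1 b' c' 0 0"
  have b'1: "b' \<noteq> -1" using q b by (auto simp: b'_def divide_eq_minus_1_iff)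
  have b'q: "b' = - q \<longleftrightarrow> b = - (q ^ 2)" using q by (auto simp: b'_def field_simps power2_eq_square)
  have sep: "separated (Lam q) M"
    using torsionless_separated[OF torsionless_Us[OF q c b] cycD(1)[OF c]] .
  note cw = cyc_Us_op[OF q, of b' c']
  interpret L: ring "Lam q" by (rule Lam_ring)
  have wW: "?w \<in> Us q 1 b' c'" by (simp add: E_Us1)
  show ?thesis
  proof (cases "b' = - q")
    case False
    have "\<exists>r\<in>carrier (Lam q). \<forall>w\<in>Us q 1 b' c'. \<theta> w = r \<otimes>\<^bsub>Lam q\<^esub> w"
      if t: "linmap (op_ring (Lam q)) (sub (rreg q) (Us q 1 b' c')) (rreg q) \<theta>" for \<theta>
    proof -
      have ts: "\<theta> (?w \<otimes>\<^bsub>Lam q\<^esub> s) = \<theta> ?w \<otimes>\<^bsub>Lam q\<^esub> s" if "s \<in> carrier (Lam q)" for s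
        using linmapD(3)[OF t, of s ?w] that wW by simp
      have tw: "\<theta> ?w \<in> carrier (Lam q)" using linmapD(1)[OF t, of ?w] wW by simp
      have t0: "\<theta> \<zero>\<^bsub>Lam q\<^esub> = \<zero>\<^bsub>Lam q\<^esub>" using linmap_zero[OF cycD(1)[OF cw] LregS t] by simp
      have "\<theta> ?w \<otimes>\<^bsub>Lam q\<^esub> u = \<zero>\<^bsub>Lam q\<^esub>" if "u \<in> Us q 1 (b' / q) (- (c' * (1 + b' / q)))" for u
        using that cycD(4)[OF cw] ts[of u] t0 by simp
      then have "\<theta> ?w \<in> Us q 1 b' c'" using lann_right_syzygy[OF q False, of c'] tw by blast
      then obtain r where r: "r \<in> carrier (Lam q)" "\<theta> ?w = r \<otimes>\<^bsub>Lam q\<^esub> ?w" using Us_left[OF _ b'1] by blast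
      have "\<theta> w = r \<otimes>\<^bsub>Lam q\<^esub> w" if w: "w \<in> Us q 1 b' c'" for w
      proof -
        obtain s where "s \<in> carrier (Lam q)" "w = ?w \<otimes>\<^bsub>Lam q\<^esub> s" using Us_right[OF w q] by blast
        then show ?thesis using ts r by (simp add: L.m_assoc del: E_mult)
      qed
      then show ?thesis using r(1) by blast
    qed
    then have "reflexive (Lam q) M" unfolding cyc_reflexive_iff[OF c] W
      by (intro conjI sep allI impI) simp
    then show ?thesis using False b'q by blast
  next
    case True
    obtain h where h: "linmap (op_ring (Lam q)) (sub (rreg q) (Us q 1 b' c')) (rreg q) h"
      "\<And>r. r \<in> carrier (op_ring (Lam q)) \<Longrightarrow> h (r \<odot>\<^bsub>sub (rreg q) (Us q 1 b' c')\<^esub> ?w) = r \<odot>\<^bsub>rreg q\<^esub> E q 0 0 0 1 0 0"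
      by (rule cyc_hom[OF cw LregS, of "E q 0 0 0 1 0 0"]) (use True q in \<open>auto elim!: UsE simp: E_zero\<close>)
    have hw: "h ?w = E q 0 0 0 1 0 0" using h(2)[of "E q 1 0 0 0 0 0"] by simp
    have "\<not> reflexive (Lam q) M"
    proof
      assume "reflexive (Lam q) M"
      from conjunct2[OF this[unfolded cyc_reflexive_iff[OF c] W], rule_format, OF h(1)]
      obtain r where r: "r \<in> carrier (Lam q)" "h ?w = r \<otimes>\<^bsub>Lam q\<^esub> ?w" using wW by metis
      obtain r0 r1 r2 r3 r4 r5 where "r = E q r0 r1 r2 r3 r4 r5" by (rule E_cases[OF r(1)])
      then show False using r(2) hw by auto
    qed
    then show ?thesis using True b'q by blast
  qed
qed

lemma not_reflexiveI:
  assumes c: "cyc (Lam q) M m U"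
    and t: "linmap (op_ring (Lam q)) (sub (rreg q) (rann (Lam q) U)) (rreg q) \<theta>"
    and n: "\<And>r0 r1 r2 r3 r4 r5. \<exists>w\<in>rann (Lam q) U. \<theta> w \<noteq> E q r0 r1 r2 r3 r4 r5 \<otimes>\<^bsub>Lam q\<^esub> w"
  shows "\<not> reflexive (Lam q) M"
  unfolding cyc_reflexive_iff[OF c] Lam_bex using t n by blast

lemma rann_Vs:
  assumes "q \<noteq> 0"
  shows "rann (Lam q) (Vs q 0 0 0) = Us q 0 0 0" "rann (Lam q) (Vs q 1 0 0) = Us q 0 0 1"
    "rann (Lam q) (Vs q q 1 0) = Us q 1 (- 1) 0"
proof -
  have rc: "rann (Lam q) U \<subseteq> carrier (Lam q)" for U by (auto simp: rann_def)
  have V: "E q w0 w1 w2 w3 w4 w5 \<in> rann (Lam q) (Vs q a b c) \<longleftrightarrow>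
    (\<forall>r1 r2 r3 u v. a * r1 + b * r2 + c * r3 = 0 \<longrightarrow> 
      E q 0 r1 r2 r3 u v \<otimes>\<^bsub>Lam q\<^esub> E q w0 w1 w2 w3 w4 w5 = \<zero>\<^bsub>Lam q\<^esub>)" for a b c w0 w1 w2 w3 w4 w5
    unfolding rann_def Vs_def mem_Collect_eq using E_closed by blast
  show "rann (Lam q) (Vs q 0 0 0) = Us q 0 0 0"
  proof (rule Lam_set_eqI[OF rc Us_carrier(1)], unfold V E_Us)
    fix w0 w1 w2 w3 w4 w5
    show "(\<forall>r1 r2 r3 u v. 0 * r1 + 0 * r2 + 0 * r3 = 0 \<longrightarrow> E q 0 r1 r2 r3 u v \<otimes>\<^bsub>Lam q\<^esub> E q w0 w1 w2 w3 w4 w5 = \<zero>\<^bsub>Lam q\<^esub>)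
      \<longleftrightarrow> w0 = 0 \<and> (\<exists>t. w1 = t * 0 \<and> w2 = t * 0 \<and> w3 = t * 0)" (is "?A \<longleftrightarrow> ?B")
    proof
      assume A: ?A
      show ?B using A[rule_format, of 1 0 0 0 0] A[rule_format, of 0 1 0 0 0] assms by (auto simp: E_zero)
    qed (auto simp: E_zero)
  qed
  show "rann (Lam q) (Vs q 1 0 0) = Us q 0 0 1"
  proof (rule Lam_set_eqI[OF rc Us_carrier(1)], unfold V E_Us)
    fix w0 w1 w2 w3 w4 w5
    show "(\<forall>r1 r2 r3 u v. 1 * r1 + 0 * r2 + 0 * r3 = 0 \<longrightarrow> E q 0 r1 r2 r3 u v \<otimes>\<^bsub>Lam q\<^esub> E q w0 w1 w2 w3 w4 w5 = \<zero>\<^bsub>Lam q\<^esub>)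
      \<longleftrightarrow> w0 = 0 \<and> (\<exists>t. w1 = t * 0 \<and> w2 = t * 0 \<and> w3 = t * 1)" (is "?A \<longleftrightarrow> ?B")
    proof
      assume A: ?A
      show ?B using A[rule_format, of 0 0 1 0 0] A[rule_format, of 0 1 0 0 0] by (auto simp: E_zero)
    qed (auto simp: E_zero)
  qed
  show "rann (Lam q) (Vs q q 1 0) = Us q 1 (- 1) 0"
  proof (rule Lam_set_eqI[OF rc Us_carrier(1)], unfold V E_Us1)
    fix w0 w1 w2 w3 w4 w5
    show "(\<forall>r1 r2 r3 u v. q * r1 + 1 * r2 + 0 * r3 = 0 \<longrightarrow> E q 0 r1 r2 r3 u v \<otimes>\<^bsub>Lam q\<^esub> E q w0 w1 w2 w3 w4 w5 = \<zero>\<^bsub>Lam q\<^esub>)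
      \<longleftrightarrow> w0 = 0 \<and> w2 = w1 * - 1 \<and> w3 = w1 * 0" (is "?A \<longleftrightarrow> ?B")
    proof
      assume A: ?A
      have "w0 = 0" "w3 = 0" using A[rule_format, of 1 "- q" 0 0 0] by (auto simp: E_zero)
      moreover have "w1 + w2 = 0" using A[rule_format, of 0 0 1 0 0] by (simp add: E_zero)
      ultimately show ?B by (simp add: eq_neg_iff_add_eq_0 add.commute)
    next
      assume B: ?B
      have "q * r1 * w1 + r2 * w1 = 0" if "q * r1 + r2 = 0" for r1 r2
        using that by (metis distrib_right mult_zero_left)
      then show ?A using B by (simp add: E_zero)
    qed
  qed
qed

text \<open>The dual is a right ideal, and it has maps into the socle that are not left multiplications.\<close>

lemma not_reflexive_special:
  assumes q: "q \<noteq> 0" and c: "cyc (Lam q) M m U"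
    and "U = Us q 0 1 0 \<or> U = Us q 0 0 1 \<or> U = Vs q q 1 0 \<or> U = Vs q 1 0 0 \<or> U = Vs q 0 0 0"
  shows "\<not> reflexive (Lam q) M"
  using assms(3)
proof (elim disjE)
  assume U: "U = Us q 0 1 0 "
  have J: "rann (Lam q) U \<subseteq> Vs q 0 0 0"
  proof
    fix w assume w: "w \<in> rann (Lam q) U"
    then have "w \<in> carrier (Lam q)" by (simp add: rann_def)
    then show "w \<in> Vs q 0 0 0" using w unfolding U by (auto elim!: E_cases simp: rann_Us0 E_Vs)
  qed
  show ?thesis
    by (rule not_reflexiveI[OF c linmap_top(2)[OF J, of 0 0 1 0 0 0]], rule bexI[of _ "E q 0 0 0 1 0 0"])
      (simp_all add: U rann_Us0)
next
  assume U: "U = Us q 0 0 1"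
  have J: "rann (Lam q) U \<subseteq> Vs q 0 0 0"
  proof
    fix w assume w: "w \<in> rann (Lam q) U"
    then have "w \<in> carrier (Lam q)" by (simp add: rann_def)
    then show "w \<in> Vs q 0 0 0" using w unfolding U by (auto elim!: E_cases simp: rann_Us0 E_Vs)
  qed
  show ?thesis
    by (rule not_reflexiveI[OF c linmap_top(2)[OF J, of 0 0 1 0 0 0]], rule bexI[of _ "E q 0 0 0 1 0 0"])
      (simp_all add: U rann_Us0)
next
  assume U: "U = Vs q q 1 0"
  have W: "rann (Lam q) U = Us q 1 (- 1) 0" unfolding U by (rule rann_Vs(3)[OF q])
  have J: "rann (Lam q) U \<subseteq> Vs q 0 0 0" unfolding W by (auto elim!: UsE simp: E_Vs)
  show ?thesis
  proof (rule not_reflexiveI[OF c linmap_top(2)[OF J, of 0 0 0 1 0 0]])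
    fix r0 r1 r2 r3 r4 r5
    show "\<exists>w\<in>rann (Lam q) U. top_map q 0 0 0 1 0 0 w \<noteq> E q r0 r1 r2 r3 r4 r5 \<otimes>\<^bsub>Lam q\<^esub> w"
      unfolding W by (rule bexI[of _ "E q 0 1 (- 1) 0 0 0"]) (simp_all add: E_Us1)
  qed
next
  assume U: "U = Vs q 1 0 0"
  have W: "rann (Lam q) U = Us q 0 0 1" unfolding U by (rule rann_Vs(2)[OF q])
  have "linmap (op_ring (Lam q)) (sub (rreg q) (rann (Lam q) U)) (rreg q) (\<lambda>r. E q 0 0 0 0 0 (Ec q 4 r))"
    unfolding W by (rule linmapI) (auto elim!: UsE E_cases)
  then show ?thesis
    by (rule not_reflexiveI[OF c], unfold W, intro bexI[of _ "E q 0 0 0 0 1 0"]) (auto simp: E_Us intro: exI[of _ 0])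
next
  assume U: "U = Vs q 0 0 0"
  have W: "rann (Lam q) U = Us q 0 0 0" unfolding U by (rule rann_Vs(1)[OF q])
  have "linmap (op_ring (Lam q)) (sub (rreg q) (rann (Lam q) U)) (rreg q) (\<lambda>r. E q 0 0 0 0 0 (Ec q 4 r))"
    unfolding W by (rule linmapI) (auto elim!: UsE E_cases)
  then show ?thesis
    by (rule not_reflexiveI[OF c], unfold W, intro bexI[of _ "E q 0 0 0 0 1 0"]) (auto simp: E_Us)
qed

section \<open>Higher extensions\<close>

lemma Ext_left_regular:
  fixes M :: "('k::field lam, 'k lam) module"
  assumes "q \<noteq> 0" "cyc (Lam q) M m (Us q 1 b c)" "\<And>k. k < n \<Longrightarrow> q ^ k * b \<noteq> -1"
  shows "Ext_vanishes (Lam q) (Suc n) M (lreg q) \<longleftrightarrow> q ^ n * b \<noteq> -1"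
  using assms(2,3)
proof (induction n arbitrary: b c M m)
  case 0
  then show ?case using Ext_1_Us[OF assms(1) 0(1)] by simp
next
  case (Suc n)
  have b: "b \<noteq> -1" using Suc.prems(2)[of 0] by simp
  show ?case
    unfolding cyc_Ext_shift[OF Lam_noeth(1) Suc.prems(1)]
    using Suc.IH[OF cyc_Us[OF b]] Suc.prems(2)[of "Suc _"] by (simp add: mult_ac)
qed

lemma Ext_left:
  assumes q: "q \<noteq> 0" and c: "cyc (Lam q) M m (Us q 1 b c)" and k: "\<And>k. k < n \<Longrightarrow> q ^ k * b \<noteq> -1"
  shows "Ext_vanishes (Lam q) (Suc n) M (lreg q) \<longleftrightarrow> q ^ n * b \<noteq> -1"
proof (cases n)
  case 0
  then show ?thesis using Ext_1_Us[OF q c] by simp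
next
  case (Suc n')
  have b: "b \<noteq> -1" using k[of 0] Suc by simp
  show ?thesis
    unfolding Suc cyc_Ext_shift[OF Lam_noeth(1) c]
    using Ext_left_regular[OF q cyc_Us[OF b], of n'] k[of "Suc _"] Suc by (simp add: mult_ac)
qed

text \<open>The syzygies stay in the family, with parameters \<open>b, qb, q\<^sup>2b, \<dots>\<close>, until one of them reaches
  \<open>- 1\<close>, where an extension group is nonzero.\<close>

lemma semi_Gorenstein_Us:
  assumes q: "q \<noteq> 0" and c: "cyc (Lam q) M m (Us q 1 b c)"
  shows "semi_Gorenstein_projective (Lam q) M \<longleftrightarrow> (\<forall>n. q ^ n * b \<noteq> -1)"
proof -
  have "semi_Gorenstein_projective (Lam q) M \<longleftrightarrow> (\<forall>n. Ext_vanishes (Lam q) (Suc n) M (lreg q))"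
    unfolding semi_Gorenstein_projective_def by (metis Suc_le_D Suc_le_mono le0 One_nat_def)
  also have "\<dots> \<longleftrightarrow> (\<forall>n. q ^ n * b \<noteq> -1)"
  proof
    assume e: "\<forall>n. Ext_vanishes (Lam q) (Suc n) M (lreg q)"
    show "\<forall>n. q ^ n * b \<noteq> -1"
    proof
      fix n show "q ^ n * b \<noteq> -1"
        by (induction n rule: less_induct) (use Ext_left[OF q c] e in blast)
    qed
  qed (use Ext_left[OF q c] in blast)
  finally show ?thesis .
qed

lemma Ext_1_right:
  assumes q: "q \<noteq> 0" and c: "cyc (op_ring (Lam q)) N m (Us q 1 b c)"
  shows "b \<noteq> - q \<Longrightarrow> b \<noteq> -1 \<Longrightarrow> Ext_vanishes (op_ring (Lam q)) 1 N (rreg q)"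
    and "b = - q \<Longrightarrow> \<not> Ext_vanishes (op_ring (Lam q)) 1 N (rreg q)"
proof -
  note e = cyc_Ext_1_cyc[OF Lam_noeth(2) c cyc_Us_op[OF q]]
  assume b: "b \<noteq> - q" "b \<noteq> -1"
  have "\<exists>v\<in>carrier (op_ring (Lam q)). w = E q 0 1 b c 0 0 \<otimes>\<^bsub>op_ring (Lam q)\<^esub> v"
    if "w \<in> carrier (op_ring (Lam q))" 
      "\<forall>u\<in>Us q 1 (b / q) (- (c * (1 + b / q))). u \<otimes>\<^bsub>op_ring (Lam q)\<^esub> w = \<zero>\<^bsub>op_ring (Lam q)\<^esub>" for w
  proof -
    have "w \<in> Us q 1 b c" using that lann_right_syzygy[OF q b(1), of c] by auto
    then show ?thesis using Us_left[OF _ b(2)] by simp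
  qed
  then show "Ext_vanishes (op_ring (Lam q)) 1 N (rreg q)" unfolding e by blast
next
  note e = cyc_Ext_1_cyc[OF Lam_noeth(2) c cyc_Us_op[OF q]]
  assume b: "b = - q"
  let ?z = "E q 0 0 0 1 0 0"
  have "\<forall>u\<in>Us q 1 (b / q) (- (c * (1 + b / q))). u \<otimes>\<^bsub>op_ring (Lam q)\<^esub> ?z = \<zero>\<^bsub>op_ring (Lam q)\<^esub>"
    using q by (auto elim!: UsE simp: b E_zero)
  moreover have "?z \<noteq> E q 0 1 b c 0 0 \<otimes>\<^bsub>op_ring (Lam q)\<^esub> v" if "v \<in> carrier (op_ring (Lam q))" for v
    using that by (auto elim!: E_cases)
  moreover have "?z \<in> carrier (op_ring (Lam q))" by simp
  ultimately show "\<not> Ext_vanishes (op_ring (Lam q)) 1 N (rreg q)" unfolding e by blast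
qed

lemma Ext_right_regular:
  fixes N :: "('k::field lam, 'k lam) module"
  assumes q: "q \<noteq> 0" and "cyc (op_ring (Lam q)) N m (Us q 1 b c)"
  shows "(b \<noteq> - (q ^ Suc n) \<longrightarrow> b \<noteq> - (q ^ n) \<longrightarrow> Ext_vanishes (op_ring (Lam q)) (Suc n) N (rreg q)) \<and>
    (b = - (q ^ Suc n) \<longrightarrow> \<not> Ext_vanishes (op_ring (Lam q)) (Suc n) N (rreg q))"
  using assms(2)
proof (induction n arbitrary: b c N m)
  case 0
  then show ?case using Ext_1_right[OF q 0(1)] by simp
next
  case (Suc n)
  have e: "b / q = - (q ^ k) \<longleftrightarrow> b = - (q ^ Suc k)" for k using q by (auto simp: field_simps)
  show ?case
    unfolding cyc_Ext_shift[OF Lam_noeth(2) Suc.prems] by (rule Suc.IH[OF cyc_Us_op[OF q, of b c], unfolded e])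
qed

lemma Ext_right:
  assumes q: "q \<noteq> 0" and c: "cyc (op_ring (Lam q)) N m (Us q 1 b c)"
  shows "b \<noteq> - (q ^ Suc n) \<Longrightarrow> b \<noteq> - (q ^ n) \<Longrightarrow> Ext_vanishes (op_ring (Lam q)) (Suc n) N (rreg q)"
    and "b = - (q ^ Suc n) \<Longrightarrow> \<not> Ext_vanishes (op_ring (Lam q)) (Suc n) N (rreg q)"
proof -
  have "(b \<noteq> - (q ^ Suc n) \<longrightarrow> b \<noteq> - (q ^ n) \<longrightarrow> Ext_vanishes (op_ring (Lam q)) (Suc n) N (rreg q)) \<and>
    (b = - (q ^ Suc n) \<longrightarrow> \<not> Ext_vanishes (op_ring (Lam q)) (Suc n) N (rreg q))"
  proof (cases n)
    case 0
    then show ?thesis using Ext_1_right[OF q c] by simp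
  next
    case (Suc n')
    have e: "b / q = - (q ^ k) \<longleftrightarrow> b = - (q ^ Suc k)" for k using q by (auto simp: field_simps)
    show ?thesis
      unfolding Suc cyc_Ext_shift[OF Lam_noeth(2) c] by (rule Ext_right_regular[OF q cyc_Us_op[OF q, of b c], of n', unfolded e])
  qed
  then show "b \<noteq> - (q ^ Suc n) \<Longrightarrow> b \<noteq> - (q ^ n) \<Longrightarrow> Ext_vanishes (op_ring (Lam q)) (Suc n) N (rreg q)"
    and "b = - (q ^ Suc n) \<Longrightarrow> \<not> Ext_vanishes (op_ring (Lam q)) (Suc n) N (rreg q)" by blast+
qed

section \<open>Modules of dimension at most three\<close>

lemma dep3:
  fixes a1 :: "'k::field"
  shows "\<exists>s t u. (s \<noteq> 0 \<or> t \<noteq> 0 \<or> u \<noteq> 0) \<and> s * a1 + t * b1 + u * c1 = 0 \<and> s * a2 + t * b2 + u * c2 = 0"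
proof -
  let ?P = "\<lambda>s t u. s * a1 + t * b1 + u * c1 = 0 \<and> s * a2 + t * b2 + u * c2 = 0"
  have cross: "?P (b1 * c2 - c1 * b2) (c1 * a2 - a1 * c2) (a1 * b2 - b1 * a2)"
    by (simp add: algebra_simps)
  show ?thesis
  proof (cases "b1 * c2 - c1 * b2 = 0 \<and> c1 * a2 - a1 * c2 = 0 \<and> a1 * b2 - b1 * a2 = 0")
    case False then show ?thesis using cross by blast
  next
    case True
    \<comment> \<open>The two rows are proportional, so one of them suffices.\<close>
    have r1: "b1 * c2 = c1 * b2" "c1 * a2 = a1 * c2" "a1 * b2 = b1 * a2" using True by auto
    consider "a1 \<noteq> 0" | "a2 \<noteq> 0" | "a1 = 0" "a2 = 0" by blast
    then show ?thesis
    proof cases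
      case 1
      have "?P (- b1) a1 0" using r1 by (simp add: algebra_simps)
      then show ?thesis using 1 by blast
    next
      case 2
      have "?P (- b2) a2 0" using r1 by (simp add: algebra_simps)
      then show ?thesis using 2 by blast
    next
      case 3
      have "?P 1 0 0" using 3 by simp
      then show ?thesis using zero_neq_one by metis
    qed
  qed
qed

lemma dep4_aux:
  fixes v :: "nat \<Rightarrow> nat \<Rightarrow> 'k::field"
  assumes "v p 2 \<noteq> 0" "{p, a, b, c} = {0, 1, 2, 3}" "card {p, a, b, c} = 4"
  shows "\<exists>t. (\<exists>j<4. t j \<noteq> 0) \<and> (\<forall>i<3. t p * v p i + t a * v a i + t b * v b i + t c * v c i = 0)"
proof -
  define w where "w j i = v j i - v j 2 / v p 2 * v p i" for j i
  obtain s t u where stu: "s \<noteq> 0 \<or> t \<noteq> 0 \<or> u \<noteq> 0" "s * w a 0 + t * w b 0 + u * w c 0 = 0" "s * w a 1 + t * w b 1 + u * w c 1 = 0"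
    using dep3 by blast
  have w2: "w j 2 = 0" for j using assms(1) by (simp add: w_def)
  define T where "T = (\<lambda>_. 0)(a := s, b := t, c := u, p := - (s * v a 2 + t * v b 2 + u * v c 2) / v p 2)"
  have d: "p \<noteq> a" "p \<noteq> b" "p \<noteq> c" "a \<noteq> b" "a \<noteq> c" "b \<noteq> c"
    using assms(3) by (auto simp: card_insert_if split: if_splits)
  have T: "T a = s" "T b = t" "T c = u" "T p = - (s * v a 2 + t * v b 2 + u * v c 2) / v p 2"
    using d by (simp_all add: T_def)
  have "a \<in> {0, 1, 2, 3}" "b \<in> {0, 1, 2, 3}" "c \<in> {0, 1, 2, 3}" using assms(2) by blast+
  then have "a < 4" "b < 4" "c < 4" by auto
  then have "\<exists>j<4. T j \<noteq> 0" using stu(1) T by metis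
  moreover have "T p * v p i + T a * v a i + T b * v b i + T c * v c i = 0" if "i < 3" for i
  proof -
    have "T p * v p i + T a * v a i + T b * v b i + T c * v c i = s * w a i + t * w b i + u * w c i"
      by (simp add: T w_def algebra_simps add_divide_distrib diff_divide_distrib)
    also have "\<dots> = 0"
    proof -
      have "i = 0 \<or> i = 1 \<or> i = 2" using that by auto
      then show ?thesis using stu w2 by auto
    qed
    finally show ?thesis .
  qed
  ultimately show ?thesis by blast
qed

lemma dep4:
  fixes v :: "nat \<Rightarrow> nat \<Rightarrow> 'k::field"
  shows "\<exists>t :: nat \<Rightarrow> 'k. (\<exists>j<4. t j \<noteq> 0) \<and> (\<forall>i<3. t 0 * v 0 i + t 1 * v 1 i + t 2 * v 2 i + t 3 * v 3 i = 0)"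
proof -
  consider "v 0 2 \<noteq> 0" | "v 1 2 \<noteq> 0" | "v 2 2 \<noteq> 0" | "v 3 2 \<noteq> 0" | "v 0 2 = 0" "v 1 2 = 0" "v 2 2 = 0" "v 3 2 = 0"
    by blast
  then show ?thesis
  proof cases
    case 1 
    from dep4_aux[of v 0 1 2 3, OF 1] show ?thesis by (simp add: insert_commute)
  next
    case 2 
    from dep4_aux[of v 1 0 2 3, OF 2] show ?thesis by (simp add: insert_commute add_ac)
  next
    case 3
    from dep4_aux[of v 2 0 1 3, OF 3] show ?thesis by (simp add: insert_commute add_ac)
  next
    case 4
    from dep4_aux[of v 3 0 1 2, OF 4] show ?thesis by (simp add: insert_commute add_ac)
  next
    case 5
    obtain s t u where stu: "s \<noteq> 0 \<or> t \<noteq> 0 \<or> u \<noteq> 0" "s * v 0 0 + t * v 1 0 + u * v 2 0 = 0" "s * v 0 1 + t * v 1 1 + u * v 2 1 = 0"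
      using dep3 by blast
    define T :: "nat \<Rightarrow> 'k" where "T = (\<lambda>_. 0)(0 := s, 1 := t, 2 := u)"
    have T: "T 0 = s" "T 1 = t" "T 2 = u" "T 3 = 0" by (simp_all add: T_def)
    have "T 0 \<noteq> 0 \<or> T 1 \<noteq> 0 \<or> T 2 \<noteq> 0" using stu(1) T by simp
    moreover have "0 < (4 :: nat)" "1 < (4 :: nat)" "2 < (4 :: nat)" by simp_all
    ultimately have "\<exists>j<4. T j \<noteq> 0" by blast
    moreover have "T 0 * v 0 i + T 1 * v 1 i + T 2 * v 2 i + T 3 * v 3 i = 0" if "i < 3" for i
    proof -
      have "i = 0 \<or> i = 1 \<or> i = 2" using that by auto
      then show ?thesis using stu 5 T by auto
    qed
    ultimately show ?thesis by blast
  qed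
qed

locale small_module =
  fixes q :: "'k::field" and M :: "('k lam, 'm) module" and \<kappa> :: "nat \<Rightarrow> 'm \<Rightarrow> 'k"
  assumes q: "q \<noteq> 0" and Mm: "left_module (Lam q) M"
    and \<kappa>_add: "x \<in> carrier M \<Longrightarrow> y \<in> carrier M \<Longrightarrow> \<kappa> i (x \<oplus>\<^bsub>M\<^esub> y) = \<kappa> i x + \<kappa> i y"
    and \<kappa>_smult: "x \<in> carrier M \<Longrightarrow> \<kappa> i (E q t 0 0 0 0 0 \<odot>\<^bsub>M\<^esub> x) = t * \<kappa> i x"
    and \<kappa>_inj: "x \<in> carrier M \<Longrightarrow> (\<And>i. i < 3 \<Longrightarrow> \<kappa> i x = 0) \<Longrightarrow> x = \<zero>\<^bsub>M\<^esub>"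
begin

sublocale L: left_module "Lam q" M by (rule Mm)

abbreviation act (infixr "\<cdot>" 75) where "r \<cdot> x \<equiv> r \<odot>\<^bsub>M\<^esub> x"
abbreviation sc where "sc t x \<equiv> E q t 0 0 0 0 0 \<odot>\<^bsub>M\<^esub> x"
definition px where "px x = E q 0 1 0 0 0 0 \<cdot> x"
definition py where "py x = E q 0 0 1 0 0 0 \<cdot> x"
definition pz where "pz x = E q 0 0 0 1 0 0 \<cdot> x"

lemma cl [simp]: "x \<in> carrier M \<Longrightarrow> px x \<in> carrier M" "x \<in> carrier M \<Longrightarrow> py x \<in> carrier M"
  "x \<in> carrier M \<Longrightarrow> pz x \<in> carrier M" "x \<in> carrier M \<Longrightarrow> E q a b c d e f \<cdot> x \<in> carrier M"
  by (simp_all add: px_def py_def pz_def)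

lemma \<kappa>_zero [simp]: "\<kappa> i \<zero>\<^bsub>M\<^esub> = 0"
  using \<kappa>_add[of "\<zero>\<^bsub>M\<^esub>" "\<zero>\<^bsub>M\<^esub>" i]
  by (simp only: L.M.l_zero L.M.zero_closed add_cancel_right_right)

lemma \<kappa>_eqI:
  assumes "x \<in> carrier M" "y \<in> carrier M" "\<And>i. i < 3 \<Longrightarrow> \<kappa> i x = \<kappa> i y"
  shows "x = y"
proof -
  have n: "\<kappa> i (\<ominus>\<^bsub>M\<^esub> y) = - \<kappa> i y" for i
    using \<kappa>_add[of y "\<ominus>\<^bsub>M\<^esub> y" i] assms(2) by (simp add: L.M.r_neg add_eq_0_iff)
  have "x \<ominus>\<^bsub>M\<^esub> y = \<zero>\<^bsub>M\<^esub>"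
    using assms by (intro \<kappa>_inj) (simp_all add: a_minus_def \<kappa>_add n)
  then show ?thesis using assms by (simp add: L.M.minus_zero_iff)
qed

lemma \<kappa>_E_full:
  assumes "x \<in> carrier M"
  shows "\<kappa> i (E q a b c d e f \<cdot> x) = a * \<kappa> i x + b * \<kappa> i (px x) + c * \<kappa> i (py x) + d * \<kappa> i (pz x)
    + e * \<kappa> i (E q 0 0 0 0 1 0 \<cdot> x) + f * \<kappa> i (E q 0 0 0 0 0 1 \<cdot> x)"
proof -
  have m: "E q t 0 0 0 0 0 \<cdot> r \<cdot> x = (E q t 0 0 0 0 0 \<otimes>\<^bsub>Lam q\<^esub> r) \<cdot> x" if "r \<in> carrier (Lam q)" for r t
    using L.smult_assoc[of "E q t 0 0 0 0 0" r x] that assms by simp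
  have "E q a b c d e f = E q a 0 0 0 0 0 \<oplus>\<^bsub>Lam q\<^esub> (E q 0 b 0 0 0 0 \<oplus>\<^bsub>Lam q\<^esub> (E q 0 0 c 0 0 0 \<oplus>\<^bsub>Lam q\<^esub>
    (E q 0 0 0 d 0 0 \<oplus>\<^bsub>Lam q\<^esub> (E q 0 0 0 0 e 0 \<oplus>\<^bsub>Lam q\<^esub> E q 0 0 0 0 0 f))))" by simp
  then have "E q a b c d e f \<cdot> x = E q a 0 0 0 0 0 \<cdot> x \<oplus>\<^bsub>M\<^esub> (E q 0 b 0 0 0 0 \<cdot> x \<oplus>\<^bsub>M\<^esub> (E q 0 0 c 0 0 0 \<cdot> x \<oplus>\<^bsub>M\<^esub>
    (E q 0 0 0 d 0 0 \<cdot> x \<oplus>\<^bsub>M\<^esub> (E q 0 0 0 0 e 0 \<cdot> x \<oplus>\<^bsub>M\<^esub> E q 0 0 0 0 0 f \<cdot> x))))"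
    using assms by (simp only: L.smult_l_distr E_closed L.R.a_closed)
  also have "E q 0 b 0 0 0 0 \<cdot> x = sc b (px x)" using m[of "E q 0 1 0 0 0 0" b] by (simp add: px_def)
  also have "E q 0 0 c 0 0 0 \<cdot> x = sc c (py x)" using m[of "E q 0 0 1 0 0 0" c] by (simp add: py_def)
  also have "E q 0 0 0 d 0 0 \<cdot> x = sc d (pz x)" using m[of "E q 0 0 0 1 0 0" d] by (simp add: pz_def)
  also have "E q 0 0 0 0 e 0 \<cdot> x = sc e (E q 0 0 0 0 1 0 \<cdot> x)" using m[of "E q 0 0 0 0 1 0" e] by simp
  also have "E q 0 0 0 0 0 f \<cdot> x = sc f (E q 0 0 0 0 0 1 \<cdot> x)" using m[of "E q 0 0 0 0 0 1" f] by simp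
  finally show ?thesis using assms by (simp add: \<kappa>_add \<kappa>_smult)
qed

lemma ann_mult:
  assumes "x \<in> carrier M" "r \<in> carrier (Lam q)" "s \<in> carrier (Lam q)" "r \<cdot> x = \<zero>\<^bsub>M\<^esub>"
  shows "(s \<otimes>\<^bsub>Lam q\<^esub> r) \<cdot> x = \<zero>\<^bsub>M\<^esub>"
  using L.smult_assoc[OF assms(3,2,1)] assms by (simp add: L.smult_r_null)

lemma dependent4:
  "\<exists>t0 t1 t2 t3. (t0 \<noteq> 0 \<or> t1 \<noteq> 0 \<or> t2 \<noteq> 0 \<or> t3 \<noteq> 0) \<and>
    (\<forall>i<3. t0 * \<kappa> i a + t1 * \<kappa> i b + t2 * \<kappa> i c + t3 * \<kappa> i d = 0)"
proof -
  have nth: "[a, b, c, d] ! 0 = a" "[a, b, c, d] ! 1 = b" "[a, b, c, d] ! 2 = c" "[a, b, c, d] ! 3 = d" by simp_all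
  obtain t :: "nat \<Rightarrow> 'k" where t: "\<exists>j<4. t j \<noteq> 0" "\<forall>i<3. t 0 * \<kappa> i a + t 1 * \<kappa> i b + t 2 * \<kappa> i c + t 3 * \<kappa> i d = 0"
    using dep4[of "\<lambda>j i. \<kappa> i ([a, b, c, d] ! j)"] unfolding nth by blast
  obtain j where j: "j < 4" "t j \<noteq> 0" using t(1) by blast
  then have "j = 0 \<or> j = 1 \<or> j = 2 \<or> j = 3" by auto
  then have "t 0 \<noteq> 0 \<or> t 1 \<noteq> 0 \<or> t 2 \<noteq> 0 \<or> t 3 \<noteq> 0" using j(2) by auto
  then show ?thesis using t(2) by blast
qed

text \<open>If \<open>rad\<^sup>2 m \<noteq> 0\<close> then \<open>m\<close>, \<open>rad m\<close> modulo \<open>rad\<^sup>2 m\<close> and \<open>rad\<^sup>2 m\<close> contribute at least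
  \<open>1 + 2 + 1\<close> dimensions, because \<open>rad W = rad\<^sup>2\<close> for every plane \<open>W\<close> in \<open>rad/rad\<^sup>2\<close>.\<close>

lemma soc_zero:
  assumes m: "m \<in> carrier M"
  shows "E q 0 0 0 0 u v \<cdot> m = \<zero>\<^bsub>M\<^esub>"
proof (rule ccontr)
  assume nz: "E q 0 0 0 0 u v \<cdot> m \<noteq> \<zero>\<^bsub>M\<^esub>"
  let ?c = "E q 0 0 0 0 u v \<cdot> m"
  note am = ann_mult[OF m E_closed E_closed]
  have top: "t0 = 0" if r: "E q t0 a b c d e \<cdot> m = \<zero>\<^bsub>M\<^esub>" for t0 a b c d e
  proof (rule ccontr)
    assume "t0 \<noteq> 0"
    then show False using am[OF r, of 0 0 0 0 "u / t0" "v / t0"] nz by simp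
  qed
  have kc: "\<kappa> i (E q t a b c (s * u) (s * v) \<cdot> m) =
      t * \<kappa> i m + a * \<kappa> i (px m) + b * \<kappa> i (py m) + c * \<kappa> i (pz m) + s * \<kappa> i ?c" for i t a b c s
    unfolding \<kappa>_E_full[OF m, of i t a b c "s * u" "s * v"] \<kappa>_E_full[OF m, of i 0 0 0 0 u v]
    by (simp add: algebra_simps)
  have "E q 0 0 0 0 1 0 \<cdot> m = \<zero>\<^bsub>M\<^esub>"
  proof -
    obtain t0 t1 t2 t3 where t: "t0 \<noteq> 0 \<or> t1 \<noteq> 0 \<or> t2 \<noteq> 0 \<or> t3 \<noteq> 0"
      "\<And>i. i < 3 \<Longrightarrow> t0 * \<kappa> i m + t1 * \<kappa> i (px m) + t2 * \<kappa> i (py m) + t3 * \<kappa> i ?c = 0"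
      using dependent4[of "m" "px m" "py m" "E q 0 0 0 0 u v \<cdot> m"] by blast
    have r: "E q t0 t1 t2 0 (t3 * u) (t3 * v) \<cdot> m = \<zero>\<^bsub>M\<^esub>"
      by (rule \<kappa>_inj) (use m t(2) in \<open>simp_all add: kc\<close>)
    have t0: "t0 = 0" using top[OF r] .
    have "t1 \<noteq> 0 \<or> t2 \<noteq> 0"
    proof (rule ccontr)
      assume n: "\<not> (t1 \<noteq> 0 \<or> t2 \<noteq> 0)"
      then have "t3 \<noteq> 0" using t(1) t0 by auto
      then show False using am[OF r, of "1 / t3" 0 0 0 0 0] n t0 nz by simp
    qed
    then show ?thesis
    proof
      assume "t1 \<noteq> 0" then show ?thesis using am[OF r, of 0 0 "1 / t1" 0 0 0] t0 by simp
    next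
      assume "t2 \<noteq> 0" then show ?thesis using am[OF r, of 0 "- 1 / (q * t2)" 0 0 0 0] t0 q by simp
    qed
  qed
  moreover have "E q 0 0 0 0 0 1 \<cdot> m = \<zero>\<^bsub>M\<^esub>"
  proof -
    obtain t0 t1 t2 t3 where t: "t0 \<noteq> 0 \<or> t1 \<noteq> 0 \<or> t2 \<noteq> 0 \<or> t3 \<noteq> 0"
      "\<And>i. i < 3 \<Longrightarrow> t0 * \<kappa> i m + t1 * \<kappa> i (px m) + t2 * \<kappa> i (pz m) + t3 * \<kappa> i ?c = 0"
      using dependent4[of "m" "px m" "pz m" "E q 0 0 0 0 u v \<cdot> m"] by blast
    have r: "E q t0 t1 0 t2 (t3 * u) (t3 * v) \<cdot> m = \<zero>\<^bsub>M\<^esub>"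
      by (rule \<kappa>_inj) (use m t(2) in \<open>simp_all add: kc\<close>)
    have t0: "t0 = 0" using top[OF r] .
    have "t1 \<noteq> 0 \<or> t2 \<noteq> 0"
    proof (rule ccontr)
      assume n: "\<not> (t1 \<noteq> 0 \<or> t2 \<noteq> 0)"
      then have "t3 \<noteq> 0" using t(1) t0 by auto
      then show False using am[OF r, of "1 / t3" 0 0 0 0 0] n t0 nz by simp
    qed
    then show ?thesis
    proof
      assume "t1 \<noteq> 0" then show ?thesis using am[OF r, of 0 0 0 "1 / t1" 0 0] t0 by simp
    next
      assume "t2 \<noteq> 0" then show ?thesis using am[OF r, of 0 "1 / t2" 0 0 0 0] t0 by simp
    qed
  qed
  ultimately have "?c = \<zero>\<^bsub>M\<^esub>" using m by (intro \<kappa>_inj) (simp_all add: \<kappa>_E_full[of m _ 0 0 0 0 u v])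
  then show False using nz by simp
qed

lemma \<kappa>_E: "x \<in> carrier M \<Longrightarrow>
  \<kappa> i (E q a b c d e f \<cdot> x) = a * \<kappa> i x + b * \<kappa> i (px x) + c * \<kappa> i (py x) + d * \<kappa> i (pz x)"
  unfolding \<kappa>_E_full[of x i a b c d e f] soc_zero by simp

lemma pp [simp]:
  assumes "x \<in> carrier M"
  shows "px (px x) = \<zero>\<^bsub>M\<^esub>" "px (py x) = \<zero>\<^bsub>M\<^esub>" "px (pz x) = \<zero>\<^bsub>M\<^esub>"
    "py (px x) = \<zero>\<^bsub>M\<^esub>" "py (py x) = \<zero>\<^bsub>M\<^esub>" "py (pz x) = \<zero>\<^bsub>M\<^esub>"
    "pz (px x) = \<zero>\<^bsub>M\<^esub>" "pz (py x) = \<zero>\<^bsub>M\<^esub>" "pz (pz x) = \<zero>\<^bsub>M\<^esub>"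
  using assms by (simp_all add: px_def py_def pz_def L.smult_assoc[symmetric] soc_zero)

lemma p_lin:
  assumes "x \<in> carrier M" "y \<in> carrier M"
  shows "px (x \<oplus>\<^bsub>M\<^esub> y) = px x \<oplus>\<^bsub>M\<^esub> px y" "py (x \<oplus>\<^bsub>M\<^esub> y) = py x \<oplus>\<^bsub>M\<^esub> py y" "pz (x \<oplus>\<^bsub>M\<^esub> y) = pz x \<oplus>\<^bsub>M\<^esub> pz y"
  using assms by (simp_all add: px_def py_def pz_def L.smult_r_distr)

lemma p_sc:
  assumes "x \<in> carrier M"
  shows "px (sc t x) = sc t (px x)" "py (sc t x) = sc t (py x)" "pz (sc t x) = sc t (pz x)"
  using assms by (simp_all add: px_def py_def pz_def L.smult_assoc[symmetric])

lemma p_zero [simp]: "px \<zero>\<^bsub>M\<^esub> = \<zero>\<^bsub>M\<^esub>" "py \<zero>\<^bsub>M\<^esub> = \<zero>\<^bsub>M\<^esub>" "pz \<zero>\<^bsub>M\<^esub> = \<zero>\<^bsub>M\<^esub>"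
  by (simp_all add: px_def py_def pz_def L.smult_r_null)

definition indep where
  "indep x y \<longleftrightarrow> (\<forall>s t. (\<forall>i<3. s * \<kappa> i x + t * \<kappa> i y = 0) \<longrightarrow> s = 0 \<and> t = 0)"

lemma indepD: "indep x y \<Longrightarrow> (\<And>i. i < 3 \<Longrightarrow> s * \<kappa> i x + t * \<kappa> i y = 0) \<Longrightarrow> s = 0 \<and> t = 0"
  unfolding indep_def by blast

lemma indep_nonzero:
  assumes "indep x y" shows "x \<noteq> \<zero>\<^bsub>M\<^esub>" "y \<noteq> \<zero>\<^bsub>M\<^esub>"
  using assms[unfolded indep_def, rule_format, of 1 0] assms[unfolded indep_def, rule_format, of 0 1] by auto

lemma not_indep:
  assumes "\<not> indep x y" "x \<in> carrier M" "y \<in> carrier M" "x \<noteq> \<zero>\<^bsub>M\<^esub>"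
  obtains t where "y = sc t x"
proof -
  obtain s t where st: "\<forall>i<3. s * \<kappa> i x + t * \<kappa> i y = 0" "s \<noteq> 0 \<or> t \<noteq> 0"
    using assms(1) unfolding indep_def by blast
  have "t \<noteq> 0"
  proof
    assume t: "t = 0"
    then have "x = \<zero>\<^bsub>M\<^esub>" using st by (intro \<kappa>_inj assms(2)) auto
    then show False using assms(4) by blast
  qed
  then have "\<kappa> i y = - (s / t) * \<kappa> i x" if "i < 3" for i
    using st(1) that by (auto simp: field_simps add_eq_0_iff)
  then have "y = sc (- (s / t)) x" using assms(2,3) by (intro \<kappa>_eqI) (simp_all add: \<kappa>_smult)
  then show ?thesis by (rule that)
qed

lemma cyc_if_indep:
  assumes m: "m \<in> carrier M"
    and i: "indep (px m) (py m) \<or> indep (px m) (pz m) \<or> indep (py m) (pz m)"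
  shows "\<exists>a b c. (a \<noteq> 0 \<or> b \<noteq> 0 \<or> c \<noteq> 0) \<and> cyc (Lam q) M m (Us q a b c)"
proof -
  note am = ann_mult[OF m E_closed E_closed]
  have nz: "px m \<noteq> \<zero>\<^bsub>M\<^esub> \<or> py m \<noteq> \<zero>\<^bsub>M\<^esub>"
    using i indep_nonzero by blast
  have top: "t0 = 0" if r: "E q t0 a b c d e \<cdot> m = \<zero>\<^bsub>M\<^esub>" for t0 a b c d e
  proof (rule ccontr)
    assume t0: "t0 \<noteq> 0"
    have "\<kappa> j (px m) = 0" "\<kappa> j (py m) = 0" for j
      using arg_cong[OF am[OF r, of 0 "1 / t0" 0 0 0 0], of "\<kappa> j"] arg_cong[OF am[OF r, of 0 0 "1 / t0" 0 0 0], of "\<kappa> j"] m t0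
      by (simp_all add: \<kappa>_E)
    then show False using nz \<kappa>_inj[of "px m"] \<kappa>_inj[of "py m"] m by simp
  qed
  have zero: "a = 0 \<and> b = 0 \<and> c = 0"
    if "\<forall>j<3. a * \<kappa> j (px m) + b * \<kappa> j (py m) + c * \<kappa> j (pz m) = 0"
     "indep (px m) (py m) \<and> c = 0 \<or> indep (px m) (pz m) \<and> b = 0 \<or> indep (py m) (pz m) \<and> a = 0" for a b c
    using that(2)
  proof (elim disjE conjE)
    assume "indep (px m) (py m)" "c = 0"
    then show ?thesis using indepD[of "px m" "py m" a b] that(1) by simp
  next
    assume "indep (px m) (pz m)" "b = 0"
    then show ?thesis using indepD[of "px m" "pz m" a c] that(1) by simp
  next
    assume "indep (py m) (pz m)" "a = 0"
    then show ?thesis using indepD[of "py m" "pz m" b c] that(1) by simp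
  qed
  have surj: "\<exists>r\<in>carrier (Lam q). x = r \<cdot> m" if x: "x \<in> carrier M" for x
  proof -
    have *: "\<exists>t0 a b c t. (t \<noteq> 0 \<or> t0 \<noteq> 0 \<or> a \<noteq> 0 \<or> b \<noteq> 0 \<or> c \<noteq> 0) \<and>
       (indep (px m) (py m) \<and> c = 0 \<or> indep (px m) (pz m) \<and> b = 0 \<or> indep (py m) (pz m) \<and> a = 0) \<and>
       (\<forall>j<3. t0 * \<kappa> j m + a * \<kappa> j (px m) + b * \<kappa> j (py m) + c * \<kappa> j (pz m) + t * \<kappa> j x = 0)"
      using i
    proof (elim disjE)
      assume I: "indep (px m) (py m)"
      obtain t0 t1 t2 t3 where t: "t0 \<noteq> 0 \<or> t1 \<noteq> 0 \<or> t2 \<noteq> 0 \<or> t3 \<noteq> 0"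
        "\<And>i. i < 3 \<Longrightarrow> t0 * \<kappa> i m + t1 * \<kappa> i (px m) + t2 * \<kappa> i (py m) + t3 * \<kappa> i x = 0"
        using dependent4[of "m" "px m" "py m" "x"] by blast
      show ?thesis
        by (rule exI[of _ t0], rule exI[of _ t1], rule exI[of _ t2], rule exI[of _ 0], rule exI[of _ t3], intro conjI; (use t(1) in blast | use I in \<open>simp; fail\<close> | use t(2) in simp))
    next
      assume I: "indep (px m) (pz m)"
      obtain t0 t1 t2 t3 where t: "t0 \<noteq> 0 \<or> t1 \<noteq> 0 \<or> t2 \<noteq> 0 \<or> t3 \<noteq> 0"
        "\<And>i. i < 3 \<Longrightarrow> t0 * \<kappa> i m + t1 * \<kappa> i (px m) + t2 * \<kappa> i (pz m) + t3 * \<kappa> i x = 0"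
        using dependent4[of "m" "px m" "pz m" "x"] by blast
      show ?thesis
        by (rule exI[of _ t0], rule exI[of _ t1], rule exI[of _ 0], rule exI[of _ t2], rule exI[of _ t3], intro conjI; (use t(1) in blast | use I in \<open>simp; fail\<close> | use t(2) in simp))
    next
      assume I: "indep (py m) (pz m)"
      obtain t0 t1 t2 t3 where t: "t0 \<noteq> 0 \<or> t1 \<noteq> 0 \<or> t2 \<noteq> 0 \<or> t3 \<noteq> 0"
        "\<And>i. i < 3 \<Longrightarrow> t0 * \<kappa> i m + t1 * \<kappa> i (py m) + t2 * \<kappa> i (pz m) + t3 * \<kappa> i x = 0"
        using dependent4[of "m" "py m" "pz m" "x"] by blast
      show ?thesis
        by (rule exI[of _ t0], rule exI[of _ 0], rule exI[of _ t1], rule exI[of _ t2], rule exI[of _ t3], intro conjI; (use t(1) in blast | use I in \<open>simp; fail\<close> | use t(2) in simp))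
    qed
    then obtain t0 a b c t where t: "t \<noteq> 0 \<or> t0 \<noteq> 0 \<or> a \<noteq> 0 \<or> b \<noteq> 0 \<or> c \<noteq> 0"
       "indep (px m) (py m) \<and> c = 0 \<or> indep (px m) (pz m) \<and> b = 0 \<or> indep (py m) (pz m) \<and> a = 0"
       "\<And>j. j < 3 \<Longrightarrow> t0 * \<kappa> j m + a * \<kappa> j (px m) + b * \<kappa> j (py m) + c * \<kappa> j (pz m) + t * \<kappa> j x = 0"
      by blast
    have "t \<noteq> 0"
    proof
      assume t0: "t = 0"
      have "E q t0 a b c 0 0 \<cdot> m = \<zero>\<^bsub>M\<^esub>" using t(3) m t0 by (intro \<kappa>_inj) (simp_all add: \<kappa>_E)
      then have "t0 = 0" by (rule top)
      moreover from this have "\<forall>j<3. a * \<kappa> j (px m) + b * \<kappa> j (py m) + c * \<kappa> j (pz m) = 0" using t(3) t0 by simp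
      from zero[OF this t(2)] have "a = 0 \<and> b = 0 \<and> c = 0" .
      ultimately show False using t(1) t0 by simp
    qed
    have "x = E q (- t0 / t) (- a / t) (- b / t) (- c / t) 0 0 \<cdot> m"
    proof (rule \<kappa>_eqI)
      fix j :: nat assume "j < 3"
      from t(3)[OF this] have "t * \<kappa> j x = - (t0 * \<kappa> j m + a * \<kappa> j (px m) + b * \<kappa> j (py m) + c * \<kappa> j (pz m))"
        by (metis add.commute eq_neg_iff_add_eq_0)
      then have "\<kappa> j x = - (t0 * \<kappa> j m + a * \<kappa> j (px m) + b * \<kappa> j (py m) + c * \<kappa> j (pz m)) / t"
        using \<open>t \<noteq> 0\<close> by (metis nonzero_mult_div_cancel_left)
      also have "\<dots> = \<kappa> j (E q (- t0 / t) (- a / t) (- b / t) (- c / t) 0 0 \<cdot> m)"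
        using m by (simp add: \<kappa>_E add_divide_distrib diff_divide_distrib)
      finally show "\<kappa> j x = \<kappa> j (E q (- t0 / t) (- a / t) (- b / t) (- c / t) 0 0 \<cdot> m)" .
    qed (use x m in auto)
    then show ?thesis using E_closed by blast
  qed
  obtain t0 a b c where t: "t0 \<noteq> 0 \<or> a \<noteq> 0 \<or> b \<noteq> 0 \<or> c \<noteq> 0"
    "\<And>i. i < 3 \<Longrightarrow> t0 * \<kappa> i m + a * \<kappa> i (px m) + b * \<kappa> i (py m) + c * \<kappa> i (pz m) = 0"
    using dependent4[of "m" "px m" "py m" "pz m"] by blast
  have r: "E q t0 a b c 0 0 \<cdot> m = \<zero>\<^bsub>M\<^esub>" using t m by (intro \<kappa>_inj) (simp_all add: \<kappa>_E)
  have t0: "t0 = 0" by (rule top[OF r])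
  then have abc: "a \<noteq> 0 \<or> b \<noteq> 0 \<or> c \<noteq> 0" using t(1) by auto
  have k0: "a * \<kappa> j (px m) + b * \<kappa> j (py m) + c * \<kappa> j (pz m) = 0" if "j < 3" for j using t(2)[OF that] t0 by simp
  \<comment> \<open>The coefficient vector of the relation is nonzero outside an independent pair.\<close>
  have mult: "\<exists>s. l1 = s * a \<and> l2 = s * b \<and> l3 = s * c"
    if l: "\<And>j. j < 3 \<Longrightarrow> l1 * \<kappa> j (px m) + l2 * \<kappa> j (py m) + l3 * \<kappa> j (pz m) = 0" for l1 l2 l3
  proof -
    have comb: "(l1 - s * a) * \<kappa> j (px m) + (l2 - s * b) * \<kappa> j (py m) + (l3 - s * c) * \<kappa> j (pz m) = 0" if "j < 3" for s j
    proof -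
      have "(l1 - s * a) * \<kappa> j (px m) + (l2 - s * b) * \<kappa> j (py m) + (l3 - s * c) * \<kappa> j (pz m)
        = (l1 * \<kappa> j (px m) + l2 * \<kappa> j (py m) + l3 * \<kappa> j (pz m)) - s * (a * \<kappa> j (px m) + b * \<kappa> j (py m) + c * \<kappa> j (pz m))"
        by (simp add: algebra_simps)
      then show ?thesis using l[OF that] k0[OF that] by simp
    qed
    have n: "\<not> (indep (px m) (py m) \<and> c = 0 \<or> indep (px m) (pz m) \<and> b = 0 \<or> indep (py m) (pz m) \<and> a = 0)"
      using zero[of a b c] k0 abc by blast
    have "\<exists>s. indep (px m) (py m) \<and> l3 - s * c = 0 \<or> indep (px m) (pz m) \<and> l2 - s * b = 0 \<or> indep (py m) (pz m) \<and> l1 - s * a = 0"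
      using i
    proof (elim disjE)
      assume "indep (px m) (py m)" then show ?thesis using n by (intro exI[of _ "l3 / c"]) auto
    next
      assume "indep (px m) (pz m)" then show ?thesis using n by (intro exI[of _ "l2 / b"]) auto
    next
      assume "indep (py m) (pz m)" then show ?thesis using n by (intro exI[of _ "l1 / a"]) auto
    qed
    then obtain s where "indep (px m) (py m) \<and> l3 - s * c = 0 \<or> indep (px m) (pz m) \<and> l2 - s * b = 0 \<or> indep (py m) (pz m) \<and> l1 - s * a = 0" ..
    from zero[OF _ this] comb[of _ s] show ?thesis by (intro exI[of _ s]) auto
  qed
  have "Us q a b c = {r \<in> carrier (Lam q). r \<cdot> m = \<zero>\<^bsub>M\<^esub>}"
  proof (rule Lam_set_eqI[OF Us_carrier(1)])
    fix r0 r1 r2 r3 r4 r5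
    show "E q r0 r1 r2 r3 r4 r5 \<in> Us q a b c \<longleftrightarrow> E q r0 r1 r2 r3 r4 r5 \<in> {r \<in> carrier (Lam q). r \<cdot> m = \<zero>\<^bsub>M\<^esub>}"
    proof
      assume "E q r0 r1 r2 r3 r4 r5 \<in> Us q a b c"
      then obtain s where s: "r0 = 0" "r1 = s * a" "r2 = s * b" "r3 = s * c" unfolding E_Us by blast
      have "E q r0 r1 r2 r3 r4 r5 \<cdot> m = \<zero>\<^bsub>M\<^esub>"
      proof (rule \<kappa>_inj)
        fix j :: nat assume "j < 3"
        have "\<kappa> j (E q r0 r1 r2 r3 r4 r5 \<cdot> m) = s * (a * \<kappa> j (px m) + b * \<kappa> j (py m) + c * \<kappa> j (pz m))"
          using m s by (simp add: \<kappa>_E algebra_simps)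
        then show "\<kappa> j (E q r0 r1 r2 r3 r4 r5 \<cdot> m) = 0" using k0[OF \<open>j < 3\<close>] by simp
      qed (use m in simp)
      then show "E q r0 r1 r2 r3 r4 r5 \<in> {r \<in> carrier (Lam q). r \<cdot> m = \<zero>\<^bsub>M\<^esub>}" by simp
    next
      assume "E q r0 r1 r2 r3 r4 r5 \<in> {r \<in> carrier (Lam q). r \<cdot> m = \<zero>\<^bsub>M\<^esub>}"
      then have rm: "E q r0 r1 r2 r3 r4 r5 \<cdot> m = \<zero>\<^bsub>M\<^esub>" by simp
      have r0: "r0 = 0" by (rule top[OF rm])
      have "r1 * \<kappa> j (px m) + r2 * \<kappa> j (py m) + r3 * \<kappa> j (pz m) = 0" for j
        using arg_cong[OF rm, of "\<kappa> j"] m r0 by (simp add: \<kappa>_E)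
      then show "E q r0 r1 r2 r3 r4 r5 \<in> Us q a b c" unfolding E_Us using r0 mult by blast
    qed
  qed auto
  then show ?thesis using abc surj m Mm unfolding cyc_def by blast
qed

text \<open>In the remaining cases \<open>rad m\<close> is at most one-dimensional for every \<open>m\<close>.\<close>

lemma rad_line:
  assumes m: "m \<in> carrier M"
    and i: "\<not> indep (px m) (py m)" "\<not> indep (px m) (pz m)" "\<not> indep (py m) (pz m)"
  obtains n a b c where "n \<in> carrier M" "px m = sc a n" "py m = sc b n" "pz m = sc c n"
    "px n = \<zero>\<^bsub>M\<^esub>" "py n = \<zero>\<^bsub>M\<^esub>" "pz n = \<zero>\<^bsub>M\<^esub>" "n = \<zero>\<^bsub>M\<^esub> \<or> a \<noteq> 0 \<or> b \<noteq> 0 \<or> c \<noteq> 0"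
proof -
  have one: "x = sc 1 x" and zero: "\<zero>\<^bsub>M\<^esub> = sc 0 x" if "x \<in> carrier M" for x
    using that by (auto intro!: \<kappa>_eqI simp: \<kappa>_smult)
  show ?thesis
  proof (cases "px m = \<zero>\<^bsub>M\<^esub>")
    case False
    obtain b where b: "py m = sc b (px m)" using not_indep[OF i(1)] m False by auto
    obtain c where c: "pz m = sc c (px m)" using not_indep[OF i(2)] m False by auto
    show ?thesis by (rule that[of "px m" 1 b c]) (use m b c one[of "px m"] in simp_all)
  next
    case x: True
    show ?thesis
    proof (cases "py m = \<zero>\<^bsub>M\<^esub>")
      case False
      obtain c where c: "pz m = sc c (py m)" using not_indep[OF i(3)] m False by auto
      show ?thesis by (rule that[of "py m" 0 1 c]) (use m c x one[of "py m"] zero[of "py m"] in simp_all)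
    next
      case True
      show ?thesis by (rule that[of "pz m" 0 0 1]) (use m True x one[of "pz m"] zero[of "pz m"] in simp_all)
    qed
  qed
qed

text \<open>Two generators \<open>m\<close>, \<open>m'\<close> whose radicals lie in a common line, without simple direct summand.\<close>

definition two_gens where
  "two_gens m m' n a b c a' b' c' \<longleftrightarrow> m \<in> carrier M \<and> m' \<in> carrier M \<and> n \<in> carrier M \<and>
    px m = sc a n \<and> py m = sc b n \<and> pz m = sc c n \<and> px m' = sc a' n \<and> py m' = sc b' n \<and> pz m' = sc c' n \<and>
    px n = \<zero>\<^bsub>M\<^esub> \<and> py n = \<zero>\<^bsub>M\<^esub> \<and> pz n = \<zero>\<^bsub>M\<^esub> \<and>
    (\<forall>s t u. sc s m \<oplus>\<^bsub>M\<^esub> (sc t m' \<oplus>\<^bsub>M\<^esub> sc u n) = \<zero>\<^bsub>M\<^esub> \<longrightarrow> s = 0 \<and> t = 0 \<and> u = 0) \<and>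
    (\<forall>x\<in>carrier M. \<exists>s t u. x = sc s m \<oplus>\<^bsub>M\<^esub> (sc t m' \<oplus>\<^bsub>M\<^esub> sc u n)) \<and>
    (\<forall>s t. s * a + t * a' = 0 \<and> s * b + t * b' = 0 \<and> s * c + t * c' = 0 \<longrightarrow> s = 0 \<and> t = 0)"

lemma sub_k:
  assumes "A \<subseteq> carrier M" "\<zero>\<^bsub>M\<^esub> \<in> A" "\<And>x y. x \<in> A \<Longrightarrow> y \<in> A \<Longrightarrow> x \<oplus>\<^bsub>M\<^esub> y \<in> A"
    "\<And>x a b c d. x \<in> A \<Longrightarrow> E q a b c d 0 0 \<cdot> x \<in> A"
  shows "submodule A (Lam q) M"
proof (rule L.submodI)
  fix r x assume r: "r \<in> carrier (Lam q)" and x: "x \<in> A"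
  obtain a b c d e f where re: "r = E q a b c d e f" by (rule E_cases[OF r])
  have "r \<cdot> x = E q a b c d 0 0 \<cdot> x"
    using x assms(1) by (intro \<kappa>_eqI) (auto simp: re \<kappa>_E subset_iff)
  then show "r \<cdot> x \<in> A" using assms(4)[OF x] by simp
qed (use assms in auto)

lemma indec:
  assumes "indecomposable (Lam q) M" "submodule A (Lam q) M" "submodule B (Lam q) M"
    "\<And>x. x \<in> carrier M \<Longrightarrow> \<exists>y\<in>A. \<exists>z\<in>B. x = y \<oplus>\<^bsub>M\<^esub> z" "\<And>x. x \<in> A \<Longrightarrow> x \<in> B \<Longrightarrow> x = \<zero>\<^bsub>M\<^esub>"
  shows "A = {\<zero>\<^bsub>M\<^esub>} \<or> B = {\<zero>\<^bsub>M\<^esub>}"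
proof -
  note A = L.submodD[OF assms(2)] and B = L.submodD[OF assms(3)]
  have "set_add M A B = carrier M"
  proof
    show "set_add M A B \<subseteq> carrier M" unfolding set_add_def' using A(1) B(1) by blast
    show "carrier M \<subseteq> set_add M A B" unfolding set_add_def' using assms(4) by blast
  qed
  moreover have "A \<inter> B = {\<zero>\<^bsub>M\<^esub>}" using assms(5) A(2) B(2) by blast
  ultimately show ?thesis using assms(1-3) unfolding indecomposable_def by blast
qed

lemma trivial_action:
  assumes ind: "indecomposable (Lam q) M"
    and tr: "\<And>x. x \<in> carrier M \<Longrightarrow> px x = \<zero>\<^bsub>M\<^esub> \<and> py x = \<zero>\<^bsub>M\<^esub> \<and> pz x = \<zero>\<^bsub>M\<^esub>"
  shows "\<exists>m. cyc (Lam q) M m (Vs q 0 0 0)"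
proof -
  obtain m where m: "m \<in> carrier M" "m \<noteq> \<zero>\<^bsub>M\<^esub>" using ind unfolding indecomposable_def by auto
  then obtain j where j: "\<kappa> j m \<noteq> 0" using \<kappa>_inj by blast
  let ?A = "{sc t m | t. True}" and ?B = "{x \<in> carrier M. \<kappa> j x = 0}"
  have scE: "E q a b c d e f \<cdot> x = sc a x" if "x \<in> carrier M" for a b c d e f x
    using that tr[OF that] by (intro \<kappa>_eqI) (simp_all add: \<kappa>_E)
  have zero: "\<zero>\<^bsub>M\<^esub> = sc 0 m" using m by (intro \<kappa>_eqI) (simp_all add: \<kappa>_smult)
  have A: "submodule ?A (Lam q) M"
  proof (rule sub_k)
    show "\<zero>\<^bsub>M\<^esub> \<in> ?A" using zero by blast
    fix x y assume "x \<in> ?A" "y \<in> ?A"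
    then obtain s t where "x = sc s m" "y = sc t m" by blast
    then have "x \<oplus>\<^bsub>M\<^esub> y = sc (s + t) m" using m by (intro \<kappa>_eqI) (simp_all add: \<kappa>_smult \<kappa>_add algebra_simps)
    then show "x \<oplus>\<^bsub>M\<^esub> y \<in> ?A" by blast
  next
    fix x a b c d assume "x \<in> ?A"
    then obtain s where "x = sc s m" by blast
    then have "E q a b c d 0 0 \<cdot> x = sc (a * s) m" using m scE[of x a b c d 0 0]
      by (intro \<kappa>_eqI) (simp_all add: \<kappa>_smult algebra_simps)
    then show "E q a b c d 0 0 \<cdot> x \<in> ?A" by blast
  qed (use m in auto)
  have B: "submodule ?B (Lam q) M"
  proof -
    have "\<kappa> i (E q a b c d e f \<cdot> x) = a * \<kappa> i x" if "x \<in> carrier M" for i a b c d e f x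
      using that tr[OF that] by (simp add: \<kappa>_E)
    then show ?thesis by (intro sub_k) (auto simp: \<kappa>_add)
  qed
  have "?A = {\<zero>\<^bsub>M\<^esub>} \<or> ?B = {\<zero>\<^bsub>M\<^esub>}"
  proof (rule indec[OF ind A B])
    fix x assume x: "x \<in> carrier M"
    let ?t = "\<kappa> j x / \<kappa> j m"
    have "x = sc ?t m \<oplus>\<^bsub>M\<^esub> (x \<oplus>\<^bsub>M\<^esub> sc (- ?t) m)"
      using x m by (intro \<kappa>_eqI) (simp_all add: \<kappa>_add \<kappa>_smult)
    moreover have "x \<oplus>\<^bsub>M\<^esub> sc (- ?t) m \<in> ?B" using x m j by (simp add: \<kappa>_add \<kappa>_smult)
    ultimately show "\<exists>y\<in>?A. \<exists>z\<in>?B. x = y \<oplus>\<^bsub>M\<^esub> z" by blast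
  next
    fix x assume "x \<in> ?A" "x \<in> ?B"
    then obtain t where t: "x = sc t m" "\<kappa> j x = 0" by blast
    then have "t = 0" using m j by (simp add: \<kappa>_smult)
    then show "x = \<zero>\<^bsub>M\<^esub>" using t zero by simp
  qed
  moreover have "m = sc 1 m" using m by (intro \<kappa>_eqI) (simp_all add: \<kappa>_smult)
  ultimately have B0: "?B = {\<zero>\<^bsub>M\<^esub>}" using m(2) by blast
  have "\<exists>r\<in>carrier (Lam q). x = r \<cdot> m" if x: "x \<in> carrier M" for x
  proof -
    let ?t = "\<kappa> j x / \<kappa> j m"
    have "x \<oplus>\<^bsub>M\<^esub> sc (- ?t) m \<in> ?B" using x m j by (simp add: \<kappa>_add \<kappa>_smult)
    then have z: "x \<oplus>\<^bsub>M\<^esub> sc (- ?t) m = \<zero>\<^bsub>M\<^esub>" using B0 by blast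
    have e: "\<kappa> i x = ?t * \<kappa> i m" for i
      using arg_cong[OF z, of "\<kappa> i"] x m by (simp add: \<kappa>_add \<kappa>_smult)
    have "x = sc ?t m"
    proof (rule \<kappa>_eqI)
      show "\<kappa> i x = \<kappa> i (sc ?t m)" for i unfolding \<kappa>_smult[OF m(1)] by (rule e)
    qed (use x m in simp_all)
    then show ?thesis using E_closed by blast
  qed
  moreover have "Vs q 0 0 0 = {r \<in> carrier (Lam q). r \<cdot> m = \<zero>\<^bsub>M\<^esub>}"
  proof (rule Lam_set_eqI[OF Us_carrier(2)])
    fix a b c d e f
    have "sc a m = \<zero>\<^bsub>M\<^esub> \<longleftrightarrow> a = 0"
    proof
      assume "sc a m = \<zero>\<^bsub>M\<^esub>"
      then have "\<kappa> j (sc a m) = 0" by (simp only: \<kappa>_zero)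
      then show "a = 0" using \<kappa>_smult[OF m(1)] j by simp
    qed (use zero in simp)
    then show "E q a b c d e f \<in> Vs q 0 0 0 \<longleftrightarrow> E q a b c d e f \<in> {r \<in> carrier (Lam q). r \<cdot> m = \<zero>\<^bsub>M\<^esub>}"
      unfolding E_Vs mem_Collect_eq scE[OF m(1), of a b c d e f] by simp
  qed auto
  ultimately show ?thesis using m Mm unfolding cyc_def by blast
qed


lemma classification:
  assumes ind: "indecomposable (Lam q) M"
  shows "(\<exists>m. cyc (Lam q) M m (Vs q 0 0 0)) \<or>
    (\<exists>m a b c. (a \<noteq> 0 \<or> b \<noteq> 0 \<or> c \<noteq> 0) \<and> cyc (Lam q) M m (Vs q a b c)) \<or>
    (\<exists>m a b c. (a \<noteq> 0 \<or> b \<noteq> 0 \<or> c \<noteq> 0) \<and> cyc (Lam q) M m (Us q a b c)) \<or>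
    (\<exists>m m' n a b c a' b' c'. two_gens m m' n a b c a' b' c')"
proof (cases "\<exists>m\<in>carrier M. indep (px m) (py m) \<or> indep (px m) (pz m) \<or> indep (py m) (pz m)")
  case True
  then obtain m where m: "m \<in> carrier M" "indep (px m) (py m) \<or> indep (px m) (pz m) \<or> indep (py m) (pz m)" by blast
  have "\<exists>m a b c. (a \<noteq> 0 \<or> b \<noteq> 0 \<or> c \<noteq> 0) \<and> cyc (Lam q) M m (Us q a b c)"
    by (rule exI[of _ m]) (rule cyc_if_indep[OF m])
  then show ?thesis by (rule disjI2[OF disjI2[OF disjI1]])
next
  case no: False
  show ?thesis
  proof (cases "\<forall>x\<in>carrier M. px x = \<zero>\<^bsub>M\<^esub> \<and> py x = \<zero>\<^bsub>M\<^esub> \<and> pz x = \<zero>\<^bsub>M\<^esub>")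
    case True
    then have "\<exists>m. cyc (Lam q) M m (Vs q 0 0 0)" by (intro trivial_action[OF ind]) simp
    then show ?thesis by (rule disjI1)
  next
    case False
    then obtain m where m: "m \<in> carrier M" and mz: "px m \<noteq> \<zero>\<^bsub>M\<^esub> \<or> py m \<noteq> \<zero>\<^bsub>M\<^esub> \<or> pz m \<noteq> \<zero>\<^bsub>M\<^esub>" by blast
    have nm: "\<not> indep (px m) (py m)" "\<not> indep (px m) (pz m)" "\<not> indep (py m) (pz m)" using no m by blast+
    obtain n a b c where n: "n \<in> carrier M" "px m = sc a n" "py m = sc b n" "pz m = sc c n"
      "px n = \<zero>\<^bsub>M\<^esub>" "py n = \<zero>\<^bsub>M\<^esub>" "pz n = \<zero>\<^bsub>M\<^esub>" "n = \<zero>\<^bsub>M\<^esub> \<or> a \<noteq> 0 \<or> b \<noteq> 0 \<or> c \<noteq> 0"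
      by (rule rad_line[OF m nm])
    have nz: "n \<noteq> \<zero>\<^bsub>M\<^esub>" using mz n(2-4) by (auto simp: L.smult_r_null)
    then have abc: "a \<noteq> 0 \<or> b \<noteq> 0 \<or> c \<noteq> 0" using n(8) by blast
    obtain i0 where i0: "i0 < 3" "\<kappa> i0 n \<noteq> 0" using \<kappa>_inj[OF n(1)] nz by blast
    have kE: "\<kappa> i (E q r0 r1 r2 r3 r4 r5 \<cdot> m) = r0 * \<kappa> i m + (a * r1 + b * r2 + c * r3) * \<kappa> i n" for i r0 r1 r2 r3 r4 r5
      using m n by (simp add: \<kappa>_E \<kappa>_smult algebra_simps)
    have kn: "\<kappa> i (E q r0 r1 r2 r3 r4 r5 \<cdot> n) = r0 * \<kappa> i n" for i r0 r1 r2 r3 r4 r5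
      using n by (simp add: \<kappa>_E)
    have ind2: "s = 0 \<and> u = 0" if z: "\<And>i. i < 3 \<Longrightarrow> s * \<kappa> i m + u * \<kappa> i n = 0" for s u
    proof -
      have e: "sc s m \<oplus>\<^bsub>M\<^esub> sc u n = \<zero>\<^bsub>M\<^esub>" using m n(1) z by (intro \<kappa>_inj) (simp_all add: \<kappa>_add \<kappa>_smult)
      have "\<kappa> i0 (px (sc s m \<oplus>\<^bsub>M\<^esub> sc u n)) = s * (a * \<kappa> i0 n)"
        "\<kappa> i0 (py (sc s m \<oplus>\<^bsub>M\<^esub> sc u n)) = s * (b * \<kappa> i0 n)"
        "\<kappa> i0 (pz (sc s m \<oplus>\<^bsub>M\<^esub> sc u n)) = s * (c * \<kappa> i0 n)"
        using m n by (simp_all add: p_lin p_sc \<kappa>_add \<kappa>_smult)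
      then have "s * a = 0" "s * b = 0" "s * c = 0" using i0(2) unfolding e by simp_all
      then have s: "s = 0" using abc by auto
      then show ?thesis using z[OF i0(1)] i0(2) by simp
    qed
    have "\<exists>l1 l2 l3. a * l1 + b * l2 + c * l3 = 1"
    proof -
      have "a * (1 / a) + b * 0 + c * 0 = 1" if "a \<noteq> 0" using that by simp
      moreover have "a * 0 + b * (1 / b) + c * 0 = 1" if "b \<noteq> 0" using that by simp
      moreover have "a * 0 + b * 0 + c * (1 / c) = 1" if "c \<noteq> 0" using that by simp
      ultimately show ?thesis using abc by blast
    qed
    then obtain l1 l2 l3 where l: "a * l1 + b * l2 + c * l3 = 1" by blast
    show ?thesis
    proof (cases "\<forall>x\<in>carrier M. \<exists>s u. \<forall>i<3. \<kappa> i x = s * \<kappa> i m + u * \<kappa> i n")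
      case True
      have "\<exists>r\<in>carrier (Lam q). x = r \<cdot> m" if x: "x \<in> carrier M" for x
      proof -
        obtain s u where su: "\<forall>i<3. \<kappa> i x = s * \<kappa> i m + u * \<kappa> i n" using True x by blast
        have "a * (u * l1) + b * (u * l2) + c * (u * l3) = u"
          using arg_cong[OF l, of "\<lambda>z. u * z"] by (simp add: algebra_simps)
        then have "x = E q s (u * l1) (u * l2) (u * l3) 0 0 \<cdot> m"
          using su x m by (intro \<kappa>_eqI) (simp_all only: kE cl)
        then show ?thesis using E_closed by blast
      qed
      moreover have "Vs q a b c = {r \<in> carrier (Lam q). r \<cdot> m = \<zero>\<^bsub>M\<^esub>}"
      proof (rule Lam_set_eqI[OF Us_carrier(2)])
        fix r0 r1 r2 r3 r4 r5
        have "E q r0 r1 r2 r3 r4 r5 \<cdot> m = \<zero>\<^bsub>M\<^esub> \<longleftrightarrow> r0 = 0 \<and> a * r1 + b * r2 + c * r3 = 0"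
        proof
          assume z: "E q r0 r1 r2 r3 r4 r5 \<cdot> m = \<zero>\<^bsub>M\<^esub>"
          have "r0 * \<kappa> i m + (a * r1 + b * r2 + c * r3) * \<kappa> i n = 0" for i
            using kE[of i r0 r1 r2 r3 r4 r5] unfolding z by simp
          then show "r0 = 0 \<and> a * r1 + b * r2 + c * r3 = 0" by (rule ind2)
        next
          assume "r0 = 0 \<and> a * r1 + b * r2 + c * r3 = 0"
          then show "E q r0 r1 r2 r3 r4 r5 \<cdot> m = \<zero>\<^bsub>M\<^esub>"
            using m by (intro \<kappa>_inj) (simp_all only: kE cl, simp)
        qed
        then show "E q r0 r1 r2 r3 r4 r5 \<in> Vs q a b c \<longleftrightarrow> E q r0 r1 r2 r3 r4 r5 \<in> {r \<in> carrier (Lam q). r \<cdot> m = \<zero>\<^bsub>M\<^esub>}"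
          by (simp add: E_Vs)
      qed auto
      ultimately have "cyc (Lam q) M m (Vs q a b c)" using m Mm unfolding cyc_def by blast
      with abc have "\<exists>m a b c. (a \<noteq> 0 \<or> b \<noteq> 0 \<or> c \<noteq> 0) \<and> cyc (Lam q) M m (Vs q a b c)" by (intro exI conjI)
      then show ?thesis by (rule disjI2[OF disjI1])
    next
      case False
      then obtain m' where m': "m' \<in> carrier M" and out: "\<And>s u. \<exists>i<3. \<kappa> i m' \<noteq> s * \<kappa> i m + u * \<kappa> i n" by blast
      have ind3: "s = 0 \<and> t = 0 \<and> u = 0"
        if z: "\<And>i. i < 3 \<Longrightarrow> s * \<kappa> i m + t * \<kappa> i m' + u * \<kappa> i n = 0" for s t u
      proof -
        have t: "t = 0"
        proof (rule ccontr)
          assume "t \<noteq> 0"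
          have "\<kappa> i m' = (- s / t) * \<kappa> i m + (- u / t) * \<kappa> i n" if "i < 3" for i
          proof -
            have "t * \<kappa> i m' = - (s * \<kappa> i m + u * \<kappa> i n)"
              using z[OF that] by (simp add: eq_neg_iff_add_eq_0 algebra_simps)
            then have "\<kappa> i m' = - (s * \<kappa> i m + u * \<kappa> i n) / t"
              using \<open>t \<noteq> 0\<close> by (metis nonzero_mult_div_cancel_left)
            then show ?thesis by (simp add: add_divide_distrib diff_divide_distrib)
          qed
          then show False using out by blast
        qed
        then show ?thesis using ind2[of s u] z by simp
      qed
      have span: "\<exists>s t u. \<forall>i<3. \<kappa> i x = s * \<kappa> i m + t * \<kappa> i m' + u * \<kappa> i n" for x
      proof -
        obtain t0 t1 t2 t3 where t: "t0 \<noteq> 0 \<or> t1 \<noteq> 0 \<or> t2 \<noteq> 0 \<or> t3 \<noteq> 0"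
          "\<And>i. i < 3 \<Longrightarrow> t0 * \<kappa> i m + t1 * \<kappa> i m' + t2 * \<kappa> i n + t3 * \<kappa> i x = 0"
          using dependent4[of m m' n x] by blast
        have t3: "t3 \<noteq> 0"
        proof
          assume "t3 = 0"
          then have "t0 = 0 \<and> t1 = 0 \<and> t2 = 0" using t(2) by (intro ind3) simp
          then show False using t(1) \<open>t3 = 0\<close> by simp
        qed
        have "\<kappa> i x = (- t0 / t3) * \<kappa> i m + (- t1 / t3) * \<kappa> i m' + (- t2 / t3) * \<kappa> i n" if "i < 3" for i
        proof -
          have "t3 * \<kappa> i x = - (t0 * \<kappa> i m + t1 * \<kappa> i m' + t2 * \<kappa> i n)"
            using t(2)[OF that] by (metis add.commute eq_neg_iff_add_eq_0)
          then have "\<kappa> i x = - (t0 * \<kappa> i m + t1 * \<kappa> i m' + t2 * \<kappa> i n) / t3"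
            using t3 by (metis nonzero_mult_div_cancel_left)
          then show ?thesis by (simp add: add_divide_distrib diff_divide_distrib)
        qed
        then show ?thesis by blast
      qed
      have nm': "\<not> indep (px m') (py m')" "\<not> indep (px m') (pz m')" "\<not> indep (py m') (pz m')" using no m' by blast+
      obtain n' a1 b1 c1 where n': "n' \<in> carrier M" "px m' = sc a1 n'" "py m' = sc b1 n'" "pz m' = sc c1 n'"
        "px n' = \<zero>\<^bsub>M\<^esub>" "py n' = \<zero>\<^bsub>M\<^esub>" "pz n' = \<zero>\<^bsub>M\<^esub>" "n' = \<zero>\<^bsub>M\<^esub> \<or> a1 \<noteq> 0 \<or> b1 \<noteq> 0 \<or> c1 \<noteq> 0"
        by (rule rad_line[OF m' nm'])
      have "\<exists>\<alpha>. \<forall>i<3. \<kappa> i n' = \<alpha> * \<kappa> i n"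
      proof (rule ccontr)
        assume no_\<alpha>: "\<not> ?thesis"
        then have no_\<alpha>': "\<exists>i<3. \<kappa> i n' \<noteq> \<alpha> * \<kappa> i n" for \<alpha> by blast
        have "n' \<noteq> \<zero>\<^bsub>M\<^esub>" using no_\<alpha>'[of 0] by auto
        then have abc1: "a1 \<noteq> 0 \<or> b1 \<noteq> 0 \<or> c1 \<noteq> 0" using n'(8) by blast
        have indn: "v = 0 \<and> w = 0" if z: "\<And>i. i < 3 \<Longrightarrow> v * \<kappa> i n + w * \<kappa> i n' = 0" for v w
        proof -
          have w: "w = 0"
          proof (rule ccontr)
            assume w: "w \<noteq> 0"
            have "\<kappa> i n' = (- v / w) * \<kappa> i n" if "i < 3" for i
            proof -
              have "w * \<kappa> i n' = - (v * \<kappa> i n)" using z[OF that] by (metis add.commute eq_neg_iff_add_eq_0)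
              then have "\<kappa> i n' = - (v * \<kappa> i n) / w" using w by (metis nonzero_mult_div_cancel_left)
              then show ?thesis by simp
            qed
            then show False using no_\<alpha> by blast
          qed
          then show ?thesis using z[OF i0(1)] i0(2) by simp
        qed
        obtain s t u where stu: "\<forall>i<3. \<kappa> i n' = s * \<kappa> i m + t * \<kappa> i m' + u * \<kappa> i n" using span by blast
        have e: "n' = sc s m \<oplus>\<^bsub>M\<^esub> (sc t m' \<oplus>\<^bsub>M\<^esub> sc u n)"
        proof (rule \<kappa>_eqI)
          fix i :: nat assume "i < 3"
          then have "\<kappa> i n' = s * \<kappa> i m + t * \<kappa> i m' + u * \<kappa> i n" using stu by blast
          then show "\<kappa> i n' = \<kappa> i (sc s m \<oplus>\<^bsub>M\<^esub> (sc t m' \<oplus>\<^bsub>M\<^esub> sc u n))"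
            using m m' n(1) by (simp add: \<kappa>_add \<kappa>_smult)
        qed (use m m' n(1) n'(1) in simp_all)
        let ?w = "sc s m \<oplus>\<^bsub>M\<^esub> (sc t m' \<oplus>\<^bsub>M\<^esub> sc u n)"
        have "\<kappa> i (px ?w) = s * a * \<kappa> i n + t * a1 * \<kappa> i n'" "\<kappa> i (py ?w) = s * b * \<kappa> i n + t * b1 * \<kappa> i n'"
          "\<kappa> i (pz ?w) = s * c * \<kappa> i n + t * c1 * \<kappa> i n'" for i
          using m m' n(1-7) n'(1-4) by (simp_all add: p_lin p_sc \<kappa>_add \<kappa>_smult)
        then have "s * a * \<kappa> i n + t * a1 * \<kappa> i n' = 0" "s * b * \<kappa> i n + t * b1 * \<kappa> i n' = 0"
          "s * c * \<kappa> i n + t * c1 * \<kappa> i n' = 0" for i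
          unfolding e[symmetric] n'(5-7) \<kappa>_zero by metis+
        then have "s * a = 0 \<and> t * a1 = 0" "s * b = 0 \<and> t * b1 = 0" "s * c = 0 \<and> t * c1 = 0"
          using indn by blast+
        then have "s = 0" "t = 0" using abc abc1 by auto
        then have "\<forall>i<3. \<kappa> i n' = u * \<kappa> i n" using stu by simp
        then show False using no_\<alpha> by blast
      qed
      then obtain \<alpha> where \<alpha>: "\<forall>i<3. \<kappa> i n' = \<alpha> * \<kappa> i n" by blast
      have n'n: "n' = sc \<alpha> n"
      proof (rule \<kappa>_eqI)
        fix i :: nat assume "i < 3"
        then show "\<kappa> i n' = \<kappa> i (sc \<alpha> n)" using \<alpha> \<kappa>_smult[OF n(1)] by metis
      qed (use n(1) n'(1) in simp_all)
      define a' b' c' where "a' = a1 * \<alpha>" and "b' = b1 * \<alpha>" and "c' = c1 * \<alpha>"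
      have pm': "px m' = sc a' n" "py m' = sc b' n" "pz m' = sc c' n"
        using n(1) n'(2-4) unfolding n'n a'_def b'_def c'_def by (simp_all add: L.smult_assoc[symmetric])
      have soc: "s = 0 \<and> t = 0" if st: "s * a + t * a' = 0" "s * b + t * b' = 0" "s * c + t * c' = 0" for s t
      proof (rule ccontr)
        assume stz: "\<not> ?thesis"
        have t: "t \<noteq> 0"
        proof
          assume "t = 0"
          then have "s = 0" using st abc by auto
          then show False using stz \<open>t = 0\<close> by simp
        qed
        define m2 where "m2 = sc s m \<oplus>\<^bsub>M\<^esub> sc t m'"
        have m2: "m2 \<in> carrier M" using m m' by (simp add: m2_def)
        have km2: "\<kappa> i m2 = s * \<kappa> i m + t * \<kappa> i m'" for i using m m' by (simp add: m2_def \<kappa>_add \<kappa>_smult)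
        have "\<kappa> i (px m2) = (s * a + t * a') * \<kappa> i n" "\<kappa> i (py m2) = (s * b + t * b') * \<kappa> i n"
          "\<kappa> i (pz m2) = (s * c + t * c') * \<kappa> i n" for i
          unfolding m2_def using m m' n(1-4) pm' by (simp_all add: p_lin p_sc \<kappa>_add \<kappa>_smult algebra_simps)
        then have kpm2: "\<kappa> i (px m2) = 0" "\<kappa> i (py m2) = 0" "\<kappa> i (pz m2) = 0" for i using st by simp_all
        have kE2: "\<kappa> i (E q r0 r1 r2 r3 r4 r5 \<cdot> m2) = r0 * \<kappa> i m2" for i r0 r1 r2 r3 r4 r5
          using m2 by (simp add: \<kappa>_E kpm2)
        let ?A = "{x \<in> carrier M. \<exists>u v. \<forall>i<3. \<kappa> i x = u * \<kappa> i m + v * \<kappa> i n}"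
        let ?B = "{x \<in> carrier M. \<exists>w. \<forall>i<3. \<kappa> i x = w * \<kappa> i m2}"
        have A: "submodule ?A (Lam q) M"
        proof (rule sub_k)
          have "\<forall>i<3. \<kappa> i \<zero>\<^bsub>M\<^esub> = 0 * \<kappa> i m + 0 * \<kappa> i n" by simp
          then show "\<zero>\<^bsub>M\<^esub> \<in> ?A" by blast
          fix x y assume "x \<in> ?A" "y \<in> ?A"
          then obtain u v u' v' where xy: "x \<in> carrier M" "y \<in> carrier M" "\<forall>i<3. \<kappa> i x = u * \<kappa> i m + v * \<kappa> i n"
            "\<forall>i<3. \<kappa> i y = u' * \<kappa> i m + v' * \<kappa> i n" by blast
          have "\<forall>i<3. \<kappa> i (x \<oplus>\<^bsub>M\<^esub> y) = (u + u') * \<kappa> i m + (v + v') * \<kappa> i n"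
            using xy by (simp add: \<kappa>_add distrib_right)
          then show "x \<oplus>\<^bsub>M\<^esub> y \<in> ?A" using xy(1,2) by blast
        next
          fix x d0 d1 d2 d3 assume "x \<in> ?A"
          then obtain u v where x: "x \<in> carrier M" "\<forall>i<3. \<kappa> i x = u * \<kappa> i m + v * \<kappa> i n" by blast
          have xe: "x = sc u m \<oplus>\<^bsub>M\<^esub> sc v n"
            by (rule \<kappa>_eqI) (use x m n(1) in \<open>simp_all add: \<kappa>_add \<kappa>_smult\<close>)
          have "\<kappa> i (px x) = u * a * \<kappa> i n" "\<kappa> i (py x) = u * b * \<kappa> i n" "\<kappa> i (pz x) = u * c * \<kappa> i n" for i
            unfolding xe using m n by (simp_all add: p_lin p_sc \<kappa>_add \<kappa>_smult)
          then have "\<forall>i<3. \<kappa> i (E q d0 d1 d2 d3 0 0 \<cdot> x) = (d0 * u) * \<kappa> i m + (d0 * v + (d1 * a + d2 * b + d3 * c) * u) * \<kappa> i n"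
            using x by (simp add: \<kappa>_E algebra_simps)
          then show "E q d0 d1 d2 d3 0 0 \<cdot> x \<in> ?A" using x(1) cl(4) by blast
        qed blast
        have B: "submodule ?B (Lam q) M"
        proof (rule sub_k)
          have "\<forall>i<3. \<kappa> i \<zero>\<^bsub>M\<^esub> = 0 * \<kappa> i m2" by simp
          then show "\<zero>\<^bsub>M\<^esub> \<in> ?B" by blast
          fix x y assume "x \<in> ?B" "y \<in> ?B"
          then obtain u u' where xy: "x \<in> carrier M" "y \<in> carrier M" "\<forall>i<3. \<kappa> i x = u * \<kappa> i m2"
            "\<forall>i<3. \<kappa> i y = u' * \<kappa> i m2" by blast
          have "\<forall>i<3. \<kappa> i (x \<oplus>\<^bsub>M\<^esub> y) = (u + u') * \<kappa> i m2" using xy by (simp add: \<kappa>_add distrib_right)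
          then show "x \<oplus>\<^bsub>M\<^esub> y \<in> ?B" using xy(1,2) by blast
        next
          fix x d0 d1 d2 d3 assume "x \<in> ?B"
          then obtain u where x: "x \<in> carrier M" "\<forall>i<3. \<kappa> i x = u * \<kappa> i m2" by blast
          have xe: "x = sc u m2" by (rule \<kappa>_eqI) (use x m2 in \<open>simp_all add: \<kappa>_smult\<close>)
          have "\<kappa> i (px x) = 0" "\<kappa> i (py x) = 0" "\<kappa> i (pz x) = 0" for i
            unfolding xe using m2 by (simp_all add: p_lin p_sc \<kappa>_smult kpm2)
          then have "\<forall>i<3. \<kappa> i (E q d0 d1 d2 d3 0 0 \<cdot> x) = (d0 * u) * \<kappa> i m2"
            using x by (simp add: \<kappa>_E)
          then show "E q d0 d1 d2 d3 0 0 \<cdot> x \<in> ?B" using x(1) cl(4) by blast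
        qed blast
        have "?A = {\<zero>\<^bsub>M\<^esub>} \<or> ?B = {\<zero>\<^bsub>M\<^esub>}"
        proof (rule indec[OF ind A B])
          fix x assume x: "x \<in> carrier M"
          obtain e1 e2 e3 where e: "\<forall>i<3. \<kappa> i x = e1 * \<kappa> i m + e2 * \<kappa> i m' + e3 * \<kappa> i n" using span by blast
          let ?y = "sc (e1 - e2 / t * s) m \<oplus>\<^bsub>M\<^esub> sc e3 n" and ?z = "sc (e2 / t) m2"
          have ky: "\<kappa> i ?y = (e1 - e2 / t * s) * \<kappa> i m + e3 * \<kappa> i n" for i using m n(1) by (simp add: \<kappa>_add \<kappa>_smult)
          have kz: "\<kappa> i ?z = e2 / t * \<kappa> i m2" for i using m2 by (simp add: \<kappa>_smult)
          have c: "?y \<in> carrier M" "?z \<in> carrier M" using m n(1) m2 by simp_all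
          have "?y \<in> ?A" using c(1) ky by blast
          moreover have "?z \<in> ?B" using c(2) kz by blast
          moreover have "x = ?y \<oplus>\<^bsub>M\<^esub> ?z"
          proof (rule \<kappa>_eqI)
            fix i :: nat assume "i < 3"
            then have "\<kappa> i x = e1 * \<kappa> i m + e2 * \<kappa> i m' + e3 * \<kappa> i n" using e by blast
            also have "\<dots> = ((e1 - e2 / t * s) * \<kappa> i m + e3 * \<kappa> i n) + e2 / t * (s * \<kappa> i m + t * \<kappa> i m')"
              using t by (simp add: algebra_simps)
            also have "\<dots> = \<kappa> i (?y \<oplus>\<^bsub>M\<^esub> ?z)" unfolding \<kappa>_add[OF c] ky kz km2 ..
            finally show "\<kappa> i x = \<kappa> i (?y \<oplus>\<^bsub>M\<^esub> ?z)" .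
          qed (use x c in simp_all)
          ultimately show "\<exists>y\<in>?A. \<exists>z\<in>?B. x = y \<oplus>\<^bsub>M\<^esub> z" by blast
        next
          fix x assume "x \<in> ?A" "x \<in> ?B"
          then obtain u v w where x: "x \<in> carrier M" "\<forall>i<3. \<kappa> i x = u * \<kappa> i m + v * \<kappa> i n" "\<forall>i<3. \<kappa> i x = w * \<kappa> i m2" by blast
          have "(u - w * s) * \<kappa> i m + (- (w * t)) * \<kappa> i m' + v * \<kappa> i n = 0" if "i < 3" for i
          proof -
            have "u * \<kappa> i m + v * \<kappa> i n = w * (s * \<kappa> i m + t * \<kappa> i m')" using x(2,3) that km2 by metis
            then show ?thesis by (simp add: algebra_simps)
          qed
          then have "- (w * t) = 0" using ind3 by blast
          then have "w = 0" using t by simp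
          then show "x = \<zero>\<^bsub>M\<^esub>" using x(1,3) by (intro \<kappa>_inj) simp_all
        qed
        then show False
        proof
          assume A0: "?A = {\<zero>\<^bsub>M\<^esub>}"
          have "\<forall>i<3. \<kappa> i n = 0 * \<kappa> i m + 1 * \<kappa> i n" by simp
          then have "n \<in> ?A" using n(1) by blast
          then show False using A0 nz by blast
        next
          assume B0: "?B = {\<zero>\<^bsub>M\<^esub>}"
          have "\<forall>i<3. \<kappa> i m2 = 1 * \<kappa> i m2" by simp
          then have "m2 \<in> ?B" using m2 by blast
          then have "m2 = \<zero>\<^bsub>M\<^esub>" using B0 by blast
          then have "s * \<kappa> i m + t * \<kappa> i m' + 0 * \<kappa> i n = 0" for i using km2[of i] by simp
          then have "t = 0" using ind3 by blast
          then show False using t by simp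
        qed
      qed
      have "two_gens m m' n a b c a' b' c'" unfolding two_gens_def
      proof (intro conjI allI impI ballI)
        fix s t u assume z: "sc s m \<oplus>\<^bsub>M\<^esub> (sc t m' \<oplus>\<^bsub>M\<^esub> sc u n) = \<zero>\<^bsub>M\<^esub>"
        have "s * \<kappa> i m + t * \<kappa> i m' + u * \<kappa> i n = 0" for i
          using arg_cong[OF z, of "\<kappa> i"] m m' n(1) by (simp add: \<kappa>_add \<kappa>_smult add.assoc)
        from ind3[OF this] show "s = 0" "t = 0" "u = 0" by blast+
      next
        fix x assume x: "x \<in> carrier M"
        obtain s t u where "\<forall>i<3. \<kappa> i x = s * \<kappa> i m + t * \<kappa> i m' + u * \<kappa> i n" using span by blast
        then have "x = sc s m \<oplus>\<^bsub>M\<^esub> (sc t m' \<oplus>\<^bsub>M\<^esub> sc u n)"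
          using x m m' n(1) by (intro \<kappa>_eqI) (simp_all add: \<kappa>_add \<kappa>_smult add.assoc)
        then show "\<exists>s t u. x = sc s m \<oplus>\<^bsub>M\<^esub> (sc t m' \<oplus>\<^bsub>M\<^esub> sc u n)" by blast
      next
        fix s t assume "s * a + t * a' = 0 \<and> s * b + t * b' = 0 \<and> s * c + t * c' = 0"
        then show "s = 0" "t = 0" using soc[of s t] by blast+
      qed (fact m m' n pm')+
      then have "\<exists>m m' n a b c a' b' c'. two_gens m m' n a b c a' b' c'" by (intro exI)
      then show ?thesis by (rule disjI2[OF disjI2[OF disjI2]])
    qed
  qed
qed

text \<open>A functional that is nonzero on \<open>n\<close> forces the coefficient vectors of \<open>x, y, z\<close> on \<open>m\<close> and on \<open>m'\<close> to be
  proportional, and then a combination of \<open>m\<close> and \<open>m'\<close> spans a simple summand.\<close>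

lemma two_gens_not_separated:
  assumes "two_gens m m' n a b c a' b' c'"
  shows "\<not> separated (Lam q) M"
proof
  assume sep: "separated (Lam q) M"
  have m: "m \<in> carrier M" "m' \<in> carrier M" "n \<in> carrier M"
    and p: "px m = sc a n" "py m = sc b n" "pz m = sc c n" "px m' = sc a' n" "py m' = sc b' n" "pz m' = sc c' n"
      "px n = \<zero>\<^bsub>M\<^esub>" "py n = \<zero>\<^bsub>M\<^esub>"
    and ind: "\<And>s t u. sc s m \<oplus>\<^bsub>M\<^esub> (sc t m' \<oplus>\<^bsub>M\<^esub> sc u n) = \<zero>\<^bsub>M\<^esub> \<Longrightarrow> s = 0 \<and> t = 0 \<and> u = 0"
    and soc: "\<And>s t. s * a + t * a' = 0 \<Longrightarrow> s * b + t * b' = 0 \<Longrightarrow> s * c + t * c' = 0 \<Longrightarrow> s = 0 \<and> t = 0"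
    using assms unfolding two_gens_def by blast+
  have "n \<noteq> \<zero>\<^bsub>M\<^esub>"
  proof
    assume "n = \<zero>\<^bsub>M\<^esub>"
    then have "sc 0 m \<oplus>\<^bsub>M\<^esub> (sc 0 m' \<oplus>\<^bsub>M\<^esub> sc 1 n) = \<zero>\<^bsub>M\<^esub>"
      using m by (intro \<kappa>_inj) (simp_all add: \<kappa>_add \<kappa>_smult)
    then show False using ind[of 0 0 1] by simp
  qed
  then obtain g where g: "linmap (Lam q) M (lreg q) g" "g n \<noteq> \<zero>\<^bsub>Lam q\<^esub>"
    using sep m(3) unfolding separated_def by blast
  have gx: "g (r \<cdot> x) = r \<otimes>\<^bsub>Lam q\<^esub> g x" if "r \<in> carrier (Lam q)" "x \<in> carrier M" for r x
    using linmapD(3)[OF g(1) that] by simp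
  have g0: "g \<zero>\<^bsub>M\<^esub> = E q 0 0 0 0 0 0" using linmap_zero[OF Mm Lreg g(1)] by (simp add: E_zero)
  have gc: "g x \<in> carrier (Lam q)" if "x \<in> carrier M" for x using linmapD(1)[OF g(1) that] by simp
  obtain s0 s1 s2 s3 s4 s5 where s: "g n = E q s0 s1 s2 s3 s4 s5" by (rule E_cases[OF gc[OF m(3)]])
  have "s0 = 0 \<and> s1 = 0 \<and> s2 = 0 \<and> s3 = 0"
    using gx[of "E q 0 1 0 0 0 0" n] gx[of "E q 0 0 1 0 0 0" n] m(3) p(7,8) q unfolding px_def py_def by (simp add: g0 s)
  then have s': "g n = E q 0 0 0 0 s4 s5" using s by simp
  have eqs: "- (q * w2) = x * s4 \<and> w1 = y * s4 \<and> y * s5 = 0 \<and> z * s4 = 0 \<and> w1 + w2 = z * s5"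
    if l: "l \<in> carrier M" "px l = sc x n" "py l = sc y n" "pz l = sc z n" and w: "g l = E q w0 w1 w2 w3 w4 w5"
    for l x y z w0 w1 w2 w3 w4 w5
  proof -
    have "g (px l) = E q 0 w0 0 0 (- (q * w2)) w3" "g (py l) = E q 0 0 w0 0 w1 0" "g (pz l) = E q 0 0 0 w0 0 (w1 + w2)"
      using gx[of _ l] l(1) w unfolding px_def py_def pz_def by simp_all
    moreover have "g (sc t n) = E q 0 0 0 0 (t * s4) (t * s5)" for t using gx[of _ n] m(3) s' by simp
    ultimately show ?thesis using l(2-4) by auto
  qed
  obtain w0 w1 w2 w3 w4 w5 where w: "g m = E q w0 w1 w2 w3 w4 w5" by (rule E_cases[OF gc[OF m(1)]])
  obtain v0 v1 v2 v3 v4 v5 where v: "g m' = E q v0 v1 v2 v3 v4 v5" by (rule E_cases[OF gc[OF m(2)]])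
  note e = eqs[OF m(1) p(1-3) w] and e' = eqs[OF m(2) p(4-6) v]
  have nz: "s4 \<noteq> 0 \<or> s5 \<noteq> 0" using g(2) s' by (auto simp: E_zero)
  have abc: "\<not> (a = 0 \<and> b = 0 \<and> c = 0)" using soc[of 1 0] by auto
  show False
  proof (cases "s5 = 0")
    case False
    have bc: "x = 0 \<or> s4 = 0" "y = 0" "z = 0"
      if "- (q * w2) = x * s4 \<and> w1 = y * s4 \<and> y * s5 = 0 \<and> z * s4 = 0 \<and> w1 + w2 = z * s5" for x y z w1 w2
      using that q False by auto
    have "b = 0" "c = 0" "b' = 0" "c' = 0" using bc[OF e] bc[OF e'] by simp_all
    then show False using soc[of a' "- a"] abc by (auto simp: mult.commute)
  next
    case True
    have ab: "x = q * y" "z = 0"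
      if "- (q * w2) = x * s4 \<and> w1 = y * s4 \<and> y * s5 = 0 \<and> z * s4 = 0 \<and> w1 + w2 = z * s5" for x y z w1 w2
    proof -
      show "z = 0" using that nz True by auto
      have w: "w1 + w2 = z * s5" "w1 = y * s4" using that by blast+
      have "w1 + w2 = 0" using w(1) True by simp
      with w(2) have "w2 = - (y * s4)" by (metis add.commute eq_neg_iff_add_eq_0)
      then have "x * s4 = (q * y) * s4" using that by auto
      then show "x = q * y" using nz True by simp
    qed
    have "c = 0" "c' = 0" "a = q * b" "a' = q * b'" using ab[OF e] ab[OF e'] by simp_all
    then show False using soc[of b' "- b"] abc by (auto simp: algebra_simps)
  qed
qed

text \<open>A combination of \<open>y m\<close> and \<open>y m'\<close> vanishes. The kernel of \<open>\<Lambda>\<^sup>2 \<rightarrow> M\<close> has a linear map to the socle that sends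
  this relation to \<open>zx\<close>; it does not extend, since \<open>zx\<close> is not in \<open>y\<Lambda>\<close>.\<close>

lemma two_gens_not_Ext_1:
  assumes "two_gens m m' n a b c a' b' c'"
  shows "\<not> Ext_vanishes (Lam q) 1 M (lreg q)"
proof
  have m: "m \<in> carrier M" "m' \<in> carrier M" "n \<in> carrier M"
    and p: "px m = sc a n" "py m = sc b n" "pz m = sc c n" "px m' = sc a' n" "py m' = sc b' n" "pz m' = sc c' n"
    and ind: "\<And>s t u. sc s m \<oplus>\<^bsub>M\<^esub> (sc t m' \<oplus>\<^bsub>M\<^esub> sc u n) = \<zero>\<^bsub>M\<^esub> \<Longrightarrow> s = 0 \<and> t = 0 \<and> u = 0"
    and span: "\<And>x. x \<in> carrier M \<Longrightarrow> \<exists>s t u. x = sc s m \<oplus>\<^bsub>M\<^esub> (sc t m' \<oplus>\<^bsub>M\<^esub> sc u n)"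
    and soc: "\<And>s t. s * a + t * a' = 0 \<Longrightarrow> s * b + t * b' = 0 \<Longrightarrow> s * c + t * c' = 0 \<Longrightarrow> s = 0 \<and> t = 0"
    using assms unfolding two_gens_def by blast+
  have abc: "a \<noteq> 0 \<or> b \<noteq> 0 \<or> c \<noteq> 0" using soc[of 1 0] by auto
  have "\<exists>l1 l2 l3. a * l1 + b * l2 + c * l3 = 1"
  proof -
    have "a * (1 / a) + b * 0 + c * 0 = 1" if "a \<noteq> 0" using that by simp
    moreover have "a * 0 + b * (1 / b) + c * 0 = 1" if "b \<noteq> 0" using that by simp
    moreover have "a * 0 + b * 0 + c * (1 / c) = 1" if "c \<noteq> 0" using that by simp
    ultimately show ?thesis using abc by blast
  qed
  then obtain l1 l2 l3 where l: "a * l1 + b * l2 + c * l3 = 1" by blast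
  let ?F = "free_module (Lam q) 2"
  define e where "e u = u 0 \<cdot> m \<oplus>\<^bsub>M\<^esub> u 1 \<cdot> m'" for u :: "nat \<Rightarrow> 'k lam"
  have le: "linmap (Lam q) ?F M e"
    unfolding e_def
    by (intro linmap_add[OF Mm] linmap_comp[OF linmap_coord[of 0 2] linmap_smult_vec[OF Mm m(1)]]
        linmap_comp[OF linmap_coord[of 1 2] linmap_smult_vec[OF Mm m(2)]]) simp_all
  have ke: "\<kappa> i (E q r0 r1 r2 r3 r4 r5 \<cdot> m \<oplus>\<^bsub>M\<^esub> E q t0 t1 t2 t3 t4 t5 \<cdot> m') = r0 * \<kappa> i m + t0 * \<kappa> i m' +
      (a * r1 + b * r2 + c * r3 + a' * t1 + b' * t2 + c' * t3) * \<kappa> i n" for i r0 r1 r2 r3 r4 r5 t0 t1 t2 t3 t4 t5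
    using m p by (simp add: \<kappa>_add \<kappa>_E \<kappa>_smult algebra_simps)
  define pr where "pr r t = (\<lambda>i\<in>{..<2::nat}. if i = 0 then r else t)" for r t :: "'k lam"
  have pr: "pr r t 0 = r" "pr r t 1 = t" for r t by (simp_all add: pr_def)
  have prc: "pr r t \<in> carrier ?F" if "r \<in> carrier (Lam q)" "t \<in> carrier (Lam q)" for r t
    using that by (auto simp: pr_def)
  have im: "e ` carrier ?F = carrier M"
  proof
    show "e ` carrier ?F \<subseteq> carrier M" using linmapD(1)[OF le] by blast
    show "carrier M \<subseteq> e ` carrier ?F"
    proof
      fix x assume x: "x \<in> carrier M"
      obtain s t u where stu: "x = sc s m \<oplus>\<^bsub>M\<^esub> (sc t m' \<oplus>\<^bsub>M\<^esub> sc u n)" using span[OF x] by blast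
      have u: "a * (u * l1) + b * (u * l2) + c * (u * l3) = u"
        using arg_cong[OF l, of "\<lambda>z. u * z"] by (simp add: algebra_simps)
      have "e (pr (E q s (u * l1) (u * l2) (u * l3) 0 0) (E q t 0 0 0 0 0)) = x"
        unfolding e_def pr
      proof (rule \<kappa>_eqI)
        fix i :: nat
        show "\<kappa> i (E q s (u * l1) (u * l2) (u * l3) 0 0 \<cdot> m \<oplus>\<^bsub>M\<^esub> E q t 0 0 0 0 0 \<cdot> m') = \<kappa> i x"
          unfolding ke using u m by (simp add: stu \<kappa>_add \<kappa>_smult)
      qed (use m x in simp_all)
      then show "x \<in> e ` carrier ?F" using prc by (metis E_closed imageI)
    qed
  qed
  assume "Ext_vanishes (Lam q) 1 M (lreg q)"
  then have ext: "extnd (Lam q) (a_kernel ?F M e) ?F (lreg q)"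
    using Ext_1_iff[OF Lam_noeth(1) Mm Lreg proj_free[OF Lam_ring] le im] by blast
  let ?K = "a_kernel ?F M e"
  have KJ: "u 0 \<in> Vs q 0 0 0 \<and> u 1 \<in> Vs q 0 0 0" if u: "u \<in> ?K" for u
  proof -
    have uF: "u \<in> carrier ?F" and z: "e u = \<zero>\<^bsub>M\<^esub>" using u unfolding a_kernel_def' by blast+
    have "u 0 \<in> carrier (Lam q)" "u 1 \<in> carrier (Lam q)" using uF by (auto simp: PiE_iff)
    then obtain r0 r1 r2 r3 r4 r5 t0 t1 t2 t3 t4 t5 where rt: "u 0 = E q r0 r1 r2 r3 r4 r5" "u 1 = E q t0 t1 t2 t3 t4 t5"
      by (metis E_cases)
    let ?v = "a * r1 + b * r2 + c * r3 + a' * t1 + b' * t2 + c' * t3"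
    have "r0 * \<kappa> i m + t0 * \<kappa> i m' + ?v * \<kappa> i n = 0" for i
      using arg_cong[OF z, of "\<kappa> i"] unfolding e_def rt ke by simp
    then have "sc r0 m \<oplus>\<^bsub>M\<^esub> (sc t0 m' \<oplus>\<^bsub>M\<^esub> sc ?v n) = \<zero>\<^bsub>M\<^esub>"
      using m by (intro \<kappa>_inj) (simp_all add: \<kappa>_add \<kappa>_smult add.assoc)
    from ind[OF this] show ?thesis unfolding rt by (simp add: E_Vs)
  qed
  \<comment> \<open>A combination \<open>c0 y m + c1 y m' = 0\<close> and a form with value \<open>1\<close> on \<open>(c0, c1)\<close>; products of
    \<open>y\<close> with elements of the algebra never reach \<open>zx\<close>.\<close>
  obtain c0 c1 \<mu> \<nu> where cm: "b * c0 + b' * c1 = 0" "\<mu> * c0 + \<nu> * c1 = 1"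
  proof (cases "b = 0")
    case True then show ?thesis by (intro that[of 1 0 1 0]) simp_all
  next
    case False then show ?thesis by (intro that[of "- b' / b" 1 0 1]) simp_all
  qed
  define h where "h u = top_map q 0 0 0 0 \<mu> 0 (u 0) \<oplus>\<^bsub>Lam q\<^esub> top_map q 0 0 0 0 \<nu> 0 (u 1)" for u :: "nat \<Rightarrow> 'k lam"
  have KF: "?K \<subseteq> carrier ?F" unfolding a_kernel_def' by blast
  have hl: "linmap (Lam q) (sub ?F ?K) (lreg q) h"
  proof -
    have "linmap (Lam q) (sub ?F ?K) (sub (lreg q) (Vs q 0 0 0)) (\<lambda>u. u 0)"
      "linmap (Lam q) (sub ?F ?K) (sub (lreg q) (Vs q 0 0 0)) (\<lambda>u. u 1)"
      using KJ by (auto intro!: linmap_into linmap_sub[OF linmap_coord KF])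
    from linmap_add[OF Lreg linmap_comp[OF this(1) linmap_top(1)[OF order_refl]] linmap_comp[OF this(2) linmap_top(1)[OF order_refl]]]
    show ?thesis unfolding h_def by simp
  qed
  then obtain g where g: "linmap (Lam q) ?F (lreg q) g" "\<And>u. u \<in> ?K \<Longrightarrow> g u = h u"
    using ext unfolding extnd_def by blast
  let ?u = "pr (E q 0 0 c0 0 0 0) (E q 0 0 c1 0 0 0)"
  have uF: "?u \<in> carrier ?F" by (rule prc) simp_all
  have "e ?u = \<zero>\<^bsub>M\<^esub>" unfolding e_def pr
    by (rule \<kappa>_inj) (use m cm(1) in \<open>simp_all only: ke cl L.M.a_closed, simp\<close>)
  then have uK: "?u \<in> ?K" using uF unfolding a_kernel_def' by blast
  have hu: "h ?u = E q 0 0 0 0 0 1" unfolding h_def pr using cm(2) by simp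
  have ue: "?u = E q 0 0 c0 0 0 0 \<odot>\<^bsub>?F\<^esub> pr \<one>\<^bsub>Lam q\<^esub> \<zero>\<^bsub>Lam q\<^esub> \<oplus>\<^bsub>?F\<^esub> E q 0 0 c1 0 0 0 \<odot>\<^bsub>?F\<^esub> pr \<zero>\<^bsub>Lam q\<^esub> \<one>\<^bsub>Lam q\<^esub>"
    by (auto simp: pr_def E_one E_zero intro!: restrict_ext)
  have pc: "pr \<one>\<^bsub>Lam q\<^esub> \<zero>\<^bsub>Lam q\<^esub> \<in> carrier ?F" "pr \<zero>\<^bsub>Lam q\<^esub> \<one>\<^bsub>Lam q\<^esub> \<in> carrier ?F" by (rule prc; simp)+
  interpret F: left_module "Lam q" ?F by (rule free_left_module[OF Lam_ring])
  obtain v0 v1 v2 v3 v4 v5 where v: "g (pr \<one>\<^bsub>Lam q\<^esub> \<zero>\<^bsub>Lam q\<^esub>) = E q v0 v1 v2 v3 v4 v5"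
    using linmapD(1)[OF g(1) pc(1)] by (metis E_cases regular_simps(1))
  obtain w0 w1 w2 w3 w4 w5 where w: "g (pr \<zero>\<^bsub>Lam q\<^esub> \<one>\<^bsub>Lam q\<^esub>) = E q w0 w1 w2 w3 w4 w5"
    using linmapD(1)[OF g(1) pc(2)] by (metis E_cases regular_simps(1))
  have "g ?u = E q 0 0 c0 0 0 0 \<otimes>\<^bsub>Lam q\<^esub> g (pr \<one>\<^bsub>Lam q\<^esub> \<zero>\<^bsub>Lam q\<^esub>) \<oplus>\<^bsub>Lam q\<^esub> E q 0 0 c1 0 0 0 \<otimes>\<^bsub>Lam q\<^esub> g (pr \<zero>\<^bsub>Lam q\<^esub> \<one>\<^bsub>Lam q\<^esub>)"
    unfolding ue linmapD(2)[OF g(1) F.smult_closed[OF E_closed pc(1)] F.smult_closed[OF E_closed pc(2)]]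
      linmapD(3)[OF g(1) E_closed pc(1)] linmapD(3)[OF g(1) E_closed pc(2)] by simp
  then show False using g(2)[OF uK] unfolding hu v w by simp
qed

lemma simple_iff:
  assumes ind: "indecomposable (Lam q) M"
  shows "simple_module (Lam q) M \<longleftrightarrow> (\<exists>m. cyc (Lam q) M m (Vs q 0 0 0))"
proof
  assume s: "simple_module (Lam q) M"
  let ?N = "{x \<in> carrier M. px x = \<zero>\<^bsub>M\<^esub> \<and> py x = \<zero>\<^bsub>M\<^esub> \<and> pz x = \<zero>\<^bsub>M\<^esub>}"
  have N: "submodule ?N (Lam q) M"
  proof (rule L.submodI)
    fix r x assume r: "r \<in> carrier (Lam q)" and x: "x \<in> ?N"
    obtain a b c d e f where re: "r = E q a b c d e f" by (rule E_cases[OF r])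
    have "r \<cdot> x = sc a x" using x by (intro \<kappa>_eqI) (simp_all add: re \<kappa>_E)
    then show "r \<cdot> x \<in> ?N" using x by (simp add: p_lin p_sc L.smult_r_null)
  qed (auto simp: p_lin)
  have "?N \<noteq> {\<zero>\<^bsub>M\<^esub>}"
  proof
    assume N0: "?N = {\<zero>\<^bsub>M\<^esub>}"
    obtain m where m: "m \<in> carrier M" "m \<noteq> \<zero>\<^bsub>M\<^esub>" using ind unfolding indecomposable_def by auto
    have "px m \<in> ?N" "py m \<in> ?N" "pz m \<in> ?N" using m(1) by simp_all
    then have "px m = \<zero>\<^bsub>M\<^esub>" "py m = \<zero>\<^bsub>M\<^esub>" "pz m = \<zero>\<^bsub>M\<^esub>" unfolding N0 by simp_all
    then have "m \<in> ?N" using m(1) by simp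
    then show False using m(2) unfolding N0 by simp
  qed
  then have "?N = carrier M" using s N unfolding simple_module_def by blast
  then show "\<exists>m. cyc (Lam q) M m (Vs q 0 0 0)" by (intro trivial_action[OF ind]) blast
next
  assume "\<exists>m. cyc (Lam q) M m (Vs q 0 0 0)"
  then obtain m where "cyc (Lam q) M m (Vs q 0 0 0)" ..
  note c = cycD[OF this]
  show "simple_module (Lam q) M" unfolding simple_module_def
  proof (intro conjI allI impI)
    show "carrier M \<noteq> {\<zero>\<^bsub>M\<^esub>}" using ind unfolding indecomposable_def by blast
    fix N assume N: "submodule N (Lam q) M"
    note ND = L.submodD[OF N]
    show "N = {\<zero>\<^bsub>M\<^esub>} \<or> N = carrier M"
    proof (cases "N \<subseteq> {\<zero>\<^bsub>M\<^esub>}")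
      case True then show ?thesis using ND(2) by blast
    next
      case False
      then obtain x where x: "x \<in> N" "x \<noteq> \<zero>\<^bsub>M\<^esub>" by blast
      then obtain r where r: "r \<in> carrier (Lam q)" "x = r \<cdot> m" using c(3) ND(1) by blast
      obtain r0 r1 r2 r3 r4 r5 where re: "r = E q r0 r1 r2 r3 r4 r5" by (rule E_cases[OF r(1)])
      have "r \<notin> Vs q 0 0 0" using r x(2) c(4) by blast
      then have r0: "r0 \<noteq> 0" unfolding re by (simp add: E_Vs)
      have J: "E q 0 r1 r2 r3 r4 r5 \<cdot> m = \<zero>\<^bsub>M\<^esub>" for r1 r2 r3 r4 r5
        using Vs_000[of q r1 r2 r3 r4 r5] c(4) by blast
      have "E q r0 0 0 0 0 0 \<oplus>\<^bsub>Lam q\<^esub> E q 0 r1 r2 r3 r4 r5 = r" unfolding re by simp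
      then have "x = sc r0 m \<oplus>\<^bsub>M\<^esub> E q 0 r1 r2 r3 r4 r5 \<cdot> m" using r(2) L.smult_l_distr[OF E_closed E_closed c(2)] by metis
      then have "x = sc r0 m" using J c(2) by simp
      then have "sc (1 / r0) x = (E q (1 / r0) 0 0 0 0 0 \<otimes>\<^bsub>Lam q\<^esub> E q r0 0 0 0 0 0) \<cdot> m"
        using L.smult_assoc[OF E_closed E_closed c(2)] by metis
      then have "sc (1 / r0) x = m" using r0 c(2) L.smult_one[OF c(2)] by (simp add: E_one)
      then have "m \<in> N" using ND(4)[OF E_closed x(1)] by metis
      then have "carrier M \<subseteq> N" using c(3) ND(4) by blast
      then show ?thesis using ND(1) by blast
    qed
  qed
qed

end

section \<open>Coordinates from a basis\<close>

lemma finsum_lsum: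
  assumes "left_module R M"
  shows "(\<And>j. j < n \<Longrightarrow> v j \<in> carrier M) \<Longrightarrow> (\<Oplus>\<^bsub>M\<^esub>i\<in>{..<n::nat}. v i) = lsum M n v"
proof (induction n)
  interpret left_module R M by fact
  case 0 show ?case by simp
next
  interpret left_module R M by fact
  case (Suc n)
  have "(\<Oplus>\<^bsub>M\<^esub>i\<in>{..<Suc n}. v i) = v n \<oplus>\<^bsub>M\<^esub> (\<Oplus>\<^bsub>M\<^esub>i\<in>{..<n}. v i)"
    unfolding lessThan_Suc using Suc.prems by (intro M.finsum_insert) auto
  then show ?case using Suc by (simp add: M.a_comm lsum_closed)
qed

lemma small_module_exists:
  assumes q: "q \<noteq> 0" and M: "left_module (Lam q) M" and d: "has_dim q M n" and n: "n \<le> 3"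
  shows "\<exists>\<kappa>. small_module q M \<kappa>"
proof -
  interpret M: left_module "Lam q" M by fact
  obtain v where v: "v \<in> {..<n} \<rightarrow> carrier M"
    and ex1: "\<And>m. m \<in> carrier M \<Longrightarrow> \<exists>!c. c \<in> {..<n} \<rightarrow>\<^sub>E UNIV \<and> m = (\<Oplus>\<^bsub>M\<^esub>i\<in>{..<n}. cls q (const (c i)) \<odot>\<^bsub>M\<^esub> v i)"
    using d unfolding has_dim_def by (elim exE conjE bexE) (rule that, assumption, drule (1) bspec)
  have vc: "v j \<in> carrier M" if "j < n" for j using v that by blast
  let ?l = "\<lambda>c. lsum M n (\<lambda>i. E q (c i) 0 0 0 0 0 \<odot>\<^bsub>M\<^esub> v i)"
  have tc: "E q t 0 0 0 0 0 \<odot>\<^bsub>M\<^esub> v j \<in> carrier M" if "j < n" for t j using vc[OF that] by simp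
  have fl: "(\<Oplus>\<^bsub>M\<^esub>i\<in>{..<n}. cls q (const (c i)) \<odot>\<^bsub>M\<^esub> v i) = ?l c" for c
    unfolding cls_const by (rule finsum_lsum[OF M]) (rule tc)
  define co where "co m = (THE c. c \<in> {..<n} \<rightarrow>\<^sub>E UNIV \<and> m = ?l c)" for m
  have co: "co m \<in> {..<n} \<rightarrow>\<^sub>E UNIV \<and> m = ?l (co m)" if "m \<in> carrier M" for m
    unfolding co_def by (rule theI'[OF ex1[OF that, unfolded fl]])
  have uniq: "co m = restrict c {..<n}" if "m \<in> carrier M" "m = ?l c" for m c
  proof -
    have "?l (restrict c {..<n}) = ?l c" by (rule lsum_cong) simp
    then have "restrict c {..<n} \<in> {..<n} \<rightarrow>\<^sub>E UNIV \<and> m = ?l (restrict c {..<n})"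
      using that(2) by (simp del: lsum.simps)
    then show ?thesis unfolding co_def by (rule the1_equality[OF ex1[OF that(1), unfolded fl]])
  qed
  define \<kappa> where "\<kappa> i m = (if i < n then co m i else 0)" for i m
  have "small_module q M \<kappa>"
  proof
    fix x y i assume xy: "x \<in> carrier M" "y \<in> carrier M"
    have "x \<oplus>\<^bsub>M\<^esub> y = ?l (co x) \<oplus>\<^bsub>M\<^esub> ?l (co y)" 
      by (rule arg_cong2[where f = "\<lambda>u w. u \<oplus>\<^bsub>M\<^esub> w", OF conjunct2[OF co[OF xy(1)]] conjunct2[OF co[OF xy(2)]]])
    also have "\<dots> = lsum M n (\<lambda>i. E q (co x i) 0 0 0 0 0 \<odot>\<^bsub>M\<^esub> v i \<oplus>\<^bsub>M\<^esub> E q (co y i) 0 0 0 0 0 \<odot>\<^bsub>M\<^esub> v i)"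
      by (rule M.lsum_add[symmetric]) (rule tc, assumption)+
    also have "\<dots> = ?l (\<lambda>i. co x i + co y i)"
    proof (rule lsum_cong)
      fix j assume "j < n"
      then show "E q (co x j) 0 0 0 0 0 \<odot>\<^bsub>M\<^esub> v j \<oplus>\<^bsub>M\<^esub> E q (co y j) 0 0 0 0 0 \<odot>\<^bsub>M\<^esub> v j = E q (co x j + co y j) 0 0 0 0 0 \<odot>\<^bsub>M\<^esub> v j"
        using M.smult_l_distr[of "E q (co x j) 0 0 0 0 0" "E q (co y j) 0 0 0 0 0" "v j"] vc by simp
    qed
    finally have "co (x \<oplus>\<^bsub>M\<^esub> y) = restrict (\<lambda>i. co x i + co y i) {..<n}"
      by (rule uniq[rotated]) (use xy in simp)
    then show "\<kappa> i (x \<oplus>\<^bsub>M\<^esub> y) = \<kappa> i x + \<kappa> i y" by (simp add: \<kappa>_def)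
  next
    fix x i t assume x: "x \<in> carrier M"
    have "E q t 0 0 0 0 0 \<odot>\<^bsub>M\<^esub> x = E q t 0 0 0 0 0 \<odot>\<^bsub>M\<^esub> ?l (co x)" 
      by (rule arg_cong[where f = "\<lambda>u. E q t 0 0 0 0 0 \<odot>\<^bsub>M\<^esub> u", OF conjunct2[OF co[OF x]]])
    also have "\<dots> = lsum M n (\<lambda>i. E q t 0 0 0 0 0 \<odot>\<^bsub>M\<^esub> (E q (co x i) 0 0 0 0 0 \<odot>\<^bsub>M\<^esub> v i))"
      by (rule M.lsum_smult[symmetric, OF E_closed]) (rule tc)
    also have "\<dots> = ?l (\<lambda>i. t * co x i)"
    proof (rule lsum_cong)
      fix j assume "j < n"
      then show "E q t 0 0 0 0 0 \<odot>\<^bsub>M\<^esub> (E q (co x j) 0 0 0 0 0 \<odot>\<^bsub>M\<^esub> v j) = E q (t * co x j) 0 0 0 0 0 \<odot>\<^bsub>M\<^esub> v j"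
        using M.smult_assoc[of "E q t 0 0 0 0 0" "E q (co x j) 0 0 0 0 0" "v j"] vc by simp
    qed
    finally have "co (E q t 0 0 0 0 0 \<odot>\<^bsub>M\<^esub> x) = restrict (\<lambda>i. t * co x i) {..<n}"
      by (rule uniq[rotated]) (use x in simp)
    then show "\<kappa> i (E q t 0 0 0 0 0 \<odot>\<^bsub>M\<^esub> x) = t * \<kappa> i x" by (simp add: \<kappa>_def)
  next
    fix x assume x: "x \<in> carrier M" and z: "\<And>i. i < 3 \<Longrightarrow> \<kappa> i x = 0"
    have "co x j = 0" if "j < n" for j using z[of j] n that by (simp add: \<kappa>_def)
    then have "?l (co x) = \<zero>\<^bsub>M\<^esub>"
      using vc M.smult_l_null by (intro M.lsum_zero) (simp add: E_zero[symmetric])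
    then show "x = \<zero>\<^bsub>M\<^esub>" by (rule trans[OF conjunct2[OF co[OF x]]])
  qed (fact q M)+
  then show ?thesis by blast
qed

section \<open>Minimal presentations and torsionfreeness\<close>

text \<open>Nakayama's lemma for \<open>\<Lambda>\<^sup>n\<close>: from \<open>L + rad F = F\<close> it follows that \<open>L\<close> contains
  \<open>rad\<^sup>2 F\<close>, then \<open>rad F\<close>, then \<open>F\<close>.\<close>

lemma nakayama:
  assumes L: "submodule L (Lam q) (free_module (Lam q) n)"
    and K: "K \<subseteq> carrier (free_module (Lam q) n)" "\<And>u i. u \<in> K \<Longrightarrow> i < n \<Longrightarrow> u i \<in> Vs q 0 0 0"
    and sum: "set_add (free_module (Lam q) n) L K = carrier (free_module (Lam q) n)"
  shows "L = carrier (free_module (Lam q) n)"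
proof -
  let ?F = "free_module (Lam q) n"
  interpret F: left_module "Lam q" ?F by (rule free_left_module[OF Lam_ring])
  note LD = F.submodD[OF L]
  have dec: "\<exists>l\<in>L. \<exists>k\<in>K. u = l \<oplus>\<^bsub>?F\<^esub> k" if "u \<in> carrier ?F" for u
    using that unfolding sum[symmetric] set_add_def' by blast
  have ext: "u = v" if "u \<in> carrier ?F" "v \<in> carrier ?F" "\<And>i. i < n \<Longrightarrow> u i = v i" for u v
  proof (rule extensionalityI[of _ "{..<n}"])
    show "u \<in> extensional {..<n}" "v \<in> extensional {..<n}" using that(1,2) by (auto simp: PiE_iff)
  qed (use that(3) in simp)
  have mult: "r \<odot>\<^bsub>?F\<^esub> w \<in> L" if r: "r \<in> carrier (Lam q)" and w: "w \<in> carrier ?F"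
    and k: "\<And>k. k \<in> carrier ?F \<Longrightarrow> (\<And>i. i < n \<Longrightarrow> k i \<in> Vs q 0 0 0) \<Longrightarrow> r \<odot>\<^bsub>?F\<^esub> k \<in> L" for r w
  proof -
    obtain l k0 where lk: "l \<in> L" "k0 \<in> K" "w = l \<oplus>\<^bsub>?F\<^esub> k0" using dec[OF w] by blast
    have "r \<odot>\<^bsub>?F\<^esub> k0 \<in> L" using k[of k0] K lk(2) by blast
    moreover have "r \<odot>\<^bsub>?F\<^esub> w = r \<odot>\<^bsub>?F\<^esub> l \<oplus>\<^bsub>?F\<^esub> r \<odot>\<^bsub>?F\<^esub> k0"
      unfolding lk(3) by (rule F.smult_r_distr[OF r]) (use lk LD(1) K(1) in blast)+
    ultimately show ?thesis using LD(3) LD(4)[OF r lk(1)] by (simp del: free_simps)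
  qed
  have cvec: "(\<lambda>i\<in>{..<n}. w i) \<in> carrier ?F" if "\<And>i. i < n \<Longrightarrow> w i \<in> carrier (Lam q)" for w using that by simp
  have uc: "u i \<in> carrier (Lam q)" if "u \<in> carrier ?F" "i < n" for u i using that by (auto simp: PiE_iff)
  have J: "\<exists>a b c d e. v = E q 0 a b c d e" if "v \<in> Vs q 0 0 0" for v
    by (rule VsE[OF that]) blast
  have soc0: "E q 0 0 0 0 d e \<odot>\<^bsub>?F\<^esub> k = \<zero>\<^bsub>?F\<^esub>" if k: "k \<in> carrier ?F" "\<And>i. i < n \<Longrightarrow> k i \<in> Vs q 0 0 0" for k d e
  proof (rule ext)
    show "E q 0 0 0 0 d e \<odot>\<^bsub>?F\<^esub> k \<in> carrier ?F" "\<zero>\<^bsub>?F\<^esub> \<in> carrier ?F" using F.smult_closed[OF E_closed k(1)] by blast+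
    fix i assume i: "i < n"
    obtain a1 a2 a3 a4 a5 where "k i = E q 0 a1 a2 a3 a4 a5" using J[OF k(2)[OF i]] by blast
    then show "(E q 0 0 0 0 d e \<odot>\<^bsub>?F\<^esub> k) i = \<zero>\<^bsub>?F\<^esub> i" using i by (simp add: E_zero)
  qed
  have soc: "u \<in> L" if u: "u \<in> carrier ?F" "\<And>i. i < n \<Longrightarrow> u i \<in> Us q 0 0 0" for u
  proof -
    let ?D = "\<lambda>i\<in>{..<n}. E q (Ec q 4 (u i)) 0 0 0 0 0" and ?E = "\<lambda>i\<in>{..<n}. E q (Ec q 5 (u i)) 0 0 0 0 0"
    have c: "?D \<in> carrier ?F" "?E \<in> carrier ?F" by (rule cvec, simp)+
    have l: "E q 0 0 0 0 1 0 \<odot>\<^bsub>?F\<^esub> ?D \<in> L" "E q 0 0 0 0 0 1 \<odot>\<^bsub>?F\<^esub> ?E \<in> L"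
      by (rule mult[OF E_closed]; (rule c | simp only: soc0 LD(2)))+
    have "u = E q 0 0 0 0 1 0 \<odot>\<^bsub>?F\<^esub> ?D \<oplus>\<^bsub>?F\<^esub> E q 0 0 0 0 0 1 \<odot>\<^bsub>?F\<^esub> ?E"
    proof (rule ext[OF u(1)])
      show "E q 0 0 0 0 1 0 \<odot>\<^bsub>?F\<^esub> ?D \<oplus>\<^bsub>?F\<^esub> E q 0 0 0 0 0 1 \<odot>\<^bsub>?F\<^esub> ?E \<in> carrier ?F" using LD(1) LD(3)[OF l] by blast
      fix i assume i: "i < n"
      obtain s d e where "u i = E q 0 (s * 0) (s * 0) (s * 0) d e" using u(2)[OF i] by (rule UsE)
      then show "u i = (E q 0 0 0 0 1 0 \<odot>\<^bsub>?F\<^esub> ?D \<oplus>\<^bsub>?F\<^esub> E q 0 0 0 0 0 1 \<odot>\<^bsub>?F\<^esub> ?E) i" using i by simp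
    qed
    then show ?thesis using LD(3)[OF l] by (simp del: free_simps)
  qed
  have p: "E q 0 x y z 0 0 \<odot>\<^bsub>?F\<^esub> k \<in> L" if k: "k \<in> carrier ?F" "\<And>i. i < n \<Longrightarrow> k i \<in> Vs q 0 0 0" for k x y z
  proof (rule soc)
    show "E q 0 x y z 0 0 \<odot>\<^bsub>?F\<^esub> k \<in> carrier ?F" by (rule F.smult_closed[OF E_closed k(1)])
    fix i assume i: "i < n"
    obtain a1 a2 a3 a4 a5 where "k i = E q 0 a1 a2 a3 a4 a5" using J[OF k(2)[OF i]] by blast
    then show "(E q 0 x y z 0 0 \<odot>\<^bsub>?F\<^esub> k) i \<in> Us q 0 0 0" using i by (simp add: E_Us)
  qed
  have rad: "u \<in> L" if u: "u \<in> carrier ?F" "\<And>i. i < n \<Longrightarrow> u i \<in> Vs q 0 0 0" for u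
  proof -
    let ?v = "\<lambda>j. \<lambda>i\<in>{..<n}. E q (Ec q j (u i)) 0 0 0 0 0"
    let ?s = "\<lambda>i\<in>{..<n}. E q 0 0 0 0 (Ec q 4 (u i)) (Ec q 5 (u i))"
    have c: "?v j \<in> carrier ?F" for j by (rule cvec) simp
    have l: "E q 0 1 0 0 0 0 \<odot>\<^bsub>?F\<^esub> ?v 1 \<in> L" "E q 0 0 1 0 0 0 \<odot>\<^bsub>?F\<^esub> ?v 2 \<in> L" "E q 0 0 0 1 0 0 \<odot>\<^bsub>?F\<^esub> ?v 3 \<in> L"
      by (rule mult[OF E_closed c p]; assumption)+
    have s: "?s \<in> L" by (rule soc, rule cvec) (simp_all add: E_Us)
    note sum = LD(3)[OF l(1) LD(3)[OF l(2) LD(3)[OF l(3) s]]]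
    have "u = E q 0 1 0 0 0 0 \<odot>\<^bsub>?F\<^esub> ?v 1 \<oplus>\<^bsub>?F\<^esub> (E q 0 0 1 0 0 0 \<odot>\<^bsub>?F\<^esub> ?v 2 \<oplus>\<^bsub>?F\<^esub> (E q 0 0 0 1 0 0 \<odot>\<^bsub>?F\<^esub> ?v 3 \<oplus>\<^bsub>?F\<^esub> ?s))"
    proof (rule ext[OF u(1)])
      show "E q 0 1 0 0 0 0 \<odot>\<^bsub>?F\<^esub> ?v 1 \<oplus>\<^bsub>?F\<^esub> (E q 0 0 1 0 0 0 \<odot>\<^bsub>?F\<^esub> ?v 2 \<oplus>\<^bsub>?F\<^esub> (E q 0 0 0 1 0 0 \<odot>\<^bsub>?F\<^esub> ?v 3 \<oplus>\<^bsub>?F\<^esub> ?s)) \<in> carrier ?F"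
        using LD(1) sum by blast
      fix i assume i: "i < n"
      obtain a b c d e where "u i = E q 0 a b c d e" using J[OF u(2)[OF i]] by blast
      then show "u i = (E q 0 1 0 0 0 0 \<odot>\<^bsub>?F\<^esub> ?v 1 \<oplus>\<^bsub>?F\<^esub> (E q 0 0 1 0 0 0 \<odot>\<^bsub>?F\<^esub> ?v 2 \<oplus>\<^bsub>?F\<^esub> (E q 0 0 0 1 0 0 \<odot>\<^bsub>?F\<^esub> ?v 3 \<oplus>\<^bsub>?F\<^esub> ?s))) i"
        using i by simp
    qed
    then show ?thesis using sum by metis
  qed
  have "u \<in> L" if u: "u \<in> carrier ?F" for u
  proof -
    obtain l k where lk: "l \<in> L" "k \<in> K" "u = l \<oplus>\<^bsub>?F\<^esub> k" using dec[OF u] by blast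
    have "k \<in> L" using rad[of k] K lk(2) by blast
    then show ?thesis using LD(3)[OF lk(1)] lk(3) by (simp del: free_simps)
  qed
  then show ?thesis using LD(1) by blast
qed

text \<open>Generators of \<open>Us q 1 b c\<close> whose relations lie in the radical: one suffices, except for
  \<open>(b, c) = (- 1, 0)\<close>, where \<open>zx\<close> is not a multiple of \<open>x - y\<close>.\<close>

lemma Us_generators:
  assumes q: "q \<noteq> 0"
  shows "\<exists>k gen. (\<forall>j<k. gen j \<in> carrier (Lam q)) \<and>
    (\<lambda>u. lsum (lreg q) k (\<lambda>j. u j \<otimes>\<^bsub>Lam q\<^esub> gen j)) ` carrier (free_module (Lam q) k) = Us q 1 b c \<and>
    (\<forall>u\<in>carrier (free_module (Lam q) k). lsum (lreg q) k (\<lambda>j. u j \<otimes>\<^bsub>Lam q\<^esub> gen j) = \<zero>\<^bsub>Lam q\<^esub> \<longrightarrow>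
      (\<forall>j<k. u j \<in> Vs q 0 0 0))"
proof (cases "b = -1 \<and> c = 0")
  case False
  let ?l = "E q 0 1 b c 0 0"
  obtain A where A: "cyc (Lam q) (sub (lreg q) (Us q 1 b c)) ?l A" and AJ: "A \<subseteq> Vs q 0 0 0"
  proof (cases "b = -1")
    case True
    have "Us q 0 0 1 \<subseteq> Vs q 0 0 0" by (auto elim!: UsE simp: E_Vs)
    then show ?thesis using that cyc_Us_minus_1[of c q] False True by blast
  next
    case b: False
    have "Us q 1 (q * b) (- c / (1 + b)) \<subseteq> Vs q 0 0 0" by (auto elim!: UsE simp: E_Vs)
    then show ?thesis using that cyc_Us[OF b] by blast
  qed
  note cA = cycD[OF A]
  have one: "lsum (lreg q) (Suc 0) (\<lambda>j. u j \<otimes>\<^bsub>Lam q\<^esub> ?l) = u 0 \<otimes>\<^bsub>Lam q\<^esub> ?l" if u: "u 0 \<in> carrier (Lam q)" for u :: "nat \<Rightarrow> 'a lam"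
  proof -
    obtain r0 r1 r2 r3 r4 r5 where "u 0 = E q r0 r1 r2 r3 r4 r5" by (rule E_cases[OF u])
    then show ?thesis by (simp add: E_zero)
  qed
  have u0: "u 0 \<in> carrier (Lam q)" if "u \<in> carrier (free_module (Lam q) (Suc 0))" for u using that by (auto simp: PiE_iff)
  have "(\<lambda>u. lsum (lreg q) (Suc 0) (\<lambda>j. u j \<otimes>\<^bsub>Lam q\<^esub> ?l)) ` carrier (free_module (Lam q) (Suc 0)) = Us q 1 b c"
  proof
    show "(\<lambda>u. lsum (lreg q) (Suc 0) (\<lambda>j. u j \<otimes>\<^bsub>Lam q\<^esub> ?l)) ` carrier (free_module (Lam q) (Suc 0)) \<subseteq> Us q 1 b c"
    proof clarify
      fix u assume "u \<in> carrier (free_module (Lam q) (Suc 0))"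
      note u = u0[OF this]
      obtain r0 r1 r2 r3 r4 r5 where "u 0 = E q r0 r1 r2 r3 r4 r5" by (rule E_cases[OF u])
      then show "lsum (lreg q) (Suc 0) (\<lambda>j. u j \<otimes>\<^bsub>Lam q\<^esub> ?l) \<in> Us q 1 b c" unfolding one[of u, OF u] by (simp add: E_Us1)
    qed
    show "Us q 1 b c \<subseteq> (\<lambda>u. lsum (lreg q) (Suc 0) (\<lambda>j. u j \<otimes>\<^bsub>Lam q\<^esub> ?l)) ` carrier (free_module (Lam q) (Suc 0))"
    proof
      fix x assume "x \<in> Us q 1 b c"
      then obtain r where r: "r \<in> carrier (Lam q)" "x = r \<otimes>\<^bsub>Lam q\<^esub> ?l" using cA(3)[of x] by auto
      have "(\<lambda>i\<in>{..<Suc 0}. r) \<in> carrier (free_module (Lam q) (Suc 0))" using r(1) by simp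
      moreover have "x = lsum (lreg q) (Suc 0) (\<lambda>j. (\<lambda>i\<in>{..<Suc 0}. r) j \<otimes>\<^bsub>Lam q\<^esub> ?l)" 
        using one[of "\<lambda>i\<in>{..<Suc 0}. r"] r by simp
      ultimately show "x \<in> (\<lambda>u. lsum (lreg q) (Suc 0) (\<lambda>j. u j \<otimes>\<^bsub>Lam q\<^esub> ?l)) ` carrier (free_module (Lam q) (Suc 0))"
        unfolding image_iff by (intro bexI[of _ "\<lambda>i\<in>{..<Suc 0}. r"])
    qed
  qed
  moreover have "u j \<in> Vs q 0 0 0" if "u \<in> carrier (free_module (Lam q) (Suc 0))"
    "lsum (lreg q) (Suc 0) (\<lambda>j. u j \<otimes>\<^bsub>Lam q\<^esub> ?l) = \<zero>\<^bsub>Lam q\<^esub>" "j < Suc 0" for u j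
  proof -
    note u = u0[OF that(1)]
    have "u 0 \<otimes>\<^bsub>Lam q\<^esub> ?l = \<zero>\<^bsub>Lam q\<^esub>" using that(2) unfolding one[of u, OF u] .
    then have "u 0 \<in> A" using cA(4) u by simp
    then show ?thesis using AJ that(3) by auto
  qed
  ultimately show ?thesis by (intro exI[of _ "Suc 0"] exI[of _ "\<lambda>_. ?l"]) (auto simp del: free_simps lsum.simps)
next
  case True
  let ?g = "\<lambda>j::nat. if j = 0 then E q 0 1 (- 1) 0 0 0 else E q 0 0 0 0 0 1"
  have two: "lsum (lreg q) 2 (\<lambda>j. u j \<otimes>\<^bsub>Lam q\<^esub> ?g j) = E q 0 r0 (- r0) 0 (q * r1 + r2) s0"
    if "u 0 = E q r0 r1 r2 r3 r4 r5" "u 1 = E q s0 s1 s2 s3 s4 s5" for u :: "nat \<Rightarrow> 'a lam" and r0 r1 r2 r3 r4 r5 s0 s1 s2 s3 s4 s5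
    using that by (simp add: numeral_2_eq_2 E_zero)
  have uE: "\<exists>r0 r1 r2 r3 r4 r5 s0 s1 s2 s3 s4 s5. u 0 = E q r0 r1 r2 r3 r4 r5 \<and> u 1 = E q s0 s1 s2 s3 s4 s5"
    if "u \<in> carrier (free_module (Lam q) 2)" for u
  proof -
    have "u 0 \<in> carrier (Lam q)" "u 1 \<in> carrier (Lam q)" using that by (auto simp: PiE_iff)
    then show ?thesis by (metis E_cases)
  qed
  have "(\<lambda>u. lsum (lreg q) 2 (\<lambda>j. u j \<otimes>\<^bsub>Lam q\<^esub> ?g j)) ` carrier (free_module (Lam q) 2) = Us q 1 b c"
  proof
    show "(\<lambda>u. lsum (lreg q) 2 (\<lambda>j. u j \<otimes>\<^bsub>Lam q\<^esub> ?g j)) ` carrier (free_module (Lam q) 2) \<subseteq> Us q 1 b c"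
    proof (rule image_subsetI)
      fix u assume "u \<in> carrier (free_module (Lam q) 2)"
      then obtain r0 r1 r2 r3 r4 r5 s0 s1 s2 s3 s4 s5 where u: "u 0 = E q r0 r1 r2 r3 r4 r5" "u 1 = E q s0 s1 s2 s3 s4 s5"
        by - (drule uE, elim exE conjE, rule that)
      show "lsum (lreg q) 2 (\<lambda>j. u j \<otimes>\<^bsub>Lam q\<^esub> ?g j) \<in> Us q 1 b c" unfolding two[OF u] using True by (simp add: E_Us1)
    qed
    show "Us q 1 b c \<subseteq> (\<lambda>u. lsum (lreg q) 2 (\<lambda>j. u j \<otimes>\<^bsub>Lam q\<^esub> ?g j)) ` carrier (free_module (Lam q) 2)"
    proof
      fix x assume "x \<in> Us q 1 b c"
      then obtain t v w where x: "x = E q 0 (t * 1) (t * b) (t * c) v w" by (rule UsE)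
      let ?u = "\<lambda>i\<in>{..<2::nat}. if i = 0 then E q t 0 v 0 0 0 else E q w 0 0 0 0 0"
      have "?u \<in> carrier (free_module (Lam q) 2)" by auto
      moreover have "x = lsum (lreg q) 2 (\<lambda>j. ?u j \<otimes>\<^bsub>Lam q\<^esub> ?g j)"
        by (subst two[of ?u t 0 v 0 0 0 w 0 0 0 0 0]) (use x True in simp_all)
      ultimately show "x \<in> (\<lambda>u. lsum (lreg q) 2 (\<lambda>j. u j \<otimes>\<^bsub>Lam q\<^esub> ?g j)) ` carrier (free_module (Lam q) 2)"
        unfolding image_iff by (intro bexI[of _ ?u])
    qed
  qed
  moreover have "u j \<in> Vs q 0 0 0" if u: "u \<in> carrier (free_module (Lam q) 2)"
    "lsum (lreg q) 2 (\<lambda>j. u j \<otimes>\<^bsub>Lam q\<^esub> ?g j) = \<zero>\<^bsub>Lam q\<^esub>" "j < 2" for u j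
  proof -
    obtain r0 r1 r2 r3 r4 r5 s0 s1 s2 s3 s4 s5 where ue: "u 0 = E q r0 r1 r2 r3 r4 r5" "u 1 = E q s0 s1 s2 s3 s4 s5"
      using uE[OF u(1)] by (elim exE conjE) (rule that)
    have "r0 = 0" "s0 = 0" using u(2) unfolding two[OF ue] by (simp_all add: E_zero)
    moreover have "j = 0 \<or> j = 1" using u(3) by auto
    ultimately show ?thesis using ue by (auto simp: E_Vs)
  qed
  moreover have "?g j \<in> carrier (Lam q)" for j by simp
  ultimately show ?thesis by (intro exI[of _ 2] exI[of _ ?g]) blast
qed

text \<open>By \<open>nakayama\<close> a kernel inside the radical is superfluous.\<close>

lemma projective_coverI:
  assumes f: "linmap (Lam q) (free_module (Lam q) n) M f" "f ` carrier (free_module (Lam q) n) = carrier M"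
    and k: "\<And>u i. u \<in> carrier (free_module (Lam q) n) \<Longrightarrow> f u = \<zero>\<^bsub>M\<^esub> \<Longrightarrow> i < n \<Longrightarrow> u i \<in> Vs q 0 0 0"
  shows "projective_cover (Lam q) (free_module (Lam q) n) (restrict f (carrier (free_module (Lam q) n))) M"
proof -
  let ?F = "free_module (Lam q) n" and ?f = "restrict f (carrier (free_module (Lam q) n))"
  have "L = carrier ?F" if "submodule L (Lam q) ?F" "set_add ?F L (a_kernel ?F M ?f) = carrier ?F" for L
  proof (rule nakayama[OF that(1) _ _ that(2)])
    show "a_kernel ?F M ?f \<subseteq> carrier ?F" unfolding a_kernel_def' by blast
    show "u i \<in> Vs q 0 0 0" if "u \<in> a_kernel ?F M ?f" "i < n" for u i
    proof -
      have u: "u \<in> carrier ?F" "?f u = \<zero>\<^bsub>M\<^esub>" using that(1) unfolding a_kernel_def' by blast+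
      then have "f u = \<zero>\<^bsub>M\<^esub>" by (simp del: free_simps)
      then show ?thesis using k u(1) that(2) by blast
    qed
  qed
  moreover have "?f ` carrier ?F = carrier M" using f(2) by (simp del: free_simps)
  ultimately show ?thesis
    unfolding projective_cover_def fg_projective_iff
    using proj_free[OF Lam_ring] linmap_restrict[OF free_left_module[OF Lam_ring] f(1)] by blast
qed

text \<open>With \<open>im\<close> the image of \<open>P0\<^sup>* \<rightarrow> P1\<^sup>*\<close>, the module \<open>Tr M\<close> is \<open>P1\<^sup>*/im\<close>, and \<open>im\<close> is a cyclic right
  module of the family, with parameter \<open>b/q\<close>. So the first extension group asks whether maps from \<open>im\<close> extend, and the
  higher ones are computed inside the family.\<close>

lemma infinity_torsionfreeI:
  assumes q: "q \<noteq> 0" and c: "cyc (Lam q) M m (Us q 1 b c)" and b: "\<And>n. b \<noteq> - (q ^ Suc n)"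
  shows "infinity_torsionfree (Lam q) M"
proof -
  let ?R = "Lam q" and ?S = "op_ring (Lam q)"
  note cd = cycD[OF c]
  interpret M: left_module "Lam q" M by (rule cd(1))
  define P0 where "P0 = free_module (Lam q) 1"
  define p where "p = restrict (\<lambda>u. u 0 \<odot>\<^bsub>M\<^esub> m) (carrier P0)"
  have P0m: "left_module ?R P0" unfolding P0_def by (rule free_left_module[OF Lam_ring])
  have p0: "linmap ?R P0 M (\<lambda>u. u 0 \<odot>\<^bsub>M\<^esub> m)"
    unfolding P0_def by (rule linmap_comp[OF linmap_coord linmap_smult_vec[OF cd(1,2)]]) simp
  have P0c: "u 0 \<in> carrier ?R" if "u \<in> carrier P0" for u using that unfolding P0_def by (auto simp: PiE_iff)
  have vec: "(\<lambda>i\<in>{..<1::nat}. r) \<in> carrier P0" if "r \<in> carrier ?R" for r using that unfolding P0_def by simp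
  have p0s: "(\<lambda>u. u 0 \<odot>\<^bsub>M\<^esub> m) ` carrier P0 = carrier M"
  proof
    show "(\<lambda>u. u 0 \<odot>\<^bsub>M\<^esub> m) ` carrier P0 \<subseteq> carrier M" using linmapD(1)[OF p0] by blast
    show "carrier M \<subseteq> (\<lambda>u. u 0 \<odot>\<^bsub>M\<^esub> m) ` carrier P0"
    proof
      fix x assume "x \<in> carrier M"
      then obtain r where r: "r \<in> carrier ?R" "x = r \<odot>\<^bsub>M\<^esub> m" using cd(3) by blast
      then show "x \<in> (\<lambda>u. u 0 \<odot>\<^bsub>M\<^esub> m) ` carrier P0" by (intro rev_image_eqI[OF vec[OF r(1)]]) simp
    qed
  qed
  have UJ: "Us q 1 b c \<subseteq> Vs q 0 0 0" by (auto elim!: UsE simp: E_Vs)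
  have cov0: "projective_cover ?R P0 p M" unfolding p_def P0_def
  proof (rule projective_coverI[OF p0[unfolded P0_def] p0s[unfolded P0_def]])
    fix u :: "nat \<Rightarrow> 'a lam" and i assume u: "u \<in> carrier (free_module ?R 1)" "u 0 \<odot>\<^bsub>M\<^esub> m = \<zero>\<^bsub>M\<^esub>" "i < (1::nat)"
    then have "u 0 \<in> Us q 1 b c" using cd(4) P0c[unfolded P0_def] by blast
    then show "u i \<in> Vs q 0 0 0" using UJ u(3) by auto
  qed
  obtain k gen where gen0: "\<forall>j<k. gen j \<in> carrier ?R"
    and gi: "(\<lambda>u. lsum (lreg q) k (\<lambda>j. u j \<otimes>\<^bsub>?R\<^esub> gen j)) ` carrier (free_module ?R k) = Us q 1 b c"
    and gk0: "\<forall>u\<in>carrier (free_module ?R k). lsum (lreg q) k (\<lambda>j. u j \<otimes>\<^bsub>?R\<^esub> gen j) = \<zero>\<^bsub>?R\<^esub> \<longrightarrow> (\<forall>j<k. u j \<in> Vs q 0 0 0)"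
    using Us_generators[OF q, of b c] by (elim exE conjE) (rule that)
  note gen = gen0[rule_format] and gk = bspec[OF gk0, rule_format]
  define P1 where "P1 = free_module ?R k"
  have P1m: "left_module ?R P1" unfolding P1_def by (rule free_left_module[OF Lam_ring])
  let ?s = "\<lambda>u. lsum (lreg q) k (\<lambda>j. u j \<otimes>\<^bsub>?R\<^esub> gen j)"
  let ?f = "\<lambda>u. \<lambda>i\<in>{..<1::nat}. ?s u"
  have ls: "linmap ?R P1 (lreg q) ?s"
  proof -
    have "linmap ?R P1 (lreg q) (\<lambda>u. lsum (lreg q) k (\<lambda>j. u j \<odot>\<^bsub>lreg q\<^esub> gen j))"
      unfolding P1_def by (rule linmap_lin_comb[OF Lreg]) (use gen linmap_coord in auto)
    then show ?thesis by simp
  qed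
  have lf: "linmap ?R P1 P0 ?f"
    unfolding P0_def by (rule linmap_coords[OF Lam_ring, where f = "\<lambda>_. ?s"]) (rule ls)
  define f where "f = restrict ?f (carrier P1)"
  have kp: "a_kernel P0 M p = {u \<in> carrier P0. u 0 \<in> Us q 1 b c}"
    unfolding a_kernel_def' p_def using cd(4) P0c by auto
  have fim: "?f ` carrier P1 = a_kernel P0 M p"
  proof
    show "?f ` carrier P1 \<subseteq> a_kernel P0 M p"
    proof (rule image_subsetI)
      fix u assume u: "u \<in> carrier P1"
      have "?s u \<in> Us q 1 b c" using u gi unfolding P1_def by blast
      then show "?f u \<in> a_kernel P0 M p" unfolding kp using linmapD(1)[OF lf u] by simp
    qed
    show "a_kernel P0 M p \<subseteq> ?f ` carrier P1"
    proof
      fix w assume w: "w \<in> a_kernel P0 M p"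
      then have w0: "w \<in> carrier P0" "w 0 \<in> Us q 1 b c" unfolding kp by blast+
      obtain u where u: "u \<in> carrier P1" "w 0 = ?s u" using w0(2) gi unfolding P1_def by blast
      have "w = ?f u"
      proof (rule extensionalityI[of _ "{..<1}"])
        show "w \<in> extensional {..<1}" using w0(1) unfolding P0_def by (auto simp: PiE_iff)
      qed (use u(2) in simp_all)
      then show "w \<in> ?f ` carrier P1" using u(1) by blast
    qed
  qed
  have KP: "a_kernel P0 M p \<subseteq> carrier P0" unfolding a_kernel_def' by blast
  have lf': "linmap ?R P1 (sub P0 (a_kernel P0 M p)) ?f" by (rule linmap_into[OF lf]) (use fim in blast)
  have cov1: "projective_cover ?R P1 f (sub P0 (a_kernel P0 M p))"
    unfolding f_def P1_def
  proof (rule projective_coverI[OF lf'[unfolded P1_def]])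
    show "?f ` carrier (free_module ?R k) = carrier (sub P0 (a_kernel P0 M p))" using fim unfolding P1_def by simp
    fix u i assume u: "u \<in> carrier (free_module ?R k)" "?f u = \<zero>\<^bsub>sub P0 (a_kernel P0 M p)\<^esub>" "i < k"
    have "?s u = \<zero>\<^bsub>?R\<^esub>" using fun_cong[OF u(2), of 0] unfolding P0_def by simp
    then show "u i \<in> Vs q 0 0 0" using gk u(1,3) by blast
  qed
  have pm: "linmap ?R P0 M p" "p ` carrier P0 = carrier M"
    using linmap_cong[OF P0m p0, of p] p0s unfolding p_def by simp_all
  have fm: "linmap ?R P1 P0 f" "f ` carrier P1 = a_kernel P0 M p"
    using linmap_cong[OF P1m lf, of f] fim unfolding f_def by simp_all
  interpret pr: presentation "Lam q" P1 f P0 p M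
  proof
    show "proj ?R P1" "proj ?R P0" unfolding P1_def P0_def by (rule proj_free[OF Lam_ring])+
  qed (fact Lam_noeth cd(1) pm fm)+
  have peq: "p u = u 0 \<odot>\<^bsub>M\<^esub> m" if "u \<in> carrier P0" for u using that unfolding p_def by simp
  let ?\<epsilon> = "dual_map P1 f (\<lambda>u\<in>carrier P0. u 0)"
  have im1: "cyc ?S (sub (dual ?R P1) pr.im) ?\<epsilon> (rann ?R (Us q 1 b c))" by (rule pr.cyc_im(1)[OF c P0_def peq])
  have im2: "\<exists>g. linmap ?S (dual ?R P1) (rreg q) g \<and> g ?\<epsilon> = v" if "v \<in> Us q 1 b c" for v
    by (rule pr.cyc_im(2)[OF c P0_def peq that])
  have imS: "pr.im \<subseteq> carrier (dual ?R P1)" by (rule left_module.submodD(1)[OF pr.D1m pr.im_sub])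
  have bq: "b \<noteq> - q" using b[of 0] by simp
  have e1: "extnd ?S pr.im (dual ?R P1) (rreg q)"
  proof (rule iffD2[OF cyc_extnd[OF pr.D1m imS im1]], intro ballI impI)
    fix w assume w: "w \<in> carrier ?S" "\<forall>u\<in>rann (Lam q) (Us q 1 b c). u \<otimes>\<^bsub>?S\<^esub> w = \<zero>\<^bsub>?S\<^esub>"
    then have "w \<in> Us q 1 b c" using lann_right_syzygy[OF q bq, of c] unfolding rann_Us[OF q] by auto
    then show "\<exists>g. linmap ?S (dual ?R P1) (rreg q) g \<and> g ?\<epsilon> = w" by (rule im2)
  qed
  have be: "b / q = - (q ^ k) \<longleftrightarrow> b = - (q ^ Suc k)" for k using q by (auto simp: field_simps)
  have "Ext_vanishes ?S i pr.T (rreg q)" if "i \<ge> 1" for i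
  proof (cases "i = 1")
    case True then show ?thesis using pr.Ext_T(1)[OF LregS] e1 by simp
  next
    case False
    define n where "n = i - 2"
    have n: "i = Suc (Suc n)" using that False unfolding n_def by simp
    have "Ext_vanishes ?S (Suc n) (sub (dual ?R P1) pr.im) (rreg q)"
      using Ext_right(1)[OF q im1[unfolded rann_Us[OF q]], of n] b unfolding be by blast
    then show ?thesis unfolding n using pr.Ext_T(2)[OF LregS] by blast
  qed
  moreover have "is_transpose ?R M pr.T"
    unfolding is_transpose_def minimal_presentation_def pr.T_def pr.im_def using cov0 cov1 by blast
  ultimately show ?thesis unfolding infinity_torsionfree_def by blast
qed

text \<open>The presentation that defines \<open>Tr M\<close> is an arbitrary minimal one; its second syzygy is \<open>M\<^sup>*\<close>, which
  depends on \<open>M\<close> alone.\<close>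

lemma infinity_torsionfreeD:
  assumes q: "q \<noteq> 0" and M: "left_module (Lam q) M" and t: "infinity_torsionfree (Lam q) M"
  shows "reflexive (Lam q) M"
    and "\<And>m b c n. cyc (Lam q) M m (Us q 1 b c) \<Longrightarrow> b \<noteq> - (q ^ Suc (Suc (Suc n)))"
proof -
  let ?R = "Lam q" and ?S = "op_ring (Lam q)"
  obtain T where T: "is_transpose ?R M T" "\<And>i. i \<ge> 1 \<Longrightarrow> Ext_vanishes ?S i T (rreg q)"
    using t unfolding infinity_torsionfree_def by blast
  obtain P1 f P0 p where mp: "minimal_presentation ?R P1 f P0 p M"
    and Teq: "T = quotient_module (dual ?R P1) (dual_map P1 f ` carrier (dual ?R P0))"
    using T(1) unfolding is_transpose_def by blast
  have P0: "proj ?R P0" and P1: "proj ?R P1" and p: "p \<in> mod_hom ?R P0 M" "p ` carrier P0 = carrier M"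
    and f: "f \<in> mod_hom ?R P1 (sub P0 (a_kernel P0 M p))" "f ` carrier P1 = a_kernel P0 M p"
    using mp unfolding minimal_presentation_def projective_cover_def fg_projective_iff by auto
  have KP: "a_kernel P0 M p \<subseteq> carrier P0" unfolding a_kernel_def' by blast
  interpret M: left_module "Lam q" M by fact
  interpret pr: presentation "Lam q" P1 f P0 p M
    by unfold_locales (fact Lam_noeth P0 P1 M p(2) f(2) mod_hom_linmap[OF p(1)] linmap_from[OF mod_hom_linmap[OF f(1)] KP])+
  have TT: "T = pr.T" unfolding Teq pr.T_def pr.im_def ..
  have E: "Ext_vanishes ?S (Suc i) pr.T (rreg q)" for i using T(2)[of "Suc i"] unfolding TT by simp
  have "extnd ?S pr.im (dual ?R P1) (rreg q)" using E[of 0] pr.Ext_T(1)[OF LregS] by simp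
  moreover have Ei: "Ext_vanishes ?S (Suc i) (sub (dual ?R P1) pr.im) (rreg q)" for i
    using E[of "Suc i"] pr.Ext_T(2)[OF LregS] by blast
  have "extnd ?S pr.ker (dual ?R P0) (rreg q)" using Ei[of 0] pr.Ext_T(3)[OF LregS] by simp
  ultimately show "reflexive ?R M" by (rule pr.reflexive_if_extnd)
  fix m b c n assume c: "cyc ?R M m (Us q 1 b c)"
  have "cyc ?S (sub (rreg q) (rann ?R (Us q 1 b c))) (E q 0 1 (b / q) (- (c * (1 + b / q))) 0 0)
      (Us q 1 (b / q / q) (- (- (c * (1 + b / q)) * (1 + b / q / q))))"
    unfolding rann_Us[OF q] by (rule cyc_Us_op[OF q])
  from pr.cyc_ker[OF c this] obtain v where
    v: "cyc ?S (sub (dual ?R P0) pr.ker) v (Us q 1 (b / q / q) (- (- (c * (1 + b / q)) * (1 + b / q / q))))" by blast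
  have Ek: "Ext_vanishes ?S (Suc n) (sub (dual ?R P0) pr.ker) (rreg q)"
    using Ei[of "Suc n"] pr.Ext_T(4)[OF LregS] by blast
  show "b \<noteq> - (q ^ Suc (Suc (Suc n)))"
  proof
    assume "b = - (q ^ Suc (Suc (Suc n)))"
    then have "b / q / q = - (q ^ Suc n)" using q by simp
    then show False using Ext_right(2)[OF q v] Ek by blast
  qed
qed

lemma infinity_torsionfree_Us:
  assumes q: "q \<noteq> 0" and c: "cyc (Lam q) M m (Us q 1 b c)"
  shows "infinity_torsionfree (Lam q) M \<longleftrightarrow> (\<forall>n. b \<noteq> - (q ^ Suc n))"
proof
  assume t: "infinity_torsionfree (Lam q) M"
  note d = infinity_torsionfreeD[OF q cycD(1)[OF c] t]
  have "separated (Lam q) M" using d(1) reflexive_iff[OF cycD(1)[OF c]] by blast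
  then have bq: "b \<noteq> - q" using not_separated_Us[OF q, of M m c] c by blast
  have b2: "b \<noteq> - (q ^ 2)" using reflexive_Us[OF q c bq] d(1) by blast
  show "\<forall>n. b \<noteq> - (q ^ Suc n)"
  proof
    fix n
    show "b \<noteq> - (q ^ Suc n)"
    proof (cases n)
      case 0
      then show ?thesis using bq by simp
    next
      case n: (Suc n1)
      show ?thesis
      proof (cases n1)
        case 0
        then show ?thesis using n b2 by (simp add: power2_eq_square)
      next
        case (Suc n2)
        show ?thesis unfolding n Suc by (rule d(2)[OF c])
      qed
    qed
  qed
qed (use infinity_torsionfreeI[OF q c] in blast)

section \<open>The eight conditions\<close>

context small_module
begin

lemma separated_cases:
  assumes ind: "indecomposable (Lam q) M" and sep: "separated (Lam q) M"
  obtains m U where "cyc (Lam q) M m U"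
      "U = Us q 0 1 0 \<or> U = Us q 0 0 1 \<or> U = Vs q q 1 0 \<or> U = Vs q 1 0 0 \<or> U = Vs q 0 0 0"
  | m b c where "cyc (Lam q) M m (Us q 1 b c)" "b \<noteq> - q"
proof -
  consider (simple) m where "cyc (Lam q) M m (Vs q 0 0 0)"
    | (V) m a b c where "a \<noteq> 0 \<or> b \<noteq> 0 \<or> c \<noteq> 0" "cyc (Lam q) M m (Vs q a b c)"
    | (U) m a b c where "a \<noteq> 0 \<or> b \<noteq> 0 \<or> c \<noteq> 0" "cyc (Lam q) M m (Us q a b c)"
    | (two) m m' n a b c a' b' c' where "two_gens m m' n a b c a' b' c'"
    using classification[OF ind] by blast
  then show thesis
  proof cases
    case simple
    then show ?thesis by (rule that(1)) simp
  next
    case V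
    then show ?thesis using separated_Vs[OF q V(2,1) sep] by (intro that(1)[OF V(2)]) blast
  next
    case U
    show ?thesis
    proof (cases "a = 0")
      case False
      have c: "cyc (Lam q) M m (Us q 1 (b / a) (c / a))" using U(2) unfolding Us_scale[OF False, of q b c] .
      have "b / a \<noteq> - q"
      proof
        assume "b / a = - q"
        then show False using c not_separated_Us[OF q, of M m "c / a"] sep by simp
      qed
      with c show ?thesis by (rule that(2))
    next
      case True
      then have "b = 0 \<or> c = 0" using not_separated_Us0[of q M m b c] U(2) sep by blast
      then have "Us q a b c = Us q 0 1 0 \<or> Us q a b c = Us q 0 0 1"
        using True U(1) Us_scale2(1)[of b q] Us_scale2(2)[of c q] by auto
      then show ?thesis by (intro that(1)[OF U(2)]) blast
    qed
  next
    case two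
    then show ?thesis using two_gens_not_separated sep by blast
  qed
qed

lemma Ext_1_cases:
  assumes ind: "indecomposable (Lam q) M" and ext: "Ext_vanishes (Lam q) 1 M (lreg q)"
  obtains m b c where "cyc (Lam q) M m (Us q 1 b c)" "b \<noteq> - 1"
proof -
  consider (V) m a b c where "cyc (Lam q) M m (Vs q a b c)"
    | (U) m a b c where "a \<noteq> 0 \<or> b \<noteq> 0 \<or> c \<noteq> 0" "cyc (Lam q) M m (Us q a b c)"
    | (two) m m' n a b c a' b' c' where "two_gens m m' n a b c a' b' c'"
    using classification[OF ind] by blast
  then show thesis
  proof cases
    case V
    then show ?thesis using not_Ext_1_Vs[OF q V] ext by blast
  next
    case U
    show ?thesis
    proof (cases "a = 0")
      case False
      have c: "cyc (Lam q) M m (Us q 1 (b / a) (c / a))" using U(2) unfolding Us_scale[OF False, of q b c] .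
      then show ?thesis using Ext_1_Us[OF q c] ext by (intro that[OF c]) blast
    next
      case True
      then show ?thesis using not_Ext_1_Us0[OF q, of M m b c] U ext by blast
    qed
  next
    case two
    then show ?thesis using two_gens_not_Ext_1 ext by blast
  qed
qed

end

lemma powi_nonpos_iff:
  fixes q :: "'k::field"
  assumes q: "q \<noteq> 0"
  shows "(\<forall>n. q ^ n * b \<noteq> -1) \<longleftrightarrow> (\<forall>i::int. i \<le> 0 \<longrightarrow> b \<noteq> - (q powi i))"
proof -
  have e: "q ^ n * b = -1 \<longleftrightarrow> b = - (q powi (- int n))" for n
  proof -
    have "q ^ n * b = -1 \<longleftrightarrow> q ^ n * b = q ^ n * - inverse (q ^ n)" using q by simp
    also have "\<dots> \<longleftrightarrow> b = - inverse (q ^ n)" using q by (subst mult_cancel_left) simp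
    finally show ?thesis by (simp add: power_int_minus)
  qed
  show ?thesis
    unfolding e
  proof (intro iffI allI impI)
    fix i :: int
    assume a: "\<forall>n. b \<noteq> - (q powi (- int n))" and i: "i \<le> 0"
    have "- int (nat (- i)) = i" using i by simp
    then show "b \<noteq> - (q powi i)" using spec[OF a, of "nat (- i)"] by (simp only: not_False_eq_True)
  qed simp
qed

lemma powi_pos_iff:
  fixes q :: "'k::field"
  shows "(\<forall>n. b \<noteq> - (q ^ Suc n)) \<longleftrightarrow> (\<forall>i::int. i \<ge> 1 \<longrightarrow> b \<noteq> - (q powi i))"
proof (intro iffI allI impI)
  fix i :: int
  assume a: "\<forall>n. b \<noteq> - (q ^ Suc n)" and i: "i \<ge> 1"
  have "i = int (Suc (nat (i - 1)))" using i by simp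
  then have "q powi i = q ^ Suc (nat (i - 1))" by (metis power_int_of_nat)
  then show "b \<noteq> - (q powi i)" using a by metis
next
  fix n
  assume a: "\<forall>i::int. i \<ge> 1 \<longrightarrow> b \<noteq> - (q powi i)"
  have "q powi int (Suc n) = q ^ Suc n" by (rule power_int_of_nat)
  then show "b \<noteq> - (q ^ Suc n)" using spec[OF a, of "int (Suc n)"] by simp
qed

lemma mult_order_infinity_iff: "mult_order q = \<infinity> \<longleftrightarrow> (\<forall>n. q ^ Suc n \<noteq> 1)"
  unfolding mult_order_def by (auto simp: gr0_conv_Suc simp del: power_Suc)

theorem mainTheorem1:
  fixes q :: "'k::field" and M :: "('k lam, 'm) module"
  assumes "q \<noteq> 0"
    and "left_module (Lam q) M"
    and "indecomposable (Lam q) M"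
    and "\<exists>n\<le>3. has_dim q M n"
  shows
    "(torsionless (Lam q) M \<longleftrightarrow>
        simple_module (Lam q) M \<or>
        isomorphic (Lam q) M (principal_module q (lin q 1 (- 1) 0)) \<or>
        isomorphic (Lam q) M (principal_module q (lin q 0 0 1)) \<or>
        (\<exists>b c. b \<noteq> - q \<and> isomorphic (Lam q) M (M_mod q 1 b c)) \<or>
        isomorphic (Lam q) M (M_mod q 0 1 0) \<or>
        isomorphic (Lam q) M (M_mod q 0 0 1)) \<and>
     (extensionless (Lam q) M \<longleftrightarrow>
        (\<exists>b c. b \<noteq> - 1 \<and> isomorphic (Lam q) M (M_mod q 1 b c))) \<and>
     (reflexive (Lam q) M \<longleftrightarrow>
        (\<exists>b c. (\<forall>i\<in>{1, 2::nat}. b \<noteq> - (q ^ i)) \<and> isomorphic (Lam q) M (M_mod q 1 b c))) \<and>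
     (Gorenstein_projective (Lam q) M \<longleftrightarrow>
        (\<exists>b c. (\<forall>i::int. b \<noteq> - (q powi i)) \<and> isomorphic (Lam q) M (M_mod q 1 b c))) \<and>
     (semi_Gorenstein_projective (Lam q) M \<longleftrightarrow>
        (\<exists>b c. (\<forall>i::int. i \<le> 0 \<longrightarrow> b \<noteq> - (q powi i)) \<and> isomorphic (Lam q) M (M_mod q 1 b c))) \<and>
     (infinity_torsionfree (Lam q) M \<longleftrightarrow>
        (\<exists>b c. (\<forall>i::int. i \<ge> 1 \<longrightarrow> b \<noteq> - (q powi i)) \<and> isomorphic (Lam q) M (M_mod q 1 b c))) \<and>
     (pivotal_semi_Gorenstein_projective (Lam q) M \<longleftrightarrow>
        mult_order q = \<infinity> \<and> (\<exists>c. isomorphic (Lam q) M (M_mod q 1 (- q) c))) \<and>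
     (pivotal_infinity_torsionfree (Lam q) M \<longleftrightarrow>
        mult_order q = \<infinity> \<and> (\<exists>c. isomorphic (Lam q) M (M_mod q 1 (- 1) c)))"
proof -
  note q = assms(1) and M = assms(2) and ind = assms(3)
  obtain \<kappa> where "small_module q M \<kappa>" using small_module_exists[OF q M] assms(4) by blast
  then interpret small_module q M \<kappa> .
  have 1: "torsionless (Lam q) M \<longleftrightarrow>
      (\<exists>m. cyc (Lam q) M m (Vs q 0 0 0)) \<or>
      (\<exists>m. cyc (Lam q) M m (Vs q q 1 0)) \<or>
      (\<exists>m. cyc (Lam q) M m (Vs q 1 0 0)) \<or>
      (\<exists>b c. b \<noteq> - q \<and> (\<exists>m. cyc (Lam q) M m (Us q 1 b c))) \<or>
      (\<exists>m. cyc (Lam q) M m (Us q 0 1 0)) \<or>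
      (\<exists>m. cyc (Lam q) M m (Us q 0 0 1))" (is "?l \<longleftrightarrow> ?r")
  proof
    assume ?l
    then have sep: "separated (Lam q) M" by (rule torsionless_separated[OF _ M])
    show ?r
    proof (rule separated_cases[OF ind sep])
      fix m U
      assume c: "cyc (Lam q) M m U"
        and "U = Us q 0 1 0 \<or> U = Us q 0 0 1 \<or> U = Vs q q 1 0 \<or> U = Vs q 1 0 0 \<or> U = Vs q 0 0 0"
      from this(2) show ?r by (elim disjE) (use c in blast)+
    qed blast
  next
    assume ?r
    then show ?l
      by (elim disjE exE conjE) (erule torsionless_Us[OF q], assumption | erule torsionless_special[OF q], simp)+
  qed
  have 2: "extensionless (Lam q) M \<longleftrightarrow> (\<exists>b c. b \<noteq> - 1 \<and> (\<exists>m. cyc (Lam q) M m (Us q 1 b c)))" (is "?l \<longleftrightarrow> ?r")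
  proof
    assume ?l
    then show ?r unfolding extensionless_def by (rule Ext_1_cases[OF ind]) blast
  next
    assume ?r
    then obtain b c m where b: "b \<noteq> - 1" and c: "cyc (Lam q) M m (Us q 1 b c)" by (elim exE conjE)
    show ?l unfolding extensionless_def using Ext_1_Us[OF q c] b by (rule iffD2)
  qed
  have r: "\<exists>m b c. cyc (Lam q) M m (Us q 1 b c) \<and> b \<noteq> - q" if r: "reflexive (Lam q) M"
  proof -
    have sep: "separated (Lam q) M" using r reflexive_iff[OF M] by blast
    show ?thesis
    proof (rule separated_cases[OF ind sep])
      fix m U
      assume "cyc (Lam q) M m U"
        and "U = Us q 0 1 0 \<or> U = Us q 0 0 1 \<or> U = Vs q q 1 0 \<or> U = Vs q 1 0 0 \<or> U = Vs q 0 0 0"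
      from not_reflexive_special[OF q this] r show ?thesis by blast
    qed blast
  qed
  have 3: "reflexive (Lam q) M \<longleftrightarrow>
      (\<exists>b c. (\<forall>i\<in>{1, 2::nat}. b \<noteq> - (q ^ i)) \<and> (\<exists>m. cyc (Lam q) M m (Us q 1 b c)))" (is "?l \<longleftrightarrow> ?r")
  proof
    assume l: ?l
    obtain m b c where c: "cyc (Lam q) M m (Us q 1 b c)" "b \<noteq> - q" using r[OF l] by blast
    then have "\<forall>i\<in>{1, 2::nat}. b \<noteq> - (q ^ i)" using reflexive_Us[OF q c] l by simp
    then show ?r using c(1) by blast
  next
    assume ?r
    then obtain m b c where b: "\<forall>i\<in>{1, 2::nat}. b \<noteq> - (q ^ i)" and c: "cyc (Lam q) M m (Us q 1 b c)" by blast
    then show ?l using reflexive_Us[OF q c] by simp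
  qed
  have s: "\<exists>m b c. cyc (Lam q) M m (Us q 1 b c)" if "semi_Gorenstein_projective (Lam q) M"
  proof -
    have "Ext_vanishes (Lam q) 1 M (lreg q)" using that unfolding semi_Gorenstein_projective_def by simp
    then show ?thesis by (rule Ext_1_cases[OF ind]) blast
  qed
  have t: "\<exists>m b c. cyc (Lam q) M m (Us q 1 b c)" if "infinity_torsionfree (Lam q) M"
    using r[OF infinity_torsionfreeD(1)[OF q M that]] by blast
  have by_cyc: "P \<longleftrightarrow> (\<exists>b c. Q b \<and> (\<exists>m. cyc (Lam q) M m (Us q 1 b c)))"
    if ex: "P \<Longrightarrow> \<exists>m b c. cyc (Lam q) M m (Us q 1 b c)"
      and iff: "\<And>m b c. cyc (Lam q) M m (Us q 1 b c) \<Longrightarrow> P \<longleftrightarrow> Q b" for P Q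
  proof
    assume P: P
    obtain m b c where c: "cyc (Lam q) M m (Us q 1 b c)" using ex[OF P] by (elim exE)
    have "Q b" using iff[OF c] P by (rule iffD1)
    then show "\<exists>b c. Q b \<and> (\<exists>m. cyc (Lam q) M m (Us q 1 b c))" using c by (intro exI conjI)
  next
    assume "\<exists>b c. Q b \<and> (\<exists>m. cyc (Lam q) M m (Us q 1 b c))"
    then obtain b c m where "Q b" and c: "cyc (Lam q) M m (Us q 1 b c)" by (elim exE conjE)
    then show P using iff[OF c] by simp
  qed
  have sU: "semi_Gorenstein_projective (Lam q) M \<longleftrightarrow> (\<forall>i::int. i \<le> 0 \<longrightarrow> b \<noteq> - (q powi i))"
    if "cyc (Lam q) M m (Us q 1 b c)" for m b c
    unfolding semi_Gorenstein_Us[OF q that] by (rule powi_nonpos_iff[OF q])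
  have tU: "infinity_torsionfree (Lam q) M \<longleftrightarrow> (\<forall>i::int. i \<ge> 1 \<longrightarrow> b \<noteq> - (q powi i))"
    if "cyc (Lam q) M m (Us q 1 b c)" for m b c
    unfolding infinity_torsionfree_Us[OF q that] by (rule powi_pos_iff)
  note 5 = by_cyc[OF s sU] and 6 = by_cyc[OF t tU]
  have int: "(\<forall>i::int. P i) \<longleftrightarrow> (\<forall>i. i \<le> 0 \<longrightarrow> P i) \<and> (\<forall>i. i \<ge> 1 \<longrightarrow> P i)" for P
  proof -
    have "i \<le> 0 \<or> i \<ge> 1" for i :: int by linarith
    then show ?thesis by blast
  qed
  have 4: "Gorenstein_projective (Lam q) M \<longleftrightarrow>
      (\<exists>b c. (\<forall>i::int. b \<noteq> - (q powi i)) \<and> (\<exists>m. cyc (Lam q) M m (Us q 1 b c)))"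
  proof (rule by_cyc)
    show "\<exists>m b c. cyc (Lam q) M m (Us q 1 b c)" if "Gorenstein_projective (Lam q) M"
      using that by (intro s) (simp add: Gorenstein_projective_def)
    fix m b c assume c: "cyc (Lam q) M m (Us q 1 b c)"
    show "Gorenstein_projective (Lam q) M \<longleftrightarrow> (\<forall>i::int. b \<noteq> - (q powi i))"
      unfolding Gorenstein_projective_def sU[OF c] tU[OF c] by (rule int[symmetric])
  qed
  have neg: "q ^ n * (- q) \<noteq> - 1 \<longleftrightarrow> q ^ Suc n \<noteq> 1" "- 1 \<noteq> - (q ^ Suc n) \<longleftrightarrow> q ^ Suc n \<noteq> 1" for n
    by (auto simp: mult.commute)
  have 7: "pivotal_semi_Gorenstein_projective (Lam q) M \<longleftrightarrow>
      mult_order q = \<infinity> \<and> (\<exists>c m. cyc (Lam q) M m (Us q 1 (- q) c))" (is "?l \<longleftrightarrow> ?r")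
  proof
    assume ?l
    then have l: "semi_Gorenstein_projective (Lam q) M" "\<not> torsionless (Lam q) M"
      unfolding pivotal_semi_Gorenstein_projective_def by blast+
    obtain m b c where c: "cyc (Lam q) M m (Us q 1 b c)" using s[OF l(1)] by blast
    then have b: "b = - q" using torsionless_Us[OF q c] l(2) by blast
    have "\<forall>n. q ^ n * (- q) \<noteq> - 1" using iffD1[OF semi_Gorenstein_Us[OF q c] l(1)] unfolding b .
    then show ?r unfolding mult_order_infinity_iff neg using c b by blast
  next
    assume ?r
    then obtain c m where o: "\<forall>n. q ^ n * (- q) \<noteq> - 1" and c: "cyc (Lam q) M m (Us q 1 (- q) c)"
      unfolding mult_order_infinity_iff neg by blast
    have t: "\<not> torsionless (Lam q) M" using not_separated_Us[OF q c] torsionless_separated[OF _ M] by blast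
    show ?l using t unfolding pivotal_semi_Gorenstein_projective_def using ind iffD2[OF semi_Gorenstein_Us[OF q c] o] by simp
  qed
  have 8: "pivotal_infinity_torsionfree (Lam q) M \<longleftrightarrow>
      mult_order q = \<infinity> \<and> (\<exists>c m. cyc (Lam q) M m (Us q 1 (- 1) c))" (is "?l \<longleftrightarrow> ?r")
  proof
    assume ?l
    then have l: "infinity_torsionfree (Lam q) M" "\<not> Ext_vanishes (Lam q) 1 M (lreg q)"
      unfolding pivotal_infinity_torsionfree_def extensionless_def by blast+
    obtain m b c where c: "cyc (Lam q) M m (Us q 1 b c)" using t[OF l(1)] by (elim exE)
    then have b: "b = - 1" using Ext_1_Us[OF q c] l(2) by blast
    have "\<forall>n. - 1 \<noteq> - (q ^ Suc n)" using iffD1[OF infinity_torsionfree_Us[OF q c] l(1)] unfolding b .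
    then show ?r unfolding mult_order_infinity_iff neg using c b by blast
  next
    assume ?r
    then obtain c m where o: "\<forall>n. - 1 \<noteq> - (q ^ Suc n)" and c: "cyc (Lam q) M m (Us q 1 (- 1) c)"
      unfolding mult_order_infinity_iff neg by blast
    then show ?l
      unfolding pivotal_infinity_torsionfree_def extensionless_def 
      using ind iffD2[OF infinity_torsionfree_Us[OF q c] o] Ext_1_Us[OF q c] by simp
  qed
  show ?thesis
    unfolding isomorphic_M_mod_iff[OF q M] isomorphic_principal_iff[OF M] simple_iff[OF ind]
    by (intro conjI 1 2 3 4 5 6 7 8)
qed

end
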